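(* Let $m\in\mathbb N$, $\mu\in\Lambda$ and $\lambda\in\Lambda_p$. (1) $1_m\tilde\Delta(\mu)\neq0$ only if $\mu\in\Lambda^+(m)$, in which case $1_m\tilde\Delta(\mu)\cong\Delta_m(\mu)$ as $B_m(\delta_0)$-modules. (2) $1_mL(\lambda)\neq0$ if and only if $\lambda\in\tilde\Lambda_p^+(m)$, where $\tilde\Lambda_p^+(m)=\Lambda_p^+(m)\setminus\{\emptyset\}$ if $m$ is positive even and $\delta_0=0$, and $\tilde\Lambda_p^+(m)=\Lambda_p^+(m)$ otherwise. (3) If $\lambda\in\tilde\Lambda_p^+(m)$ and $\mu\in\Lambda^+(m)$, then $[\tilde\Delta(\mu):L(\lambda)]=[1_m\tilde\Delta(\mu):1_mL(\lambda)]$, and $1_mL(\lambda)$ is the simple head of $1_m\tilde\Delta(\lambda)$.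
   Context: $K$ is an algebraically closed field of characteristic $p\neq2$ (so $p=0$ or $p$ is an odd prime), $\delta_0\in K$, $\mathbb N=\{0,1,2,\dots\}$. An $(m,s)$-Brauer diagram is a perfect matching of $m$ points on a bottom row and $s$ points on a top row. Pairs of bottom points are caps, pairs of top points are cups, other pairs are vertical strands. $B$ is the (non-unital) $K$-algebra with basis all Brauer diagrams. The product $gh$ of an $(m,n)$-diagram $g$ and an $(s,t)$-diagram $h$ is $0$ unless $t=m$, in which case $g$ is stacked on top of $h$ and each closed loop is replaced by the factor $\delta_0$. $1_m$ is the identity $(m,m)$-diagram. $B_m(\delta_0):=1_mB1_m$ is the Brauer algebra. All $B$-modules are left modules $V=\bigoplus_m1_mV$. $B^0\cong\bigoplus_mK\mathfrak S_m$ is the span of diagrams with neither cups nor caps, $B^\sharp$ the span of diagrams without cups. $B^0$-modules are $B^\sharp$-modules on which diagrams with caps act as zero, and $\Delta(V):=B\otimes_{B^\sharp}V$ for a $B^0$-module $V$. $\Lambda(m)$ is the set of partitions of $m$, $\Lambda_p(m)$ the subset of $p$-regular ones (no $p$ equal nonzero parts; all if $p=0$), $\Lambda=\bigcup_m\Lambda(m)$, $\Lambda_p=\bigcup_m\Lambda_p(m)$, $\Lambda^+(m)=\coprod_{d\ge0,\,m-2d\ge0}\Lambda(m-2d)$, $\Lambda_p^+(m)=\coprod_{d\ge0,\,m-2d\ge0}\Lambda_p(m-2d)$. $S(\lambda)$ is the Specht module (James' convention); for $\lambda\in\Lambda_p$, $D(\lambda)$ is its simple head. $\tilde\Delta(\mu):=\Delta(S(\mu))$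 for $\mu\in\Lambda$, and $L(\lambda)$ is the simple head of $\Delta(D(\lambda))$ for $\lambda\in\Lambda_p$. For a simple module $L$, $[V:L]$ is the supremum over all finite filtrations of $V$ by submodules of the number of sections isomorphic to $L$. Cell modules: for $0\le 2k\le m$ let $1_{m-2k}\otimes E^k\in B_m(\delta_0)$ be the diagram whose first $m-2k$ strands are vertical and straight and where, on the last $2k$ points of each row, consecutive points are joined in pairs (positions $m-2k+2j-1$ and $m-2k+2j$, $1\le j\le k$) by $k$ caps and $k$ cups. $B^k$ is the two-sided ideal of $B_m(\delta_0)$ generated by $1_{m-2k}\otimes E^k$ (and $B^{k}=0$ if $2k>m$). For $\lambda\in\Lambda(m-2k)$, the cell module is $\Delta_m(\lambda)=\big((B_m(\delta_0)(1_{m-2k}\otimes E^k)+B^{k+1})/B^{k+1}\big)\otimes_{K\mathfrak S_{m-2k}}S(\lambda)$, where $\mathfrak S_{m-2k}$ acts on the right through the first $m-2k$ strands. It has basis $d(1_{m-2k}\otimes E^k)\otimes x$, with $x$ in a basis of $S(\lambda)$ and $d$ running over representatives in $\mathfrak S_m$ of the left cosets of $\mathcal B_k\times\mathfrak S_{m-2k}$, where $\mathcal B_k$ is the subgroup of permutations of the last $2k$ points $\{m-2k+1,\dots,m\}$ preserving the set of pairs $\{\{m-2k+2j-1,\,m-2k+2j\}\mid 1\le j\le k\}$. *)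

theory Defs
  imports
    "HOL-Algebra.Algebraic_Closure_Type"
    "HOL-Combinatorics.Permutations"
    "HOL-Library.Poly_Mapping"
    "HOL-Library.Disjoint_Sets"
    "HOL-Library.Extended_Nat"
begin

section \<open>Modules\<close>

abbreviation base_field :: "'k::field ring"
  where "base_field \<equiv> ring_of_type_algebra"

text \<open>
  A left module over a \<open>K\<close>-algebra is a \<open>K\<close>-vector space, represented as a module of
  \<open>HOL-Algebra\<close> over \<^term>\<open>base_field\<close>, together with the action of the algebra. The ring
  multiplication and unit that the record \<open>module\<close> also carries are never used.
  The algebra itself may lack a unit. It is passed to the notions below as the set \<open>A\<close> of its
  elements; only the action of these elements is relevant.
\<close>

record ('k, 'r, 'v) rep = "('k, 'v) module" +
  act :: "'r \<Rightarrow> 'v \<Rightarrow> 'v"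

definition kspan :: "('k::field, 'v, 'm) module_scheme \<Rightarrow> 'v set \<Rightarrow> 'v set"
  where "kspan V S = \<Inter>{W. submodule W base_field V \<and> S \<subseteq> W}"

definition is_submodule :: "'r set \<Rightarrow> ('k::field, 'r, 'v) rep \<Rightarrow> 'v set \<Rightarrow> bool"
  where "is_submodule A V W \<longleftrightarrow>
    submodule W base_field V \<and> (\<forall>a\<in>A. \<forall>w\<in>W. act V a w \<in> W)"

definition sub_rep :: "('k, 'r, 'v) rep \<Rightarrow> 'v set \<Rightarrow> ('k, 'r, 'v) rep"
  where "sub_rep V W = V\<lparr>carrier := W\<rparr>"

text \<open>The map induced on the cosets of \<open>N\<close> by a map \<open>f\<close> preserving \<open>N\<close>.\<close>

definition coset_map :: "('k, 'r, 'v) rep \<Rightarrow> 'v set \<Rightarrow> ('v \<Rightarrow> 'v) \<Rightarrow> 'v set \<Rightarrow> 'v set"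
  where "coset_map V N f C = (\<Union>x\<in>C. N +>\<^bsub>V\<^esub> f x)"

definition quot_rep :: "('k, 'r, 'v) rep \<Rightarrow> 'v set \<Rightarrow> ('k, 'r, 'v set) rep"
  where "quot_rep V N =
    \<lparr>carrier = a_rcosets\<^bsub>V\<^esub> N, monoid.mult = undefined, one = undefined,
     zero = N, add = set_add V,
     module.smult = (\<lambda>c. coset_map V N (module.smult V c)),
     act = (\<lambda>a. coset_map V N (act V a))\<rparr>"

definition rep_iso :: "'r set \<Rightarrow> ('k, 'r, 'v) rep \<Rightarrow> ('k, 'r, 'w) rep \<Rightarrow> bool"
  where "rep_iso A V W \<longleftrightarrow>
    (\<exists>f \<in> iso (add_monoid V) (add_monoid W).
       (\<forall>c. \<forall>v\<in>carrier V. f (c \<odot>\<^bsub>V\<^esub> v) = c \<odot>\<^bsub>W\<^esub> f v) \<and>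
       (\<forall>a\<in>A. \<forall>v\<in>carrier V. f (act V a v) = act W a (f v)))"

definition nonzero_rep :: "('k, 'r, 'v) rep \<Rightarrow> bool"
  where "nonzero_rep V \<longleftrightarrow> carrier V \<noteq> {\<zero>\<^bsub>V\<^esub>}"

definition simple_rep :: "'r set \<Rightarrow> ('k::field, 'r, 'v) rep \<Rightarrow> bool"
  where "simple_rep A V \<longleftrightarrow>
    nonzero_rep V \<and> (\<forall>W. is_submodule A V W \<longrightarrow> W = {\<zero>\<^bsub>V\<^esub>} \<or> W = carrier V)"

definition maximal_submodule :: "'r set \<Rightarrow> ('k::field, 'r, 'v) rep \<Rightarrow> 'v set \<Rightarrow> bool"
  where "maximal_submodule A V M \<longleftrightarrow>
    is_submodule A V M \<and> M \<noteq> carrier V \<and>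
    (\<forall>W. is_submodule A V W \<and> M \<subseteq> W \<longrightarrow> W = M \<or> W = carrier V)"

definition rad :: "'r set \<Rightarrow> ('k::field, 'r, 'v) rep \<Rightarrow> 'v set"
  where "rad A V = carrier V \<inter> \<Inter>{M. maximal_submodule A V M}"

definition head :: "'r set \<Rightarrow> ('k::field, 'r, 'v) rep \<Rightarrow> ('k, 'r, 'v set) rep"
  where "head A V = quot_rep V (rad A V)"

definition is_simple_head :: "'r set \<Rightarrow> ('k::field, 'r, 'w) rep \<Rightarrow> ('k, 'r, 'v) rep \<Rightarrow> bool"
  where "is_simple_head A L V \<longleftrightarrow> simple_rep A L \<and> rep_iso A L (head A V)"

text \<open>Finite filtrations, listed from the zero submodule to the whole module.\<close>

definition filtrations :: "'r set \<Rightarrow> ('k::field, 'r, 'v) rep \<Rightarrow> 'v set list set"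
  where "filtrations A V =
    {F. F \<noteq> [] \<and> hd F = {\<zero>\<^bsub>V\<^esub>} \<and> last F = carrier V \<and>
        (\<forall>W\<in>set F. is_submodule A V W) \<and> sorted_wrt (\<subseteq>) F}"

definition comp_mult :: "'r set \<Rightarrow> ('k::field, 'r, 'v) rep \<Rightarrow> ('k, 'r, 'w) rep \<Rightarrow> enat"
  where "comp_mult A V L =
    (SUP F\<in>filtrations A V.
       enat (card {i. Suc i < length F \<and> rep_iso A (quot_rep (sub_rep V (F ! Suc i)) (F ! i)) L}))"


section \<open>Free vector spaces and tensor products\<close>

definition scale :: "'k::field \<Rightarrow> ('a \<Rightarrow>\<^sub>0 'k) \<Rightarrow> ('a \<Rightarrow>\<^sub>0 'k)"
  where "scale c x = Poly_Mapping.map ((*) c) x"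

definition basis :: "'a \<Rightarrow> ('a \<Rightarrow>\<^sub>0 'k::field)"
  where "basis b = Poly_Mapping.single b 1"

definition lin_ext :: "('a \<Rightarrow> ('b \<Rightarrow>\<^sub>0 'k::field)) \<Rightarrow> ('a \<Rightarrow>\<^sub>0 'k) \<Rightarrow> ('b \<Rightarrow>\<^sub>0 'k)"
  where "lin_ext f x = (\<Sum>b\<in>Poly_Mapping.keys x. scale (Poly_Mapping.lookup x b) (f b))"

definition free_space :: "'a set \<Rightarrow> ('a \<Rightarrow>\<^sub>0 'k::field) set"
  where "free_space S = {x. Poly_Mapping.keys x \<subseteq> S}"

definition free_rep ::
    "'a set \<Rightarrow> ('r \<Rightarrow> ('a \<Rightarrow>\<^sub>0 'k::field) \<Rightarrow> ('a \<Rightarrow>\<^sub>0 'k)) \<Rightarrow> ('k, 'r, 'a \<Rightarrow>\<^sub>0 'k) rep"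
  where "free_rep S f =
    \<lparr>carrier = free_space S, monoid.mult = undefined, one = undefined, zero = 0, add = (+),
     module.smult = scale, act = f\<rparr>"

text \<open>
  \<open>tensor A M r V\<close> is \<open>M \<otimes>\<^sub>A V\<close> for a bimodule \<open>M\<close> whose right action of \<open>A\<close> is \<open>r\<close>,
  as a left module through the left action on \<open>M\<close>.
\<close>

definition tensor_relations ::
    "'a set \<Rightarrow> ('k::field, 'r, 'x) rep \<Rightarrow> ('x \<Rightarrow> 'a \<Rightarrow> 'x) \<Rightarrow> ('k, 'a, 'v) rep \<Rightarrow> ('x \<times> 'v \<Rightarrow>\<^sub>0 'k) set"
  where "tensor_relations A M r V =
    {basis (x \<oplus>\<^bsub>M\<^esub> y, v) - basis (x, v) - basis (y, v) | x y v.
       x \<in> carrier M \<and> y \<in> carrier M \<and> v \<in> carrier V} \<union>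
    {basis (x, v \<oplus>\<^bsub>V\<^esub> w) - basis (x, v) - basis (x, w) | x v w.
       x \<in> carrier M \<and> v \<in> carrier V \<and> w \<in> carrier V} \<union>
    {basis (c \<odot>\<^bsub>M\<^esub> x, v) - scale c (basis (x, v)) | c x v.
       x \<in> carrier M \<and> v \<in> carrier V} \<union>
    {basis (x, c \<odot>\<^bsub>V\<^esub> v) - scale c (basis (x, v)) | c x v.
       x \<in> carrier M \<and> v \<in> carrier V} \<union>
    {basis (r x a, v) - basis (x, act V a v) | a x v.
       a \<in> A \<and> x \<in> carrier M \<and> v \<in> carrier V}"

definition tensor ::
    "'a set \<Rightarrow> ('k::field, 'r, 'x) rep \<Rightarrow> ('x \<Rightarrow> 'a \<Rightarrow> 'x) \<Rightarrow> ('k, 'a, 'v) rep \<Rightarrow>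
     ('k, 'r, ('x \<times> 'v \<Rightarrow>\<^sub>0 'k) set) rep"
  where "tensor A M r V =
    (let F = free_rep (carrier M \<times> carrier V)
               (\<lambda>b. lin_ext (\<lambda>(x, v). basis (act M b x, v)))
     in quot_rep F (kspan F (tensor_relations A M r V)))"


section \<open>Partitions\<close>

definition partitions :: "nat list set"
  where "partitions = {\<mu>. sorted_wrt (\<ge>) \<mu> \<and> 0 \<notin> set \<mu>}"

definition partitions_of :: "nat \<Rightarrow> nat list set"
  where "partitions_of m = {\<mu>\<in>partitions. sum_list \<mu> = m}"

definition regular_partitions :: "nat \<Rightarrow> nat list set"
  where "regular_partitions p = {\<mu>\<in>partitions. p = 0 \<or> (\<forall>i. count_list \<mu> i < p)}"

definition regular_partitions_of :: "nat \<Rightarrow> nat \<Rightarrow> nat list set"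
  where "regular_partitions_of p m = {\<mu>\<in>regular_partitions p. sum_list \<mu> = m}"

definition Lambda_plus :: "nat \<Rightarrow> nat list set"
  where "Lambda_plus m = (\<Union>d\<in>{d. 2 * d \<le> m}. partitions_of (m - 2 * d))"

definition Lambda_p_plus :: "nat \<Rightarrow> nat \<Rightarrow> nat list set"
  where "Lambda_p_plus p m = (\<Union>d\<in>{d. 2 * d \<le> m}. regular_partitions_of p (m - 2 * d))"

definition Lambda_p_plus_tilde :: "nat \<Rightarrow> 'k::field \<Rightarrow> nat \<Rightarrow> nat list set"
  where "Lambda_p_plus_tilde p \<delta> m =
    (if 0 < m \<and> even m \<and> \<delta> = 0 then Lambda_p_plus p m - {[]} else Lambda_p_plus p m)"


section \<open>Specht modules\<close>

text \<open>The group algebra of the symmetric group on \<open>{1..n}\<close>.\<close>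

definition sym_algebra :: "nat \<Rightarrow> ((nat \<Rightarrow> nat) \<Rightarrow>\<^sub>0 'k::field) set"
  where "sym_algebra n = free_space {\<pi>. \<pi> permutes {1..n}}"

definition young_diagram :: "nat list \<Rightarrow> (nat \<times> nat) set"
  where "young_diagram \<mu> = {(i, j). i < length \<mu> \<and> j < \<mu> ! i}"

text \<open>
  Outside the Young diagram a tableau takes the value \<open>0\<close>, which is fixed by every permutation
  of \<open>{1..n}\<close>. Hence \<open>\<pi> \<circ> t\<close> is again a tableau.
\<close>

definition tableaux :: "nat list \<Rightarrow> (nat \<times> nat \<Rightarrow> nat) set"
  where "tableaux \<mu> =
    {t. bij_betw t (young_diagram \<mu>) {1..sum_list \<mu>} \<and> (\<forall>x. x \<notin> young_diagram \<mu> \<longrightarrow> t x = 0)}"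

definition row_stabilizer :: "nat list \<Rightarrow> (nat \<times> nat \<Rightarrow> nat) \<Rightarrow> (nat \<Rightarrow> nat) set"
  where "row_stabilizer \<mu> t =
    {\<pi>. \<pi> permutes {1..sum_list \<mu>} \<and>
        (\<forall>(i, j)\<in>young_diagram \<mu>. \<exists>j'. (i, j') \<in> young_diagram \<mu> \<and> \<pi> (t (i, j)) = t (i, j'))}"

definition column_stabilizer :: "nat list \<Rightarrow> (nat \<times> nat \<Rightarrow> nat) \<Rightarrow> (nat \<Rightarrow> nat) set"
  where "column_stabilizer \<mu> t =
    {\<pi>. \<pi> permutes {1..sum_list \<mu>} \<and>
        (\<forall>(i, j)\<in>young_diagram \<mu>. \<exists>i'. (i', j) \<in> young_diagram \<mu> \<and> \<pi> (t (i, j)) = t (i', j))}"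

definition tabloid :: "nat list \<Rightarrow> (nat \<times> nat \<Rightarrow> nat) \<Rightarrow> (nat \<times> nat \<Rightarrow> nat) set"
  where "tabloid \<mu> t = {\<pi> \<circ> t | \<pi>. \<pi> \<in> row_stabilizer \<mu> t}"

definition perm_module ::
    "nat list \<Rightarrow> ('k::field, (nat \<Rightarrow> nat) \<Rightarrow>\<^sub>0 'k, (nat \<times> nat \<Rightarrow> nat) set \<Rightarrow>\<^sub>0 'k) rep"
  where "perm_module \<mu> =
    free_rep (tabloid \<mu> ` tableaux \<mu>)
      (\<lambda>a x. lin_ext (\<lambda>\<pi>. lin_ext (\<lambda>T. basis ((\<circ>) \<pi> ` T)) x) a)"

definition polytabloid ::
    "nat list \<Rightarrow> (nat \<times> nat \<Rightarrow> nat) \<Rightarrow> ((nat \<times> nat \<Rightarrow> nat) set \<Rightarrow>\<^sub>0 'k::field)"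
  where "polytabloid \<mu> t =
    (\<Sum>\<pi>\<in>column_stabilizer \<mu> t. scale (of_int (sign \<pi>)) (basis (tabloid \<mu> (\<pi> \<circ> t))))"

text \<open>The Specht module of James, a submodule of the permutation module on tabloids.\<close>

definition specht ::
    "nat list \<Rightarrow> ('k::field, (nat \<Rightarrow> nat) \<Rightarrow>\<^sub>0 'k, (nat \<times> nat \<Rightarrow> nat) set \<Rightarrow>\<^sub>0 'k) rep"
  where "specht \<mu> =
    sub_rep (perm_module \<mu>) (kspan (perm_module \<mu>) (polytabloid \<mu> ` tableaux \<mu>))"

definition D_mod ::
    "nat list \<Rightarrow> ('k::field, (nat \<Rightarrow> nat) \<Rightarrow>\<^sub>0 'k, ((nat \<times> nat \<Rightarrow> nat) set \<Rightarrow>\<^sub>0 'k) set) rep"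
  where "D_mod \<mu> = head (sym_algebra (sum_list \<mu>)) (specht \<mu>)"


section \<open>Brauer diagrams\<close>

datatype point = Bot nat | Top nat

datatype diagram = Diagram (src: nat) (tgt: nat) (strands: "point set set")

text \<open>\<open>brauer m s\<close> is the set of Brauer diagrams with \<open>m\<close> bottom and \<open>s\<close> top points.\<close>

definition brauer :: "nat \<Rightarrow> nat \<Rightarrow> diagram set"
  where "brauer m s =
    {Diagram m s P | P. partition_on (Bot ` {1..m} \<union> Top ` {1..s}) P \<and> (\<forall>e\<in>P. card e = 2)}"

definition has_cup :: "diagram \<Rightarrow> bool"
  where "has_cup d \<longleftrightarrow> (\<exists>e\<in>strands d. e \<subseteq> range Top)"

definition perm_diagram :: "nat \<Rightarrow> (nat \<Rightarrow> nat) \<Rightarrow> diagram"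
  where "perm_diagram m \<pi> = Diagram m m ((\<lambda>i. {Bot i, Top (\<pi> i)}) ` {1..m})"

text \<open>
  For the product \<open>gh\<close>, the diagram \<open>g\<close> is put on top of \<open>h\<close>, the top row of \<open>h\<close> and the bottom
  row of \<open>g\<close> becoming one middle row. A connected component of the resulting graph is either a
  closed loop on middle points or meets the outer rows in the two endpoints of a strand of \<open>gh\<close>.
\<close>

datatype stack_point = Lower nat | Middle nat | Upper nat

definition stack_edges :: "diagram \<Rightarrow> diagram \<Rightarrow> stack_point set set"
  where "stack_edges g h =
    (image (case_point Lower Middle)) ` strands h \<union> (image (case_point Middle Upper)) ` strands g"

definition stack_components :: "diagram \<Rightarrow> diagram \<Rightarrow> stack_point set set"
  where "stack_components g h =
    \<Union>(stack_edges g h) // {(x, y). \<exists>e\<in>stack_edges g h. x \<in> e \<and> y \<in> e}\<^sup>+"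

definition outer_part :: "stack_point set \<Rightarrow> point set"
  where "outer_part C = case_point Lower Upper -` C"

definition stack :: "diagram \<Rightarrow> diagram \<Rightarrow> diagram"
  where "stack g h = Diagram (src h) (tgt g) (outer_part ` stack_components g h - {{}})"

definition loops :: "diagram \<Rightarrow> diagram \<Rightarrow> nat"
  where "loops g h = card {C\<in>stack_components g h. outer_part C = {}}"


section \<open>The algebra \<open>B\<close> and its subalgebras\<close>

definition B_alg :: "(diagram \<Rightarrow>\<^sub>0 'k::field) set"
  where "B_alg = free_space (\<Union>m s. brauer m s)"

definition B_mult ::
    "'k::field \<Rightarrow> (diagram \<Rightarrow>\<^sub>0 'k) \<Rightarrow> (diagram \<Rightarrow>\<^sub>0 'k) \<Rightarrow> (diagram \<Rightarrow>\<^sub>0 'k)"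
  where "B_mult \<delta> x y =
    lin_ext (\<lambda>g. lin_ext (\<lambda>h.
      if tgt h = src g then scale (\<delta> ^ loops g h) (basis (stack g h)) else 0) y) x"

definition B_id :: "nat \<Rightarrow> (diagram \<Rightarrow>\<^sub>0 'k::field)"
  where "B_id m = basis (perm_diagram m id)"

definition B_sharp :: "(diagram \<Rightarrow>\<^sub>0 'k::field) set"
  where "B_sharp = free_space {d \<in> (\<Union>m s. brauer m s). \<not> has_cup d}"

definition brauer_algebra :: "'k::field \<Rightarrow> nat \<Rightarrow> (diagram \<Rightarrow>\<^sub>0 'k) set"
  where "brauer_algebra \<delta> m = (\<lambda>x. B_mult \<delta> (B_mult \<delta> (B_id m) x) (B_id m)) ` B_alg"

definition B_regular :: "'k::field \<Rightarrow> ('k, diagram \<Rightarrow>\<^sub>0 'k, diagram \<Rightarrow>\<^sub>0 'k) rep"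
  where "B_regular \<delta> = free_rep (\<Union>m s. brauer m s) (B_mult \<delta>)"

text \<open>The \<open>B\<^sub>m(\<delta>)\<close>-module \<open>1\<^sub>mV\<close>.\<close>

definition trunc ::
    "nat \<Rightarrow> ('k::field, diagram \<Rightarrow>\<^sub>0 'k, 'v) rep \<Rightarrow> ('k, diagram \<Rightarrow>\<^sub>0 'k, 'v) rep"
  where "trunc m V = sub_rep V (act V (B_id m) ` carrier V)"

text \<open>
  Under the identification of \<open>B\<^sup>0\<close> with the direct sum of the group algebras of the symmetric
  groups (\<open>\<pi>\<close> in the \<open>n\<close>-th summand corresponding to \<open>perm_diagram n \<pi>\<close>), \<open>sym_part n\<close> is the
  projection of \<open>B\<close> onto the \<open>n\<close>-th summand killing all other diagrams. Its restriction to
  \<open>B\<^sup>\<sharp>\<close> is an algebra homomorphism; \<open>inflate n V\<close> is a module over \<open>B\<^sup>\<sharp>\<close>, not over \<open>B\<close>.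
\<close>

definition sym_part :: "nat \<Rightarrow> (diagram \<Rightarrow>\<^sub>0 'k::field) \<Rightarrow> ((nat \<Rightarrow> nat) \<Rightarrow>\<^sub>0 'k)"
  where "sym_part n b =
    (\<Sum>\<pi> | \<pi> permutes {1..n}. Poly_Mapping.single \<pi> (Poly_Mapping.lookup b (perm_diagram n \<pi>)))"

definition inflate ::
    "nat \<Rightarrow> ('k::field, (nat \<Rightarrow> nat) \<Rightarrow>\<^sub>0 'k, 'v) rep \<Rightarrow> ('k, diagram \<Rightarrow>\<^sub>0 'k, 'v) rep"
  where "inflate n V =
    \<lparr>carrier = carrier V, monoid.mult = undefined, one = undefined, zero = zero V, add = add V,
     module.smult = module.smult V, act = (\<lambda>b. act V (sym_part n b))\<rparr>"

definition Delta ::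
    "'k::field \<Rightarrow> ('k, diagram \<Rightarrow>\<^sub>0 'k, 'v) rep \<Rightarrow>
     ('k, diagram \<Rightarrow>\<^sub>0 'k, ((diagram \<Rightarrow>\<^sub>0 'k) \<times> 'v \<Rightarrow>\<^sub>0 'k) set) rep"
  where "Delta \<delta> V = tensor B_sharp (B_regular \<delta>) (B_mult \<delta>) V"

definition Delta_tilde where
  "Delta_tilde \<delta> \<mu> = Delta \<delta> (inflate (sum_list \<mu>) (specht \<mu>))"

definition L_mod where
  "L_mod \<delta> \<mu> = head B_alg (Delta \<delta> (inflate (sum_list \<mu>) (D_mod \<mu>)))"


section \<open>Cell modules\<close>

text \<open>The diagram with \<open>m - 2k\<close> straight strands followed by \<open>k\<close> caps and \<open>k\<close> cups.\<close>

definition E_diagram :: "nat \<Rightarrow> nat \<Rightarrow> diagram"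
  where "E_diagram m k = Diagram m m
    ((\<lambda>i. {Bot i, Top i}) ` {1..m - 2 * k} \<union>
     (\<lambda>j. {Bot (m - 2 * k + 2 * j - 1), Bot (m - 2 * k + 2 * j)}) ` {1..k} \<union>
     (\<lambda>j. {Top (m - 2 * k + 2 * j - 1), Top (m - 2 * k + 2 * j)}) ` {1..k})"

definition two_sided_ideal :: "'k::field \<Rightarrow> nat \<Rightarrow> (diagram \<Rightarrow>\<^sub>0 'k) set \<Rightarrow> bool"
  where "two_sided_ideal \<delta> m I \<longleftrightarrow>
    submodule I base_field (sub_rep (B_regular \<delta>) (brauer_algebra \<delta> m)) \<and>
    (\<forall>a\<in>brauer_algebra \<delta> m. \<forall>x\<in>I. B_mult \<delta> a x \<in> I \<and> B_mult \<delta> x a \<in> I)"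

definition brauer_ideal :: "'k::field \<Rightarrow> nat \<Rightarrow> nat \<Rightarrow> (diagram \<Rightarrow>\<^sub>0 'k) set"
  where "brauer_ideal \<delta> m k =
    (if 2 * k \<le> m then \<Inter>{I. two_sided_ideal \<delta> m I \<and> basis (E_diagram m k) \<in> I} else {0})"

definition cell_module where
  "cell_module \<delta> m \<mu> =
    (let n = sum_list \<mu>;
         k = (m - n) div 2;
         N = brauer_ideal \<delta> m (k + 1);
         U = sub_rep (B_regular \<delta>)
               {B_mult \<delta> x (basis (E_diagram m k)) + y | x y. x \<in> brauer_algebra \<delta> m \<and> y \<in> N};
         r = (\<lambda>C a. coset_map U N
               (\<lambda>x. B_mult \<delta> x (lin_ext (\<lambda>\<pi>. basis (perm_diagram m \<pi>)) a)) C)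
     in tensor (sym_algebra n) (quot_rep U N) r (specht \<mu>))"

end

(*
  Everything but the comparison with cell modules follows from truncation by the idempotent e = 1_m:
  for a simple module L with eL nonzero, taking eV turns filtrations of V into filtrations of eV,
  a submodule W of eV being lifted to the submodule it generates and to the largest submodule U
  with eU contained in W. The multiplicities of L and eL therefore agree. The same lifting
  with e = 1_n shows that Delta(V) is local whenever the module V over the symmetric group is, since
  1_n Delta(V) = V generates Delta(V). For a p-regular partition S(lambda) is local by James's
  argument with column antisymmetrizers.

  The truncation 1_m L(lambda) is nonzero as soon as the identity of n = |lambda| points factors
  through n + 2d = m points: by straightening a zigzag if n > 0, and by a circle of value delta_0
  if n = 0. If n = 0 < m and delta_0 = 0, every such composite contains a closed loop and vanishes.

  Finally, 1_m Delta(S(mu)) is spanned by the elements d (x) v with d a diagram from n = |mu| to m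
  points, and those with a cap in d vanish. Adding k = (m - n)/2 caps at the end of the bottom row turns
  d into an element of the cell bimodule.
*)
theory Submission
  imports Defs
begin

section \<open>Modules over an algebra without unit: homomorphisms, quotients, isomorphism
  theorems\<close>

section \<open>Linear algebra over records\<close>

text \<open>Standard modules are infinite-dimensional over K and \<open>B_alg\<close> has no unit,
  so neither composition series nor the identity 1v = v is available. Multiplicities are therefore
  compared as suprema, and heads are controlled by exhibiting a largest proper submodule, which
  settles the existence of maximal submodules at once.

  A second obstacle is that L(lambda) is the head of Delta(D(lambda)), whereas the claims concern
  Delta(S(lambda)). The two are linked by the composite of S(lambda) -> D(lambda) with D(lambda) ->
  1_n L(lambda), which extends to Delta(S(lambda)) by the extension principle that also compares
  multiplicities.

  The characteristic enters twice: 2 is invertible, so an antisymmetrizer kills a tabloid fixed by a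
  transposition of its column; and p-regularity makes the order of a certain Young subgroup
  invertible, which is the coefficient showing that the radical of S(lambda) is proper.

  Composition of diagrams is treated by connected components of graphs: contracting the middle
  points is one operation, however many diagrams are stacked, whereas tracing strands would split
  into many cases.\<close>

lemma base_field_simps [simp]:
  "carrier (base_field :: 'k::field ring) = UNIV"
  "x \<oplus>\<^bsub>(base_field :: 'k ring)\<^esub> y = x + y"
  "x \<otimes>\<^bsub>(base_field :: 'k ring)\<^esub> y = x * y"
  "\<zero>\<^bsub>(base_field :: 'k ring)\<^esub> = 0"
  "\<one>\<^bsub>(base_field :: 'k ring)\<^esub> = 1"
  by (simp_all add: ring_of_type_algebra_def)

abbreviation vsp :: "('k::field, 'v, 'm) module_scheme \<Rightarrow> bool"
  where "vsp V \<equiv> module base_field V"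

text \<open>Negatives are \<open>(-1) \<odot> x\<close>: that they cancel \<open>x\<close> follows
  from \<open>0 \<odot> x = \<zero>\<close>, which is why this law takes the place of an axiom on
  inverses.\<close>

lemma vspI:
  fixes V :: "('k::field, 'v, 'm) module_scheme" (structure)
  assumes "\<And>x y. x \<in> carrier V \<Longrightarrow> y \<in> carrier V \<Longrightarrow> x \<oplus> y \<in> carrier V"
    and "\<zero> \<in> carrier V"
    and "\<And>x y z. x \<in> carrier V \<Longrightarrow> y \<in> carrier V \<Longrightarrow> z \<in> carrier V \<Longrightarrow> (x \<oplus> y) \<oplus> z = x \<oplus> (y \<oplus> z)"
    and "\<And>x y. x \<in> carrier V \<Longrightarrow> y \<in> carrier V \<Longrightarrow> x \<oplus> y = y \<oplus> x"
    and "\<And>x. x \<in> carrier V \<Longrightarrow> \<zero> \<oplus> x = x"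
    and "\<And>c x. x \<in> carrier V \<Longrightarrow> c \<odot> x \<in> carrier V"
    and "\<And>c d x. x \<in> carrier V \<Longrightarrow> (c + d) \<odot> x = c \<odot> x \<oplus> d \<odot> x"
    and "\<And>c x y. x \<in> carrier V \<Longrightarrow> y \<in> carrier V \<Longrightarrow> c \<odot> (x \<oplus> y) = c \<odot> x \<oplus> c \<odot> y"
    and "\<And>c d x. x \<in> carrier V \<Longrightarrow> (c * d) \<odot> x = c \<odot> (d \<odot> x)"
    and "\<And>x. x \<in> carrier V \<Longrightarrow> 1 \<odot> x = x"
    and "\<And>x. x \<in> carrier V \<Longrightarrow> 0 \<odot> x = \<zero>"
  shows "vsp V"
proof (rule moduleI)
  show "cring (base_field :: 'k ring)" by (rule cring_from_type_algebra)
  show "abelian_group V"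
  proof (rule abelian_groupI)
    fix x assume x: "x \<in> carrier V"
    have "(-1) \<odot> x \<oplus> x = (-1 + 1) \<odot> x"
      using assms(7)[OF x, of "-1" 1] assms(10)[OF x] by simp
    then show "\<exists>y\<in>carrier V. y \<oplus> x = \<zero>"
      using assms(6,11) x by (intro bexI[of _ "(-1) \<odot> x"]) auto
  qed (use assms in auto)
qed (use assms in auto)

text \<open>Scalar multiples by \<open>-1\<close> supply negatives, so closure under inverses needs
  no clause of its own.\<close>

lemma submodule_iff:
  fixes V :: "('k::field, 'v, 'm) module_scheme" (structure)
  assumes "vsp V"
  shows "submodule W base_field V \<longleftrightarrow> W \<subseteq> carrier V \<and> \<zero> \<in> W \<and>
    (\<forall>x\<in>W. \<forall>y\<in>W. x \<oplus> y \<in> W) \<and> (\<forall>c. \<forall>x\<in>W. c \<odot> x \<in> W)"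
proof -
  interpret module base_field V by fact
  have minus: "\<ominus> x = (-1) \<odot> x" if "x \<in> carrier V" for x
  proof -
    have "\<ominus>\<^bsub>base_field\<^esub> 1 = (-1 :: 'k)"
      using R.minus_equality[of "-1" 1] by simp
    then show ?thesis using smult_l_minus[of 1 x] smult_one[OF that] that by simp
  qed
  show ?thesis
  proof (intro iffI conjI ballI allI)
    assume s: "submodule W base_field V"
    note E = submoduleE[OF s]
    show "W \<subseteq> carrier V" by (rule E)
    obtain x where x: "x \<in> W" using E(2) by auto
    then have "x \<oplus> \<ominus> x \<in> W" using E by auto
    then show "\<zero> \<in> W" using x E(1) by (auto simp: r_neg)
  next
    assume *: "W \<subseteq> carrier V \<and> \<zero> \<in> W \<and>
      (\<forall>x\<in>W. \<forall>y\<in>W. x \<oplus> y \<in> W) \<and> (\<forall>c. \<forall>x\<in>W. c \<odot> x \<in> W)"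
    then show "submodule W base_field V"
      by (intro submoduleI) (auto simp: minus)
  qed (use submoduleE in auto)
qed

text \<open>Only the single operators given by elements of \<open>A\<close> are constrained, not
  their dependence on \<open>A\<close>. The choice \<open>A = {}\<close> thus gives plain vector
  spaces, and passing to a subset of \<open>A\<close>, such as a corner, is immediate.\<close>

definition lrep :: "'r set \<Rightarrow> ('k::field, 'r, 'v) rep \<Rightarrow> bool"
  where "lrep A V \<longleftrightarrow> vsp V \<and>
    (\<forall>a\<in>A. \<forall>v\<in>carrier V. act V a v \<in> carrier V) \<and>
    (\<forall>a\<in>A. \<forall>v\<in>carrier V. \<forall>w\<in>carrier V. act V a (v \<oplus>\<^bsub>V\<^esub> w) = act V a v \<oplus>\<^bsub>V\<^esub> act V a w) \<and>
    (\<forall>a\<in>A. \<forall>c. \<forall>v\<in>carrier V. act V a (c \<odot>\<^bsub>V\<^esub> v) = c \<odot>\<^bsub>V\<^esub> act V a v)"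

definition rhom :: "'r set \<Rightarrow> ('k::field, 'r, 'v) rep \<Rightarrow> ('k, 'r, 'w) rep \<Rightarrow> ('v \<Rightarrow> 'w) \<Rightarrow> bool"
  where "rhom A V W f \<longleftrightarrow>
    (\<forall>v\<in>carrier V. f v \<in> carrier W) \<and>
    (\<forall>v\<in>carrier V. \<forall>w\<in>carrier V. f (v \<oplus>\<^bsub>V\<^esub> w) = f v \<oplus>\<^bsub>W\<^esub> f w) \<and>
    (\<forall>c. \<forall>v\<in>carrier V. f (c \<odot>\<^bsub>V\<^esub> v) = c \<odot>\<^bsub>W\<^esub> f v) \<and>
    (\<forall>a\<in>A. \<forall>v\<in>carrier V. f (act V a v) = act W a (f v))"

lemma rhomD:
  assumes "rhom A V W f"
  shows "v \<in> carrier V \<Longrightarrow> f v \<in> carrier W"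
    "v \<in> carrier V \<Longrightarrow> w \<in> carrier V \<Longrightarrow> f (v \<oplus>\<^bsub>V\<^esub> w) = f v \<oplus>\<^bsub>W\<^esub> f w"
    "v \<in> carrier V \<Longrightarrow> f (c \<odot>\<^bsub>V\<^esub> v) = c \<odot>\<^bsub>W\<^esub> f v"
    "a \<in> A \<Longrightarrow> v \<in> carrier V \<Longrightarrow> f (act V a v) = act W a (f v)"
  using assms by (auto simp: rhom_def)

lemma lrepD:
  assumes "lrep A V"
  shows "vsp V"
    "a \<in> A \<Longrightarrow> v \<in> carrier V \<Longrightarrow> act V a v \<in> carrier V"
    "a \<in> A \<Longrightarrow> v \<in> carrier V \<Longrightarrow> w \<in> carrier V \<Longrightarrow> act V a (v \<oplus>\<^bsub>V\<^esub> w) = act V a v \<oplus>\<^bsub>V\<^esub> act V a w"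
    "a \<in> A \<Longrightarrow> v \<in> carrier V \<Longrightarrow> act V a (c \<odot>\<^bsub>V\<^esub> v) = c \<odot>\<^bsub>V\<^esub> act V a v"
  using assms by (auto simp: lrep_def)

lemma vspD:
  fixes V :: "('k::field, 'v, 'm) module_scheme" (structure)
  assumes "vsp V"
  shows "\<zero> \<in> carrier V"
    "x \<in> carrier V \<Longrightarrow> y \<in> carrier V \<Longrightarrow> x \<oplus> y \<in> carrier V"
    "x \<in> carrier V \<Longrightarrow> c \<odot> x \<in> carrier V"
    "x \<in> carrier V \<Longrightarrow> 0 \<odot> x = \<zero>"
    "c \<odot> \<zero> = \<zero>"
    "x \<in> carrier V \<Longrightarrow> \<zero> \<oplus> x = x"
    "x \<in> carrier V \<Longrightarrow> x \<oplus> \<zero> = x"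
    "x \<in> carrier V \<Longrightarrow> 1 \<odot> x = x"
    "x \<in> carrier V \<Longrightarrow> y \<in> carrier V \<Longrightarrow> c \<odot> (x \<oplus> y) = c \<odot> x \<oplus> c \<odot> y"
    "x \<in> carrier V \<Longrightarrow> c \<odot> (d \<odot> x) = (c * d) \<odot> x"
    "x \<in> carrier V \<Longrightarrow> (c + d) \<odot> x = c \<odot> x \<oplus> d \<odot> x"
    "x \<in> carrier V \<Longrightarrow> y \<in> carrier V \<Longrightarrow> z \<in> carrier V \<Longrightarrow> (x \<oplus> y) \<oplus> z = x \<oplus> (y \<oplus> z)"
    "x \<in> carrier V \<Longrightarrow> y \<in> carrier V \<Longrightarrow> x \<oplus> y = y \<oplus> x"
    "x \<in> carrier V \<Longrightarrow> y \<in> carrier V \<Longrightarrow> z \<in> carrier V \<Longrightarrow> x \<oplus> (y \<oplus> z) = y \<oplus> (x \<oplus> z)"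
    "x \<in> carrier V \<Longrightarrow> x \<oplus> (-1) \<odot> x = \<zero>"
proof -
  interpret module base_field V by fact
  show "x \<in> carrier V \<Longrightarrow> 0 \<odot> x = \<zero>" using smult_l_null[of x] by simp
  show "c \<odot> \<zero> = \<zero>" using smult_r_null[of c] by simp
  show "x \<in> carrier V \<Longrightarrow> 1 \<odot> x = x" using smult_one[of x] by simp
  show "x \<in> carrier V \<Longrightarrow> c \<odot> (d \<odot> x) = (c * d) \<odot> x" using smult_assoc1[of c d x] by simp
  show l: "x \<in> carrier V \<Longrightarrow> (c + d) \<odot> x = c \<odot> x \<oplus> d \<odot> x" for x c d
    using smult_l_distr[of c d x] by simp
  show "x \<in> carrier V \<Longrightarrow> x \<oplus> (-1) \<odot> x = \<zero>"
    using l[of x 1 "-1"] smult_one[of x] smult_l_null[of x] by simp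
  show "x \<in> carrier V \<Longrightarrow> c \<odot> x \<in> carrier V" using smult_closed by simp
  show "x \<in> carrier V \<Longrightarrow> y \<in> carrier V \<Longrightarrow> c \<odot> (x \<oplus> y) = c \<odot> x \<oplus> c \<odot> y"
    using smult_r_distr by simp
  show "x \<in> carrier V \<Longrightarrow> y \<in> carrier V \<Longrightarrow> z \<in> carrier V \<Longrightarrow> (x \<oplus> y) \<oplus> z = x \<oplus> (y \<oplus> z)"
    by (rule M.a_assoc)
  show "x \<in> carrier V \<Longrightarrow> y \<in> carrier V \<Longrightarrow> x \<oplus> y = y \<oplus> x" by (rule M.a_comm)
  show "x \<in> carrier V \<Longrightarrow> y \<in> carrier V \<Longrightarrow> z \<in> carrier V \<Longrightarrow> x \<oplus> (y \<oplus> z) = y \<oplus> (x \<oplus> z)"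
    by (rule M.a_lcomm)
  show "\<zero> \<in> carrier V" by (rule M.zero_closed)
  show "x \<in> carrier V \<Longrightarrow> y \<in> carrier V \<Longrightarrow> x \<oplus> y \<in> carrier V" by (rule M.a_closed)
  show "x \<in> carrier V \<Longrightarrow> \<zero> \<oplus> x = x" by (rule M.l_zero)
  show "x \<in> carrier V \<Longrightarrow> x \<oplus> \<zero> = x" by (rule M.r_zero)
qed

text \<open>Subtraction is written \<open>x \<oplus> (-1) \<odot> y\<close> throughout, since these
  are the operations that submodules and homomorphisms visibly preserve.\<close>

lemma diff_eq_zero_iff:
  fixes V :: "('k::field, 'v, 'm) module_scheme" (structure)
  assumes "vsp V" "x \<in> carrier V" "y \<in> carrier V"
  shows "x \<oplus> (-1) \<odot> y = \<zero> \<longleftrightarrow> x = y"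
proof
  note D = vspD[OF assms(1)]
  assume "x \<oplus> (-1) \<odot> y = \<zero>"
  then have "(x \<oplus> (-1) \<odot> y) \<oplus> y = y" using D assms by simp
  then show "x = y" using D(12)[of x "(-1) \<odot> y" y] D(13)[of "(-1) \<odot> y" y] D(15)[of y] D assms by simp
qed (use vspD[OF assms(1)] assms in auto)

lemma rhom_zero:
  assumes "vsp V" "vsp W" "rhom A V W f"
  shows "f \<zero>\<^bsub>V\<^esub> = \<zero>\<^bsub>W\<^esub>"
  using rhomD(3)[OF assms(3) vspD(1)[OF assms(1)], of 0] vspD(4)[OF assms(2)]
    rhomD(1)[OF assms(3) vspD(1)[OF assms(1)]] vspD(5)[OF assms(1)] by simp

lemma act_zero: "lrep A V \<Longrightarrow> a \<in> A \<Longrightarrow> act V a \<zero>\<^bsub>V\<^esub> = \<zero>\<^bsub>V\<^esub>"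
  using lrepD(4)[of A V a "\<zero>\<^bsub>V\<^esub>" 0] lrepD(1,2)[of A V] vspD(1,4,5)[of V] by metis

lemma rhom_comp:
  assumes "rhom A U V f" "rhom A V W g"
  shows "rhom A U W (g \<circ> f)"
  using assms by (auto simp: rhom_def)

lemma rep_iso_iff:
  "rep_iso A V W \<longleftrightarrow> (\<exists>f. rhom A V W f \<and> bij_betw f (carrier V) (carrier W))"
  unfolding rep_iso_def rhom_def iso_def hom_def by (auto 0 4 simp: Pi_def bij_betw_def)

text \<open>Sections of filtrations are compared by maps to \<open>L\<close>, whereas
  \<open>is_simple_head\<close> asks for a map from \<open>L\<close>; hence both directions
  occur.\<close>

lemma rep_iso_sym:
  assumes "lrep A V" "rep_iso A V W"
  shows "rep_iso A W V"
proof -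
  obtain f where f: "rhom A V W f" "bij_betw f (carrier V) (carrier W)"
    using assms(2) by (auto simp: rep_iso_iff)
  define g where "g = the_inv_into (carrier V) f"
  have g: "bij_betw g (carrier W) (carrier V)" "\<And>v. v \<in> carrier V \<Longrightarrow> g (f v) = v"
    using f(2) unfolding g_def
    by (rule bij_betw_the_inv_into) (use f(2) in \<open>simp add: bij_betw_def the_inv_into_f_f\<close>)
  have sur: "\<exists>v\<in>carrier V. w = f v" if "w \<in> carrier W" for w
    using f(2) that by (auto simp: bij_betw_def)
  note D = lrepD[OF assms(1)] rhomD[OF f(1)]
  have "rhom A W V g"
    unfolding rhom_def
  proof (intro conjI ballI allI)
    fix w assume w: "w \<in> carrier W"
    then obtain v where v: "v \<in> carrier V" "w = f v" using sur by blast
    show "g w \<in> carrier V" using g v by simp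
    show "g (c \<odot>\<^bsub>W\<^esub> w) = c \<odot>\<^bsub>V\<^esub> g w" for c
      using D(7)[OF v(1), of c, symmetric] g(2) v vspD(3)[OF D(1)] by simp
    show "g (act W a w) = act V a (g w)" if "a \<in> A" for a
      using D(8)[OF that v(1), symmetric] g(2) v D(2) that by simp
    fix w' assume "w' \<in> carrier W"
    then obtain v' where v': "v' \<in> carrier V" "w' = f v'" using sur by blast
    show "g (w \<oplus>\<^bsub>W\<^esub> w') = g w \<oplus>\<^bsub>V\<^esub> g w'"
      using D(6)[OF v(1) v'(1), symmetric] g(2) v v' vspD(2)[OF D(1)] by simp
  qed
  with g(1) show ?thesis by (auto simp: rep_iso_iff)
qed

subsection \<open>Submodules and quotients\<close>

lemma is_submodule_iff:
  assumes "vsp V"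
  shows "is_submodule A V W \<longleftrightarrow> W \<subseteq> carrier V \<and> \<zero>\<^bsub>V\<^esub> \<in> W \<and>
    (\<forall>x\<in>W. \<forall>y\<in>W. x \<oplus>\<^bsub>V\<^esub> y \<in> W) \<and> (\<forall>c. \<forall>x\<in>W. c \<odot>\<^bsub>V\<^esub> x \<in> W) \<and> (\<forall>a\<in>A. \<forall>w\<in>W. act V a w \<in> W)"
  unfolding is_submodule_def submodule_iff[OF assms] by auto

lemma is_submodule_zero: "lrep A V \<Longrightarrow> is_submodule A V {\<zero>\<^bsub>V\<^esub>}"
  using act_zero[of A V] lrepD(1)[of A V] vspD[of V] by (auto simp: is_submodule_iff)

lemma is_submodule_carrier: "lrep A V \<Longrightarrow> is_submodule A V (carrier V)"
  using lrepD[of A V] vspD[of V] by (auto simp: is_submodule_iff)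

lemma is_submodule_Int:
  "vsp V \<Longrightarrow> is_submodule A V W \<Longrightarrow> is_submodule A V W' \<Longrightarrow> is_submodule A V (W \<inter> W')"
  by (auto simp: is_submodule_iff)

lemma sub_rep_simps [simp]:
  "carrier (sub_rep V W) = W" "zero (sub_rep V W) = zero V" "add (sub_rep V W) = add V"
  "module.smult (sub_rep V W) = module.smult V" "act (sub_rep V W) = act V"
  by (simp_all add: sub_rep_def)

lemma lrep_sub_rep:
  assumes "lrep A V" "is_submodule A V W"
  shows "lrep A (sub_rep V W)"
proof -
  have "vsp (sub_rep V W)"
    using submodule.submodule_is_module[of W base_field V] assms
    by (auto simp: is_submodule_def sub_rep_def lrep_def)
  then show ?thesis
    using assms lrepD[OF assms(1)] unfolding lrep_def is_submodule_iff[OF lrepD(1)[OF assms(1)]]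
    by (simp add: subset_iff)
qed

lemma is_submodule_sub_rep:
  assumes "lrep A V" "is_submodule A V W"
  shows "is_submodule A (sub_rep V W) U \<longleftrightarrow> is_submodule A V U \<and> U \<subseteq> W"
  using lrepD(1)[OF assms(1)] lrepD(1)[OF lrep_sub_rep[OF assms]] assms(2)
  by (auto simp: is_submodule_iff)

lemma cls_eq:
  fixes V :: "('k::field, 'v, 'm) module_scheme" (structure)
  assumes "vsp V" "submodule N base_field V" "x \<in> carrier V" "y \<in> carrier V"
  shows "N +> x = N +> y \<longleftrightarrow> x \<oplus> (-1) \<odot> y \<in> N"
proof -
  note D = vspD[OF assms(1)] and N = assms(2)[unfolded submodule_iff[OF assms(1)]]
  have sub: "n \<in> carrier V" if "n \<in> N" for n using that N by auto
  have cancel: "(x \<oplus> (-1) \<odot> y) \<oplus> y = x"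
    using D(12)[of x "(-1) \<odot> y" y] D(13)[of "(-1) \<odot> y" y] D(15)[of y] D(3,7) assms by simp
  show ?thesis
  proof
    assume eq: "N +> x = N +> y"
    have "x \<in> N +> x" using N D(6)[OF assms(3)] by (auto simp: a_r_coset_def' intro!: bexI[of _ \<zero>])
    then obtain n where n: "n \<in> N" "x = n \<oplus> y" using eq by (auto simp: a_r_coset_def')
    then have "x \<oplus> (-1) \<odot> y = n"
      using D(12)[of n y "(-1) \<odot> y"] D(15)[of y] D(3,7) assms sub by auto
    then show "x \<oplus> (-1) \<odot> y \<in> N" using n by simp
  next
    define d where "d = x \<oplus> (-1) \<odot> y"
    assume "x \<oplus> (-1) \<odot> y \<in> N"
    then have d: "d \<in> N" and x: "x = d \<oplus> y" using cancel by (simp_all add: d_def)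
    have "n \<oplus> x = (n \<oplus> d) \<oplus> y" if "n \<in> N" for n
      using x D(12)[of n d y] sub that d assms by simp
    moreover have "n \<oplus> y = (n \<oplus> (-1) \<odot> d) \<oplus> x" if "n \<in> N" for n
    proof -
      have "(-1) \<odot> d \<oplus> x = y"
        using D(12)[of "(-1) \<odot> d" d y] D(13)[of "(-1) \<odot> d" d] D(15)[of d] D(3,6) sub[OF d] assms x by simp
      then show ?thesis using D(12)[of n "(-1) \<odot> d" x] sub that d assms D(3) by simp
    qed
    moreover have "n \<oplus> d \<in> N \<and> n \<oplus> (-1) \<odot> d \<in> N" if "n \<in> N" for n
      using that d N by blast
    ultimately show "N +> x = N +> y" unfolding a_r_coset_def' by (auto, metis, metis)
  qed
qed

text \<open>The union defining \<open>coset_map\<close> collapses: changing the representative by n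
  in \<open>N\<close> changes the image by \<open>f n\<close>, which lies in \<open>N\<close> again,
  so all cosets in the union coincide.\<close>

lemma coset_map_cls:
  fixes V :: "('k::field, 'r, 'v) rep" (structure)
  assumes "vsp V" "submodule N base_field V" "x \<in> carrier V"
    and f: "\<And>v. v \<in> carrier V \<Longrightarrow> f v \<in> carrier V"
      "\<And>v w. v \<in> carrier V \<Longrightarrow> w \<in> carrier V \<Longrightarrow> f (v \<oplus> w) = f v \<oplus> f w"
      "\<And>v. v \<in> N \<Longrightarrow> f v \<in> N"
  shows "coset_map V N f (N +> x) = N +> f x"
proof -
  note D = vspD[OF assms(1)] and N = assms(2)[unfolded submodule_iff[OF assms(1)]]
  have eq: "N +> f (n \<oplus> x) = N +> f x" if "n \<in> N" for n
  proof -
    have "f n \<oplus> f x \<oplus> (-1) \<odot> f x = f n"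
      using D(12)[of "f n" "f x" "(-1) \<odot> f x"] D(15)[of "f x"] D(3)[of "f x" "-1"] D(7)[of "f n"]
        f(1)[of n] f(1)[of x] assms(3) that N by auto
    then show ?thesis
      using cls_eq[OF assms(1,2), of "f (n \<oplus> x)" "f x"] f(1)[of "n \<oplus> x"] f(2)[of n x] f(1)[of x] f(3)[of n] that N D(2)[of n x] assms(3) by auto
  qed
  have "coset_map V N f (N +> x) = (\<Union>n\<in>N. N +> f (n \<oplus> x))"
    by (auto simp: coset_map_def a_r_coset_def')
  also have "\<dots> = N +> f x" using eq N by auto
  finally show ?thesis .
qed

lemma quot_rep_simps [simp]:
  "zero (quot_rep V N) = N" "add (quot_rep V N) = set_add V"
  "module.smult (quot_rep V N) = (\<lambda>c. coset_map V N (module.smult V c))"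
  "act (quot_rep V N) = (\<lambda>a. coset_map V N (act V a))"
  by (simp_all add: quot_rep_def)

lemma carrier_quot_rep: "carrier (quot_rep V N) = (\<lambda>x. N +>\<^bsub>V\<^esub> x) ` carrier V"
  by (auto simp: quot_rep_def A_RCOSETS_def')

lemma quot_props:
  fixes V :: "('k::field, 'r, 'v) rep" (structure)
  assumes "lrep A V" "is_submodule A V N"
  shows quot_add: "x \<in> carrier V \<Longrightarrow> y \<in> carrier V \<Longrightarrow> (N +> x) \<oplus>\<^bsub>quot_rep V N\<^esub> (N +> y) = N +> (x \<oplus> y)"
    and quot_smult: "x \<in> carrier V \<Longrightarrow> c \<odot>\<^bsub>quot_rep V N\<^esub> (N +> x) = N +> (c \<odot> x)"
    and quot_act: "a \<in> A \<Longrightarrow> x \<in> carrier V \<Longrightarrow> act (quot_rep V N) a (N +> x) = N +> act V a x"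
    and quot_zero: "N +> \<zero> = N"
    and quot_kernel: "x \<in> carrier V \<Longrightarrow> N +> x = N \<longleftrightarrow> x \<in> N"
proof -
  have V: "vsp V" using assms lrepD by auto
  note D = vspD[OF V]
  interpret module base_field V by (rule V)
  have N: "submodule N base_field V" using assms(2) by (simp add: is_submodule_def)
  note N' = assms(2)[unfolded is_submodule_iff[OF V]]
  have S: "abelian_subgroup N V"
    by (rule abelian_subgroupI3[OF additive_subgroup.intro[OF submodule.axioms(1)[OF N]] M.abelian_group_axioms])
  show "x \<in> carrier V \<Longrightarrow> y \<in> carrier V \<Longrightarrow> (N +> x) \<oplus>\<^bsub>quot_rep V N\<^esub> (N +> y) = N +> (x \<oplus> y)"
    using abelian_subgroup.a_rcos_sum[OF S] by simp
  show "x \<in> carrier V \<Longrightarrow> c \<odot>\<^bsub>quot_rep V N\<^esub> (N +> x) = N +> (c \<odot> x)"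
    using coset_map_cls[OF V N, of x "\<lambda>v. c \<odot> v"] D N' by simp
  show "a \<in> A \<Longrightarrow> x \<in> carrier V \<Longrightarrow> act (quot_rep V N) a (N +> x) = N +> act V a x"
    using coset_map_cls[OF V N, of x "act V a"] lrepD[OF assms(1)] N' by simp
  show z: "N +> \<zero> = N" using N' by simp
  show "x \<in> carrier V \<Longrightarrow> N +> x = N \<longleftrightarrow> x \<in> N"
    using cls_eq[OF V N, of x \<zero>] z D by simp
qed

lemma lrep_quot_rep:
  assumes "lrep A V" "is_submodule A V N"
  shows "lrep A (quot_rep V N)"
proof -
  note V = lrepD[OF assms(1)]
  note D = vspD[OF V(1)] V(2-)
  note Q = quot_props[OF assms, simplified]
  have v: "vsp (quot_rep V N)"
  proof (rule vspI)
    show "\<zero>\<^bsub>quot_rep V N\<^esub> \<in> carrier (quot_rep V N)"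
      using Q(4) D by (auto simp: carrier_quot_rep image_iff intro!: bexI[of _ "\<zero>\<^bsub>V\<^esub>"])
    show "\<zero>\<^bsub>quot_rep V N\<^esub> \<oplus>\<^bsub>quot_rep V N\<^esub> x = x" if "x \<in> carrier (quot_rep V N)" for x
      using that Q(4) Q(1)[of "\<zero>\<^bsub>V\<^esub>"] D by (auto simp: carrier_quot_rep)
    show "0 \<odot>\<^bsub>quot_rep V N\<^esub> x = \<zero>\<^bsub>quot_rep V N\<^esub>" if "x \<in> carrier (quot_rep V N)" for x
      using that Q(2,4) D by (auto simp: carrier_quot_rep)
  qed (use D Q in \<open>auto simp: carrier_quot_rep\<close>)
  show ?thesis
    unfolding lrep_def using v D Q by (auto simp: carrier_quot_rep)
qed

lemma rhom_cls:
  assumes "lrep A V" "is_submodule A V N"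
  shows "rhom A V (quot_rep V N) (\<lambda>x. N +>\<^bsub>V\<^esub> x)"
  using quot_props[OF assms] unfolding rhom_def by (auto simp: carrier_quot_rep)

definition hker :: "('k::field, 'r, 'v) rep \<Rightarrow> ('k, 'r, 'w) rep \<Rightarrow> ('v \<Rightarrow> 'w) \<Rightarrow> 'v set"
  where "hker V W f = {v\<in>carrier V. f v = \<zero>\<^bsub>W\<^esub>}"

lemma rhom_eq_iff:
  assumes "vsp V" "vsp W" "rhom A V W f" "x \<in> carrier V" "y \<in> carrier V"
  shows "f x = f y \<longleftrightarrow> x \<oplus>\<^bsub>V\<^esub> (-1) \<odot>\<^bsub>V\<^esub> y \<in> hker V W f"
  using rhomD[OF assms(3)] assms diff_eq_zero_iff[OF assms(2), of "f x" "f y"] vspD[OF assms(1)]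
  by (simp add: hker_def)

lemma rep_iso_quotI:
  assumes "lrep A V" "lrep A W" "rhom A V W f" "f ` carrier V = carrier W" "is_submodule A V N"
    "hker V W f = N"
  shows "rep_iso A (quot_rep V N) W"
proof -
  note V = lrepD(1)[OF assms(1)] and W = lrepD(1)[OF assms(2)]
  note Q = quot_props[OF assms(1,5)]
  have N: "submodule N base_field V" using assms(5) by (simp add: is_submodule_def)
  define g where "g C = f (SOME x. x \<in> carrier V \<and> N +>\<^bsub>V\<^esub> x = C)" for C
  have eq: "f x = f y \<longleftrightarrow> N +>\<^bsub>V\<^esub> x = N +>\<^bsub>V\<^esub> y" if "x \<in> carrier V" "y \<in> carrier V" for x y
    using rhom_eq_iff[OF V W assms(3) that] cls_eq[OF V N that] assms(6) by simp
  have g: "g (N +>\<^bsub>V\<^esub> x) = f x" if "x \<in> carrier V" for x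
  proof -
    have "\<exists>y. y \<in> carrier V \<and> N +>\<^bsub>V\<^esub> y = N +>\<^bsub>V\<^esub> x" using that by auto
    from someI_ex[OF this] show ?thesis unfolding g_def using eq that by blast
  qed
  have "rhom A (quot_rep V N) W g"
    unfolding rhom_def
    using Q g rhomD[OF assms(3)] vspD[OF V] lrepD(2)[OF assms(1)] by (auto simp: carrier_quot_rep simp del: quot_rep_simps)
  moreover have "bij_betw g (carrier (quot_rep V N)) (carrier W)"
    using g eq assms(4) by (auto simp: bij_betw_def inj_on_def carrier_quot_rep image_image)
  ultimately show ?thesis by (auto simp: rep_iso_iff)
qed

text \<open>Replaces an isomorphism out of a quotient by a surjection with prescribed kernel,
  defined on representatives. Sections of filtrations are handled in this form, so that truncation
  and extension never manipulate cosets.\<close>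

lemma rep_iso_quot_iff:
  assumes "lrep A V" "lrep A W" "is_submodule A V N"
  shows "rep_iso A (quot_rep V N) W \<longleftrightarrow>
    (\<exists>f. rhom A V W f \<and> f ` carrier V = carrier W \<and> hker V W f = N)"
proof
  assume "rep_iso A (quot_rep V N) W"
  then obtain f where f: "rhom A (quot_rep V N) W f" "bij_betw f (carrier (quot_rep V N)) (carrier W)"
    by (auto simp: rep_iso_iff)
  define g where "g = f \<circ> (\<lambda>x. N +>\<^bsub>V\<^esub> x)"
  note q = lrep_quot_rep[OF assms(1,3)]
  have z: "f N = \<zero>\<^bsub>W\<^esub>"
    using rhom_zero[OF lrepD(1)[OF q] lrepD(1)[OF assms(2)] f(1)] by simp
  have "rhom A V W g" unfolding g_def by (rule rhom_comp[OF rhom_cls[OF assms(1,3)] f(1)])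
  moreover have "g ` carrier V = carrier W"
    using f(2) by (auto simp: g_def bij_betw_def carrier_quot_rep)
  moreover have "hker V W g = N"
  proof -
    have "f (N +>\<^bsub>V\<^esub> x) = \<zero>\<^bsub>W\<^esub> \<longleftrightarrow> x \<in> N" if "x \<in> carrier V" for x
    proof -
      have "N \<in> carrier (quot_rep V N)" using vspD(1)[OF lrepD(1)[OF q]] by simp
      then have "f (N +>\<^bsub>V\<^esub> x) = f N \<longleftrightarrow> N +>\<^bsub>V\<^esub> x = N"
        using inj_on_eq_iff[OF bij_betw_imp_inj_on[OF f(2)], of "N +>\<^bsub>V\<^esub> x" N] that
        unfolding carrier_quot_rep by blast
      then show ?thesis using z quot_kernel[OF assms(1,3) that] by simp
    qed
    moreover have "N \<subseteq> carrier V" using assms by (auto simp: is_submodule_iff lrepD)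
    ultimately show ?thesis by (auto simp: hker_def g_def)
  qed
  ultimately show "\<exists>f. rhom A V W f \<and> f ` carrier V = carrier W \<and> hker V W f = N" by blast
qed (use rep_iso_quotI assms in blast)

lemma is_submodule_hker:
  assumes "lrep A V" "lrep A W" "rhom A V W f"
  shows "is_submodule A V (hker V W f)"
  unfolding is_submodule_iff[OF lrepD(1)[OF assms(1)]]
  using lrepD[OF assms(1)] rhomD[OF assms(3)] vspD[OF lrepD(1)[OF assms(1)]] vspD[OF lrepD(1)[OF assms(2)]]
    act_zero[OF assms(2)] rhom_zero[OF lrepD(1)[OF assms(1)] lrepD(1)[OF assms(2)] assms(3)]
  by (auto simp: hker_def)

lemma is_submodule_vimage:
  assumes "lrep A V" "lrep A W" "rhom A V W f" "is_submodule A W U"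
  shows "is_submodule A V {v\<in>carrier V. f v \<in> U}"
  using lrepD[OF assms(1)] rhomD[OF assms(3)] vspD[OF lrepD(1)[OF assms(1)]]
    rhom_zero[OF lrepD(1)[OF assms(1)] lrepD(1)[OF assms(2)] assms(3)]
    assms(4)[unfolded is_submodule_iff[OF lrepD(1)[OF assms(2)]]]
  unfolding is_submodule_iff[OF lrepD(1)[OF assms(1)]]
  by auto

lemma is_submodule_image:
  assumes "lrep A V" "lrep A W" "rhom A V W f" "is_submodule A V U"
  shows "is_submodule A W (f ` U)"
proof -
  note V = lrepD(1)[OF assms(1)] and W = lrepD(1)[OF assms(2)]
  note U = assms(4)[unfolded is_submodule_iff[OF V]] and f = rhomD[OF assms(3)]
  have sub: "u \<in> U \<Longrightarrow> u \<in> carrier V" for u using U by auto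
  show ?thesis
    unfolding is_submodule_iff[OF W]
  proof (intro conjI ballI allI)
    show "f ` U \<subseteq> carrier W" using f(1) sub by auto
    show "\<zero>\<^bsub>W\<^esub> \<in> f ` U" using U rhom_zero[OF V W assms(3)] by (metis imageI)
  next
    fix x y assume "x \<in> f ` U" "y \<in> f ` U"
    then obtain u v where "u \<in> U" "v \<in> U" "x = f u" "y = f v" by auto
    then show "x \<oplus>\<^bsub>W\<^esub> y \<in> f ` U" using f(2)[of u v] sub U by (metis imageI)
  next
    fix c x assume "x \<in> f ` U"
    then obtain u where "u \<in> U" "x = f u" by auto
    then show "c \<odot>\<^bsub>W\<^esub> x \<in> f ` U" using f(3)[of u c] sub U by (metis imageI)
  next
    fix a x assume "a \<in> A" "x \<in> f ` U"
    then obtain u where "a \<in> A" "u \<in> U" "x = f u" by auto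
    then show "act W a x \<in> f ` U" using f(4)[of a u] sub U by (metis imageI)
  qed
qed

section \<open>Modules with a largest proper submodule, and the passage from V to eV\<close>

section \<open>Idempotent truncation\<close>

definition arep :: "'r set \<Rightarrow> ('r \<Rightarrow> 'r \<Rightarrow> 'r) \<Rightarrow> ('k::field, 'r, 'v) rep \<Rightarrow> bool"
  where "arep A mul V \<longleftrightarrow> lrep A V \<and>
    (\<forall>a\<in>A. \<forall>b\<in>A. \<forall>v\<in>carrier V. act V (mul a b) v = act V a (act V b v))"

text \<open>\<open>R\<close> is the largest proper submodule. Carrying it along explicitly avoids
  any question about the existence of maximal submodules, and it is automatically the
  radical.\<close>

definition is_local :: "'r set \<Rightarrow> ('k::field, 'r, 'v) rep \<Rightarrow> 'v set \<Rightarrow> bool"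
  where "is_local A V R \<longleftrightarrow> is_submodule A V R \<and> R \<noteq> carrier V \<and>
    (\<forall>W. is_submodule A V W \<longrightarrow> W \<subseteq> R \<or> W = carrier V)"

lemma rad_local:
  assumes "is_local A V R" "lrep A V"
  shows "rad A V = R"
proof -
  have "R \<subseteq> carrier V" using assms by (auto simp: is_local_def is_submodule_iff lrepD)
  moreover have "{M. maximal_submodule A V M} = {R}"
  proof (intro equalityI subsetI; clarsimp)
    show "M = R" if M: "maximal_submodule A V M" for M
    proof -
      have "M \<subseteq> R" using M assms(1) unfolding maximal_submodule_def is_local_def by blast
      then show ?thesis using M assms(1) by (auto simp: maximal_submodule_def is_local_def)
    qed
    show "maximal_submodule A V R"
      using assms(1) by (auto simp: maximal_submodule_def is_local_def)
  qed
  ultimately show ?thesis by (auto simp: rad_def)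
qed

text \<open>Submodules of \<open>L\<close> are pulled back along \<open>f\<close>: a preimage inside
  \<open>R\<close> comes from zero, and any other preimage is everything.\<close>

lemma simple_of_local:
  assumes "is_local A V R" "lrep A V" "lrep A L"
    and f: "rhom A V L f" "f ` carrier V = carrier L" "hker V L f = R"
  shows "simple_rep A L"
  unfolding simple_rep_def
proof (intro conjI allI impI)
  note R = assms(1)[unfolded is_local_def]
  have RV: "R \<subseteq> carrier V" using assms by (auto simp: is_local_def is_submodule_iff lrepD)
  then obtain v where "v \<in> carrier V" "v \<notin> R" using R by auto
  then have "f v \<noteq> \<zero>\<^bsub>L\<^esub>" "f v \<in> carrier L" using f(2,3) by (auto simp: hker_def)
  then show "nonzero_rep L" by (auto simp: nonzero_rep_def)
  fix W assume W: "is_submodule A L W"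
  have WL: "W \<subseteq> carrier L" "\<zero>\<^bsub>L\<^esub> \<in> W" using W assms(3) by (auto simp: is_submodule_iff lrepD)
  define P where "P = {v \<in> carrier V. f v \<in> W}"
  have im: "f ` P = W"
  proof
    show "W \<subseteq> f ` P"
    proof
      fix w assume w: "w \<in> W"
      then obtain v where "v \<in> carrier V" "w = f v" using WL f(2) by auto
      then show "w \<in> f ` P" using w by (simp add: P_def)
    qed
  qed (auto simp: P_def)
  have "is_submodule A V P" unfolding P_def by (rule is_submodule_vimage[OF assms(2,3) f(1) W])
  then consider "P \<subseteq> R" | "P = carrier V" using R by auto
  then show "W = {\<zero>\<^bsub>L\<^esub>} \<or> W = carrier L"
  proof cases
    case 1
    then have "f ` P \<subseteq> {\<zero>\<^bsub>L\<^esub>}" using f(3) by (auto simp: hker_def)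
    then show ?thesis using im WL by auto
  next
    case 2
    then show ?thesis using im f(2) by auto
  qed
qed

lemma simple_headI:
  assumes "is_local A V R" "lrep A V" "lrep A L"
    and f: "rhom A V L f" "f ` carrier V = carrier L" "hker V L f = R"
  shows "is_simple_head A L V"
proof -
  have R: "is_submodule A V R" using assms(1) by (simp add: is_local_def)
  show ?thesis
    unfolding is_simple_head_def head_def rad_local[OF assms(1,2)]
    using simple_of_local[OF assms] rep_iso_sym[OF lrep_quot_rep[OF assms(2) R]]
      rep_iso_quotI[OF assms(2,3) f(1,2) R f(3)] by blast
qed

section \<open>Generated submodules, the corner algebra, and the two lifts of a submodule of
  eV\<close>

definition gen :: "'r set \<Rightarrow> ('k::field, 'r, 'v) rep \<Rightarrow> 'v set \<Rightarrow> 'v set"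
  where "gen A V W = \<Inter>{U. is_submodule A V U \<and> W \<subseteq> U}"

lemma gen_least: "is_submodule A V U \<Longrightarrow> W \<subseteq> U \<Longrightarrow> gen A V W \<subseteq> U"
  by (auto simp: gen_def)

lemma gen_superset: "W \<subseteq> gen A V W"
  by (auto simp: gen_def)

lemma gen_mono: "W \<subseteq> W' \<Longrightarrow> gen A V W \<subseteq> gen A V W'"
  by (auto simp: gen_def)

lemma is_submodule_gen:
  assumes "lrep A V" "W \<subseteq> carrier V"
  shows "is_submodule A V (gen A V W)"
proof -
  note S = is_submodule_iff[OF lrepD(1)[OF assms(1)]]
  have "is_submodule A V (carrier V)" by (rule is_submodule_carrier[OF assms(1)])
  then have "gen A V W \<subseteq> carrier V" using assms(2) by (rule gen_least)
  then show ?thesis unfolding S by (auto simp: gen_def S)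
qed

lemma gen_submodule: "is_submodule A V W \<Longrightarrow> gen A V W = W"
  by (auto simp: gen_def)

definition corner :: "'r set \<Rightarrow> ('r \<Rightarrow> 'r \<Rightarrow> 'r) \<Rightarrow> 'r \<Rightarrow> 'r set"
  where "corner A mul e = (\<lambda>x. mul (mul e x) e) ` A"

definition tr :: "'r \<Rightarrow> ('k::field, 'r, 'v) rep \<Rightarrow> ('k, 'r, 'v) rep"
  where "tr e V = sub_rep V (act V e ` carrier V)"

text \<open>The factor \<open>a\<close> makes this set stable under \<open>A\<close>. As
  \<open>A\<close> need not contain a unit, the condition on \<open>v\<close> itself is recovered
  from the case \<open>a = e\<close>, because \<open>e\<close> is idempotent.\<close>

definition up :: "'r set \<Rightarrow> 'r \<Rightarrow> ('k::field, 'r, 'v) rep \<Rightarrow> 'v set \<Rightarrow> 'v set"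
  where "up A e V W = {v\<in>carrier V. \<forall>a\<in>A. act V e (act V a v) \<in> W}"

lemma tr_simps [simp]:
  "zero (tr e V) = zero V" "add (tr e V) = add V"
  "module.smult (tr e V) = module.smult V" "act (tr e V) = act V"
  "sub_rep (tr e V) W = sub_rep V W"
  by (simp_all add: tr_def sub_rep_def)

lemma carrier_tr: "carrier (tr e V) = act V e ` carrier V"
  by (simp add: tr_def)

lemma gen_carrier_local:
  assumes "is_submodule A V W"
  shows "lrep A V \<Longrightarrow> W \<subseteq> carrier V"
  using assms by (simp add: is_submodule_iff lrepD)

locale idem =
  fixes A :: "'r set" and mul :: "'r \<Rightarrow> 'r \<Rightarrow> 'r" and e :: 'r
  assumes e_in: "e \<in> A" and mul_closed: "a \<in> A \<Longrightarrow> b \<in> A \<Longrightarrow> mul a b \<in> A" and e_idem: "mul e e = e"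
begin

abbreviation "C \<equiv> corner A mul e"

lemma corner_sub: "C \<subseteq> A"
  using e_in mul_closed by (auto simp: corner_def)

lemma eae: "a \<in> A \<Longrightarrow> mul (mul e a) e \<in> C"
  by (auto simp: corner_def)

context
  fixes V :: "('k::field, 'r, 'v) rep"
  assumes V: "arep A mul V"
begin

lemma arepD:
  shows arep_lrep: "lrep A V" and arep_vsp: "vsp V"
    and arep_act: "a \<in> A \<Longrightarrow> v \<in> carrier V \<Longrightarrow> act V a v \<in> carrier V"
    and arep_mul: "a \<in> A \<Longrightarrow> b \<in> A \<Longrightarrow> v \<in> carrier V \<Longrightarrow> act V (mul a b) v = act V a (act V b v)"
  using V by (auto simp: arep_def lrepD)

lemmas lD = lrepD(3,4)[OF arep_lrep] vspD(1-7)[OF arep_vsp] act_zero[OF arep_lrep] arep_act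

lemma e_e: "v \<in> carrier V \<Longrightarrow> act V e (act V e v) = act V e v"
  using arep_mul[of e e v] e_in e_idem by simp

lemma mem_tr: "v \<in> carrier (tr e V) \<longleftrightarrow> v \<in> carrier V \<and> act V e v = v"
  unfolding carrier_tr using e_e arep_act[OF e_in] by (auto simp: image_iff) metis

lemma act_eae: "a \<in> A \<Longrightarrow> v \<in> carrier V \<Longrightarrow> act V (mul (mul e a) e) v = act V e (act V a (act V e v))"
  using arep_mul e_in mul_closed arep_act by simp

lemma act_eae_tr: "a \<in> A \<Longrightarrow> v \<in> carrier (tr e V) \<Longrightarrow> act V (mul (mul e a) e) v = act V e (act V a v)"
  using act_eae mem_tr by simp

lemma lrep_C: "lrep C V"
  using arep_lrep corner_sub unfolding lrep_def by (meson subsetD)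

lemma sub_tr: "is_submodule C V (carrier (tr e V))"
  unfolding is_submodule_iff[OF arep_vsp]
proof (intro conjI ballI allI)
  show "carrier (tr e V) \<subseteq> carrier V" using mem_tr by auto
  fix a w assume a: "a \<in> C" and w: "w \<in> carrier (tr e V)"
  from a obtain b where b: "b \<in> A" "a = mul (mul e b) e" by (auto simp: corner_def)
  then show "act V a w \<in> carrier (tr e V)"
    using act_eae_tr[OF b(1) w] w e_e arep_act e_in by (simp add: mem_tr)
qed (use e_in lD mem_tr in simp_all)

lemma lrep_tr: "lrep C (tr e V)"
  using lrep_sub_rep[OF lrep_C sub_tr] by (simp add: tr_def)

lemma sub_tr_iff: "is_submodule C (tr e V) W \<longleftrightarrow> is_submodule C V W \<and> W \<subseteq> carrier (tr e V)"
  using is_submodule_sub_rep[OF lrep_C sub_tr] by (simp add: tr_def)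

text \<open>The elements fixed by \<open>e\<close> are exactly those of eV, and \<open>W\<close> is
  stable under \<open>e\<close>.\<close>

lemma e_sub: "is_submodule A V W \<Longrightarrow> act V e ` W = W \<inter> carrier (tr e V)"
  using e_in e_e by (auto simp: mem_tr is_submodule_iff[OF arep_vsp] subset_iff image_iff) metis

lemma sub_e: "is_submodule A V W \<Longrightarrow> is_submodule C (tr e V) (act V e ` W)"
proof -
  assume W: "is_submodule A V W"
  then have "is_submodule C V W"
    using corner_sub by (auto simp: is_submodule_iff[OF arep_vsp])
  then show ?thesis unfolding e_sub[OF W] sub_tr_iff
    using is_submodule_Int[OF arep_vsp _ sub_tr] by auto
qed

lemma sub_up:
  assumes "is_submodule C (tr e V) W"
  shows "is_submodule A V (up A e V W)"
proof -
  note W = assms[unfolded is_submodule_iff[OF lrepD(1)[OF lrep_tr]]]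
  show ?thesis
    unfolding is_submodule_iff[OF arep_vsp]
  proof (intro conjI ballI allI)
    fix a w assume a: "a \<in> A" and w: "w \<in> up A e V W"
    have "act V e (act V b (act V a w)) \<in> W" if b: "b \<in> A" for b
    proof -
      have "mul b a \<in> A" using a b mul_closed by simp
      then have "act V e (act V (mul b a) w) \<in> W" using w unfolding up_def by blast
      then show ?thesis using arep_mul[OF b a, of w] w by (simp add: up_def)
    qed
    then show "act V a w \<in> up A e V W" using a w arep_act by (simp add: up_def)
  qed (use W e_in lD in \<open>auto simp: up_def\<close>)
qed

lemma sub_up_superset:
  assumes "is_submodule C (tr e V) W"
  shows "W \<subseteq> up A e V W"
proof
  note W = assms[unfolded is_submodule_iff[OF lrepD(1)[OF lrep_tr]]]
  fix w assume w: "w \<in> W"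
  then have w': "w \<in> carrier (tr e V)" using W by auto
  have "act V e (act V a w) \<in> W" if "a \<in> A" for a
    using act_eae_tr[OF that w'] W w eae[OF that] by (metis tr_simps(4))
  then show "w \<in> up A e V W" using w' by (simp add: up_def mem_tr)
qed

lemma e_up:
  assumes "is_submodule C (tr e V) W"
  shows "act V e ` up A e V W = W"
proof -
  have "v \<in> W" if "v \<in> up A e V W" "v \<in> carrier (tr e V)" for v
    using that e_in unfolding up_def mem_tr by force
  moreover have "W \<subseteq> carrier (tr e V)" using assms sub_tr_iff by blast
  ultimately show ?thesis
    unfolding e_sub[OF sub_up[OF assms]] using sub_up_superset[OF assms] by blast
qed

lemma sub_gen:
  assumes "is_submodule C (tr e V) W"
  shows "is_submodule A V (gen A V W)"
  using assms sub_tr_iff mem_tr by (intro is_submodule_gen arep_lrep) blast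

lemma gen_up:
  assumes "is_submodule C (tr e V) W"
  shows "gen A V W \<subseteq> up A e V W"
  by (rule gen_least[OF sub_up[OF assms] sub_up_superset[OF assms]])

text \<open>\<open>W\<close> lies in the truncation of \<open>gen A V W\<close>, and this lies in
  the truncation of \<open>up A e V W\<close>, which is \<open>W\<close> again. The sandwich avoids
  describing generated elements as sums.\<close>

lemma e_gen:
  assumes "is_submodule C (tr e V) W"
  shows "act V e ` gen A V W = W"
proof
  show "act V e ` gen A V W \<subseteq> W" using image_mono[OF gen_up[OF assms], of "act V e"] e_up[OF assms] by simp
  have "W \<subseteq> carrier (tr e V)" using assms sub_tr_iff by blast
  then show "W \<subseteq> act V e ` gen A V W" unfolding e_sub[OF sub_gen[OF assms]]
    using gen_superset[of W A V] by blast
qed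

text \<open>A submodule \<open>W\<close> is judged by eW: either eW lies in \<open>R\<close>, which
  puts \<open>W\<close> inside \<open>up A e V R\<close>, or eW is all of eV, which generates
  \<open>V\<close>.\<close>

lemma local_up:
  assumes "gen A V (carrier (tr e V)) = carrier V" "is_local C (tr e V) R"
  shows "is_local A V (up A e V R)"
  unfolding is_local_def
proof (intro conjI allI impI)
  note R = assms(2)[unfolded is_local_def]
  show "is_submodule A V (up A e V R)" using sub_up R by blast
  show "up A e V R \<noteq> carrier V"
  proof
    assume "up A e V R = carrier V"
    then have "carrier (tr e V) = R" using e_up[of R] R by (simp add: carrier_tr)
    then show False using R by simp
  qed
  fix W assume W: "is_submodule A V W"
  note W' = W[unfolded is_submodule_iff[OF arep_vsp]]
  have "act V e ` W \<subseteq> R \<or> act V e ` W = carrier (tr e V)"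
    using sub_e[OF W] R by simp
  then show "W \<subseteq> up A e V R \<or> W = carrier V"
  proof
    assume "act V e ` W \<subseteq> R"
    then have "W \<subseteq> up A e V R" using W' by (auto simp: up_def)
    then show ?thesis ..
  next
    assume "act V e ` W = carrier (tr e V)"
    then have "carrier (tr e V) \<subseteq> W" using e_sub[OF W] by blast
    then have "carrier V \<subseteq> W" using gen_least[OF W] assms(1) by blast
    then show ?thesis using W' by blast
  qed
qed

text \<open>A submodule of eV is tested on the submodule of \<open>V\<close> that it generates,
  whose truncation gives it back by \<open>e_gen\<close>.\<close>

lemma local_tr:
  assumes "is_local A V M" "act V e ` M \<noteq> carrier (tr e V)"
  shows "is_local C (tr e V) (act V e ` M)"
  unfolding is_local_def
proof (intro conjI allI impI)
  note M = assms(1)[unfolded is_local_def]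
  show "is_submodule C (tr e V) (act V e ` M)" using sub_e M by blast
  fix W assume W: "is_submodule C (tr e V) W"
  have "gen A V W \<subseteq> M \<or> gen A V W = carrier V" using sub_gen[OF W] M by blast
  then have "act V e ` gen A V W \<subseteq> act V e ` M \<or> act V e ` gen A V W = carrier (tr e V)"
    by (auto simp: carrier_tr)
  then show "W \<subseteq> act V e ` M \<or> W = carrier (tr e V)" using e_gen[OF W] by simp
qed (rule assms(2))

lemma arep_quot:
  assumes "is_submodule A V N"
  shows "arep A mul (quot_rep V N)"
  using lrep_quot_rep[OF arep_lrep assms] quot_act[OF arep_lrep assms] arep_act arep_mul mul_closed
  by (auto simp: arep_def carrier_quot_rep simp del: quot_rep_simps)

end

section \<open>Multiplicities of a simple module before and after truncation\<close>

context
  fixes V :: "('k::field, 'r, 'v) rep" and L :: "('k, 'r, 'w) rep"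
  assumes V: "arep A mul V" and L: "arep A mul L"
begin

text \<open>Exactness of truncation: \<open>\<psi>\<close> commutes with \<open>e\<close>, and its
  kernel on eP is the part of \<open>Q\<close> inside eP, which is eQ by
  \<open>e_sub\<close>.\<close>

lemma rhom_tr:
  assumes P: "is_submodule A V P" and Q: "is_submodule A V Q" "Q \<subseteq> P"
    and \<psi>: "rhom A (sub_rep V P) L \<psi>" "\<psi> ` P = carrier L" "hker (sub_rep V P) L \<psi> = Q"
  shows "rhom C (sub_rep V (act V e ` P)) (tr e L) \<psi>"
    "\<psi> ` (act V e ` P) = carrier (tr e L)"
    "hker (sub_rep V (act V e ` P)) (tr e L) \<psi> = act V e ` Q"
proof -
  note f = rhomD[OF \<psi>(1), simplified]
  have eP: "act V e ` P \<subseteq> P" using e_sub[OF V P] by blast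
  have im: "\<psi> (act V e v) = act L e (\<psi> v)" if "v \<in> P" for v using f(4)[OF e_in that] .
  have "\<psi> v \<in> carrier (tr e L)" if "v \<in> act V e ` P" for v
    using that im f(1) by (auto simp: carrier_tr)
  then show "rhom C (sub_rep V (act V e ` P)) (tr e L) \<psi>"
    using f(2,3,4) eP corner_sub unfolding rhom_def by (simp add: subset_iff)
  show "\<psi> ` (act V e ` P) = carrier (tr e L)"
  proof -
    have "\<psi> ` (act V e ` P) = act L e ` (\<psi> ` P)"
      unfolding image_image using im by (intro image_cong) auto
    then show ?thesis using \<psi>(2) by (simp add: carrier_tr)
  qed
  have "hker (sub_rep V (act V e ` P)) (tr e L) \<psi> = Q \<inter> act V e ` P"
    using eP by (auto simp: hker_def \<psi>(3)[symmetric])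
  also have "\<dots> = act V e ` Q" using e_sub[OF V P] e_sub[OF V Q(1)] Q(2) by blast
  finally show "hker (sub_rep V (act V e ` P)) (tr e L) \<psi> = act V e ` Q" .
qed

text \<open>
  A homomorphism on truncations extends to the generated submodule because \<open>L\<close> has no nonzero
  submodule killed by \<open>e\<close>: the image \<open>l\<close> of \<open>v\<close> is determined by all \<open>e a l = \<phi> (e a v)\<close>.
\<close>

lemma rhom_extend:
  assumes W: "is_submodule C (tr e V) W" and simple: "simple_rep A L" and nz: "nonzero_rep (tr e L)"
    and \<phi>: "rhom C (sub_rep V W) (tr e L) \<phi>" "\<phi> ` W = carrier (tr e L)"
      "hker (sub_rep V W) (tr e L) \<phi> = W0"
  shows "\<exists>\<psi>. rhom A (sub_rep V (gen A V W)) L \<psi> \<and> \<psi> ` gen A V W = carrier L \<and>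
    hker (sub_rep V (gen A V W)) L \<psi> = gen A V W \<inter> up A e V W0"
proof -
  note lV = lD[OF V] and lL = lD[OF L] and vV = arep_vsp[OF V] and vL = arep_vsp[OF L]
  note f = rhomD[OF \<phi>(1), simplified]
  let ?G = "gen A V W"
  have G: "is_submodule A V ?G" by (rule sub_gen[OF V W])
  note G' = G[unfolded is_submodule_iff[OF vV]]
  have GV: "v \<in> carrier V" if "v \<in> ?G" for v using G' that by auto
  have eW: "act V e (act V a v) \<in> W" if "a \<in> A" "v \<in> ?G" for a v
    using e_gen[OF V W] G' that by blast
  have W': "is_submodule C V W" "W \<subseteq> carrier (tr e V)" using W sub_tr_iff[OF V] by auto
  have fz: "\<phi> \<zero>\<^bsub>V\<^esub> = \<zero>\<^bsub>L\<^esub>"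
    using rhom_zero[OF _ _ \<phi>(1)] lrepD(1)[OF lrep_sub_rep[OF lrep_C[OF V] W'(1)]] lrepD(1)[OF lrep_tr[OF L]]
    by simp
  have up0: "up A e L {\<zero>\<^bsub>L\<^esub>} = {\<zero>\<^bsub>L\<^esub>}"
  proof -
    have s: "is_submodule C (tr e L) {\<zero>\<^bsub>L\<^esub>}"
      using is_submodule_zero[OF lrep_tr[OF L]] by simp
    have "up A e L {\<zero>\<^bsub>L\<^esub>} \<noteq> carrier L"
      using e_up[OF L s] nz by (auto simp: nonzero_rep_def carrier_tr)
    then show ?thesis using sub_up[OF L s] simple by (auto simp: simple_rep_def)
  qed
  \<comment> \<open>The extension is first built as a relation. Uniqueness of \<open>l\<close> comes
    from \<open>up0\<close> and existence from the closure properties, so no formula on generators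
    has to be shown well defined.\<close>
  define rel where "rel v l \<longleftrightarrow> v \<in> ?G \<and> l \<in> carrier L \<and>
    (\<forall>a\<in>A. \<phi> (act V e (act V a v)) = act L e (act L a l))" for v l
  have uniq: "l = l'" if "rel v l" "rel v l'" for v l l'
  proof -
    let ?d = "l \<oplus>\<^bsub>L\<^esub> (-1) \<odot>\<^bsub>L\<^esub> l'"
    have l: "l \<in> carrier L" "l' \<in> carrier L" using that by (auto simp: rel_def)
    have "act L e (act L a ?d) = \<zero>\<^bsub>L\<^esub>" if a: "a \<in> A" for a
    proof -
      have "act L e (act L a l) = act L e (act L a l')"
        using \<open>rel v l\<close> \<open>rel v l'\<close> a by (simp add: rel_def)
      then show ?thesis
        using lL l a e_in vspD(15)[OF vL, of "act L e (act L a l')"] by simp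
    qed
    then have "?d \<in> up A e L {\<zero>\<^bsub>L\<^esub>}" using l lL by (simp add: up_def)
    then show ?thesis using up0 diff_eq_zero_iff[OF vL l] by simp
  qed
  have rel_add: "rel (v \<oplus>\<^bsub>V\<^esub> v') (l \<oplus>\<^bsub>L\<^esub> l')" if "rel v l" "rel v' l'" for v v' l l'
    unfolding rel_def
  proof (intro conjI ballI)
    show "v \<oplus>\<^bsub>V\<^esub> v' \<in> ?G" "l \<oplus>\<^bsub>L\<^esub> l' \<in> carrier L" using that G' lL by (auto simp: rel_def)
    fix a assume a: "a \<in> A"
    show "\<phi> (act V e (act V a (v \<oplus>\<^bsub>V\<^esub> v'))) = act L e (act L a (l \<oplus>\<^bsub>L\<^esub> l'))"
      using that a e_in lV lL GV f(2) eW by (simp add: rel_def)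
  qed
  have rel_smult: "rel (c \<odot>\<^bsub>V\<^esub> v) (c \<odot>\<^bsub>L\<^esub> l)" if "rel v l" for v l c
    unfolding rel_def
  proof (intro conjI ballI)
    show "c \<odot>\<^bsub>V\<^esub> v \<in> ?G" "c \<odot>\<^bsub>L\<^esub> l \<in> carrier L" using that G' lL by (auto simp: rel_def)
    fix a assume a: "a \<in> A"
    show "\<phi> (act V e (act V a (c \<odot>\<^bsub>V\<^esub> v))) = act L e (act L a (c \<odot>\<^bsub>L\<^esub> l))"
      using that a e_in lV lL GV f(3) eW by (simp add: rel_def)
  qed
  have rel_act: "rel (act V b v) (act L b l)" if "rel v l" "b \<in> A" for v l b
    unfolding rel_def
  proof (intro conjI ballI)
    show "act V b v \<in> ?G" "act L b l \<in> carrier L" using that G' lL by (auto simp: rel_def)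
    fix a assume a: "a \<in> A"
    have "mul a b \<in> A" using a that mul_closed by simp
    then have "\<phi> (act V e (act V (mul a b) v)) = act L e (act L (mul a b) l)"
      using that by (simp add: rel_def)
    then show "\<phi> (act V e (act V a (act V b v))) = act L e (act L a (act L b l))"
      using that a arep_mul[OF V] arep_mul[OF L] GV by (simp add: rel_def)
  qed
  have rel_zero: "rel \<zero>\<^bsub>V\<^esub> \<zero>\<^bsub>L\<^esub>"
    using G' lV lL e_in fz by (auto simp: rel_def)
  have rel_W: "rel w (\<phi> w)" if w: "w \<in> W" for w
    unfolding rel_def
  proof (intro conjI ballI)
    show "w \<in> ?G" by (rule subsetD[OF gen_superset w])
    have fw: "\<phi> w \<in> carrier (tr e L)" using f(1) w by simp
    then show "\<phi> w \<in> carrier L" using mem_tr[OF L] by simp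
    fix a assume a: "a \<in> A"
    show "\<phi> (act V e (act V a w)) = act L e (act L a (\<phi> w))"
      using f(4)[OF eae[OF a] w] act_eae_tr[OF V a, of w] act_eae_tr[OF L a fw] w W'(2) by auto
  qed
  \<comment> \<open>The domain of the relation is a submodule containing \<open>W\<close>, hence it
    exhausts \<open>gen A V W\<close>.\<close>
  have sD: "is_submodule A V {v. \<exists>l. rel v l}"
    unfolding is_submodule_iff[OF vV]
  proof (intro conjI ballI allI)
    show "{v. \<exists>l. rel v l} \<subseteq> carrier V" using GV by (auto simp: rel_def)
  qed (use rel_add rel_smult rel_act rel_zero in blast)+
  have "{v. \<exists>l. rel v l} = ?G"
  proof
    show "{v. \<exists>l. rel v l} \<subseteq> ?G" by (auto simp: rel_def)
    show "?G \<subseteq> {v. \<exists>l. rel v l}" using rel_W by (intro gen_least[OF sD]) blast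
  qed
  then have tot: "\<exists>l. rel v l" if "v \<in> ?G" for v using that by blast
  define \<psi> where "\<psi> v = (THE l. rel v l)" for v
  have \<psi>: "\<psi> v = l" if "rel v l" for v l
    unfolding \<psi>_def using that uniq by blast
  have r\<psi>: "rel v (\<psi> v)" if "v \<in> ?G" for v using tot[OF that] \<psi> by auto
  have hom: "rhom A (sub_rep V ?G) L \<psi>"
    unfolding rhom_def sub_rep_simps
  proof (intro conjI ballI allI)
    show "\<psi> v \<in> carrier L" if "v \<in> ?G" for v using r\<psi>[OF that] by (simp add: rel_def)
    show "\<psi> (v \<oplus>\<^bsub>V\<^esub> w) = \<psi> v \<oplus>\<^bsub>L\<^esub> \<psi> w" if "v \<in> ?G" "w \<in> ?G" for v w
      by (rule \<psi>[OF rel_add[OF r\<psi>[OF that(1)] r\<psi>[OF that(2)]]])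
    show "\<psi> (c \<odot>\<^bsub>V\<^esub> v) = c \<odot>\<^bsub>L\<^esub> \<psi> v" if "v \<in> ?G" for c v by (rule \<psi>[OF rel_smult[OF r\<psi>[OF that]]])
    show "\<psi> (act V a v) = act L a (\<psi> v)" if "a \<in> A" "v \<in> ?G" for a v
      by (rule \<psi>[OF rel_act[OF r\<psi>[OF that(2)] that(1)]])
  qed
  have sG: "lrep A (sub_rep V ?G)" by (rule lrep_sub_rep[OF arep_lrep[OF V] G])
  have "is_submodule A (sub_rep V ?G) ?G"
    using is_submodule_carrier[OF sG] by simp
  then have sI: "is_submodule A L (\<psi> ` ?G)"
    by (rule is_submodule_image[OF sG arep_lrep[OF L] hom])
  have "carrier (tr e L) \<subseteq> \<psi> ` ?G"
    unfolding \<phi>(2)[symmetric]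
  proof (rule image_subsetI)
    fix w assume w: "w \<in> W"
    show "\<phi> w \<in> \<psi> ` ?G"
      using \<psi>[OF rel_W[OF w]] subsetD[OF gen_superset w] by (metis imageI)
  qed
  moreover have "carrier (tr e L) \<noteq> {\<zero>\<^bsub>L\<^esub>}" "\<zero>\<^bsub>L\<^esub> \<in> carrier (tr e L)"
    using nz vspD(1)[OF lrepD(1)[OF lrep_tr[OF L]]] by (simp_all add: nonzero_rep_def)
  ultimately have surj: "\<psi> ` ?G = carrier L" using sI simple unfolding simple_rep_def by blast
  have ker: "\<psi> v = \<zero>\<^bsub>L\<^esub> \<longleftrightarrow> v \<in> up A e V W0" if v: "v \<in> ?G" for v
  proof -
    have "\<psi> v = \<zero>\<^bsub>L\<^esub> \<longleftrightarrow> \<psi> v \<in> up A e L {\<zero>\<^bsub>L\<^esub>}" using up0 by simp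
    also have "\<dots> \<longleftrightarrow> (\<forall>a\<in>A. \<phi> (act V e (act V a v)) = \<zero>\<^bsub>L\<^esub>)"
      using r\<psi>[OF v] by (auto simp: up_def rel_def)
    also have "\<dots> \<longleftrightarrow> (\<forall>a\<in>A. act V e (act V a v) \<in> W0)"
      using eW[OF _ v] by (auto simp: \<phi>(3)[symmetric] hker_def)
    finally show ?thesis using GV[OF v] by (simp add: up_def)
  qed
  have "hker (sub_rep V ?G) L \<psi> = ?G \<inter> up A e V W0"
    using ker by (auto simp: hker_def)
  with hom surj show ?thesis by blast
qed

lemma tr_filtration:
  assumes "F \<in> filtrations A V"
  shows "map (\<lambda>W. act V e ` W) F \<in> filtrations C (tr e V)"
proof -
  have F: "F \<noteq> []" "hd F = {\<zero>\<^bsub>V\<^esub>}" "last F = carrier V" "\<forall>W\<in>set F. is_submodule A V W" "sorted_wrt (\<subseteq>) F"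
    using assms by (auto simp: filtrations_def)
  have "sorted_wrt (\<lambda>W W'. act V e ` W \<subseteq> act V e ` W') F"
    by (rule sorted_wrt_mono_rel[OF _ F(5)]) (rule image_mono)
  then show ?thesis
    using F sub_e[OF V] act_zero[OF arep_lrep[OF V] e_in]
    by (simp add: filtrations_def hd_map last_map carrier_tr sorted_wrt_map)
qed

text \<open>Neither module needs to have a composition series. Every finite filtration on one side
  yields a finite filtration on the other with at least as many sections of the required type, so
  each supremum bounds the other.\<close>

lemma comp_mult_tr:
  assumes "simple_rep A L" "nonzero_rep (tr e L)"
  shows "comp_mult A V L = comp_mult C (tr e V) (tr e L)"
proof (rule antisym)
  note lV = arep_lrep[OF V] and lL = arep_lrep[OF L]
  have vsub: "is_submodule A V W \<Longrightarrow> W \<subseteq> carrier V" for W using gen_carrier_local lV by blast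
  show "comp_mult A V L \<le> comp_mult C (tr e V) (tr e L)"
    unfolding comp_mult_def
  proof (rule SUP_mono)
    fix F assume F: "F \<in> filtrations A V"
    let ?F = "map (\<lambda>W. act V e ` W) F"
    have "rep_iso C (quot_rep (sub_rep (tr e V) (?F ! Suc i)) (?F ! i)) (tr e L)"
      if i: "Suc i < length F" and iso: "rep_iso A (quot_rep (sub_rep V (F ! Suc i)) (F ! i)) L" for i
    proof -
      have P: "is_submodule A V (F ! Suc i)" and Q: "is_submodule A V (F ! i)" and sub: "F ! i \<subseteq> F ! Suc i"
        using F i by (auto simp: filtrations_def sorted_wrt_nth_less)
      have "is_submodule A (sub_rep V (F ! Suc i)) (F ! i)"
        using is_submodule_sub_rep[OF lV P] Q sub by simp
      then obtain \<psi> where \<psi>: "rhom A (sub_rep V (F ! Suc i)) L \<psi>" "\<psi> ` (F ! Suc i) = carrier L"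
        "hker (sub_rep V (F ! Suc i)) L \<psi> = F ! i"
        using iso rep_iso_quot_iff[OF lrep_sub_rep[OF lV P] lL] by auto
      note t = rhom_tr[OF P Q sub \<psi>]
      have eP: "is_submodule C V (act V e ` (F ! Suc i))" and eQ: "is_submodule C V (act V e ` (F ! i))"
        using sub_e[OF V] P Q sub_tr_iff[OF V] by blast+
      have "rep_iso C (quot_rep (sub_rep V (act V e ` (F ! Suc i))) (act V e ` (F ! i))) (tr e L)"
        using t sub eQ is_submodule_sub_rep[OF lrep_C[OF V] eP]
        by (intro rep_iso_quotI[OF lrep_sub_rep[OF lrep_C[OF V] eP] lrep_tr[OF L]]) auto
      then show ?thesis using i by simp
    qed
    then have "card {i. Suc i < length F \<and> rep_iso A (quot_rep (sub_rep V (F ! Suc i)) (F ! i)) L}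
      \<le> card {i. Suc i < length ?F \<and> rep_iso C (quot_rep (sub_rep (tr e V) (?F ! Suc i)) (?F ! i)) (tr e L)}"
      by (intro card_mono) (auto intro: finite_subset[of _ "{..<length F}"])
    with tr_filtration[OF F] show "\<exists>F'\<in>filtrations C (tr e V).
        enat (card {i. Suc i < length F \<and> rep_iso A (quot_rep (sub_rep V (F ! Suc i)) (F ! i)) L})
        \<le> enat (card {i. Suc i < length F' \<and> rep_iso C (quot_rep (sub_rep (tr e V) (F' ! Suc i)) (F' ! i)) (tr e L)})"
      by (intro bexI[of _ ?F]) auto
  qed
  show "comp_mult C (tr e V) (tr e L) \<le> comp_mult A V L"
    unfolding comp_mult_def
  proof (rule SUP_mono)
    fix F assume F: "F \<in> filtrations C (tr e V)"
    define n where "n = length F"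
    have n: "n > 0" using F by (auto simp: filtrations_def n_def)
    have sF: "is_submodule C (tr e V) (F ! i)" if "i < n" for i
      using F that by (auto simp: filtrations_def n_def)
    have sub: "F ! i \<subseteq> F ! Suc i" if "Suc i < n" for i
      using F that by (auto simp: filtrations_def n_def sorted_wrt_nth_less)
    \<comment> \<open>A step from W to W' in eV is refined to three terms: gen W, then the part of
      gen W' inside up W, then gen W'. If W'/W is isomorphic to eL, the upper of the two sections is
      isomorphic to \<open>L\<close>. Even indices carry the generated submodules, odd ones the
      intermediate terms.\<close>
    define g where "g j = (if even j then gen A V (F ! (j div 2))
      else gen A V (F ! Suc (j div 2)) \<inter> up A e V (F ! (j div 2)))" for j
    \<comment> \<open>The indices below \<open>2 * n - 1\<close> end with the submodule generated by
      eV. It may be proper, so the whole module is appended.\<close>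
    define F' where "F' = map g [0..<2 * n - 1] @ [carrier V]"
    have sg: "is_submodule A V (g j)" if "j < 2 * n - 1" for j
    proof (cases "even j")
      case True
      then have "j div 2 < n" using that by auto
      then show ?thesis using sub_gen[OF V sF] True by (simp add: g_def)
    next
      case False
      then have "Suc (j div 2) < n" using that by presburger
      then show ?thesis using sub_gen[OF V sF] sub_up[OF V sF] False is_submodule_Int[OF arep_vsp[OF V]]
        by (simp add: g_def)
    qed
    have mono: "g j \<subseteq> g (Suc j)" if "Suc j < 2 * n - 1" for j
    proof (cases "even j")
      case True
      then have j: "Suc (j div 2) < n" using that by presburger
      have "gen A V (F ! (j div 2)) \<subseteq> up A e V (F ! (j div 2))" using gen_up[OF V sF] j by simp
      then show ?thesis using True gen_mono[OF sub[OF j], of A V] by (simp add: g_def)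
    next
      case False
      then show ?thesis by (auto simp: g_def)
    qed
    have nth: "F' ! j = (if j = 2 * n - 1 then carrier V else g j)" if "j < 2 * n" for j
      using that n by (auto simp: F'_def nth_append)
    have len: "length F' = 2 * n" using n by (simp add: F'_def)
    have sF': "is_submodule A V (F' ! j)" if "j < 2 * n" for j
      using sg[of j] nth[OF that] is_submodule_carrier[OF lV] that by auto
    have "F' \<in> filtrations A V"
    proof -
      have z: "gen A V (F ! 0) = {\<zero>\<^bsub>V\<^esub>}"
        using F gen_submodule[OF is_submodule_zero[OF lV]] by (auto simp: filtrations_def hd_conv_nth)
      have "hd F' = {\<zero>\<^bsub>V\<^esub>}"
        using nth[of 0] n len z by (simp add: hd_conv_nth F'_def g_def)
      moreover have "sorted_wrt (\<subseteq>) F'"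
      proof (subst sorted_wrt_iff_nth_Suc_transp, unfold len)
        show "transp ((\<subseteq>) :: 'v set \<Rightarrow> 'v set \<Rightarrow> bool)" by (auto simp: transp_def)
      next
        show "\<forall>i. Suc i < 2 * n \<longrightarrow> F' ! i \<subseteq> F' ! Suc i"
        proof (intro allI impI)
        fix i assume i: "Suc i < 2 * n"
        show "F' ! i \<subseteq> F' ! Suc i"
        proof (cases "Suc i = 2 * n - 1")
          case True
          then show ?thesis using nth[OF i] vsub[OF sF'] i by auto
        next
          case False
          then show ?thesis using nth[OF i] nth[of i] mono[of i] i by auto
        qed
        qed
      qed
      moreover have "last F' = carrier V" "F' \<noteq> []" by (auto simp: F'_def)
      moreover have "\<forall>W\<in>set F'. is_submodule A V W" using sF' len by (auto simp: in_set_conv_nth)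
      ultimately show ?thesis by (simp add: filtrations_def)
    qed
    moreover have "card {i. Suc i < length F \<and> rep_iso C (quot_rep (sub_rep (tr e V) (F ! Suc i)) (F ! i)) (tr e L)}
      \<le> card {i. Suc i < length F' \<and> rep_iso A (quot_rep (sub_rep V (F' ! Suc i)) (F' ! i)) L}"
    \<comment> \<open>Section i of \<open>F\<close> corresponds to the step of \<open>F'\<close>
      from index \<open>2 * i + 1\<close> to index \<open>2 * i + 2\<close>.\<close>
    proof (rule card_inj_on_le[of "\<lambda>i. 2 * i + 1"])
      show "(\<lambda>i. 2 * i + 1) ` {i. Suc i < length F \<and> rep_iso C (quot_rep (sub_rep (tr e V) (F ! Suc i)) (F ! i)) (tr e L)}
        \<subseteq> {i. Suc i < length F' \<and> rep_iso A (quot_rep (sub_rep V (F' ! Suc i)) (F' ! i)) L}"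
      proof (intro subsetI, elim imageE CollectE conjE, hypsubst)
        fix i assume i: "Suc i < length F"
          and iso: "rep_iso C (quot_rep (sub_rep (tr e V) (F ! Suc i)) (F ! i)) (tr e L)"
        have i': "Suc i < n" using i by (simp add: n_def)
        have W: "is_submodule C (tr e V) (F ! Suc i)" and W0: "is_submodule C (tr e V) (F ! i)"
          using sF i' by auto
        have "is_submodule C (sub_rep (tr e V) (F ! Suc i)) (F ! i)"
          using is_submodule_sub_rep[OF lrep_tr[OF V] W] W0 sub[OF i'] by simp
        then obtain \<phi> where \<phi>: "rhom C (sub_rep V (F ! Suc i)) (tr e L) \<phi>"
          "\<phi> ` (F ! Suc i) = carrier (tr e L)" "hker (sub_rep V (F ! Suc i)) (tr e L) \<phi> = F ! i"
          using iso rep_iso_quot_iff[OF lrep_sub_rep[OF lrep_tr[OF V] W] lrep_tr[OF L]] by auto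
        have 1: "F' ! Suc (2 * i + 1) = gen A V (F ! Suc i)"
          using nth[of "Suc (2 * i + 1)"] i' by (auto simp: g_def)
        have 2: "F' ! (2 * i + 1) = gen A V (F ! Suc i) \<inter> up A e V (F ! i)"
          using nth[of "2 * i + 1"] i' by (auto simp: g_def)
        have P: "is_submodule A V (gen A V (F ! Suc i))" by (rule sub_gen[OF V W])
        have Q: "is_submodule A (sub_rep V (gen A V (F ! Suc i))) (gen A V (F ! Suc i) \<inter> up A e V (F ! i))"
          using is_submodule_sub_rep[OF lV P] is_submodule_Int[OF arep_vsp[OF V] P sub_up[OF V W0]] by simp
        have "rep_iso A (quot_rep (sub_rep V (gen A V (F ! Suc i))) (gen A V (F ! Suc i) \<inter> up A e V (F ! i))) L"
          using rhom_extend[OF W assms \<phi>] rep_iso_quotI[OF lrep_sub_rep[OF lV P] lL _ _ Q] by auto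
        then show "2 * i + 1 \<in> {i. Suc i < length F' \<and> rep_iso A (quot_rep (sub_rep V (F' ! Suc i)) (F' ! i)) L}"
          unfolding mem_Collect_eq 1 2 using i' len by simp
      qed
    qed (auto simp: inj_on_def intro: finite_subset[of _ "{..<length F'}"])
    ultimately show "\<exists>F'\<in>filtrations A V.
        enat (card {i. Suc i < length F \<and> rep_iso C (quot_rep (sub_rep (tr e V) (F ! Suc i)) (F ! i)) (tr e L)})
        \<le> enat (card {i. Suc i < length F' \<and> rep_iso A (quot_rep (sub_rep V (F' ! Suc i)) (F' ! i)) L})"
      by auto
  qed
qed

end

end

section \<open>Linear extension, spans, and the universal property of tensor products\<close>

section \<open>Free spaces and tensor products\<close>

lemma lookup_scale [simp]: "Poly_Mapping.lookup (scale c x) b = c * Poly_Mapping.lookup x b"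
  by (simp add: scale_def Poly_Mapping.map.rep_eq when_def)

lemma scale_simps [simp]:
  "scale c 0 = 0" "scale 0 x = 0" "scale 1 x = x" "scale c (scale d x) = scale (c * d) x"
  "scale c (x + y) = scale c x + scale c y"
  by (auto intro!: poly_mapping_eqI simp: lookup_add algebra_simps)

lemma scale_add_left: "scale (c + d) x = scale c x + scale d x"
  by (auto intro!: poly_mapping_eqI simp: lookup_add algebra_simps)

lemma scale_minus: "scale (-1) x = - x"
  by (auto intro!: poly_mapping_eqI)

lemma scale_sum: "scale c (\<Sum>i\<in>I. f i) = (\<Sum>i\<in>I. scale c (f i))"
  by (induction I rule: infinite_finite_induct) auto

lemma lookup_basis: "Poly_Mapping.lookup (basis b) b' = (if b = b' then 1 else 0)"
  by (simp add: basis_def lookup_single when_def)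

lemma keys_basis [simp]: "Poly_Mapping.keys (basis b :: 'a \<Rightarrow>\<^sub>0 'k::field) = {b}"
  by (simp add: basis_def)

lemma lin_ext_superset:
  assumes "finite S" "Poly_Mapping.keys x \<subseteq> S"
  shows "lin_ext f x = (\<Sum>b\<in>S. scale (Poly_Mapping.lookup x b) (f b))"
  unfolding lin_ext_def using assms
  by (intro sum.mono_neutral_left) (auto simp: in_keys_iff)

lemma lin_ext_simps [simp]:
  "lin_ext f 0 = 0" "lin_ext f (basis b) = f b"
  "lin_ext f (x + y) = lin_ext f x + lin_ext f y"
  "lin_ext f (scale c x) = scale c (lin_ext f x)"
proof -
  show "lin_ext f 0 = 0" by (simp add: lin_ext_def)
  show "lin_ext f (basis b) = f b" by (simp add: lin_ext_def lookup_basis)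
  let ?S = "Poly_Mapping.keys x \<union> Poly_Mapping.keys y"
  have "Poly_Mapping.keys (x + y) \<subseteq> ?S" by (rule keys_add)
  then show "lin_ext f (x + y) = lin_ext f x + lin_ext f y"
    using lin_ext_superset[of ?S x f] lin_ext_superset[of ?S y f] lin_ext_superset[of ?S "x + y" f]
    by (simp add: lookup_add scale_add_left sum.distrib)
  have "Poly_Mapping.keys (scale c x) \<subseteq> Poly_Mapping.keys x" by (auto simp: in_keys_iff)
  then show "lin_ext f (scale c x) = scale c (lin_ext f x)"
    using lin_ext_superset[of "Poly_Mapping.keys x" "scale c x" f] by (simp add: lin_ext_def scale_sum)
qed

lemma lin_ext_minus [simp]: "lin_ext f (- x) = - lin_ext f x"
  using lin_ext_simps(4)[of f "-1" x] by (simp only: scale_minus)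

lemma lin_ext_diff [simp]: "lin_ext f (x - y) = lin_ext f x - lin_ext f y"
  using lin_ext_simps(3)[of f x "- y"] by simp

lemma lin_ext_sum: "lin_ext f (\<Sum>i\<in>I. g i) = (\<Sum>i\<in>I. lin_ext f (g i))"
  by (induction I rule: infinite_finite_induct) auto

lemma free_space_simps [simp, intro]:
  "0 \<in> free_space S" "x \<in> free_space S \<Longrightarrow> y \<in> free_space S \<Longrightarrow> x + y \<in> free_space S"
  "x \<in> free_space S \<Longrightarrow> scale c x \<in> free_space S"
  "b \<in> S \<Longrightarrow> basis b \<in> free_space S"
  using keys_add[of x y] by (auto simp: free_space_def in_keys_iff lookup_basis split: if_splits)

lemma free_space_minus: "x \<in> free_space S \<Longrightarrow> y \<in> free_space S \<Longrightarrow> x - y \<in> free_space S"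
  using free_space_simps(2)[of x S "scale (-1) y"] free_space_simps(3)[of y S "-1"] by (simp add: scale_minus)

lemma free_space_sum: "(\<And>i. i \<in> I \<Longrightarrow> f i \<in> free_space S) \<Longrightarrow> (\<Sum>i\<in>I. f i) \<in> free_space S"
  by (induction I rule: infinite_finite_induct) auto

lemma poly_mapping_basis_sum: "x = (\<Sum>b\<in>Poly_Mapping.keys x. scale (Poly_Mapping.lookup x b) (basis b))"
  by (intro poly_mapping_eqI) (auto simp: lookup_sum lookup_basis if_distrib[of "(*) _"] in_keys_iff cong: if_cong)

lemma lin_ext_basis [simp]: "lin_ext basis x = x"
  using poly_mapping_basis_sum[of x] by (simp add: lin_ext_def)

lemma free_space_induct [consumes 1, case_names zero add]:
  assumes "x \<in> free_space S" "P 0"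
    and "\<And>x c b. x \<in> free_space S \<Longrightarrow> P x \<Longrightarrow> b \<in> S \<Longrightarrow> P (x + scale c (basis b))"
  shows "P x"
proof -
  have "(\<Sum>b\<in>T. scale (Poly_Mapping.lookup x b) (basis b)) \<in> free_space S \<and> P (\<Sum>b\<in>T. scale (Poly_Mapping.lookup x b) (basis b))"
    if "finite T" "T \<subseteq> S" for T
    using that
  proof (induction T rule: finite_induct)
    case (insert b T)
    then show ?case
      using assms(3)[of "\<Sum>b\<in>T. scale (Poly_Mapping.lookup x b) (basis b)" b "Poly_Mapping.lookup x b"]
      by (simp add: add.commute)
  qed (use assms(2) in simp)
  from this[of "Poly_Mapping.keys x"] show ?thesis
    using assms(1) poly_mapping_basis_sum[of x] by (simp add: free_space_def)
qed

lemma lin_ext_cong: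
  assumes "x \<in> free_space S" "\<And>b. b \<in> S \<Longrightarrow> f b = g b"
  shows "lin_ext f x = lin_ext g x"
  using assms(1) by (induction rule: free_space_induct) (auto simp: assms(2))

lemma lin_ext_closed:
  assumes "x \<in> free_space S" "\<And>b. b \<in> S \<Longrightarrow> f b \<in> free_space T"
  shows "lin_ext f x \<in> free_space T"
  using assms(1) by (induction rule: free_space_induct) (auto simp: assms(2))

lemma lin_ext_comp: "lin_ext f (lin_ext g x) = lin_ext (\<lambda>b. lin_ext f (g b)) x"
  unfolding lin_ext_def[of g x] by (simp add: lin_ext_sum lin_ext_def[of "\<lambda>b. lin_ext f (g b)"])

lemma free_rep_simps [simp]:
  "carrier (free_rep S f) = free_space S" "zero (free_rep S f) = 0" "add (free_rep S f) = (+)"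
  "module.smult (free_rep S f) = scale" "act (free_rep S f) = f"
  by (simp_all add: free_rep_def)

lemma vsp_free_rep: "vsp (free_rep S f)"
  by (rule vspI) (auto simp: algebra_simps scale_add_left)

lemma lrep_free_rep:
  assumes "\<And>a x. a \<in> A \<Longrightarrow> x \<in> free_space S \<Longrightarrow> f a x \<in> free_space S"
    "\<And>a x y. a \<in> A \<Longrightarrow> f a (x + y) = f a x + f a y"
    "\<And>a c x. a \<in> A \<Longrightarrow> f a (scale c x) = scale c (f a x)"
  shows "lrep A (free_rep S f)"
  using assms vsp_free_rep unfolding lrep_def by auto

subsection \<open>Linear spans\<close>

lemma kspan_superset: "S \<subseteq> kspan V S"
  by (auto simp: kspan_def)

lemma kspan_least: "submodule W base_field V \<Longrightarrow> S \<subseteq> W \<Longrightarrow> kspan V S \<subseteq> W"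
  by (auto simp: kspan_def)

lemma submodule_kspan:
  assumes "vsp V" "S \<subseteq> carrier V"
  shows "submodule (kspan V S) base_field V"
proof -
  have "submodule (carrier V) base_field V"
    using assms vspD by (auto simp: submodule_iff)
  then have "kspan V S \<subseteq> carrier V" using assms(2) by (rule kspan_least)
  then show ?thesis unfolding submodule_iff[OF assms(1)]
    by (auto simp: kspan_def submodule_iff[OF assms(1)])
qed

lemma is_submodule_kspan:
  assumes "lrep A V" "S \<subseteq> carrier V" "\<And>a s. a \<in> A \<Longrightarrow> s \<in> S \<Longrightarrow> act V a s \<in> kspan V S"
  shows "is_submodule A V (kspan V S)"
proof -
  note V = lrepD[OF assms(1)] and D = vspD[OF lrepD(1)[OF assms(1)]]
  have K: "submodule (kspan V S) base_field V" using submodule_kspan[OF V(1) assms(2)] .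
  note K' = K[unfolded submodule_iff[OF V(1)]]
  have "act V a w \<in> kspan V S" if a: "a \<in> A" and w: "w \<in> kspan V S" for a w
  proof -
    have "submodule {v \<in> carrier V. act V a v \<in> kspan V S} base_field V"
      unfolding submodule_iff[OF V(1)] using K' V a D act_zero[OF assms(1) a] by auto
    then have "kspan V S \<subseteq> {v \<in> carrier V. act V a v \<in> kspan V S}"
      using assms(2,3) a by (intro kspan_least) auto
    then show ?thesis using w by auto
  qed
  then show ?thesis using K unfolding is_submodule_def by auto
qed

subsection \<open>Linear maps from free spaces to records\<close>

text \<open>The analogue of \<open>lin_ext\<close> with values in a module record, whose addition is
  a record field and not a type class operation. It provides the maps out of tensor
  products.\<close>

definition vlin :: "('k::field, 'r, 'v) rep \<Rightarrow> ('a \<Rightarrow> 'v) \<Rightarrow> ('a \<Rightarrow>\<^sub>0 'k) \<Rightarrow> 'v"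
  where "vlin V f x = (\<Oplus>\<^bsub>V\<^esub>b\<in>Poly_Mapping.keys x. Poly_Mapping.lookup x b \<odot>\<^bsub>V\<^esub> f b)"

lemma vlin_superset:
  assumes "vsp V" "finite S" "Poly_Mapping.keys x \<subseteq> S" "\<And>b. b \<in> S \<Longrightarrow> f b \<in> carrier V"
  shows "vlin V f x = (\<Oplus>\<^bsub>V\<^esub>b\<in>S. Poly_Mapping.lookup x b \<odot>\<^bsub>V\<^esub> f b)"
proof -
  interpret module base_field V by fact
  note D = vspD[OF assms(1)]
  show ?thesis unfolding vlin_def
    by (rule add.finprod_mono_neutral_cong_left) (use assms D in \<open>auto simp: in_keys_iff\<close>)
qed

lemma
  assumes "vsp V" "\<And>b. b \<in> S \<Longrightarrow> f b \<in> carrier V"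
  shows vlin_closed: "x \<in> free_space S \<Longrightarrow> vlin V f x \<in> carrier V"
    and vlin_add: "x \<in> free_space S \<Longrightarrow> y \<in> free_space S \<Longrightarrow> vlin V f (x + y) = vlin V f x \<oplus>\<^bsub>V\<^esub> vlin V f y"
    and vlin_scale: "x \<in> free_space S \<Longrightarrow> vlin V f (scale c x) = c \<odot>\<^bsub>V\<^esub> vlin V f x"
    and vlin_basis: "b \<in> S \<Longrightarrow> vlin V f (basis b) = f b"
    and vlin_zero: "vlin V f 0 = \<zero>\<^bsub>V\<^esub>"
proof -
  interpret module base_field V by fact
  note D = vspD[OF assms(1)]
  show c: "x \<in> free_space S \<Longrightarrow> vlin V f x \<in> carrier V" for x
    unfolding vlin_def using assms(2) D by (intro finsum_closed) (auto simp: free_space_def)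
  show "vlin V f (x + y) = vlin V f x \<oplus>\<^bsub>V\<^esub> vlin V f y" if "x \<in> free_space S" "y \<in> free_space S"
  proof -
    let ?S = "Poly_Mapping.keys x \<union> Poly_Mapping.keys y"
    have S: "f b \<in> carrier V" if "b \<in> ?S" for b using that \<open>x \<in> _\<close> \<open>y \<in> _\<close> assms(2) by (auto simp: free_space_def)
    have "Poly_Mapping.keys (x + y) \<subseteq> ?S" by (rule keys_add)
    then have "vlin V f (x + y) = (\<Oplus>\<^bsub>V\<^esub>b\<in>?S. Poly_Mapping.lookup (x + y) b \<odot>\<^bsub>V\<^esub> f b)"
      by (intro vlin_superset assms(1) S) auto
    also have "\<dots> = (\<Oplus>\<^bsub>V\<^esub>b\<in>?S. Poly_Mapping.lookup x b \<odot>\<^bsub>V\<^esub> f b \<oplus>\<^bsub>V\<^esub> Poly_Mapping.lookup y b \<odot>\<^bsub>V\<^esub> f b)"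
      using S D by (intro finsum_cong') (auto simp: lookup_add)
    also have "\<dots> = vlin V f x \<oplus>\<^bsub>V\<^esub> vlin V f y"
      using S D vlin_superset[OF assms(1), of ?S x f] vlin_superset[OF assms(1), of ?S y f]
      by (subst finsum_addf) auto
    finally show ?thesis .
  qed
  show "vlin V f (scale c x) = c \<odot>\<^bsub>V\<^esub> vlin V f x" if "x \<in> free_space S"
  proof -
    have S: "f b \<in> carrier V" if "b \<in> Poly_Mapping.keys x" for b using that \<open>x \<in> _\<close> assms(2) by (auto simp: free_space_def)
    have "Poly_Mapping.keys (scale c x) \<subseteq> Poly_Mapping.keys x" by (auto simp: in_keys_iff)
    then have "vlin V f (scale c x) = (\<Oplus>\<^bsub>V\<^esub>b\<in>Poly_Mapping.keys x. Poly_Mapping.lookup (scale c x) b \<odot>\<^bsub>V\<^esub> f b)"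
      by (intro vlin_superset assms(1) S) auto
    also have "\<dots> = (\<Oplus>\<^bsub>V\<^esub>b\<in>Poly_Mapping.keys x. c \<odot>\<^bsub>V\<^esub> (Poly_Mapping.lookup x b \<odot>\<^bsub>V\<^esub> f b))"
      using S D by (intro finsum_cong') auto
    also have "\<dots> = c \<odot>\<^bsub>V\<^esub> vlin V f x"
      unfolding vlin_def using S D by (intro finsum_smult_ldistr[symmetric]) auto
    finally show ?thesis .
  qed
  show "b \<in> S \<Longrightarrow> vlin V f (basis b) = f b"
    using D assms(2)[of b] by (simp add: vlin_def lookup_basis finsum_insert)
  show "vlin V f 0 = \<zero>\<^bsub>V\<^esub>" by (simp add: vlin_def)
qed

lemma rhom_quot_factor:
  assumes "lrep A V" "lrep A W" "is_submodule A V N" "rhom A V W f" "\<And>x. x \<in> N \<Longrightarrow> f x = \<zero>\<^bsub>W\<^esub>"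
  shows "\<exists>g. rhom A (quot_rep V N) W g \<and> (\<forall>x\<in>carrier V. g (N +>\<^bsub>V\<^esub> x) = f x)"
proof -
  note V = lrepD(1)[OF assms(1)] and W = lrepD(1)[OF assms(2)]
  note Q = quot_props[OF assms(1,3)]
  have N: "submodule N base_field V" using assms(3) by (simp add: is_submodule_def)
  define g where "g C = f (SOME x. x \<in> carrier V \<and> N +>\<^bsub>V\<^esub> x = C)" for C
  have eq: "f x = f y" if "x \<in> carrier V" "y \<in> carrier V" "N +>\<^bsub>V\<^esub> x = N +>\<^bsub>V\<^esub> y" for x y
    using rhom_eq_iff[OF V W assms(4) that(1,2)] cls_eq[OF V N that(1,2)] assms(5) that
      vspD[OF V] by (simp add: hker_def)
  have g: "g (N +>\<^bsub>V\<^esub> x) = f x" if "x \<in> carrier V" for x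
  proof -
    have "\<exists>y. y \<in> carrier V \<and> N +>\<^bsub>V\<^esub> y = N +>\<^bsub>V\<^esub> x" using that by auto
    from someI_ex[OF this] show ?thesis unfolding g_def using eq that by blast
  qed
  have "rhom A (quot_rep V N) W g"
    unfolding rhom_def
    using Q g rhomD[OF assms(4)] vspD[OF V] lrepD(2)[OF assms(1)] by (auto simp: carrier_quot_rep simp del: quot_rep_simps)
  with g show ?thesis by blast
qed

subsection \<open>Tensor products\<close>

definition tensor_free :: "('k::field, 'r, 'x) rep \<Rightarrow> ('k, 'a, 'v) rep \<Rightarrow> ('k, 'r, 'x \<times> 'v \<Rightarrow>\<^sub>0 'k) rep"
  where "tensor_free M V = free_rep (carrier M \<times> carrier V)
    (\<lambda>b. lin_ext (\<lambda>(x, v). basis (act M b x, v)))"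

text \<open>The pure tensor of \<open>x\<close> and \<open>v\<close>.\<close>

definition tens :: "'a set \<Rightarrow> ('k::field, 'r, 'x) rep \<Rightarrow> ('x \<Rightarrow> 'a \<Rightarrow> 'x) \<Rightarrow> ('k, 'a, 'v) rep \<Rightarrow>
    'x \<Rightarrow> 'v \<Rightarrow> ('x \<times> 'v \<Rightarrow>\<^sub>0 'k) set"
  where "tens A M r V x v =
    kspan (tensor_free M V) (tensor_relations A M r V) +>\<^bsub>tensor_free M V\<^esub> basis (x, v)"

lemma tensor_eq:
  "tensor A M r V = quot_rep (tensor_free M V) (kspan (tensor_free M V) (tensor_relations A M r V))"
  by (simp add: tensor_def tensor_free_def Let_def)

lemma tensor_relations_induct [consumes 1, case_names add_left add_right smult_left smult_right balanced]:
  assumes "s \<in> tensor_relations A M r V"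
    and "\<And>x y v. x \<in> carrier M \<Longrightarrow> y \<in> carrier M \<Longrightarrow> v \<in> carrier V \<Longrightarrow>
      P (basis (x \<oplus>\<^bsub>M\<^esub> y, v) - basis (x, v) - basis (y, v))"
    and "\<And>x v w. x \<in> carrier M \<Longrightarrow> v \<in> carrier V \<Longrightarrow> w \<in> carrier V \<Longrightarrow>
      P (basis (x, v \<oplus>\<^bsub>V\<^esub> w) - basis (x, v) - basis (x, w))"
    and "\<And>c x v. x \<in> carrier M \<Longrightarrow> v \<in> carrier V \<Longrightarrow> P (basis (c \<odot>\<^bsub>M\<^esub> x, v) - scale c (basis (x, v)))"
    and "\<And>c x v. x \<in> carrier M \<Longrightarrow> v \<in> carrier V \<Longrightarrow> P (basis (x, c \<odot>\<^bsub>V\<^esub> v) - scale c (basis (x, v)))"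
    and "\<And>a x v. a \<in> A \<Longrightarrow> x \<in> carrier M \<Longrightarrow> v \<in> carrier V \<Longrightarrow> P (basis (r x a, v) - basis (x, act V a v))"
  shows "P s"
  using assms(1) unfolding tensor_relations_def
  by (elim UnE) (use assms(2-) in blast)+

text \<open>The left operators \<open>B\<close> are kept apart from the algebra \<open>A\<close>
  that is balanced. There are two instances: \<open>B_alg\<close> over \<open>B_sharp\<close>, and
  the Brauer algebra over the group algebra.\<close>

locale bimod =
  fixes B :: "'r set" and A :: "'a set" and M :: "('k::field, 'r, 'x) rep" and r :: "'x \<Rightarrow> 'a \<Rightarrow> 'x"
    and V :: "('k, 'a, 'v) rep"
  assumes M: "lrep B M" and V: "vsp V"
    and r_closed: "x \<in> carrier M \<Longrightarrow> a \<in> A \<Longrightarrow> r x a \<in> carrier M"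
    and r_act: "b \<in> B \<Longrightarrow> x \<in> carrier M \<Longrightarrow> a \<in> A \<Longrightarrow> act M b (r x a) = r (act M b x) a"
    and V_closed: "a \<in> A \<Longrightarrow> v \<in> carrier V \<Longrightarrow> act V a v \<in> carrier V"
begin

abbreviation "F \<equiv> tensor_free M V"
abbreviation "N \<equiv> kspan F (tensor_relations A M r V)"
abbreviation "T \<equiv> tensor A M r V"
abbreviation "tn \<equiv> tens A M r V"

lemmas MD = lrepD(2-4)[OF M] vspD(1-3)[OF lrepD(1)[OF M]] and VD = vspD(1-3)[OF V]

lemma F_simps [simp]:
  "carrier F = free_space (carrier M \<times> carrier V)" "zero F = 0" "add F = (+)" "module.smult F = scale"
  "act F b = lin_ext (\<lambda>(x, v). basis (act M b x, v))"
  by (simp_all add: tensor_free_def)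

lemma lrep_F: "lrep B F"
  unfolding tensor_free_def
  by (rule lrep_free_rep) (auto intro!: lin_ext_closed MD)

lemma relations_subset: "tensor_relations A M r V \<subseteq> carrier F"
proof
  fix s assume "s \<in> tensor_relations A M r V"
  then show "s \<in> carrier F"
    by (induction rule: tensor_relations_induct) (simp_all add: free_space_minus MD VD r_closed V_closed)
qed

lemma vsp_F: "vsp F" by (rule lrepD(1)[OF lrep_F])

lemma in_N:
  shows "x \<in> carrier M \<Longrightarrow> y \<in> carrier M \<Longrightarrow> v \<in> carrier V \<Longrightarrow>
    basis (x \<oplus>\<^bsub>M\<^esub> y, v) - basis (x, v) - basis (y, v) \<in> N"
  and "x \<in> carrier M \<Longrightarrow> v \<in> carrier V \<Longrightarrow> w \<in> carrier V \<Longrightarrow>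
    basis (x, v \<oplus>\<^bsub>V\<^esub> w) - basis (x, v) - basis (x, w) \<in> N"
  and "x \<in> carrier M \<Longrightarrow> v \<in> carrier V \<Longrightarrow> basis (c \<odot>\<^bsub>M\<^esub> x, v) - scale c (basis (x, v)) \<in> N"
  and "x \<in> carrier M \<Longrightarrow> v \<in> carrier V \<Longrightarrow> basis (x, c \<odot>\<^bsub>V\<^esub> v) - scale c (basis (x, v)) \<in> N"
  and "a \<in> A \<Longrightarrow> x \<in> carrier M \<Longrightarrow> v \<in> carrier V \<Longrightarrow> basis (r x a, v) - basis (x, act V a v) \<in> N"
proof -
  show "x \<in> carrier M \<Longrightarrow> y \<in> carrier M \<Longrightarrow> v \<in> carrier V \<Longrightarrow> basis (x \<oplus>\<^bsub>M\<^esub> y, v) - basis (x, v) - basis (y, v) \<in> N"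
    unfolding tensor_relations_def
    by (rule subsetD[OF kspan_superset], rule UnI1, rule UnI1, rule UnI1, rule UnI1, rule CollectI, intro exI conjI, rule refl; assumption)
  show "x \<in> carrier M \<Longrightarrow> v \<in> carrier V \<Longrightarrow> w \<in> carrier V \<Longrightarrow> basis (x, v \<oplus>\<^bsub>V\<^esub> w) - basis (x, v) - basis (x, w) \<in> N"
    unfolding tensor_relations_def
    by (rule subsetD[OF kspan_superset], rule UnI1, rule UnI1, rule UnI1, rule UnI2, rule CollectI, intro exI conjI, rule refl; assumption)
  show "x \<in> carrier M \<Longrightarrow> v \<in> carrier V \<Longrightarrow> basis (c \<odot>\<^bsub>M\<^esub> x, v) - scale c (basis (x, v)) \<in> N"
    unfolding tensor_relations_def
    by (rule subsetD[OF kspan_superset], rule UnI1, rule UnI1, rule UnI2, rule CollectI, intro exI conjI, rule refl; assumption)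
  show "x \<in> carrier M \<Longrightarrow> v \<in> carrier V \<Longrightarrow> basis (x, c \<odot>\<^bsub>V\<^esub> v) - scale c (basis (x, v)) \<in> N"
    unfolding tensor_relations_def
    by (rule subsetD[OF kspan_superset], rule UnI1, rule UnI2, rule CollectI, intro exI conjI, rule refl; assumption)
  show "a \<in> A \<Longrightarrow> x \<in> carrier M \<Longrightarrow> v \<in> carrier V \<Longrightarrow> basis (r x a, v) - basis (x, act V a v) \<in> N"
    unfolding tensor_relations_def
    by (rule subsetD[OF kspan_superset], rule UnI2, rule CollectI, intro exI conjI, rule refl; assumption)
qed

lemma sub_N: "is_submodule B F N"
proof (rule is_submodule_kspan[OF lrep_F relations_subset])
  fix b s assume b: "b \<in> B" and s: "s \<in> tensor_relations A M r V"
  show "act F b s \<in> N"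
    using s by (induction rule: tensor_relations_induct) (use b MD r_act in \<open>simp_all add: in_N\<close>)
qed

lemma lrep_T: "lrep B T"
  unfolding tensor_eq by (rule lrep_quot_rep[OF lrep_F sub_N])

lemma vsp_T: "vsp T" by (rule lrepD(1)[OF lrep_T])

lemma tn_closed: "x \<in> carrier M \<Longrightarrow> v \<in> carrier V \<Longrightarrow> tn x v \<in> carrier T"
  by (auto simp: tensor_eq carrier_quot_rep tens_def)

lemma act_tn: "b \<in> B \<Longrightarrow> x \<in> carrier M \<Longrightarrow> v \<in> carrier V \<Longrightarrow> act T b (tn x v) = tn (act M b x) v"
  unfolding tensor_eq tens_def by (subst quot_act[OF lrep_F sub_N]) auto

lemma cls_F_eq:
  assumes "x \<in> carrier F" "y \<in> carrier F"
  shows "N +>\<^bsub>F\<^esub> x = N +>\<^bsub>F\<^esub> y \<longleftrightarrow> x - y \<in> N"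
  using cls_eq[OF vsp_F, of N x y] sub_N assms by (simp add: is_submodule_def scale_minus)

lemma tn_add_left:
  assumes "x \<in> carrier M" "y \<in> carrier M" "v \<in> carrier V"
  shows "tn (x \<oplus>\<^bsub>M\<^esub> y) v = tn x v \<oplus>\<^bsub>T\<^esub> tn y v"
proof -
  have "tn x v \<oplus>\<^bsub>T\<^esub> tn y v = N +>\<^bsub>F\<^esub> (basis (x, v) + basis (y, v))"
    unfolding tensor_eq tens_def using assms by (subst quot_add[OF lrep_F sub_N]) auto
  also have "\<dots> = tn (x \<oplus>\<^bsub>M\<^esub> y) v"
    unfolding tens_def using assms MD
    by (subst eq_commute, subst cls_F_eq) (auto intro!: in_N simp: diff_diff_eq[symmetric])
  finally show ?thesis ..
qed

lemma tn_add_right: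
  assumes "x \<in> carrier M" "v \<in> carrier V" "w \<in> carrier V"
  shows "tn x (v \<oplus>\<^bsub>V\<^esub> w) = tn x v \<oplus>\<^bsub>T\<^esub> tn x w"
proof -
  have "tn x v \<oplus>\<^bsub>T\<^esub> tn x w = N +>\<^bsub>F\<^esub> (basis (x, v) + basis (x, w))"
    unfolding tensor_eq tens_def using assms by (subst quot_add[OF lrep_F sub_N]) auto
  also have "\<dots> = tn x (v \<oplus>\<^bsub>V\<^esub> w)"
    unfolding tens_def using assms VD
    by (subst eq_commute, subst cls_F_eq) (auto intro!: in_N simp: diff_diff_eq[symmetric])
  finally show ?thesis ..
qed

lemma tn_smult_left:
  assumes "x \<in> carrier M" "v \<in> carrier V"
  shows "tn (c \<odot>\<^bsub>M\<^esub> x) v = c \<odot>\<^bsub>T\<^esub> tn x v"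
proof -
  have "c \<odot>\<^bsub>T\<^esub> tn x v = N +>\<^bsub>F\<^esub> (scale c (basis (x, v)))"
    unfolding tensor_eq tens_def using assms by (subst quot_smult[OF lrep_F sub_N]) auto
  also have "\<dots> = tn (c \<odot>\<^bsub>M\<^esub> x) v"
    unfolding tens_def using assms MD
    by (subst eq_commute, subst cls_F_eq) (auto intro!: in_N)
  finally show ?thesis ..
qed

lemma tn_smult_right:
  assumes "x \<in> carrier M" "v \<in> carrier V"
  shows "tn x (c \<odot>\<^bsub>V\<^esub> v) = c \<odot>\<^bsub>T\<^esub> tn x v"
proof -
  have "c \<odot>\<^bsub>T\<^esub> tn x v = N +>\<^bsub>F\<^esub> (scale c (basis (x, v)))"
    unfolding tensor_eq tens_def using assms by (subst quot_smult[OF lrep_F sub_N]) auto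
  also have "\<dots> = tn x (c \<odot>\<^bsub>V\<^esub> v)"
    unfolding tens_def using assms VD
    by (subst eq_commute, subst cls_F_eq) (auto intro!: in_N)
  finally show ?thesis ..
qed

lemma tn_balanced:
  assumes "x \<in> carrier M" "v \<in> carrier V" "a \<in> A"
  shows "tn (r x a) v = tn x (act V a v)"
  unfolding tens_def using assms r_closed V_closed
  by (subst cls_F_eq) (auto intro!: in_N)

lemma tn_zero_right: "x \<in> carrier M \<Longrightarrow> tn x \<zero>\<^bsub>V\<^esub> = \<zero>\<^bsub>T\<^esub>"
  using tn_smult_right[of x "\<zero>\<^bsub>V\<^esub>" 0] vspD(4)[OF V VD(1)] VD vspD(4)[OF vsp_T tn_closed[of x "\<zero>\<^bsub>V\<^esub>"]] by simp

lemma tn_zero_left: "v \<in> carrier V \<Longrightarrow> tn \<zero>\<^bsub>M\<^esub> v = \<zero>\<^bsub>T\<^esub>"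
  using tn_smult_left[of "\<zero>\<^bsub>M\<^esub>" v 0] vspD(4)[OF lrepD(1)[OF M] MD(4)] MD vspD(4)[OF vsp_T tn_closed[of "\<zero>\<^bsub>M\<^esub>" v]] by simp

lemma tensor_induct [consumes 1, case_names zero add]:
  assumes "t \<in> carrier T" "P \<zero>\<^bsub>T\<^esub>"
    and "\<And>t x v. t \<in> carrier T \<Longrightarrow> P t \<Longrightarrow> x \<in> carrier M \<Longrightarrow> v \<in> carrier V \<Longrightarrow> P (t \<oplus>\<^bsub>T\<^esub> tn x v)"
  shows "P t"
proof -
  from assms(1) obtain f where f: "f \<in> free_space (carrier M \<times> carrier V)" "t = N +>\<^bsub>F\<^esub> f"
    by (auto simp: tensor_eq carrier_quot_rep)
  from f(1) have "P (N +>\<^bsub>F\<^esub> f)"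
  proof (induction rule: free_space_induct)
    case zero
    then show ?case using assms(2) quot_zero[OF lrep_F sub_N] by (simp add: tensor_eq)
  next
    case (add f c xv)
    obtain x v where xv: "xv = (x, v)" by force
    then have x: "x \<in> carrier M" "v \<in> carrier V" using add by auto
    \<comment> \<open>The coefficient is absorbed into the left factor, so the induction deals with
      sums of pure tensors only.\<close>
    have "tn (c \<odot>\<^bsub>M\<^esub> x) v = N +>\<^bsub>F\<^esub> scale c (basis xv)"
      unfolding tn_smult_left[OF x] unfolding tensor_eq tens_def xv
      using x by (subst quot_smult[OF lrep_F sub_N]) auto
    then have "N +>\<^bsub>F\<^esub> (f + scale c (basis xv)) = (N +>\<^bsub>F\<^esub> f) \<oplus>\<^bsub>T\<^esub> tn (c \<odot>\<^bsub>M\<^esub> x) v"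
      unfolding tensor_eq using add quot_add[OF lrep_F sub_N, of f "scale c (basis xv)"] by simp
    moreover have "N +>\<^bsub>F\<^esub> f \<in> carrier T" using add by (simp add: tensor_eq carrier_quot_rep)
    ultimately show ?case using assms(3) add x MD by simp
  qed
  then show ?thesis using f by simp
qed

text \<open>Equivariance is asked for a subset \<open>B'\<close> of the operators. The empty set
  gives linear maps, and the Brauer algebra inside \<open>B_alg\<close> gives maps that are defined
  on the whole standard module but commute with the smaller algebra only.\<close>

lemma tensor_universal:
  fixes W :: "('k, 'r, 'w) rep"
  assumes "B' \<subseteq> B" and W: "lrep B' W"
    and \<phi>: "\<And>x v. x \<in> carrier M \<Longrightarrow> v \<in> carrier V \<Longrightarrow> \<phi> x v \<in> carrier W"
      "\<And>x y v. x \<in> carrier M \<Longrightarrow> y \<in> carrier M \<Longrightarrow> v \<in> carrier V \<Longrightarrow> \<phi> (x \<oplus>\<^bsub>M\<^esub> y) v = \<phi> x v \<oplus>\<^bsub>W\<^esub> \<phi> y v"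
      "\<And>x v w. x \<in> carrier M \<Longrightarrow> v \<in> carrier V \<Longrightarrow> w \<in> carrier V \<Longrightarrow> \<phi> x (v \<oplus>\<^bsub>V\<^esub> w) = \<phi> x v \<oplus>\<^bsub>W\<^esub> \<phi> x w"
      "\<And>c x v. x \<in> carrier M \<Longrightarrow> v \<in> carrier V \<Longrightarrow> \<phi> (c \<odot>\<^bsub>M\<^esub> x) v = c \<odot>\<^bsub>W\<^esub> \<phi> x v"
      "\<And>c x v. x \<in> carrier M \<Longrightarrow> v \<in> carrier V \<Longrightarrow> \<phi> x (c \<odot>\<^bsub>V\<^esub> v) = c \<odot>\<^bsub>W\<^esub> \<phi> x v"
      "\<And>a x v. a \<in> A \<Longrightarrow> x \<in> carrier M \<Longrightarrow> v \<in> carrier V \<Longrightarrow> \<phi> (r x a) v = \<phi> x (act V a v)"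
      "\<And>b x v. b \<in> B' \<Longrightarrow> x \<in> carrier M \<Longrightarrow> v \<in> carrier V \<Longrightarrow> \<phi> (act M b x) v = act W b (\<phi> x v)"
  shows "\<exists>\<Phi>. rhom B' T W \<Phi> \<and> (\<forall>x\<in>carrier M. \<forall>v\<in>carrier V. \<Phi> (tn x v) = \<phi> x v)"
proof -
  let ?S = "carrier M \<times> carrier V"
  define h where "h = vlin W (\<lambda>(x, v). \<phi> x v)"
  have vW: "vsp W" using lrepD(1)[OF W] .
  have cl: "(\<lambda>(x, v). \<phi> x v) b \<in> carrier W" if "b \<in> ?S" for b using that \<phi>(1) by auto
  note h = vlin_closed[where S = "?S" and f = "\<lambda>(x, v). \<phi> x v", OF vW cl, folded h_def] vlin_add[where S = "?S" and f = "\<lambda>(x, v). \<phi> x v", OF vW cl, folded h_def]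
    vlin_scale[where S = "?S" and f = "\<lambda>(x, v). \<phi> x v", OF vW cl, folded h_def] vlin_basis[where S = "?S" and f = "\<lambda>(x, v). \<phi> x v", OF vW cl, folded h_def]
    vlin_zero[where S = "?S" and f = "\<lambda>(x, v). \<phi> x v", OF vW cl, folded h_def]
  have hb: "h (basis (x, v)) = \<phi> x v" if "x \<in> carrier M" "v \<in> carrier V" for x v
    using h(4)[where b = "(x, v)"] that by simp
  have lF: "lrep B' F" and sN: "is_submodule B' F N"
    using lrep_F sub_N assms(1) unfolding lrep_def is_submodule_def by (meson subsetD)+
  have hd: "h (x - y) = h x \<oplus>\<^bsub>W\<^esub> (-1) \<odot>\<^bsub>W\<^esub> h y" if "x \<in> free_space ?S" "y \<in> free_space ?S" for x y
    using h(2)[of x "scale (-1) y"] h(3)[of y "-1"] free_space_simps(3)[of y ?S "-1"] that by (simp add: scale_minus)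
  have hom: "rhom B' F W h"
    unfolding rhom_def F_simps
  proof (intro conjI ballI allI)
    fix b and f :: "('x \<times> 'v) \<Rightarrow>\<^sub>0 'k" assume b: "b \<in> B'" and "f \<in> free_space ?S"
    from this(2) have "f \<in> free_space ?S \<and> h (act F b f) = act W b (h f)"
    proof (induction rule: free_space_induct)
      case zero
      then show ?case using h(5) act_zero[OF W b] by simp
    next
      case (add f c xv)
      obtain x v where xv: "xv = (x, v)" by force
      then have x: "x \<in> carrier M" "v \<in> carrier V" using add by auto
      have b': "b \<in> B" using b assms(1) by auto
      have "act F b f \<in> free_space ?S" using lrepD(2)[OF lF b, of f] add by simp
      then show ?case
        using add h hb x b b' \<phi>(7)[OF b x] MD(1)[OF b', of x] \<phi>(1)[OF x] lrepD(3,4)[OF W b] vspD(3)[OF vW]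
        by (simp add: xv)
    qed
    then show "h (lin_ext (\<lambda>(x, v). basis (act M b x, v)) f) = act W b (h f)" by simp
  qed (use h in auto)
  have ker: "submodule (hker F W h) base_field F"
    using is_submodule_hker[OF lF W hom] by (simp add: is_submodule_def)
  have "tensor_relations A M r V \<subseteq> hker F W h"
  proof
    fix s assume s: "s \<in> tensor_relations A M r V"
    then have sF: "s \<in> free_space ?S" using relations_subset by auto
    have "h s = \<zero>\<^bsub>W\<^esub>"
      using s
    proof (induction rule: tensor_relations_induct)
      case (add_left x y v)
      have "h (basis (x \<oplus>\<^bsub>M\<^esub> y, v)) = h (basis (x, v) + basis (y, v))"
        using add_left hb MD \<phi> h(2) by simp
      then show ?case using add_left MD h(1) hd[of "basis (x \<oplus>\<^bsub>M\<^esub> y, v)" "basis (x, v) + basis (y, v)"]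
          vspD(15)[OF vW] by (simp add: diff_diff_eq[symmetric])
    next
      case (add_right x v w)
      have "h (basis (x, v \<oplus>\<^bsub>V\<^esub> w)) = h (basis (x, v) + basis (x, w))"
        using add_right hb VD \<phi> h(2) by simp
      then show ?case using add_right VD h(1) hd[of "basis (x, v \<oplus>\<^bsub>V\<^esub> w)" "basis (x, v) + basis (x, w)"]
          vspD(15)[OF vW] by (simp add: diff_diff_eq[symmetric])
    next
      case (smult_left c x v)
      then show ?case using MD h hb \<phi> hd vspD(3,15)[OF vW] by simp
    next
      case (smult_right c x v)
      then show ?case using VD h hb \<phi> hd vspD(3,15)[OF vW] by simp
    next
      case (balanced a x v)
      then show ?case using r_closed V_closed h hb \<phi> hd vspD(3,15)[OF vW] by simp
    qed
    then show "s \<in> hker F W h" using sF by (simp add: hker_def)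
  qed
  then have "N \<subseteq> hker F W h" by (rule kspan_least[OF ker])
  then have "\<And>x. x \<in> N \<Longrightarrow> h x = \<zero>\<^bsub>W\<^esub>" by (auto simp: hker_def)
  from rhom_quot_factor[OF lF W sN hom this] obtain g where
    g: "rhom B' T W g" "\<And>x. x \<in> carrier F \<Longrightarrow> g (N +>\<^bsub>F\<^esub> x) = h x"
    unfolding tensor_eq by blast
  then have "g (tn x v) = \<phi> x v" if "x \<in> carrier M" "v \<in> carrier V" for x v
    using that hb by (simp add: tens_def)
  with g(1) show ?thesis by blast
qed

end

section \<open>Connected components of set systems and their behaviour under contraction\<close>

section \<open>Connected components\<close>

text \<open>A point of an edge is related to itself, so the transitive closure is already an
  equivalence relation on \<open>\<Union>E\<close>.\<close>

definition adj :: "'a set set \<Rightarrow> ('a \<times> 'a) set"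
  where "adj E = {(x, y). \<exists>e\<in>E. x \<in> e \<and> y \<in> e}"

definition comps :: "'a set set \<Rightarrow> 'a set set"
  where "comps E = \<Union>E // (adj E)\<^sup>+"

lemma stack_components_eq: "stack_components g h = comps (stack_edges g h)"
  by (simp add: stack_components_def comps_def adj_def)

lemma adjI: "e \<in> E \<Longrightarrow> x \<in> e \<Longrightarrow> y \<in> e \<Longrightarrow> (x, y) \<in> adj E"
  by (auto simp: adj_def)

lemma conn_refl: "x \<in> \<Union>E \<Longrightarrow> (x, x) \<in> (adj E)\<^sup>+"
  by (auto simp: adj_def)

lemma sym_conn: "sym ((adj E)\<^sup>+)"
  by (intro sym_trancl symI) (auto simp: adj_def)

lemma conn_sub: "(adj E)\<^sup>+ \<subseteq> \<Union>E \<times> \<Union>E"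
  by (intro trancl_subset_Sigma) (auto simp: adj_def)

lemma equiv_conn: "equiv (\<Union>E) ((adj E)\<^sup>+)"
  by (rule equivI[OF conn_sub _ sym_conn trans_trancl]) (auto intro!: refl_onI conn_refl)

lemma conn_mono: "E \<subseteq> F \<Longrightarrow> (adj E)\<^sup>+ \<subseteq> (adj F)\<^sup>+"
  by (intro trancl_mono_subset) (auto simp: adj_def)

lemma partition_comps: "partition_on (\<Union>E) (comps E)"
  unfolding comps_def by (rule partition_on_quotient[OF equiv_conn])

lemma Union_comps: "\<Union>(comps E) = \<Union>E"
  using partition_comps[of E] by (simp add: partition_on_def)

lemma comps_nonempty: "C \<in> comps E \<Longrightarrow> C \<noteq> {}"
  using partition_comps[of E] by (auto simp: partition_on_def)

lemma comps_conn: "C \<in> comps E \<Longrightarrow> x \<in> C \<Longrightarrow> y \<in> C \<Longrightarrow> (x, y) \<in> (adj E)\<^sup>+"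
  unfolding comps_def by (rule quotient_eq_iff[THEN iffD1, OF equiv_conn]) auto

lemma comps_closed: "C \<in> comps E \<Longrightarrow> x \<in> C \<Longrightarrow> (x, y) \<in> (adj E)\<^sup>+ \<Longrightarrow> y \<in> C"
  unfolding comps_def by (rule in_quotient_imp_closed[OF equiv_conn])

lemma conn_invariant:
  assumes "(x, y) \<in> (adj E)\<^sup>+" "x \<in> S" "\<And>e. e \<in> E \<Longrightarrow> e \<inter> S \<noteq> {} \<Longrightarrow> e \<subseteq> S"
  shows "y \<in> S"
  using assms(1,2)
proof (induction rule: trancl_induct)
  case (base y)
  then show ?case using assms(3) by (auto simp: adj_def)
next
  case (step y z)
  then show ?case using assms(3) by (fastforce simp: adj_def)
qed

lemma comps_eqI:
  assumes P: "partition_on (\<Union>E) P"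
    and closed: "\<And>e B. e \<in> E \<Longrightarrow> B \<in> P \<Longrightarrow> e \<inter> B \<noteq> {} \<Longrightarrow> e \<subseteq> B"
    and conn: "\<And>B x y. B \<in> P \<Longrightarrow> x \<in> B \<Longrightarrow> y \<in> B \<Longrightarrow> (x, y) \<in> (adj E)\<^sup>+"
  shows "comps E = P"
proof -
  have cls: "(adj E)\<^sup>+ `` {x} = B" if "B \<in> P" "x \<in> B" for x B
    using conn[OF that(1)] conn_invariant[of x _ E B] closed[OF _ that(1)] that by blast
  have un: "\<Union>P = \<Union>E" using P by (auto simp: partition_on_def)
  show ?thesis
  proof (intro equalityI subsetI)
    fix C assume "C \<in> comps E"
    then obtain x where x: "x \<in> \<Union>E" "C = (adj E)\<^sup>+ `` {x}" by (auto simp: comps_def quotient_def)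
    with un obtain B where "B \<in> P" "x \<in> B" by auto
    then show "C \<in> P" using cls x by simp
  next
    fix B assume B: "B \<in> P"
    then have "B \<noteq> {}" using P by (auto simp: partition_on_def)
    then obtain x where x: "x \<in> B" by auto
    then have "x \<in> \<Union>E" using B un by auto
    then show "B \<in> comps E" using cls[OF B x] by (auto simp: comps_def quotient_def)
  qed
qed

lemma partition_on_subE: "partition_on A P \<Longrightarrow> B \<in> P \<Longrightarrow> C \<in> P \<Longrightarrow> x \<in> B \<Longrightarrow> x \<in> C \<Longrightarrow> B = C"
  by (auto simp: partition_on_def disjoint_def)

lemma partition_on_Diff:
  assumes "partition_on A P"
  shows "partition_on (A - Q) ((\<lambda>C. C - Q) ` P - {{}})"
proof (rule partition_onI)
  show "\<Union>((\<lambda>C. C - Q) ` P - {{}}) = A - Q" using assms by (auto simp: partition_on_def)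
  show "disjnt p p'" if p: "p \<in> (\<lambda>C. C - Q) ` P - {{}}" "p' \<in> (\<lambda>C. C - Q) ` P - {{}}" "p \<noteq> p'" for p p'
  proof -
    obtain C C' where "C \<in> P" "C' \<in> P" "p = C - Q" "p' = C' - Q" using p by auto
    moreover have "C \<noteq> C'" using p(3) calculation by auto
    ultimately show ?thesis using assms by (auto simp: partition_on_def disjoint_def disjnt_def)
  qed
qed auto

lemma finite_comps: "finite (\<Union>E) \<Longrightarrow> finite (comps E)"
  using finite_elements partition_comps by blast

lemma comps_Un_sub:
  assumes "C \<in> comps E"
  shows "\<exists>D\<in>comps (E \<union> F). C \<subseteq> D"
proof -
  obtain x where x: "x \<in> C" using comps_nonempty[OF assms] by auto
  then have "x \<in> \<Union>(E \<union> F)" using assms Union_comps[of E] by auto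
  then obtain D where D: "D \<in> comps (E \<union> F)" "x \<in> D" using Union_comps[of "E \<union> F"] by auto
  have "y \<in> D" if "y \<in> C" for y
    using comps_closed[OF D] comps_conn[OF assms x that] conn_mono[of E "E \<union> F"] by auto
  then show ?thesis using D by auto
qed

text \<open>
  Contracting the points of \<open>Q\<close>, which no edge of \<open>F\<close> touches: this single fact yields both the
  associativity of stacking and its closure on perfect matchings.
\<close>

lemma comps_contract:
  fixes E F :: "'a set set"
  assumes Q: "Q \<inter> \<Union>F = {}"
  defines "E' \<equiv> (\<lambda>C. C - Q) ` comps E - {{}}"
  shows "comps (E' \<union> F) = (\<lambda>C. C - Q) ` comps (E \<union> F) - {{}}"
    and "{C \<in> comps (E \<union> F). C \<subseteq> Q} = {C \<in> comps E. C \<subseteq> Q}"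
proof -
  have "\<Union>E' = \<Union>(comps E) - Q" by (auto simp: E'_def)
  then have UE': "\<Union>E' = \<Union>E - Q" by (simp add: Union_comps)
  have U: "\<Union>(E' \<union> F) = \<Union>(E \<union> F) - Q" using UE' Q by auto
  show "comps (E' \<union> F) = (\<lambda>C. C - Q) ` comps (E \<union> F) - {{}}"
  proof (rule comps_eqI)
    show "partition_on (\<Union>(E' \<union> F)) ((\<lambda>C. C - Q) ` comps (E \<union> F) - {{}})"
      unfolding U by (rule partition_on_Diff[OF partition_comps])
  next
    fix e B assume e: "e \<in> E' \<union> F" and B: "B \<in> (\<lambda>C. C - Q) ` comps (E \<union> F) - {{}}" and ne: "e \<inter> B \<noteq> {}"
    then obtain D x where D: "D \<in> comps (E \<union> F)" "B = D - Q" "x \<in> e" "x \<in> D" by auto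
    show "e \<subseteq> B"
    proof (cases "e \<in> E'")
      case True
      then obtain C where C: "C \<in> comps E" "e = C - Q" by (auto simp: E'_def)
      then obtain D' where D': "D' \<in> comps (E \<union> F)" "C \<subseteq> D'" using comps_Un_sub by blast
      have "D' = D" using partition_on_subE[OF partition_comps D'(1) D(1), of x] D C D' by auto
      then show ?thesis using C D D' by auto
    next
      case False
      then have "e \<in> F" using e by simp
      then have "y \<in> D" if "y \<in> e" for y
        using comps_closed[OF D(1,4), of y] adjI[of e "E \<union> F" x y] D that by auto
      then show ?thesis using D \<open>e \<in> F\<close> Q by auto
    qed
  next
    fix B x y assume B: "B \<in> (\<lambda>C. C - Q) ` comps (E \<union> F) - {{}}" and xy: "x \<in> B" "y \<in> B"
    then obtain D where D: "D \<in> comps (E \<union> F)" "B = D - Q" by auto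
    let ?c = "(adj (E' \<union> F))\<^sup>+"
    have conv: "(x, y) \<in> ?c" if "(x, z) \<in> ?c" "z \<notin> Q" "z = y \<or> (z, y) \<in> (adj E)\<^sup>+" "y \<notin> Q" for x y z
    proof (cases "z = y")
      case False
      then have zy: "(z, y) \<in> (adj E)\<^sup>+" using that by simp
      then have "z \<in> \<Union>(comps E)" unfolding Union_comps using conn_sub[of E] by blast
      then obtain C where C: "C \<in> comps E" "z \<in> C" by blast
      then have "y \<in> C" using comps_closed zy by fastforce
      then have "C - Q \<in> E'" "z \<in> C - Q" "y \<in> C - Q" using C that by (auto simp: E'_def)
      then have "(z, y) \<in> adj (E' \<union> F)" by (intro adjI[of "C - Q"]) auto
      then show ?thesis using that(1) by auto
    qed (use that in simp)
    have "(x, y) \<in> (adj (E \<union> F))\<^sup>+" using comps_conn[OF D(1)] xy D by auto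
    \<comment> \<open>The path is followed with a lag. The point z outside \<open>Q\<close> has been
      reached in the contracted graph, and the current point is z or joined to z by edges of
      \<open>E\<close> alone. An edge of \<open>F\<close> starts and ends outside \<open>Q\<close>,
      so the contracted component of \<open>E\<close> through z bridges the gap before it is
      used.\<close>
    then have "\<exists>z. (x, z) \<in> ?c \<and> z \<notin> Q \<and> (z = y \<or> (z, y) \<in> (adj E)\<^sup>+)"
    proof (induction rule: trancl_induct)
      case (base y)
      have "x \<in> \<Union>(E' \<union> F)" "x \<notin> Q" using D xy U partition_comps[of "E \<union> F"] by (auto simp: partition_on_def)
      then have xx: "(x, x) \<in> ?c" by (intro conn_refl)
      from base obtain e where e: "e \<in> E \<union> F" "x \<in> e" "y \<in> e" by (auto simp: adj_def)
      show ?case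
      proof (cases "e \<in> E")
        case True
        then show ?thesis using adjI[of e E x y] e xx \<open>x \<notin> Q\<close> by blast
      next
        case False
        then have "e \<in> F" using e by simp
        then have "(x, y) \<in> ?c" "y \<notin> Q" using adjI[of e "E' \<union> F" x y] e Q by auto
        then show ?thesis by blast
      qed
    next
      case (step y w)
      then obtain z where z: "(x, z) \<in> ?c" "z \<notin> Q" "z = y \<or> (z, y) \<in> (adj E)\<^sup>+" by auto
      from step obtain e where e: "e \<in> E \<union> F" "y \<in> e" "w \<in> e" by (auto simp: adj_def)
      show ?case
      proof (cases "e \<in> E")
        case True
        then have "(y, w) \<in> adj E" using adjI e by fast
        then show ?thesis using z trancl_into_trancl[of z y "adj E" w] by blast
      next
        case False
        then have "e \<in> F" using e by simp
        then have "(y, w) \<in> adj (E' \<union> F)" "w \<notin> Q" "y \<notin> Q" using adjI[of e "E' \<union> F" y w] e Q by auto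
        then show ?thesis using conv[OF z] by (blast intro: trancl_into_trancl)
      qed
    qed
    then show "(x, y) \<in> ?c" using conv xy D by blast
  qed
  \<comment> \<open>A component of \<open>E\<close> inside \<open>Q\<close> is met by no edge of
    \<open>F\<close>, so it stays a component.\<close>
  have sub: "comps E \<inter> {C. C \<subseteq> Q} \<subseteq> comps (E \<union> F)"
  proof
    fix C assume "C \<in> comps E \<inter> {C. C \<subseteq> Q}"
    then have C: "C \<in> comps E" "C \<subseteq> Q" by auto
    then obtain D where D: "D \<in> comps (E \<union> F)" "C \<subseteq> D" using comps_Un_sub by blast
    obtain x where x: "x \<in> C" using C comps_nonempty by blast
    have cl: "e \<subseteq> C" if "e \<in> E \<union> F" "e \<inter> C \<noteq> {}" for e
    proof -
      have "e \<in> E" using that C Q by auto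
      then show ?thesis using that comps_closed[OF C(1)] adjI[of e E] by blast
    qed
    have "D \<subseteq> C"
      using conn_invariant[of x _ "E \<union> F" C, OF comps_conn[OF D(1)] x cl] x D by auto
    then show "C \<in> comps (E \<union> F)" using D by auto
  qed
  moreover have "C \<in> comps E" if C: "C \<in> comps (E \<union> F)" "C \<subseteq> Q" for C
  proof -
    obtain x where x: "x \<in> C" using C comps_nonempty by blast
    have "x \<in> \<Union>(E \<union> F)" using x C Union_comps[of "E \<union> F"] by auto
    then have "x \<in> \<Union>E" using x C Q by auto
    then obtain D where D: "D \<in> comps E" "x \<in> D" using Union_comps[of E] by auto
    obtain D' where D': "D' \<in> comps (E \<union> F)" "D \<subseteq> D'" using D comps_Un_sub by blast
    then have "D' = C" using partition_on_subE[OF partition_comps D'(1) C(1), of x] x D by auto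
    then have "D \<in> comps (E \<union> F)" using sub D D' C by auto
    then have "D = C" using partition_on_subE[OF partition_comps _ C(1), of D x] D x by auto
    then show ?thesis using D by simp
  qed
  ultimately show "{C \<in> comps (E \<union> F). C \<subseteq> Q} = {C \<in> comps E. C \<subseteq> Q}" by auto
qed

lemma comps_image:
  assumes "inj f"
  shows "comps ((`) f ` E) = (`) f ` comps E"
proof (rule comps_eqI)
  have "partition_on (f ` \<Union>E) ((`) f ` comps E - {{}})"
    using assms partition_on_inj_image[OF partition_comps, of f E] by (simp add: inj_on_subset)
  moreover have "{} \<notin> (`) f ` comps E" using partition_comps[of E] by (auto simp: partition_on_def)
  ultimately show "partition_on (\<Union>((`) f ` E)) ((`) f ` comps E)" by (simp add: image_Union)
next
  fix e B assume "e \<in> (`) f ` E" "B \<in> (`) f ` comps E" and ne: "e \<inter> B \<noteq> {}"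
  then obtain e' C where e: "e' \<in> E" "e = f ` e'" "C \<in> comps E" "B = f ` C" by auto
  then obtain x where x: "x \<in> e'" "x \<in> C" using ne assms by (auto simp: inj_eq)
  then have "e' \<subseteq> C" using comps_closed[OF e(3)] adjI[OF e(1)] by blast
  then show "e \<subseteq> B" using e by auto
next
  fix B x y assume "B \<in> (`) f ` comps E" "x \<in> B" "y \<in> B"
  then obtain C u v where C: "C \<in> comps E" "u \<in> C" "v \<in> C" "x = f u" "y = f v" by auto
  have "(f u, f v) \<in> (adj ((`) f ` E))\<^sup>+" if "(u, v) \<in> (adj E)\<^sup>+" for u v
    using that
  proof (induction rule: trancl_induct)
    case (base y)
    then show ?case by (force simp: adj_def)
  next
    case (step y z)
    then have "(f y, f z) \<in> adj ((`) f ` E)" by (force simp: adj_def)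
    then show ?case using step by auto
  qed
  from this[OF comps_conn[OF C(1-3)]] show "(x, y) \<in> (adj ((`) f ` E))\<^sup>+" unfolding C .
qed

lemma comps_Un_disjoint:
  assumes "\<Union>E \<inter> \<Union>F = {}"
  shows "comps (E \<union> F) = comps E \<union> comps F"
proof -
  \<comment> \<open>Contraction with all points of \<open>E\<close> as the contracted set; every
    component of \<open>E\<close> then counts as lying inside it.\<close>
  have *: "{C \<in> comps (E \<union> F). C \<subseteq> \<Union>E} = comps E" if "\<Union>E \<inter> \<Union>F = {}" for E F :: "'a set set"
    using comps_contract(2)[OF that, of E] partition_comps[of E] by (auto simp: partition_on_def)
  have "C \<subseteq> \<Union>E \<or> C \<subseteq> \<Union>F" if C: "C \<in> comps (E \<union> F)" for C
  proof -
    obtain x where x: "x \<in> C" using C comps_nonempty by blast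
    have "x \<in> \<Union>(E \<union> F)" using x C Union_comps[of "E \<union> F"] by auto
    moreover have "C \<subseteq> S" if S: "x \<in> S" "S = \<Union>E \<or> S = \<Union>F" for S
    proof
      fix y assume y: "y \<in> C"
      show "y \<in> S"
        by (rule conn_invariant[OF comps_conn[OF C x y] S(1)]) (use S(2) assms in blast)
    qed
    ultimately show ?thesis by (metis UnE Union_Un_distrib)
  qed
  then have "comps (E \<union> F) = {C \<in> comps (E \<union> F). C \<subseteq> \<Union>E} \<union> {C \<in> comps (E \<union> F). C \<subseteq> \<Union>F}" by blast
  moreover have "{C \<in> comps (E \<union> F). C \<subseteq> \<Union>F} = comps F"
    using *[of F E] assms by (simp add: Un_commute Int_commute)
  ultimately show ?thesis using *[OF assms] by simp
qed

lemma comps_connected: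
  assumes "\<Union>E \<noteq> {}" "\<And>x y. x \<in> \<Union>E \<Longrightarrow> y \<in> \<Union>E \<Longrightarrow> (x, y) \<in> (adj E)\<^sup>+"
  shows "comps E = {\<Union>E}"
  by (rule comps_eqI) (use assms in \<open>auto simp: partition_on_def\<close>)

lemma comps_single: "e \<noteq> {} \<Longrightarrow> comps {e} = {e}"
  using comps_connected[of "{e}"] by (auto simp: adj_def)

lemma comps_insert_disjoint: "e \<noteq> {} \<Longrightarrow> e \<inter> \<Union>E = {} \<Longrightarrow> comps (insert e E) = insert e (comps E)"
  using comps_Un_disjoint[of "{e}" E] comps_single[of e] by auto

lemma comps_partition:
  assumes "partition_on V E"
  shows "comps E = E"
proof (rule comps_eqI)
  show "partition_on (\<Union>E) E" using assms by (simp add: partition_on_def)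
  show "e \<subseteq> B" if "e \<in> E" "B \<in> E" "e \<inter> B \<noteq> {}" for e B
    using partition_on_subE[OF assms that(1,2)] that(3) by blast
  show "(x, y) \<in> (adj E)\<^sup>+" if "B \<in> E" "x \<in> B" "y \<in> B" for B x y
    using adjI[OF that] by auto
qed

lemma comps_insert_partition:
  assumes E: "partition_on V E" and e: "e \<noteq> {}"
  shows "comps (insert e E) = insert (e \<union> \<Union>{f\<in>E. f \<inter> e \<noteq> {}}) {f\<in>E. f \<inter> e = {}}"
    (is "_ = insert ?X ?R")
proof (rule comps_eqI)
  show "partition_on (\<Union>(insert e E)) (insert ?X ?R)"
  proof (rule partition_onI)
    show "\<Union>(insert ?X ?R) = \<Union>(insert e E)" by auto
    have a: "disjnt ?X f" if "f \<in> ?R" for f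
      using that partition_on_subE[OF E, of f] by (auto simp: disjnt_def)
    have b: "disjnt f g" if "f \<in> ?R" "g \<in> ?R" "f \<noteq> g" for f g
      using that partition_on_subE[OF E, of f g] by (auto simp: disjnt_def)
    show "disjnt p p'" if p: "p \<in> insert ?X ?R" "p' \<in> insert ?X ?R" "p \<noteq> p'" for p p'
      using p(1,2)
    proof (elim insertE, goal_cases)
      case 1
      then show ?case using p(3) by simp
    next
      case 2
      then show ?case using a[of p'] by (simp only:)
    next
      case 3
      then show ?case using disjnt_sym[OF a[of p]] by (simp only:)
    next
      case 4
      then show ?case using b p(3) by blast
    qed
  qed (use e E in \<open>auto simp: partition_on_def\<close>)
next
  fix f B assume "f \<in> insert e E" "B \<in> insert ?X ?R" "f \<inter> B \<noteq> {}"
  then show "f \<subseteq> B" using partition_on_subE[OF E] by blast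
next
  fix B x y assume B: "B \<in> insert ?X ?R" "x \<in> B" "y \<in> B"
  let ?c = "(adj (insert e E))\<^sup>+"
  have to_e: "\<exists>a\<in>e. (x, a) \<in> ?c" if "x \<in> ?X" for x
    using that adjI[of e "insert e E" x x] adjI[of _ "insert e E" x] by blast
  show "(x, y) \<in> ?c"
  proof (cases "B = ?X")
    case True
    then obtain a b where ab: "a \<in> e" "b \<in> e" "(x, a) \<in> ?c" "(y, b) \<in> ?c" using to_e B by meson
    have "(a, b) \<in> ?c" using ab adjI[of e "insert e E" a b] by blast
    moreover have "(b, y) \<in> ?c" using ab(4) sym_conn by (meson symD)
    ultimately show ?thesis using ab(3) by (meson trancl_trans)
  next
    case False
    then show ?thesis using B adjI[of B "insert e E" x y] by blast
  qed
qed

section \<open>Perfect matchings and symmetric differences of their point sets\<close>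

section \<open>Perfect matchings\<close>

definition pm :: "'a set \<Rightarrow> 'a set set \<Rightarrow> bool"
  where "pm V E \<longleftrightarrow> partition_on V E \<and> (\<forall>e\<in>E. card e = 2)"

lemma pm_edge:
  assumes "pm V E" "a \<in> V"
  obtains x where "x \<noteq> a" "{a, x} \<in> E" "x \<in> V" "\<And>f. f \<in> E \<Longrightarrow> a \<in> f \<Longrightarrow> f = {a, x}"
proof -
  from assms obtain f where f: "f \<in> E" "a \<in> f" by (auto simp: pm_def partition_on_def)
  then have "card f = 2" using assms by (auto simp: pm_def)
  then obtain x where x: "f = {a, x}" "x \<noteq> a" using f(2) by (auto simp: card_2_iff)
  then have "x \<in> V" using f assms by (auto simp: pm_def partition_on_def)
  moreover have "g = {a, x}" if "g \<in> E" "a \<in> g" for g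
    using partition_on_subE[of V E g f a] that f x assms by (auto simp: pm_def)
  ultimately show thesis using that f x by blast
qed

text \<open>The edge \<open>e\<close> joins the at most two old edges it meets into a path. Deleting
  the points that are now covered twice leaves the two ends of that path, or nothing if
  \<open>e\<close> was already an edge.\<close>

lemma pm_add_edge:
  assumes E: "pm V E" and e: "card e = 2"
  shows "pm ((V \<union> e) - (V \<inter> e)) ((\<lambda>C. C - (V \<inter> e)) ` comps (insert e E) - {{}})"
proof -
  have P: "partition_on V E" using E by (simp add: pm_def)
  have ne: "e \<noteq> {}" using e by auto
  let ?Q = "V \<inter> e" and ?X = "e \<union> \<Union>{f\<in>E. f \<inter> e \<noteq> {}}"
  have comps: "comps (insert e E) = insert ?X {f\<in>E. f \<inter> e = {}}"
    by (rule comps_insert_partition[OF P ne])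
  have "\<Union>(insert e E) = V \<union> e" using P by (auto simp: partition_on_def)
  then have "partition_on ((V \<union> e) - ?Q) ((\<lambda>C. C - ?Q) ` comps (insert e E) - {{}})"
    using partition_on_Diff[OF partition_comps[of "insert e E"], of ?Q] by simp
  moreover have "card D = 2" if D: "D \<in> (\<lambda>C. C - ?Q) ` comps (insert e E) - {{}}" for D
  proof -
    from D obtain C where C: "C \<in> comps (insert e E)" "D = C - ?Q" "D \<noteq> {}" by auto
    show ?thesis
    proof (cases "C = ?X")
      case False
      then have "C \<in> E" "C \<inter> e = {}" using C comps by auto
      then have "D = C" using C by auto
      then show ?thesis using \<open>C \<in> E\<close> E by (auto simp: pm_def)
    next
      case True
      obtain a b where ab: "e = {a, b}" "a \<noteq> b" using e by (auto simp: card_2_iff)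
      have D: "D = (e - V) \<union> (\<Union>{f\<in>E. a \<in> f} - e) \<union> (\<Union>{f\<in>E. b \<in> f} - e)"
        using C(2) True ab P by (auto simp: partition_on_def)
      have nb: "\<Union>{f\<in>E. c \<in> f} = {}" if "c \<notin> V" for c using that P by (auto simp: partition_on_def)
      have bl: "\<exists>x. x \<noteq> c \<and> x \<in> V \<and> {c, x} \<in> E \<and> \<Union>{f\<in>E. c \<in> f} = {c, x}" if c: "c \<in> V" for c
        by (rule pm_edge[OF E c]) blast
      consider "a \<notin> V" "b \<notin> V" | "a \<in> V" "b \<notin> V" | "a \<notin> V" "b \<in> V" | "a \<in> V" "b \<in> V" by auto
      then show ?thesis
      proof cases
        case 1
        then have "D = {a, b}" using D nb[of a] nb[of b] ab by auto
        then show ?thesis using ab by simp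
      next
        case 2
        then obtain x where "x \<noteq> a" "x \<in> V" "\<Union>{f\<in>E. a \<in> f} = {a, x}" using bl by blast
        then have "D = {b, x}" "b \<noteq> x" using D nb[of b] ab 2 by auto
        then show ?thesis by simp
      next
        case 3
        then obtain x where "x \<noteq> b" "x \<in> V" "\<Union>{f\<in>E. b \<in> f} = {b, x}" using bl by blast
        then have "D = {a, x}" "a \<noteq> x" using D nb[of a] ab 3 by auto
        then show ?thesis by simp
      next
        case 4
        then obtain x where x: "x \<noteq> a" "{a, x} \<in> E" "\<Union>{f\<in>E. a \<in> f} = {a, x}" using bl by blast
        obtain y where y: "y \<noteq> b" "{b, y} \<in> E" "\<Union>{f\<in>E. b \<in> f} = {b, y}" using bl 4 by blast
        have D': "D = {x, y} - {a, b}" using D x y ab 4 by auto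
        \<comment> \<open>If \<open>x = b\<close>, then \<open>e\<close> doubles an old edge, the
          component closes up to a loop, and \<open>D\<close> would be empty.\<close>
        have "x \<noteq> b"
        proof
          assume "x = b"
          then have "{b, y} = {a, b}" using partition_on_subE[OF P x(2) y(2), of b] by auto
          then show False using D' \<open>x = b\<close> y C(3) by (auto simp: doubleton_eq_iff)
        qed
        moreover have "y \<noteq> a"
        proof
          assume "y = a"
          then have "{a, x} = {b, a}" using partition_on_subE[OF P x(2) y(2), of a] by auto
          then show False using \<open>x \<noteq> b\<close> ab by (auto simp: doubleton_eq_iff)
        qed
        moreover have "x \<noteq> y"
        proof
          assume "x = y"
          then have "{a, x} = {b, x}" using partition_on_subE[OF P x(2) y(2), of x] by auto
          then show False using ab by (auto simp: doubleton_eq_iff)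
        qed
        ultimately show ?thesis using D' x y by auto
      qed
    qed
  qed
  ultimately show ?thesis by (simp add: pm_def)
qed

text \<open>For stacked diagrams the common points form the middle row. The edges of
  \<open>F\<close> are added one at a time, each time deleting the doubly covered points at once;
  since the later edges avoid these points, \<open>comps_contract\<close> shows that the early
  deletion does not affect the final result.\<close>

lemma pm_symmetric_diff:
  assumes "finite F" "pm V E" "pm W F"
  shows "pm ((V \<union> W) - (V \<inter> W)) ((\<lambda>C. C - (V \<inter> W)) ` comps (E \<union> F) - {{}})"
  using assms
proof (induction F arbitrary: V E W rule: finite_induct)
  case empty
  then have W: "W = {}" by (auto simp: pm_def partition_on_def)
  have "comps E = E" "{} \<notin> E" using comps_partition empty by (auto simp: pm_def partition_on_def)
  then show ?case using empty W by simp
next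
  case (insert e F)
  let ?W = "W - e" and ?Q = "V \<inter> e"
  have F: "partition_on W (insert e F)" "card e = 2" using insert.prems by (auto simp: pm_def)
  have eF: "e \<inter> \<Union>F = {}" using F insert.hyps partition_on_subE[OF F(1), of e] by blast
  have W: "W = e \<union> \<Union>F" using F by (auto simp: partition_on_def)
  have "partition_on ?W F"
    using F W eF by (auto simp: partition_on_def disjoint_def)
  then have pF: "pm ?W F" using insert.prems by (auto simp: pm_def)
  define V' where "V' = (V \<union> e) - ?Q"
  define E' where "E' = (\<lambda>C. C - ?Q) ` comps (insert e E) - {{}}"
  have "pm V' E'" unfolding V'_def E'_def by (rule pm_add_edge[OF insert.prems(1) F(2)])
  from insert.IH[OF this pF]
  have IH: "pm ((V' \<union> ?W) - (V' \<inter> ?W)) ((\<lambda>C. C - (V' \<inter> ?W)) ` comps (E' \<union> F) - {{}})" .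
  have "?Q \<inter> \<Union>F = {}" using eF by auto
  from comps_contract(1)[OF this, of "insert e E", folded E'_def]
  have c: "comps (E' \<union> F) = (\<lambda>C. C - ?Q) ` comps (E \<union> insert e F) - {{}}" by simp
  have "(V' \<union> ?W) - (V' \<inter> ?W) = (V \<union> W) - (V \<inter> W)" using W eF by (auto simp: V'_def)
  moreover have q: "C - ?Q - (V' \<inter> ?W) = C - (V \<inter> W)" for C using W eF by (auto simp: V'_def)
  have "(\<lambda>C. C - (V' \<inter> ?W)) ` comps (E' \<union> F) - {{}} = (\<lambda>C. C - ?Q - (V' \<inter> ?W)) ` comps (E \<union> insert e F) - {{}}"
    unfolding c by auto
  ultimately show ?case using IH unfolding q by simp
qed

lemma pm_image:
  assumes "inj f"
  shows "pm (f ` V) ((`) f ` E) \<longleftrightarrow> pm V E"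
proof -
  have inj: "inj_on f S" for S using assms inj_on_subset by blast
  have "partition_on (f ` V) ((`) f ` E) \<longleftrightarrow> partition_on V E"
  proof
    assume P: "partition_on V E"
    then have "{} \<notin> (`) f ` E" by (auto simp: partition_on_def)
    then show "partition_on (f ` V) ((`) f ` E)" using partition_on_inj_image[OF P inj] by simp
  next
    assume "partition_on (f ` V) ((`) f ` E)"
    then show "partition_on V E"
      using assms by (auto simp: partition_on_def disjoint_def image_Int[symmetric] inj_image_eq_iff simp flip: image_Union)
  qed
  then show ?thesis by (simp add: pm_def card_image[OF inj])
qed

section \<open>Composition in the Brauer category: associativity, duality, and factorization of
  diagrams\<close>

section \<open>Stacking Brauer diagrams\<close>

text \<open>Diagrams are drawn in the plane with rows indexed by natural numbers.\<close>

declare One_nat_def [simp del]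

definition emb :: "nat \<Rightarrow> nat \<Rightarrow> point \<Rightarrow> nat \<times> nat"
  where "emb r s = case_point (Pair r) (Pair s)"

lemma emb_simps [simp]: "emb r s (Bot i) = (r, i)" "emb r s (Top i) = (s, i)"
  by (simp_all add: emb_def)

lemma inj_emb: "r \<noteq> s \<Longrightarrow> inj (emb r s)"
  by (auto simp: inj_def emb_def split: point.splits)

abbreviation row :: "nat \<Rightarrow> (nat \<times> nat) set"
  where "row r \<equiv> {r} \<times> UNIV"

abbreviation emb_strands :: "nat \<Rightarrow> nat \<Rightarrow> diagram \<Rightarrow> (nat \<times> nat) set set"
  where "emb_strands r s d \<equiv> (`) (emb r s) ` strands d"

lemma inj_image_set: "inj f \<Longrightarrow> (`) f ` A = (`) f ` B \<longleftrightarrow> A = B"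
  by (simp add: inj_image_eq_iff inj_on_def)

definition points :: "nat \<Rightarrow> nat \<Rightarrow> point set"
  where "points a b = Bot ` {1..a} \<union> Top ` {1..b}"

lemma brauer_iff: "d \<in> brauer a b \<longleftrightarrow> src d = a \<and> tgt d = b \<and> pm (points a b) (strands d)"
  by (cases d) (auto simp: brauer_def pm_def points_def)

lemma src_stack [simp]: "src (stack g h) = src h" and tgt_stack [simp]: "tgt (stack g h) = tgt g"
  by (simp_all add: stack_def)

definition stack_emb :: "nat \<Rightarrow> nat \<Rightarrow> nat \<Rightarrow> stack_point \<Rightarrow> nat \<times> nat"
  where "stack_emb r s t = case_stack_point (Pair r) (Pair s) (Pair t)"

text \<open>Transfers stacking from the three-row type \<open>stack_point\<close> to rows of the
  plane, where any number of stacked diagrams live in one graph. The comparison of bracketings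
  depends on this.\<close>

lemma stack_comps:
  assumes "r \<noteq> s" "s \<noteq> t" "r \<noteq> t"
  shows emb_stack: "emb_strands r t (stack g h) =
      (\<lambda>C. C - row s) ` comps (emb_strands r s h \<union> emb_strands s t g) - {{}}"
    and loops_eq: "loops g h = card {C \<in> comps (emb_strands r s h \<union> emb_strands s t g). C \<subseteq> row s}"
proof -
  let ?f = "stack_emb r s t"
  have inj: "inj ?f" using assms by (auto simp: inj_def stack_emb_def split: stack_point.splits)
  have 1: "?f (case_point Lower Middle p) = emb r s p" and 2: "?f (case_point Middle Upper p) = emb s t p"
    and 3: "?f (case_point Lower Upper p) = emb r t p" for p
    by (simp_all add: stack_emb_def emb_def split: point.splits)
  have edges: "(`) ?f ` stack_edges g h = emb_strands r s h \<union> emb_strands s t g"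
    by (simp add: stack_edges_def image_Un image_image 1 2)
  have c: "comps (emb_strands r s h \<union> emb_strands s t g) = (`) ?f ` stack_components g h"
    unfolding edges[symmetric] comps_image[OF inj] stack_components_eq ..
  have out: "emb r t ` outer_part C = ?f ` C - row s" for C
  proof
    show "emb r t ` outer_part C \<subseteq> ?f ` C - row s"
      using assms by (auto simp: outer_part_def 3[symmetric] stack_emb_def split: point.splits)
    show "?f ` C - row s \<subseteq> emb r t ` outer_part C"
    proof
      fix x assume "x \<in> ?f ` C - row s"
      then obtain p where p: "p \<in> C" "x = ?f p" "x \<notin> row s" by auto
      then have "(\<exists>i. p = case_point Lower Upper (Bot i)) \<or> (\<exists>i. p = case_point Lower Upper (Top i))"
        by (cases p) (auto simp: stack_emb_def)
      then obtain q where "p = case_point Lower Upper q" by blast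
      then show "x \<in> emb r t ` outer_part C" using p 3 by (auto simp: outer_part_def)
    qed
  qed
  have "emb_strands r t (stack g h) = (`) (emb r t) ` (outer_part ` stack_components g h) - {{}}"
    by (auto simp: stack_def)
  then show "emb_strands r t (stack g h) =
      (\<lambda>C. C - row s) ` comps (emb_strands r s h \<union> emb_strands s t g) - {{}}"
    unfolding c by (simp add: image_image out)
  have "{C \<in> comps (emb_strands r s h \<union> emb_strands s t g). C \<subseteq> row s}
      = (`) ?f ` {C \<in> stack_components g h. outer_part C = {}}"
  proof -
    have "?f ` C \<subseteq> row s \<longleftrightarrow> outer_part C = {}" for C
      using out[of C] by (metis Diff_eq_empty_iff image_is_empty)
    then show ?thesis unfolding c by auto
  qed
  then show "loops g h = card {C \<in> comps (emb_strands r s h \<union> emb_strands s t g). C \<subseteq> row s}"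
    using inj by (simp add: loops_def card_image inj_on_def inj_image_eq_iff)
qed

lemma emb_points: "emb r s ` points a b = {r} \<times> {1..a} \<union> {s} \<times> {1..b}"
  by (force simp: points_def image_Un image_image)

lemma pm_emb:
  assumes "d \<in> brauer a b" "r \<noteq> s"
  shows "pm ({r} \<times> {1..a} \<union> {s} \<times> {1..b}) (emb_strands r s d)"
  unfolding emb_points[symmetric] using assms pm_image[OF inj_emb] by (simp add: brauer_iff)

lemma brauer_embI:
  assumes "r \<noteq> s" "src d = a" "tgt d = b" "pm ({r} \<times> {1..a} \<union> {s} \<times> {1..b}) (emb_strands r s d)"
  shows "d \<in> brauer a b"
  using assms pm_image[OF inj_emb[OF assms(1)], of "points a b" "strands d"] by (simp add: brauer_iff emb_points)

lemma pm_Union: "pm V E \<Longrightarrow> \<Union>E = V"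
  by (auto simp: pm_def partition_on_def)

lemma pm_finite: "pm V E \<Longrightarrow> finite V \<Longrightarrow> finite E"
  using finite_elements by (auto simp: pm_def)

lemma Union_emb:
  assumes "d \<in> brauer a b" "r \<noteq> s"
  shows "\<Union>(emb_strands r s d) = {r} \<times> {1..a} \<union> {s} \<times> {1..b}"
  by (rule pm_Union[OF pm_emb[OF assms]])

lemma stack_brauer:
  assumes h: "h \<in> brauer a b" and g: "g \<in> brauer b c"
  shows "stack g h \<in> brauer a c"
proof (rule brauer_embI[of 0 2])
  let ?E = "emb_strands 0 1 h" and ?F = "emb_strands 1 2 g"
  let ?V = "{0::nat} \<times> {1..a} \<union> {1} \<times> {1..b}" and ?W = "{1::nat} \<times> {1..b} \<union> {2} \<times> {1..c}"
  have E: "pm ?V ?E" and F: "pm ?W ?F" using pm_emb[OF h] pm_emb[OF g] by auto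
  have "finite ?F" using pm_finite[OF F] by simp
  from pm_symmetric_diff[OF this E F]
  have pm: "pm (?V \<union> ?W - ?V \<inter> ?W) ((\<lambda>C. C - ?V \<inter> ?W) ` comps (?E \<union> ?F) - {{}})" .
  have "\<Union>(?E \<union> ?F) = ?V \<union> ?W" using pm_Union[OF E] pm_Union[OF F] by auto
  then have sub: "C \<subseteq> ?V \<union> ?W" if "C \<in> comps (?E \<union> ?F)" for C
    using Union_upper[OF that] Union_comps[of "?E \<union> ?F"] by simp
  have "C - ?V \<inter> ?W = C - row 1" if "C \<in> comps (?E \<union> ?F)" for C using sub[OF that] by auto
  then have "(\<lambda>C. C - ?V \<inter> ?W) ` comps (?E \<union> ?F) = (\<lambda>C. C - row 1) ` comps (?E \<union> ?F)" by (intro image_cong) auto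
  moreover have "?V \<union> ?W - ?V \<inter> ?W = {0} \<times> {1..a} \<union> {2} \<times> {1..c}" by auto
  ultimately show "pm ({0} \<times> {1..a} \<union> {2} \<times> {1..c}) (emb_strands 0 2 (stack g h))"
    using pm emb_stack[of 0 1 2 g h] by simp
qed (use assms in \<open>auto simp: brauer_iff\<close>)

lemma diagram_eqI:
  assumes "src d = src d'" "tgt d = tgt d'" "emb_strands r s d = emb_strands r s d'" "r \<noteq> s"
  shows "d = d'"
  using assms inj_image_set[OF inj_emb[OF assms(4)]] by (cases d; cases d') auto

text \<open>All three diagrams are drawn on rows 0 to 3. Either bracketing contracts rows 1 and 2 of
  this one graph, only in a different order, and the loops counted altogether are the components
  contained in these two rows.\<close>

lemma stack_assoc:
  assumes f: "f \<in> brauer a b" and g: "g \<in> brauer b c" and h: "h \<in> brauer c d"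
  shows "stack h (stack g f) = stack (stack h g) f"
    and "loops g f + loops h (stack g f) = loops h g + loops (stack h g) f"
proof -
  let ?E1 = "emb_strands 0 1 f" and ?E2 = "emb_strands 1 2 g" and ?E3 = "emb_strands 2 3 h"
  let ?A = "comps (?E1 \<union> ?E2 \<union> ?E3)"
  have U: "\<Union>?E1 = {0} \<times> {1..a} \<union> {1} \<times> {1..b}" "\<Union>?E2 = {1} \<times> {1..b} \<union> {2} \<times> {1..c}"
    "\<Union>?E3 = {2} \<times> {1..c} \<union> {3} \<times> {1..d}"
    using Union_emb[OF f] Union_emb[OF g] Union_emb[OF h] by auto
  have d1: "row 1 \<inter> \<Union>?E3 = {}" and d2: "row 2 \<inter> \<Union>?E1 = {}" unfolding U by auto
  have s1: "emb_strands 0 2 (stack g f) = (\<lambda>C. C - row 1) ` comps (?E1 \<union> ?E2) - {{}}"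
    and s2: "emb_strands 1 3 (stack h g) = (\<lambda>C. C - row 2) ` comps (?E2 \<union> ?E3) - {{}}"
    by (rule emb_stack; simp)+
  have A2: "comps (?E2 \<union> ?E3 \<union> ?E1) = ?A" by (simp add: Un_ac)
  have e1: "comps (emb_strands 0 2 (stack g f) \<union> ?E3) = (\<lambda>C. C - row 1) ` ?A - {{}}"
    unfolding s1 by (rule comps_contract(1)[OF d1])
  have "comps (emb_strands 1 3 (stack h g) \<union> ?E1) = (\<lambda>C. C - row 2) ` ?A - {{}}"
    unfolding s2 A2[symmetric] by (rule comps_contract(1)[OF d2])
  then have e2: "comps (?E1 \<union> emb_strands 1 3 (stack h g)) = (\<lambda>C. C - row 2) ` ?A - {{}}"
    by (simp add: Un_commute)
  have k1: "{C \<in> comps (?E1 \<union> ?E2). C \<subseteq> row 1} = {C \<in> ?A. C \<subseteq> row 1}"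
    by (rule comps_contract(2)[OF d1, symmetric])
  have k2: "{C \<in> comps (?E2 \<union> ?E3). C \<subseteq> row 2} = {C \<in> ?A. C \<subseteq> row 2}"
    unfolding A2[symmetric] by (rule comps_contract(2)[OF d2, symmetric])
  have twice: "(\<lambda>C. C - P) ` ((\<lambda>C. C - Q) ` S - {{}}) - {{}} = (\<lambda>C. C - (P \<union> Q)) ` S - {{}}"
    for P Q and S :: "(nat \<times> nat) set set"
  proof -
    have "(\<lambda>C. C - P) ` ((\<lambda>C. C - Q) ` S - {{}}) - {{}} = (\<lambda>C. C - P) ` ((\<lambda>C. C - Q) ` S) - {{}}" by auto
    moreover have "C - Q - P = C - (P \<union> Q)" for C by auto
    ultimately show ?thesis by (simp add: image_image)
  qed
  have "emb_strands 0 3 (stack h (stack g f)) = (\<lambda>C. C - (row 2 \<union> row 1)) ` ?A - {{}}"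
    using emb_stack[of 0 2 3 h "stack g f"] twice[of "row 2" "row 1" ?A] e1 by simp
  moreover have "emb_strands 0 3 (stack (stack h g) f) = (\<lambda>C. C - (row 1 \<union> row 2)) ` ?A - {{}}"
    using emb_stack[of 0 1 3 "stack h g" f] twice[of "row 1" "row 2" ?A] e2 by simp
  ultimately show "stack h (stack g f) = stack (stack h g) f"
    by (intro diagram_eqI[of _ _ 0 3]) (auto simp: Un_commute)
  have fin: "finite ?A" by (rule finite_comps) (use U in simp)
  \<comment> \<open>The components inside rows p and q are those inside row p, and those that stay
    nonempty when row p is deleted. Deletion is injective on the latter because distinct components
    are disjoint.\<close>
  have count: "card {C \<in> ?A. C \<subseteq> row p} + card {C \<in> (\<lambda>C. C - row p) ` ?A - {{}}. C \<subseteq> row q}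
      = card {C \<in> ?A. C \<subseteq> row p \<union> row q}" if "p \<noteq> q" for p q
  proof -
    let ?S = "{C \<in> ?A. C \<subseteq> row p \<union> row q \<and> \<not> C \<subseteq> row p}"
    have "{C \<in> (\<lambda>C. C - row p) ` ?A - {{}}. C \<subseteq> row q} = (\<lambda>C. C - row p) ` ?S"
      by auto
    moreover have "inj_on (\<lambda>C. C - row p) ?S"
    proof (rule inj_onI)
      fix C D assume C: "C \<in> ?S" "D \<in> ?S" "C - row p = D - row p"
      then obtain x where "x \<in> C" "x \<notin> row p" by blast
      then have "x \<in> C" "x \<in> D" using C(3) by blast+
      then show "C = D" using partition_on_subE[OF partition_comps, of C "?E1 \<union> ?E2 \<union> ?E3" D x] C by simp
    qed
    ultimately have "card {C \<in> (\<lambda>C. C - row p) ` ?A - {{}}. C \<subseteq> row q} = card ?S"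
      by (simp add: card_image)
    moreover have "{C \<in> ?A. C \<subseteq> row p \<union> row q} = {C \<in> ?A. C \<subseteq> row p} \<union> ?S" by auto
    moreover have "{C \<in> ?A. C \<subseteq> row p} \<inter> ?S = {}" by auto
    ultimately show ?thesis using card_Un_disjoint[of "{C \<in> ?A. C \<subseteq> row p}" ?S] fin by simp
  qed
  have "loops g f + loops h (stack g f) = card {C \<in> ?A. C \<subseteq> row 1 \<union> row 2}"
    using count[of 1 2] loops_eq[of 0 1 2 g f] loops_eq[of 0 2 3 h "stack g f"] k1 e1 by simp
  moreover have "loops h g + loops (stack h g) f = card {C \<in> ?A. C \<subseteq> row 2 \<union> row 1}"
    using count[of 2 1] loops_eq[of 1 2 3 h g] loops_eq[of 0 1 3 "stack h g" f] k2 e2 by simp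
  ultimately show "loops g f + loops h (stack g f) = loops h g + loops (stack h g) f"
    by (simp add: Un_commute)
qed

subsection \<open>Turning diagrams upside down\<close>

definition flip_point :: "point \<Rightarrow> point"
  where "flip_point = case_point Top Bot"

definition flip :: "diagram \<Rightarrow> diagram"
  where "flip d = Diagram (tgt d) (src d) ((`) flip_point ` strands d)"

lemma flip_point_simps [simp]:
  "flip_point (Bot i) = Top i" "flip_point (Top i) = Bot i" "flip_point (flip_point p) = p"
  by (auto simp: flip_point_def split: point.splits)

lemma flip_simps [simp]: "src (flip d) = tgt d" "tgt (flip d) = src d" "flip (flip d) = d"
  by (cases d; simp add: flip_def image_image)+

lemma emb_flip [simp]: "emb r s (flip_point p) = emb s r p"
  by (cases p) auto

lemma emb_strands_flip [simp]: "emb_strands r s (flip d) = emb_strands s r d"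
  by (simp add: flip_def image_image)

lemma flip_brauer [simp]: "flip d \<in> brauer b a \<longleftrightarrow> d \<in> brauer a b"
proof -
  have *: "flip d \<in> brauer b a" if "d \<in> brauer a b" for d a b
    by (rule brauer_embI[of 1 0]) (use that pm_emb[OF that, of 0 1] in \<open>auto simp: brauer_iff Un_commute\<close>)
  from *[of d a b] *[of "flip d" b a] show ?thesis by auto
qed

text \<open>This duality exchanges cups with caps and left with right composition, so of two mirror
  statements only one is proved on graphs.\<close>

lemma flip_stack: "flip (stack g h) = stack (flip h) (flip g)" and loops_flip: "loops (flip h) (flip g) = loops g h"
proof -
  have "emb_strands 2 0 (stack (flip h) (flip g)) = emb_strands 2 0 (flip (stack g h))"
    using emb_stack[of 0 1 2 g h] emb_stack[of 2 1 0 "flip h" "flip g"] by (simp add: Un_commute)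
  then show "flip (stack g h) = stack (flip h) (flip g)"
    by (intro diagram_eqI[of _ _ 2 0]) simp_all
  show "loops (flip h) (flip g) = loops g h"
    using loops_eq[of 0 1 2 g h] loops_eq[of 2 1 0 "flip h" "flip g"] by (simp add: Un_commute)
qed

subsection \<open>Stacking a permutation\<close>

definition map_top :: "(nat \<Rightarrow> nat) \<Rightarrow> point \<Rightarrow> point"
  where "map_top \<pi> = case_point Bot (Top \<circ> \<pi>)"

lemma map_top_simps [simp]: "map_top \<pi> (Bot i) = Bot i" "map_top \<pi> (Top i) = Top (\<pi> i)"
  by (simp_all add: map_top_def)

lemma perm_diagram_simps [simp]: "src (perm_diagram m \<pi>) = m" "tgt (perm_diagram m \<pi>) = m"
  "strands (perm_diagram m \<pi>) = (\<lambda>i. {Bot i, Top (\<pi> i)}) ` {1..m}"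
  by (simp_all add: perm_diagram_def)

lemma perm_brauer:
  assumes "\<pi> permutes {1..m}"
  shows "perm_diagram m \<pi> \<in> brauer m m"
proof -
  have "partition_on (points m m) ((\<lambda>i. {Bot i, Top (\<pi> i)}) ` {1..m})"
  proof (rule partition_onI)
    have "\<Union>((\<lambda>i. {Bot i, Top (\<pi> i)}) ` {1..m}) = Bot ` {1..m} \<union> Top ` (\<pi> ` {1..m})" by auto
    then show "\<Union>((\<lambda>i. {Bot i, Top (\<pi> i)}) ` {1..m}) = points m m"
      by (simp add: points_def permutes_image[OF assms])
  qed (use permutes_inj[OF assms] in \<open>auto simp: disjnt_def inj_eq\<close>)
  then show ?thesis by (auto simp: brauer_iff pm_def)
qed

text \<open>Each strand of \<open>h\<close> is prolonged by the vertical strands at its upper ends.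
  The components thus correspond to the strands of \<open>h\<close>, and none of them is confined to
  the middle row.\<close>

lemma stack_perm_left:
  assumes \<pi>: "\<pi> permutes {1..b}" and h: "h \<in> brauer a b"
  shows "stack (perm_diagram b \<pi>) h = Diagram a b ((`) (map_top \<pi>) ` strands h)"
    and "loops (perm_diagram b \<pi>) h = 0"
proof -
  \<comment> \<open>\<open>j p\<close> is the piece of the stacked graph attached to the point
    \<open>p\<close> of \<open>h\<close>: a single bottom point, or a middle point together with the
    end of the vertical strand above it.\<close>
  define j where "j = (\<lambda>p. case p of Bot i \<Rightarrow> {(0, i)} | Top i \<Rightarrow> {(1::nat, i), (2, \<pi> i)})"
  have j [simp]: "j (Bot i) = {(0, i)}" "j (Top i) = {(1, i), (2, \<pi> i)}" for i by (simp_all add: j_def)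
  have inj: "\<pi> i = \<pi> i' \<longleftrightarrow> i = i'" for i i' using permutes_inj[OF \<pi>] by (auto simp: inj_eq)
  have disj: "x \<in> j p \<Longrightarrow> x \<in> j q \<Longrightarrow> p = q" for x p q by (cases p; cases q) (auto simp: inj)
  let ?F = "emb_strands 1 2 (perm_diagram b \<pi>)"
  let ?E = "emb_strands 0 1 h \<union> ?F"
  let ?C = "\<lambda>e. \<Union>(j ` e)"
  have F: "?F = (\<lambda>i. {(1, i), (2, \<pi> i)}) ` {1..b}" by (auto simp: image_image)
  have pmh: "pm (points a b) (strands h)" using h by (simp add: brauer_iff)
  then have part: "partition_on (points a b) (strands h)" by (simp add: pm_def)
  have Uh: "\<Union>(strands h) = points a b" by (rule pm_Union[OF pmh])
  have U: "\<Union>?E = \<Union>(j ` points a b)"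
  proof -
    have "\<Union>?E = emb 0 1 ` points a b \<union> \<Union>?F"
      unfolding Union_Un_distrib image_Union[symmetric] Uh ..
    also have "\<dots> = \<Union>(j ` points a b)" unfolding F emb_points by (auto simp: points_def)
    finally show ?thesis .
  qed
  have embj: "emb 0 1 p \<in> j p" for p by (cases p) auto
  have comps: "comps ?E = ?C ` strands h"
  proof (rule comps_eqI)
    show "partition_on (\<Union>?E) (?C ` strands h)"
    proof (rule partition_onI)
      show "\<Union>(?C ` strands h) = \<Union>?E" unfolding U Uh[symmetric] by auto
      show "disjnt p q" if "p \<in> ?C ` strands h" "q \<in> ?C ` strands h" "p \<noteq> q" for p q
      proof -
        from that obtain e f where e: "e \<in> strands h" "p = ?C e" and f: "f \<in> strands h" "q = ?C f" by auto
        then have "e \<noteq> f" using that by auto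
        show ?thesis unfolding disjnt_def
        proof (rule ccontr)
          assume "p \<inter> q \<noteq> {}"
          then obtain x u v where "u \<in> e" "x \<in> j u" "v \<in> f" "x \<in> j v" using e f by auto
          then show False using disj partition_on_subE[OF part e(1) f(1)] \<open>e \<noteq> f\<close> by blast
        qed
      qed
      have ne: "{} \<noteq> ?C e" if "e \<in> strands h" for e
      proof -
        have "e \<noteq> {}" using that part by (auto simp: partition_on_def)
        then obtain p where "p \<in> e" by auto
        then show ?thesis using embj[of p] by auto
      qed
      show "{} \<notin> ?C ` strands h" by (rule notI, erule imageE) (use ne in blast)
    qed
  next
    fix e B assume e: "e \<in> ?E" and "B \<in> ?C ` strands h" and ne: "e \<inter> B \<noteq> {}"
    then obtain f where f: "f \<in> strands h" "B = ?C f" by auto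
    obtain x p where x: "x \<in> e" "x \<in> j p" "p \<in> f" using ne f by auto
    from e show "e \<subseteq> B"
    proof
      assume "e \<in> emb_strands 0 1 h"
      then obtain f' where f': "f' \<in> strands h" "e = emb 0 1 ` f'" by auto
      then obtain q where "q \<in> f'" "x = emb 0 1 q" using x by auto
      then have "q = p" using disj x embj by metis
      then have "f' = f" using partition_on_subE[OF part f'(1) f(1)] \<open>q \<in> f'\<close> x by auto
      then show ?thesis using f' f embj by auto
    next
      assume "e \<in> ?F"
      then obtain i where "e = j (Top i)" unfolding F by auto
      then have "p = Top i" using disj x by blast
      moreover have "j p \<subseteq> ?C f" using x(3) by blast
      ultimately show ?thesis using \<open>e = j (Top i)\<close> f(2) by simp
    qed
  next
    fix B x y assume "B \<in> ?C ` strands h" "x \<in> B" "y \<in> B"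
    then obtain f p q where f: "f \<in> strands h" "p \<in> f" "q \<in> f" "x \<in> j p" "y \<in> j q" by auto
    let ?c = "(adj ?E)\<^sup>+"
    have to: "(x, emb 0 1 p) \<in> ?c" if "x \<in> j p" "p \<in> f" for x p
    proof (cases p)
      case (Bot i)
      have "emb 0 1 p \<in> \<Union>?E" using that f by auto
      then show ?thesis using conn_refl[of "emb 0 1 p" ?E] Bot that by simp
    next
      case (Top i)
      then have "i \<in> {1..b}" using that f Uh by (auto simp: points_def)
      then have "{(1, i), (2, \<pi> i)} \<in> ?E" unfolding F by auto
      then have "(x, (1, i)) \<in> adj ?E" by (rule adjI) (use Top that in auto)
      then show ?thesis using Top by (simp add: r_into_trancl)
    qed
    have "(emb 0 1 p, emb 0 1 q) \<in> ?c" using f adjI[of "emb 0 1 ` f" ?E "emb 0 1 p" "emb 0 1 q"] by auto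
    then show "(x, y) \<in> ?c" using to[OF f(4,2)] to[OF f(5,3)] sym_conn by (meson symD trancl_trans)
  qed
  have diff: "?C e - row 1 = emb 0 2 ` (map_top \<pi> ` e)" for e
  proof -
    have "j p - row 1 = {emb 0 2 (map_top \<pi> p)}" for p by (cases p) auto
    then show ?thesis by auto
  qed
  have ne: "{} \<notin> strands h" using part by (auto simp: partition_on_def)
  have "emb_strands 0 2 (stack (perm_diagram b \<pi>) h) = (\<lambda>C. C - row 1) ` comps ?E - {{}}"
    by (rule emb_stack) simp_all
  also have "\<dots> = (\<lambda>e. emb 0 2 ` (map_top \<pi> ` e)) ` strands h - {{}}"
    unfolding comps image_image[of "\<lambda>C. C - row 1"] diff ..
  also have "\<dots> = (\<lambda>e. emb 0 2 ` (map_top \<pi> ` e)) ` strands h" using ne by auto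
  finally have "emb_strands 0 2 (stack (perm_diagram b \<pi>) h) = (\<lambda>e. emb 0 2 ` (map_top \<pi> ` e)) ` strands h" .
  then show "stack (perm_diagram b \<pi>) h = Diagram a b ((`) (map_top \<pi>) ` strands h)"
    using h by (intro diagram_eqI[of _ _ 0 2]) (auto simp: image_image brauer_iff)
  have none: "{C \<in> comps ?E. C \<subseteq> row 1} = {}"
  proof -
    have "\<not> ?C e \<subseteq> row 1" if "e \<in> strands h" for e
    proof -
      have "map_top \<pi> ` e \<noteq> {}" using that ne by auto
      then have "?C e - row 1 \<noteq> {}" unfolding diff by simp
      then show ?thesis by blast
    qed
    then show ?thesis unfolding comps by auto
  qed
  have "loops (perm_diagram b \<pi>) h = card {C \<in> comps ?E. C \<subseteq> row 1}" by (rule loops_eq) simp_all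
  then show "loops (perm_diagram b \<pi>) h = 0" unfolding none by simp
qed

lemma stack_id_left:
  assumes "h \<in> brauer a b"
  shows "stack (perm_diagram b id) h = h" "loops (perm_diagram b id) h = 0"
proof -
  have "map_top id = id" by (auto simp: fun_eq_iff map_top_def split: point.splits)
  then show "stack (perm_diagram b id) h = h" "loops (perm_diagram b id) h = 0"
    using stack_perm_left[OF permutes_id assms] assms by (cases h, auto simp: brauer_iff)
qed

lemma stack_perm_perm:
  assumes "\<pi> permutes {1..m}" "\<sigma> permutes {1..m}"
  shows "stack (perm_diagram m \<pi>) (perm_diagram m \<sigma>) = perm_diagram m (\<pi> \<circ> \<sigma>)"
    "loops (perm_diagram m \<pi>) (perm_diagram m \<sigma>) = 0"
  using stack_perm_left[OF assms(1) perm_brauer[OF assms(2)]]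
  by (auto simp: perm_diagram_def image_image)

lemma flip_perm:
  assumes "\<pi> permutes {1..m}"
  shows "flip (perm_diagram m \<pi>) = perm_diagram m (inv_into UNIV \<pi>)"
proof -
  have "(\<lambda>i. {Top i, Bot (\<pi> i)}) ` {1..m} = (\<lambda>i. {Bot i, Top (inv_into UNIV \<pi> i)}) ` (\<pi> ` {1..m})"
    using permutes_inverses(2)[OF assms] by (auto simp: image_image insert_commute)
  then show ?thesis
    by (simp add: flip_def perm_diagram_def image_image permutes_image[OF assms])
qed

lemma flip_id: "flip (perm_diagram m id) = perm_diagram m id"
  using flip_perm[OF permutes_id] by (simp add: id_def[symmetric])

lemma stack_id_right:
  assumes "h \<in> brauer a b"
  shows "stack h (perm_diagram a id) = h" "loops h (perm_diagram a id) = 0"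
proof -
  have "flip (stack h (perm_diagram a id)) = flip h" "loops h (perm_diagram a id) = loops (perm_diagram a id) (flip h)"
    using stack_id_left[of "flip h" b a] assms flip_stack[of h "perm_diagram a id"]
      loops_flip[of "perm_diagram a id" h] by (simp_all add: flip_id)
  then show "stack h (perm_diagram a id) = h" "loops h (perm_diagram a id) = 0"
    using stack_id_left(2)[of "flip h" b a] assms by (metis flip_simps(3), simp)
qed

lemma loops_perm_right:
  assumes "\<pi> permutes {1..a}" "h \<in> brauer a b"
  shows "loops h (perm_diagram a \<pi>) = 0"
proof -
  have "loops (flip (perm_diagram a \<pi>)) (flip h) = 0"
    unfolding flip_perm[OF assms(1)]
    using stack_perm_left(2)[OF permutes_inv[OF assms(1)], of "flip h" b] assms(2) by simp
  then show ?thesis by (simp add: loops_flip)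
qed

lemma perm_diagram_inj:
  assumes "\<pi> permutes {1..m}" "\<sigma> permutes {1..m}" "perm_diagram m \<pi> = perm_diagram m \<sigma>"
  shows "\<pi> = \<sigma>"
proof
  fix i
  show "\<pi> i = \<sigma> i"
  proof (cases "i \<in> {1..m}")
    case True
    then have "{Bot i, Top (\<pi> i)} \<in> strands (perm_diagram m \<pi>)" by auto
    then have "{Bot i, Top (\<pi> i)} \<in> strands (perm_diagram m \<sigma>)" using assms by simp
    then show ?thesis by (auto simp: doubleton_eq_iff)
  next
    case False
    then show ?thesis using assms permutes_not_in by metis
  qed
qed

subsection \<open>Cups and caps\<close>

definition has_cap :: "diagram \<Rightarrow> bool"
  where "has_cap d \<longleftrightarrow> (\<exists>e\<in>strands d. e \<subseteq> range Bot)"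

lemma flip_image_iff: "flip_point ` e \<subseteq> range Top \<longleftrightarrow> e \<subseteq> range Bot"
proof -
  have "flip_point p \<in> range Top \<longleftrightarrow> p \<in> range Bot" for p by (cases p) auto
  then show ?thesis by (auto simp: image_subset_iff)
qed

lemma has_cup_flip [simp]: "has_cup (flip d) \<longleftrightarrow> has_cap d"
  by (simp add: has_cup_def has_cap_def flip_def flip_image_iff)

lemma has_cap_flip [simp]: "has_cap (flip d) \<longleftrightarrow> has_cup d"
  using has_cup_flip[of "flip d"] by simp

text \<open>A cap of the lower diagram avoids the middle row, so it is a component by itself
  whatever is stacked on top.\<close>

lemma cap_stack:
  assumes h: "h \<in> brauer a b" and g: "g \<in> brauer b c" and e: "e \<in> strands h" "e \<subseteq> range Bot"
  shows "e \<in> strands (stack g h)"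
proof -
  let ?e = "emb 0 1 ` e"
  let ?E = "emb_strands 0 1 h" and ?F = "emb_strands 1 2 g"
  have pe: "pm ({0} \<times> {1..a} \<union> {1} \<times> {1..b}) ?E" by (rule pm_emb[OF h]) simp
  have eE: "?e \<in> ?E" using e by auto
  have ne: "?e \<noteq> {}" using pe eE by (auto simp: pm_def partition_on_def)
  have part: "partition_on ({0} \<times> {1..a} \<union> {1} \<times> {1..b}) ?E" using pe by (simp add: pm_def)
  have "?e \<inter> f = {}" if "f \<in> ?E - {?e}" for f
    using partition_on_subE[OF part _ eE, of f] that by blast
  then have 1: "?e \<inter> \<Union>(?E - {?e}) = {}" by blast
  have "?e \<inter> \<Union>?F = {}"
    unfolding Union_emb[OF g, of 1 2, simplified] using e(2) by auto
  with 1 have "?e \<inter> \<Union>((?E - {?e}) \<union> ?F) = {}" by (simp add: Int_Un_distrib)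
  from comps_insert_disjoint[OF ne this] have "?e \<in> comps (insert ?e ((?E - {?e}) \<union> ?F))" by simp
  moreover have "insert ?e ((?E - {?e}) \<union> ?F) = ?E \<union> ?F"
    unfolding Un_insert_left[symmetric] insert_Diff[OF eE] ..
  ultimately have c: "?e \<in> comps (?E \<union> ?F)" by simp
  have e': "?e - row 1 = ?e" "emb 0 2 ` e = ?e" using e(2) by (auto simp: image_iff subset_iff) force+
  then have "emb 0 2 ` e \<in> (\<lambda>C. C - row 1) ` comps (?E \<union> ?F) - {{}}" using image_eqI[of ?e "\<lambda>C. C - row 1" ?e, OF _ c] ne by simp
  then have "emb 0 2 ` e \<in> emb_strands 0 2 (stack g h)" unfolding emb_stack[of 0 1 2 g h, simplified] by simp
  then show ?thesis using inj_emb[of 0 2] by (auto simp: inj_image_eq_iff)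
qed

lemma has_cap_stack: "h \<in> brauer a b \<Longrightarrow> g \<in> brauer b c \<Longrightarrow> has_cap h \<Longrightarrow> has_cap (stack g h)"
  using cap_stack by (auto simp: has_cap_def)

text \<open>For a Brauer diagram these are the lower ends of the vertical strands. There are at most
  as many as there are points in any row through which the diagram factors, and this is how caps are
  detected in elements of the ideal.\<close>

definition free_bots :: "diagram \<Rightarrow> nat set"
  where "free_bots d = {i \<in> {1..src d}. \<forall>e\<in>strands d. Bot i \<in> e \<longrightarrow> \<not> e \<subseteq> range Bot}"

lemma card_free_bots:
  assumes "d \<in> brauer a b"
  shows "card (free_bots d) \<le> b"
proof -
  have pm: "pm (points a b) (strands d)" using assms by (simp add: brauer_iff)
  have ex: "\<exists>j\<in>{1..b}. {Bot i, Top j} \<in> strands d" if i: "i \<in> free_bots d" for i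
  proof -
    have "Bot i \<in> points a b" using i assms by (auto simp: free_bots_def points_def brauer_iff)
    then obtain x where x: "{Bot i, x} \<in> strands d" "x \<in> points a b" by (rule pm_edge[OF pm])
    then have "\<not> {Bot i, x} \<subseteq> range Bot" using i by (auto simp: free_bots_def)
    then show ?thesis using x by (auto simp: points_def)
  qed
  then obtain p where p: "\<And>i. i \<in> free_bots d \<Longrightarrow> p i \<in> {1..b} \<and> {Bot i, Top (p i)} \<in> strands d" by metis
  have "inj_on p (free_bots d)"
  proof (rule inj_onI)
    fix i k assume "i \<in> free_bots d" "k \<in> free_bots d" "p i = p k"
    then have "{Bot i, Top (p i)} \<in> strands d" "{Bot k, Top (p i)} \<in> strands d" using p by metis+
    then have "{Bot i, Top (p i)} = {Bot k, Top (p i)}"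
      using partition_on_subE[of "points a b" "strands d" _ _ "Top (p i)"] pm by (auto simp: pm_def)
    then show "i = k" by (auto simp: doubleton_eq_iff)
  qed
  then have "card (free_bots d) \<le> card {1..b}" using p by (intro card_inj_on_le[of p]) auto
  then show ?thesis by simp
qed

lemma free_bots_stack: "h \<in> brauer a b \<Longrightarrow> g \<in> brauer b c \<Longrightarrow> free_bots (stack g h) \<subseteq> free_bots h"
  using cap_stack by (auto simp: free_bots_def)

lemma free_bots_no_cap: "\<not> has_cap d \<Longrightarrow> free_bots d = {1..src d}"
  by (auto simp: free_bots_def has_cap_def)

lemma no_cap_le: "d \<in> brauer a b \<Longrightarrow> \<not> has_cap d \<Longrightarrow> a \<le> b"
  using card_free_bots[of d a b] free_bots_no_cap[of d] by (auto simp: brauer_iff)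

lemma no_cup_le: "d \<in> brauer a b \<Longrightarrow> \<not> has_cup d \<Longrightarrow> b \<le> a"
  using no_cap_le[of "flip d" b a] by simp

lemma brauer_parity:
  assumes "d \<in> brauer a b"
  shows "even (a + b)"
proof -
  have P: "partition_on (points a b) (strands d)" and c: "\<And>e. e \<in> strands d \<Longrightarrow> card e = 2"
    using assms by (auto simp: brauer_iff pm_def)
  have "card (points a b) = (\<Sum>e\<in>strands d. card e)"
    using P c by (intro product_partition) (auto intro: card_ge_0_finite)
  also have "\<dots> = 2 * card (strands d)" using c by simp
  finally have "even (card (points a b))" by simp
  moreover have "card (points a b) = a + b"
    unfolding points_def by (subst card_Un_disjoint) (auto simp: card_image inj_on_def)
  ultimately show ?thesis by simp
qed

lemma no_cap_perm:
  assumes d: "d \<in> brauer n n" and nc: "\<not> has_cap d"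
  obtains \<pi> where "\<pi> permutes {1..n}" "d = perm_diagram n \<pi>"
proof -
  have pm: "pm (points n n) (strands d)" using d by (simp add: brauer_iff)
  have ex: "\<exists>j\<in>{1..n}. {Bot i, Top j} \<in> strands d" if i: "i \<in> {1..n}" for i
  proof -
    have "Bot i \<in> points n n" using i by (auto simp: points_def)
    then obtain x where x: "{Bot i, x} \<in> strands d" "x \<in> points n n" by (rule pm_edge[OF pm])
    then have "\<not> {Bot i, x} \<subseteq> range Bot" using nc unfolding has_cap_def by blast
    then show ?thesis using x by (auto simp: points_def)
  qed
  then obtain p where p: "\<And>i. i \<in> {1..n} \<Longrightarrow> p i \<in> {1..n} \<and> {Bot i, Top (p i)} \<in> strands d" by metis
  define \<pi> where "\<pi> i = (if i \<in> {1..n} then p i else i)" for i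
  have inj: "inj_on \<pi> {1..n}"
  proof (rule inj_onI)
    fix i k assume *: "i \<in> {1..n}" "k \<in> {1..n}" "\<pi> i = \<pi> k"
    then have "{Bot i, Top (p i)} \<in> strands d" "{Bot k, Top (p i)} \<in> strands d" using p by (metis \<pi>_def)+
    then have "{Bot i, Top (p i)} = {Bot k, Top (p i)}"
      using partition_on_subE[of "points n n" "strands d" _ _ "Top (p i)"] pm by (auto simp: pm_def)
    then show "i = k" by (auto simp: doubleton_eq_iff)
  qed
  have "\<pi> ` {1..n} \<subseteq> {1..n}" using p by (auto simp: \<pi>_def)
  then have "\<pi> ` {1..n} = {1..n}" by (intro endo_inj_surj inj) auto
  then have bij: "bij_betw \<pi> {1..n} {1..n}" using inj by (simp add: bij_betw_def)
  then have perm: "\<pi> permutes {1..n}" by (intro bij_imp_permutes) (auto simp: \<pi>_def)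
  have sub: "strands (perm_diagram n \<pi>) \<subseteq> strands d" using p by (auto simp: \<pi>_def)
  have "strands d \<subseteq> strands (perm_diagram n \<pi>)"
  proof
    fix e assume e: "e \<in> strands d"
    then have "card e = 2" using pm by (simp add: pm_def)
    then obtain x where x: "x \<in> e" by (auto simp: card_2_iff)
    then have "x \<in> points n n" using e pm_Union[OF pm] by auto
    then obtain f where f: "f \<in> strands (perm_diagram n \<pi>)" "x \<in> f"
      using perm_brauer[OF perm] pm_Union by (metis UnionE brauer_iff)
    then have "e = f" using partition_on_subE[of "points n n" "strands d" e f x] e x sub pm by (auto simp: pm_def)
    then show "e \<in> strands (perm_diagram n \<pi>)" using f by simp
  qed
  with sub have "d = perm_diagram n \<pi>" using d by (cases d) (auto simp: perm_diagram_def brauer_iff)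
  with perm show thesis using that by blast
qed

subsection \<open>Adding caps and cups at the end\<close>

declare add_2_eq_Suc [simp del] add_2_eq_Suc' [simp del]

lemma pm_Un:
  assumes "pm V E" "pm W F" "V \<inter> W = {}"
  shows "pm (V \<union> W) (E \<union> F)"
proof -
  have P: "partition_on V E" "partition_on W F" using assms by (simp_all add: pm_def)
  have "partition_on (V \<union> W) (E \<union> F)"
  proof (rule partition_onI)
    show "\<Union>(E \<union> F) = V \<union> W" using P by (auto simp: partition_on_def)
    have EF: "e \<inter> f = {}" if "e \<in> E" "f \<in> F" for e f
      using that P assms(3) by (auto simp: partition_on_def)
    show "disjnt p q" if "p \<in> E \<union> F" "q \<in> E \<union> F" "p \<noteq> q" for p q
      using that partition_on_subE[OF P(1), of p q] partition_on_subE[OF P(2), of p q] EF[of p q] EF[of q p]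
      unfolding disjnt_def by blast
  qed (use P in \<open>auto simp: partition_on_def\<close>)
  then show ?thesis using assms by (auto simp: pm_def)
qed

lemma pm_single: "card e = 2 \<Longrightarrow> pm e {e}"
  by (auto simp: pm_def partition_on_def)

lemma pm_insert:
  assumes "pm V E" "card e = 2" "V \<inter> e = {}"
  shows "pm (V \<union> e) (insert e E)"
  using pm_Un[OF assms(1) pm_single[OF assms(2)] assms(3)] by simp

lemma pm_remove:
  assumes "pm V E" "e \<in> E"
  shows "pm (V - e) (E - {e})"
proof -
  have P: "partition_on V E" using assms by (simp add: pm_def)
  have "f \<inter> e = {}" if "f \<in> E - {e}" for f
    using partition_on_subE[OF P _ assms(2), of f] that by blast
  then have "\<Union>(E - {e}) = V - e" using P assms(2) unfolding partition_on_def by blast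
  then show ?thesis using assms by (auto simp: pm_def partition_on_def disjoint_def)
qed

definition th :: "diagram \<Rightarrow> diagram"
  where "th d = Diagram (src d + 2) (tgt d) (insert {Bot (src d + 1), Bot (src d + 2)} (strands d))"

lemma th_simps [simp]: "src (th d) = src d + 2" "tgt (th d) = tgt d"
  "strands (th d) = insert {Bot (src d + 1), Bot (src d + 2)} (strands d)"
  by (simp_all add: th_def)

lemma points_add: "points (a + 2) b = points a b \<union> {Bot (a + 1), Bot (a + 2)}"
  "points a b \<inter> {Bot (a + 1), Bot (a + 2)} = {}"
proof -
  have "{1..a + 2} = {1..a} \<union> {a + 1, a + 2}" by auto
  then show "points (a + 2) b = points a b \<union> {Bot (a + 1), Bot (a + 2)}" by (auto simp: points_def)
qed (auto simp: points_def)

lemma th_brauer: "d \<in> brauer a b \<Longrightarrow> th d \<in> brauer (a + 2) b"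
  using pm_insert[of "points a b" "strands d" "{Bot (a + 1), Bot (a + 2)}"] points_add[of a b]
  by (auto simp: brauer_iff)

lemma th_cases:
  assumes "d \<in> brauer (a + 2) b" "{Bot (a + 1), Bot (a + 2)} \<in> strands d"
  obtains y where "y \<in> brauer a b" "d = th y"
proof
  let ?e = "{Bot (a + 1), Bot (a + 2)}" and ?y = "Diagram a b (strands d - {{Bot (a + 1), Bot (a + 2)}})"
  have "points (a + 2) b - ?e = points a b" using points_add[of a b] by blast
  then show "?y \<in> brauer a b" using assms pm_remove[of "points (a + 2) b" "strands d" ?e] by (simp add: brauer_iff)
  show "d = th ?y" using assms by (cases d) (auto simp: th_def brauer_iff)
qed

lemma th_inj:
  assumes "y \<in> brauer a b" "z \<in> brauer a b" "th y = th z"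
  shows "y = z"
proof -
  let ?e = "{Bot (a + 1), Bot (a + 2)}"
  have ne: "?e \<notin> strands d" if "d \<in> brauer a b" for d
  proof
    assume "?e \<in> strands d"
    then have "?e \<subseteq> points a b" using that pm_Union[of "points a b" "strands d"] by (auto simp: brauer_iff)
    then show False by (auto simp: points_def)
  qed
  have "insert ?e (strands y) = insert ?e (strands z)" using assms by (auto simp: th_def brauer_iff)
  then have "strands y = strands z" using ne assms insert_ident by metis
  then show ?thesis using assms by (cases y; cases z) (auto simp: brauer_iff)
qed

text \<open>The new cap is a component of its own on the bottom row.\<close>

lemma stack_th:
  assumes z: "z \<in> brauer a b" and y: "y \<in> brauer b c"
  shows "stack y (th z) = th (stack y z)" and "loops y (th z) = loops y z"
proof -
  let ?E = "emb_strands 0 1 z \<union> emb_strands 1 2 y" and ?e = "{(0::nat, a + 1), (0, a + 2)}"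
  have s: "src z = a" using z by (simp add: brauer_iff)
  have E: "emb_strands 0 1 (th z) \<union> emb_strands 1 2 y = insert ?e ?E" by (simp add: s)
  have "?e \<inter> \<Union>?E = {}" using Union_emb[OF z, of 0 1] Union_emb[OF y, of 1 2] by auto
  then have c: "comps (insert ?e ?E) = insert ?e (comps ?E)" by (intro comps_insert_disjoint) auto
  have d: "?e - row 1 = ?e" by auto
  have "emb_strands 0 2 (stack y (th z)) = (\<lambda>C. C - row 1) ` comps (insert ?e ?E) - {{}}"
    unfolding E[symmetric] by (rule emb_stack) simp_all
  also have "\<dots> = insert ?e ((\<lambda>C. C - row 1) ` comps ?E - {{}})"
    unfolding c image_insert d by auto
  also have "(\<lambda>C. C - row 1) ` comps ?E - {{}} = emb_strands 0 2 (stack y z)"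
    by (rule emb_stack[symmetric]) simp_all
  also have "insert ?e \<dots> = emb_strands 0 2 (th (stack y z))" by (simp add: s)
  finally show "stack y (th z) = th (stack y z)" by (intro diagram_eqI[of _ _ 0 2]) simp_all
  have "\<not> ?e \<subseteq> row 1" by auto
  then have "{C \<in> insert ?e (comps ?E). C \<subseteq> row 1} = {C \<in> comps ?E. C \<subseteq> row 1}" by blast
  moreover have "loops y (th z) = card {C \<in> comps (insert ?e ?E). C \<subseteq> row 1}"
    unfolding E[symmetric] by (rule loops_eq) simp_all
  moreover have "loops y z = card {C \<in> comps ?E. C \<subseteq> row 1}" by (rule loops_eq) simp_all
  ultimately show "loops y (th z) = loops y z" unfolding c by simp
qed

definition cup :: "diagram \<Rightarrow> diagram"
  where "cup d = flip (th (flip d))"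

lemma cup_simps [simp]: "src (cup d) = src d" "tgt (cup d) = tgt d + 2"
  "strands (cup d) = insert {Top (tgt d + 1), Top (tgt d + 2)} (strands d)"
  by (simp_all add: cup_def) (simp add: flip_def image_image)

lemma cup_brauer: "d \<in> brauer a b \<Longrightarrow> cup d \<in> brauer a (b + 2)"
  by (simp add: cup_def th_brauer)

lemma cup_cases:
  assumes "d \<in> brauer a (b + 2)" "{Top (b + 1), Top (b + 2)} \<in> strands d"
  obtains y where "y \<in> brauer a b" "d = cup y"
proof -
  have "{Bot (b + 1), Bot (b + 2)} \<in> strands (flip d)"
    using assms(2) image_eqI[of "{Bot (b + 1), Bot (b + 2)}" "(`) flip_point" "{Top (b + 1), Top (b + 2)}" "strands d"]
    by (simp add: flip_def)
  then obtain y where "y \<in> brauer b a" "flip d = th y" using th_cases[of "flip d" b a] assms(1) by auto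
  then show thesis using that[of "flip y"] by (metis cup_def flip_brauer flip_simps(3))
qed

lemma permutes_two:
  assumes "i \<in> S" "j \<in> S" "i \<noteq> j" "p \<in> S" "q \<in> S" "p \<noteq> q"
  obtains \<sigma> where "\<sigma> permutes S" "\<sigma> i = p" "\<sigma> j = q"
proof
  let ?t = "transpose i p"
  \<comment> \<open>The second transposition moves the image of \<open>j\<close> to \<open>q\<close>
    and leaves \<open>p\<close> alone, because \<open>?t j \<noteq> p\<close> and
    \<open>q \<noteq> p\<close>.\<close>
  let ?\<sigma> = "transpose (?t j) q \<circ> ?t"
  have "?t j \<in> S" using assms by (auto simp: transpose_def)
  then show "?\<sigma> permutes S" using assms by (intro permutes_compose permutes_swap_id)
  show "?\<sigma> i = p" "?\<sigma> j = q" using assms by (auto simp: transpose_def)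
qed

lemma stack_perm_cancel:
  assumes "\<pi> permutes {1..b}" "h \<in> brauer a b"
  shows "stack (perm_diagram b (inv_into UNIV \<pi>)) (stack (perm_diagram b \<pi>) h) = h"
proof -
  note i = permutes_inv[OF assms(1)]
  have "stack (perm_diagram b (inv_into UNIV \<pi>)) (stack (perm_diagram b \<pi>) h) =
      stack (perm_diagram b (inv_into UNIV \<pi> \<circ> \<pi>)) h"
    using stack_assoc(1)[OF assms(2) perm_brauer[OF assms(1)] perm_brauer[OF i]] stack_perm_perm(1)[OF i assms(1)] by simp
  then show ?thesis using permutes_inv_o(2)[OF assms(1)] stack_id_left(1)[OF assms(2)] by simp
qed

lemma cup_to_end:
  assumes d: "d \<in> brauer a (b + 2)" and "has_cup d"
  obtains \<sigma> y where "\<sigma> permutes {1..b + 2}" "y \<in> brauer a b" "stack (perm_diagram (b + 2) \<sigma>) d = cup y"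
proof -
  from assms obtain e where e: "e \<in> strands d" "e \<subseteq> range Top" by (auto simp: has_cup_def)
  have pm: "pm (points a (b + 2)) (strands d)" using d by (simp add: brauer_iff)
  then have "card e = 2" "e \<subseteq> points a (b + 2)" using e pm_Union[OF pm] by (auto simp: pm_def)
  then obtain p q where pq: "e = {p, q}" "p \<noteq> q" "p \<in> points a (b + 2)" "q \<in> points a (b + 2)"
    by (auto simp: card_2_iff)
  have "p \<in> range Top" "q \<in> range Top" using e(2) pq(1) by auto
  then obtain i j where "p = Top i" "q = Top j" by auto
  with pq have ij: "e = {Top i, Top j}" "i \<noteq> j" "i \<in> {1..b + 2}" "j \<in> {1..b + 2}"
    by (auto simp: points_def)
  have bb: "b + 1 \<in> {1..b + 2}" "b + 2 \<in> {1..b + 2}" "b + 1 \<noteq> b + 2" by auto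
  obtain \<sigma> where \<sigma>: "\<sigma> permutes {1..b + 2}" "\<sigma> i = b + 1" "\<sigma> j = b + 2"
    by (rule permutes_two[OF ij(3,4,2) bb])
  let ?d = "stack (perm_diagram (b + 2) \<sigma>) d"
  have "strands ?d = (`) (map_top \<sigma>) ` strands d" using stack_perm_left(1)[OF \<sigma>(1) d] by simp
  then have "{Top (b + 1), Top (b + 2)} \<in> strands ?d"
    using image_eqI[OF _ e(1), of "{Top (b + 1), Top (b + 2)}" "(`) (map_top \<sigma>)"] ij(1) \<sigma> by simp
  moreover have "?d \<in> brauer a (b + 2)" by (rule stack_brauer[OF d perm_brauer[OF \<sigma>(1)]])
  ultimately show thesis using cup_cases that \<sigma>(1) by metis
qed

lemma has_cap_perm_left:
  assumes "\<pi> permutes {1..b}" "h \<in> brauer a b"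
  shows "has_cap (stack (perm_diagram b \<pi>) h) \<longleftrightarrow> has_cap h"
proof -
  have "map_top \<pi> p \<in> range Bot \<longleftrightarrow> p \<in> range Bot" for p by (cases p) auto
  then have "map_top \<pi> ` e \<subseteq> range Bot \<longleftrightarrow> e \<subseteq> range Bot" for e
    unfolding image_subset_iff by blast
  then show ?thesis by (simp add: has_cap_def stack_perm_left(1)[OF assms])
qed

lemma has_cup_perm_right:
  assumes "\<pi> permutes {1..a}" "h \<in> brauer a b"
  shows "has_cup (stack h (perm_diagram a \<pi>)) \<longleftrightarrow> has_cup h"
proof -
  have "has_cup (stack h (perm_diagram a \<pi>)) \<longleftrightarrow> has_cap (stack (flip (perm_diagram a \<pi>)) (flip h))"
    using flip_stack[of h "perm_diagram a \<pi>"] by (metis has_cap_flip)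
  then show ?thesis
    using has_cap_perm_left[OF permutes_inv[OF assms(1)], of "flip h" b] assms(2) flip_perm[OF assms(1)] by simp
qed

text \<open>The factor \<open>h\<close> lies in \<open>B_sharp\<close> and leads to fewer points, so
  it acts as zero on an inflated module; this is what makes capped diagrams vanish in
  \<open>Delta\<close>. A permutation moves the cap to the end; \<open>h\<close> is that last cap on
  top of the permutation, and \<open>y\<close> is what remains of the diagram.\<close>

lemma cap_factor:
  assumes d: "d \<in> brauer (a + 2) b" and "has_cap d"
  obtains y h where "y \<in> brauer a b" "h \<in> brauer (a + 2) a" "\<not> has_cup h" "stack y h = d" "loops y h = 0"
proof -
  let ?id = "perm_diagram a id"
  have id: "?id \<in> brauer a a" by (rule perm_brauer[OF permutes_id])
  obtain \<sigma> z where z: "\<sigma> permutes {1..a + 2}" "z \<in> brauer b a" "stack (perm_diagram (a + 2) \<sigma>) (flip d) = cup z"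
    using cup_to_end[of "flip d" b a] assms by auto
  define y where "y = flip z"
  define p where "p = perm_diagram (a + 2) \<sigma>"
  have p: "p \<in> brauer (a + 2) (a + 2)" unfolding p_def by (rule perm_brauer[OF z(1)])
  have y: "y \<in> brauer a b" using z by (simp add: y_def)
  have "flip d = stack (perm_diagram (a + 2) (inv_into UNIV \<sigma>)) (cup z)"
    using stack_perm_cancel[OF z(1), of "flip d" b] d z(3) by simp
  then have "d = stack (flip (cup z)) (flip (perm_diagram (a + 2) (inv_into UNIV \<sigma>)))"
    by (metis flip_simps(3) flip_stack)
  then have d': "d = stack (th y) p"
    using flip_perm[OF z(1)] by (metis cup_def flip_simps(3) p_def y_def)
  define h where "h = stack (th ?id) p"
  have th: "th ?id \<in> brauer (a + 2) a" by (rule th_brauer[OF id])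
  have ty: "stack y (th ?id) = th y" "loops y (th ?id) = 0"
    using stack_th[OF id y] stack_id_right[OF y] by auto
  have "h \<in> brauer (a + 2) a" unfolding h_def by (rule stack_brauer[OF p th])
  moreover have "\<not> has_cup h"
    unfolding h_def p_def has_cup_perm_right[OF z(1) th] by (auto simp: has_cup_def)
  moreover have "stack y h = d" using stack_assoc(1)[OF p th y] d' ty by (simp add: h_def)
  moreover have "loops y h = 0"
    using stack_assoc(2)[OF p th y] ty loops_perm_right[OF z(1) th] loops_perm_right[OF z(1) th_brauer[OF y]]
    by (simp add: h_def p_def)
  ultimately show thesis using that y by blast
qed

text \<open>The tensor product of \<open>d\<close> with two straight strands on the right.\<close>

definition wid :: "diagram \<Rightarrow> diagram"
  where "wid d = Diagram (src d + 2) (tgt d + 2)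
    (strands d \<union> {{Bot (src d + 1), Top (tgt d + 1)}, {Bot (src d + 2), Top (tgt d + 2)}})"

lemma wid_brauer:
  assumes "d \<in> brauer a b"
  shows "wid d \<in> brauer (a + 2) (b + 2)"
proof -
  let ?e = "{Bot (a + 1), Top (b + 1)}" and ?f = "{Bot (a + 2), Top (b + 2)}"
  have "pm (points a b \<union> ?f \<union> ?e) (insert ?e (insert ?f (strands d)))"
    using assms by (intro pm_insert) (auto simp: brauer_iff points_def)
  moreover have "points a b \<union> ?f \<union> ?e = points (a + 2) (b + 2)"
  proof -
    have "{1..c + 2} = {1..c} \<union> {c + 1, c + 2}" for c :: nat by auto
    then show ?thesis by (auto simp: points_def)
  qed
  moreover have "strands (wid d) = insert ?e (insert ?f (strands d))"
    using assms by (auto simp: wid_def brauer_iff)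
  ultimately show ?thesis using assms by (simp add: brauer_iff wid_def)
qed

lemma stack_wid_cup:
  assumes y: "y \<in> brauer a b" and w: "w \<in> brauer b c"
  shows "stack (wid w) (cup y) = cup (stack w y)" and "loops (wid w) (cup y) = loops w y"
proof -
  let ?E = "emb_strands 0 1 y \<union> emb_strands 1 2 w"
  \<comment> \<open>The additional edges form a path from one new upper point through the cup to the
    other. It is disjoint from the rest of the graph, so the composite merely gains a cup.\<close>
  let ?G = "{{(1::nat, b + 1), (1, b + 2)}, {(1, b + 1), (2, c + 1)}, {(1, b + 2), (2, c + 2)}}"
  let ?g = "{(1::nat, b + 1), (1, b + 2), (2, c + 1), (2, c + 2)}"
  have s: "tgt y = b" "src w = b" "tgt w = c" using y w by (simp_all add: brauer_iff)
  have E: "emb_strands 0 1 (cup y) \<union> emb_strands 1 2 (wid w) = ?E \<union> ?G"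
    by (auto simp: wid_def s)
  have UG: "\<Union>?G = ?g" by auto
  have "\<Union>?E \<inter> \<Union>?G = {}" unfolding UG using Union_emb[OF y, of 0 1] Union_emb[OF w, of 1 2] by auto
  then have c: "comps (?E \<union> ?G) = comps ?E \<union> comps ?G" by (rule comps_Un_disjoint)
  have G: "comps ?G = {?g}"
  proof -
    have "comps ?G = {\<Union>?G}"
    proof (rule comps_connected)
      fix x y assume xy: "x \<in> \<Union>?G" "y \<in> \<Union>?G"
      have to: "(x, (1, b + 1)) \<in> (adj ?G)\<^sup>+" if "x \<in> \<Union>?G" for x
      proof -
        have 1: "((1, b + 2), (1, b + 1)) \<in> adj ?G" "((2, c + 1), (1, b + 1)) \<in> adj ?G"
          "((2, c + 2), (1, b + 2)) \<in> adj ?G" "((1, b + 1), (1, b + 1)) \<in> adj ?G" by (auto simp: adj_def)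
        have 2: "((2, c + 2), (1, b + 1)) \<in> (adj ?G)\<^sup>+"
          by (rule trancl_into_trancl[OF r_into_trancl[OF 1(3)] 1(1)])
        from that consider "x = (1, b + 1)" | "x = (1, b + 2)" | "x = (2, c + 1)" | "x = (2, c + 2)" by auto
        then show ?thesis
          by cases (simp_all only: r_into_trancl[OF 1(1)] r_into_trancl[OF 1(2)] r_into_trancl[OF 1(4)] 2)
      qed
      then show "(x, y) \<in> (adj ?G)\<^sup>+" using xy sym_conn by (meson symD trancl_trans)
    qed auto
    then show ?thesis unfolding UG .
  qed
  have d: "?g - row 1 = {(2, c + 1), (2, c + 2)}" by auto
  have "emb_strands 0 2 (stack (wid w) (cup y)) = (\<lambda>C. C - row 1) ` comps (?E \<union> ?G) - {{}}"
    unfolding E[symmetric] by (rule emb_stack) simp_all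
  also have "\<dots> = insert {(2, c + 1), (2, c + 2)} ((\<lambda>C. C - row 1) ` comps ?E - {{}})"
    unfolding c G image_Un image_insert image_empty d Un_Diff by simp
  also have "(\<lambda>C. C - row 1) ` comps ?E - {{}} = emb_strands 0 2 (stack w y)"
    by (rule emb_stack[symmetric]) simp_all
  also have "insert {(2, c + 1), (2, c + 2)} \<dots> = emb_strands 0 2 (cup (stack w y))" by (simp add: s)
  finally show "stack (wid w) (cup y) = cup (stack w y)"
    by (intro diagram_eqI[of _ _ 0 2]) (simp_all add: wid_def)
  have "\<not> ?g \<subseteq> row 1" by auto
  then have "{C \<in> comps ?E \<union> {?g}. C \<subseteq> row 1} = {C \<in> comps ?E. C \<subseteq> row 1}" by blast
  moreover have "loops (wid w) (cup y) = card {C \<in> comps (?E \<union> ?G). C \<subseteq> row 1}"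
    unfolding E[symmetric] by (rule loops_eq) simp_all
  moreover have "loops w y = card {C \<in> comps ?E. C \<subseteq> row 1}" by (rule loops_eq) simp_all
  ultimately show "loops (wid w) (cup y) = loops w y" unfolding c G by simp
qed

definition cups :: "nat \<Rightarrow> nat \<Rightarrow> diagram"
  where "cups n k = (cup ^^ k) (perm_diagram n id)"

lemma cups_simps: "cups n 0 = perm_diagram n id" "cups n (Suc k) = cup (cups n k)"
  by (simp_all add: cups_def)

lemma cups_brauer: "cups n k \<in> brauer n (n + 2 * k)"
proof (induction k)
  case (Suc k)
  then show ?case using cup_brauer[OF Suc] by (simp add: cups_simps algebra_simps)
qed (simp add: cups_simps perm_brauer[OF permutes_id])

text \<open>A diagram with more upper than lower points has a cup. It is moved to the end and
  removed, the rest is factored by induction, and two straight strands carry the last cup along. The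
  absence of loops matters when \<open>\<delta> = 0\<close>.\<close>

lemma cups_factor:
  assumes "y \<in> brauer n (n + 2 * k)"
  shows "\<exists>d\<in>brauer (n + 2 * k) (n + 2 * k). stack d (cups n k) = y \<and> loops d (cups n k) = 0"
  using assms
proof (induction k arbitrary: y)
  case 0
  then show ?case using stack_id_right[of y n n] by (auto simp: cups_simps)
next
  case (Suc k)
  let ?b = "n + 2 * k"
  have y: "y \<in> brauer n (?b + 2)" using Suc.prems by (simp add: algebra_simps)
  have "has_cup y" using no_cup_le[OF y] by auto
  then obtain \<sigma> w where w: "\<sigma> permutes {1..?b + 2}" "w \<in> brauer n ?b" "stack (perm_diagram (?b + 2) \<sigma>) y = cup w"
    using cup_to_end[OF y] by metis
  then obtain d where d: "d \<in> brauer ?b ?b" "stack d (cups n k) = w" "loops d (cups n k) = 0"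
    using Suc.IH by blast
  let ?p = "perm_diagram (?b + 2) (inv_into UNIV \<sigma>)"
  have p: "?p \<in> brauer (?b + 2) (?b + 2)" by (rule perm_brauer[OF permutes_inv[OF w(1)]])
  have c: "cup (cups n k) \<in> brauer n (?b + 2)" by (rule cup_brauer[OF cups_brauer])
  have wd: "wid d \<in> brauer (?b + 2) (?b + 2)" by (rule wid_brauer[OF d(1)])
  have s: "stack (wid d) (cup (cups n k)) = cup w" "loops (wid d) (cup (cups n k)) = 0"
    using stack_wid_cup[OF cups_brauer d(1)] d by auto
  have "stack (stack ?p (wid d)) (cup (cups n k)) = y"
    using stack_assoc(1)[OF c wd p] s stack_perm_cancel[OF w(1) y] w(3) by simp
  moreover have "loops (stack ?p (wid d)) (cup (cups n k)) = 0"
    using stack_assoc(2)[OF c wd p] s stack_perm_left(2)[OF permutes_inv[OF w(1)]]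
      wd cup_brauer[OF w(2)] by simp
  moreover have "stack ?p (wid d) \<in> brauer (?b + 2) (?b + 2)" by (rule stack_brauer[OF wd p])
  ultimately show ?case by (auto simp: cups_simps algebra_simps)
qed

subsection \<open>Iterated caps\<close>

lemma thn_simps [simp]: "src ((th ^^ k) d) = src d + 2 * k" "tgt ((th ^^ k) d) = tgt d"
  by (induction k) auto

lemma thn_brauer: "d \<in> brauer a b \<Longrightarrow> (th ^^ k) d \<in> brauer (a + 2 * k) b"
proof (induction k)
  case (Suc k)
  then show ?case using th_brauer[OF Suc.IH] by (simp add: algebra_simps)
qed simp

lemma thn_inj:
  assumes "y \<in> brauer a b" "z \<in> brauer a b" "(th ^^ k) y = (th ^^ k) z"
  shows "y = z"
  using assms(3)
proof (induction k)
  case (Suc k)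
  then show ?case using th_inj[OF thn_brauer[OF assms(1), of k] thn_brauer[OF assms(2), of k]] by simp
qed simp

lemma stack_thn:
  assumes z: "z \<in> brauer a b" and y: "y \<in> brauer b c"
  shows "stack y ((th ^^ k) z) = (th ^^ k) (stack y z)" and "loops y ((th ^^ k) z) = loops y z"
  using stack_th[OF thn_brauer[OF z] y] by (induction k) auto

lemma strands_thn:
  "strands ((th ^^ k) d) = strands d \<union> (\<lambda>j. {Bot (src d + 2 * j - 1), Bot (src d + 2 * j)}) ` {1..k}"
proof (induction k)
  case (Suc k)
  have "{1..Suc k} = insert (Suc k) {1..k}" by auto
  moreover have "src d + 2 * Suc k - 1 = src d + 2 * k + 1" "src d + 2 * Suc k = src d + 2 * k + 2" by auto
  ultimately show ?case using Suc by (simp only: image_insert) simp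
qed simp

lemma strands_cups:
  "strands (cups n k) = strands (perm_diagram n id) \<union> (\<lambda>j. {Top (n + 2 * j - 1), Top (n + 2 * j)}) ` {1..k}"
proof (induction k)
  case (Suc k)
  have "{1..Suc k} = insert (Suc k) {1..k}" by auto
  moreover have "tgt (cups n k) = n + 2 * k" using cups_brauer by (simp add: brauer_iff)
  moreover have "n + 2 * Suc k - 1 = n + 2 * k + 1" "n + 2 * Suc k = n + 2 * k + 2" by auto
  ultimately show ?case using Suc by (simp only: image_insert) (simp add: cups_simps)
qed (simp add: cups_simps)

lemma E_diagram_eq: "E_diagram (n + 2 * k) k = (th ^^ k) (cups n k)"
proof -
  have "src (cups n k) = n" "tgt (cups n k) = n + 2 * k" using cups_brauer[of n k] by (simp_all add: brauer_iff)
  moreover have "strands (E_diagram (n + 2 * k) k) = strands ((th ^^ k) (cups n k))"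
    unfolding strands_thn strands_cups calculation by (auto simp: E_diagram_def)
  ultimately show ?thesis by (intro diagram.expand) (simp add: E_diagram_def)
qed

text \<open>The generator of the ideal passes through a row of n points only. Both comparisons of
  the ideal with capped diagrams start from this.\<close>

lemma E_diagram_factor:
  "E_diagram (n + 2 * k) k = stack (cups n k) ((th ^^ k) (perm_diagram n id))"
  "loops (cups n k) ((th ^^ k) (perm_diagram n id)) = 0"
  using stack_thn[OF perm_brauer[OF permutes_id] cups_brauer[of n k], of k] stack_id_right[OF cups_brauer[of n k]]
  by (simp_all add: E_diagram_eq)

lemma flip_cups: "flip (cups n k) = (th ^^ k) (perm_diagram n id)"
proof (induction k)
  case 0
  show ?case by (simp only: cups_simps flip_id funpow_0)
qed (simp add: cups_simps cup_def)

lemma caps_factor: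
  assumes "y \<in> brauer (n + 2 * k) n"
  shows "\<exists>d\<in>brauer (n + 2 * k) (n + 2 * k). stack ((th ^^ k) (perm_diagram n id)) d = y \<and>
    loops ((th ^^ k) (perm_diagram n id)) d = 0"
proof -
  obtain d where d: "d \<in> brauer (n + 2 * k) (n + 2 * k)" "stack d (cups n k) = flip y" "loops d (cups n k) = 0"
    using cups_factor[of "flip y" n k] assms by auto
  have "stack (flip (cups n k)) (flip d) = y" "loops (flip (cups n k)) (flip d) = 0"
    using flip_stack[of d "cups n k"] loops_flip[of "cups n k" d] d by simp_all
  then show ?thesis using d(1) by (intro bexI[of _ "flip d"]) (simp_all add: flip_cups)
qed

lemma free_bots_thn:
  assumes d: "d \<in> brauer a b"
  shows "free_bots ((th ^^ k) d) = free_bots d"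
proof (induction k)
  case (Suc k)
  have "free_bots (th z) = free_bots z" if z: "z \<in> brauer c b" for z c
  proof -
    have "src z = c" using z by (simp add: brauer_iff)
    moreover have "Bot i \<notin> e" if "e \<in> strands z" "\<not> i \<le> c" for e i
    proof
      assume "Bot i \<in> e"
      then have "Bot i \<in> points c b" using that(1) z pm_Union[of "points c b" "strands z"] unfolding brauer_iff by blast
      then show False using that(2) by (auto simp: points_def)
    qed
    ultimately show ?thesis by (auto simp: free_bots_def)
  qed
  then show ?case using Suc thn_brauer[OF d, of k] by simp
qed simp

subsection \<open>Straightening a zigzag\<close>

text \<open>\<open>v\<close> has its cup at the upper points n and n + 1 and sends strand n to n +
  2, while \<open>b\<close> has its cap at n + 1 and n + 2. Together they form an S-shaped strand
  that straightens to strand n; this uses that there is a strand at all.\<close>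

lemma zigzag:
  assumes "n > 0"
  obtains b v where "b \<in> brauer (n + 2) n" "v \<in> brauer n (n + 2)" "stack b v = perm_diagram n id" "loops b v = 0"
proof -
  let ?id = "perm_diagram n id"
  define \<tau> where "\<tau> = transpose n (n + 2)"
  define v where "v = stack (perm_diagram (n + 2) \<tau>) (cup ?id)"
  have id: "?id \<in> brauer n n" by (rule perm_brauer[OF permutes_id])
  have \<tau>: "\<tau> permutes {1..n + 2}" unfolding \<tau>_def using assms by (intro permutes_swap_id) auto
  have v: "v \<in> brauer n (n + 2)" unfolding v_def by (rule stack_brauer[OF cup_brauer[OF id] perm_brauer[OF \<tau>]])
  have b: "th ?id \<in> brauer (n + 2) n" by (rule th_brauer[OF id])
  have n: "{1..n} = insert n {1..<n}" using assms by auto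
  have sv: "strands v = {{Bot n, Top (n + 2)}, {Top n, Top (n + 1)}} \<union> (\<lambda>i. {Bot i, Top i}) ` {1..<n}"
  proof -
    have "strands v = (`) (map_top \<tau>) ` strands (cup ?id)"
      unfolding v_def stack_perm_left(1)[OF \<tau> cup_brauer[OF id]] by simp
    also have "\<dots> = {{Bot n, Top (n + 2)}, {Top n, Top (n + 1)}} \<union> (\<lambda>i. {Bot i, Top (\<tau> i)}) ` {1..<n}"
      by (simp add: n image_image) (auto simp: \<tau>_def transpose_def insert_commute)
    also have "(\<lambda>i. {Bot i, Top (\<tau> i)}) ` {1..<n} = (\<lambda>i. {Bot i, Top i}) ` {1..<n}"
      by (intro image_cong) (auto simp: \<tau>_def transpose_def)
    finally show ?thesis .
  qed
  \<comment> \<open>\<open>?S\<close> is the S-shaped path, \<open>?R\<close> consists of the edges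
    of the other n - 1 strands, and \<open>?P\<close> of their components.\<close>
  let ?S = "{{(0::nat, n), (1, n + 2)}, {(1, n), (1, n + 1)}, {(1, n + 1), (1, n + 2)}, {(1, n), (2, n)}}"
  let ?s = "{(0::nat, n), (1, n), (1, n + 1), (1, n + 2), (2, n)}"
  let ?R = "(\<lambda>i. {(0::nat, i), (1, i)}) ` {1..<n} \<union> (\<lambda>i. {(1::nat, i), (2, i)}) ` {1..<n}"
  let ?P = "(\<lambda>i. {(0::nat, i), (1, i), (2, i)}) ` {1..<n}"
  have E: "emb_strands 0 1 v \<union> emb_strands 1 2 (th ?id) = ?S \<union> ?R"
    by (auto simp: sv n image_image image_Un)
  have US: "\<Union>?S = ?s" by auto
  have S: "comps ?S = {?s}"
  proof -
    have "comps ?S = {\<Union>?S}"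
    proof (rule comps_connected)
      fix x y assume xy: "x \<in> \<Union>?S" "y \<in> \<Union>?S"
      have to: "(x, (1, n)) \<in> (adj ?S)\<^sup>+" if "x \<in> \<Union>?S" for x
      proof -
        have 1: "((1, n), (1, n)) \<in> adj ?S" "((2, n), (1, n)) \<in> adj ?S" "((1, n + 1), (1, n)) \<in> adj ?S"
          "((1, n + 2), (1, n + 1)) \<in> adj ?S" "((0, n), (1, n + 2)) \<in> adj ?S" by (auto simp: adj_def)
        then have 2: "((1, n + 2), (1, n)) \<in> (adj ?S)\<^sup>+" by (meson trancl_into_trancl r_into_trancl)
        then have "((0, n), (1, n)) \<in> (adj ?S)\<^sup>+" using 1(5) by (meson trancl_into_trancl2)
        then show ?thesis using that 1 2 by (auto intro: r_into_trancl)
      qed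
      then show "(x, y) \<in> (adj ?S)\<^sup>+" using xy sym_conn by (meson symD trancl_trans)
    qed auto
    then show ?thesis unfolding US .
  qed
  have R: "comps ?R = ?P"
  proof (rule comps_eqI)
    show "partition_on (\<Union>?R) ?P"
      by (rule partition_onI) (auto simp: disjnt_def)
    show "e \<subseteq> B" if "e \<in> ?R" "B \<in> ?P" "e \<inter> B \<noteq> {}" for e B using that by auto
    show "(x, y) \<in> (adj ?R)\<^sup>+" if B: "B \<in> ?P" "x \<in> B" "y \<in> B" for B x y
    proof -
      obtain i where i: "i \<in> {1..<n}" "B = {(0, i), (1, i), (2, i)}" using B by auto
      have to: "(x, (1, i)) \<in> (adj ?R)\<^sup>+" if "x \<in> B" for x
      proof -
        have e: "{(0, i), (1, i)} \<in> ?R" "{(1, i), (2, i)} \<in> ?R" using i by auto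
        have "(x, (1, i)) \<in> adj ?R"
          using that i(2) adjI[OF e(1), of x "(1, i)"] adjI[OF e(2), of x "(1, i)"] by blast
        then show ?thesis by (rule r_into_trancl)
      qed
      show ?thesis using to[OF B(2)] to[OF B(3)] sym_conn by (meson symD trancl_trans)
    qed
  qed
  have disj: "\<Union>?S \<inter> \<Union>?R = {}" unfolding US by auto
  have c: "comps (?S \<union> ?R) = {?s} \<union> ?P" unfolding comps_Un_disjoint[OF disj] S R ..
  have "emb_strands 0 2 (stack (th ?id) v) = (\<lambda>C. C - row 1) ` comps (?S \<union> ?R) - {{}}"
    unfolding E[symmetric] by (rule emb_stack) simp_all
  also have "\<dots> = (\<lambda>C. C - row 1) ` ({?s} \<union> ?P)"
  proof -
    have "(0, n) \<in> ?s - row 1" "(0, i) \<in> {(0, i), (1, i), (2, i)} - row 1" for i by auto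
    then have "C - row 1 \<noteq> {}" if "C \<in> {?s} \<union> ?P" for C using that by blast
    then show ?thesis unfolding c by blast
  qed
  also have "\<dots> = insert {(0, n), (2, n)} ((\<lambda>i. {(0, i), (2, i)}) ` {1..<n})"
  proof -
    have 1: "?s - row 1 = {(0, n), (2, n)}" by auto
    have 2: "{(0, i), (1, i), (2, i)} - row 1 = {(0, i), (2, i)}" for i by auto
    show ?thesis
      unfolding image_Un image_insert image_empty image_image 1 2 Un_insert_left Un_empty_left ..
  qed
  also have "\<dots> = emb_strands 0 2 ?id" by (simp add: n image_image)
  finally have 1: "stack (th ?id) v = ?id"
    by (intro diagram_eqI[of _ _ 0 2]) (simp_all add: v_def)
  have "\<not> ?s \<subseteq> row 1" "\<not> {(0, i), (1, i), (2, i)} \<subseteq> row 1" for i :: nat by auto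
  then have none: "{C \<in> {?s} \<union> ?P. C \<subseteq> row 1} = {}" by blast
  have "loops (th ?id) v = card {C \<in> comps (?S \<union> ?R). C \<subseteq> row 1}"
    unfolding E[symmetric] by (rule loops_eq) simp_all
  then have "loops (th ?id) v = 0" unfolding c none by simp
  with 1 show thesis using that b v by blast
qed

text \<open>Takes the place of the zigzag when there is no strand to bend: cap and cup close up to
  one loop, so the composite has the value \<open>\<delta>\<close> and not 1.\<close>

lemma circle:
  "stack (th (perm_diagram 0 id)) (cup (perm_diagram 0 id)) = perm_diagram 0 id"
  "loops (th (perm_diagram 0 id)) (cup (perm_diagram 0 id)) = 1"
proof -
  let ?e = "{(1::nat, 1::nat), (1, 2)}"
  have E: "emb_strands 0 1 (cup (perm_diagram 0 id)) \<union> emb_strands 1 2 (th (perm_diagram 0 id)) = {?e}"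
    by (simp add: numeral_2_eq_2)
  have c: "comps {?e} = {?e}" by (rule comps_single) simp
  have "emb_strands 0 2 (stack (th (perm_diagram 0 id)) (cup (perm_diagram 0 id))) = (\<lambda>C. C - row 1) ` comps {?e} - {{}}"
    unfolding E[symmetric] by (rule emb_stack) simp_all
  then show "stack (th (perm_diagram 0 id)) (cup (perm_diagram 0 id)) = perm_diagram 0 id"
    unfolding c by (intro diagram_eqI[of _ _ 0 2]) auto
  have "{C \<in> {?e}. C \<subseteq> row 1} = {?e}" by auto
  moreover have "loops (th (perm_diagram 0 id)) (cup (perm_diagram 0 id)) = card {C \<in> comps {?e}. C \<subseteq> row 1}"
    unfolding E[symmetric] by (rule loops_eq) simp_all
  ultimately show "loops (th (perm_diagram 0 id)) (cup (perm_diagram 0 id)) = 1" unfolding c by simp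
qed

text \<open>There are no outer points, so every component of the nonempty middle row is a
  loop.\<close>

lemma loops_pos:
  assumes h: "h \<in> brauer 0 m" and g: "g \<in> brauer m 0" and "m > 0"
  shows "loops g h > 0"
proof -
  let ?E = "emb_strands 0 1 h \<union> emb_strands 1 2 g"
  have U: "\<Union>?E = {1} \<times> {1..m}" using Union_emb[OF h, of 0 1] Union_emb[OF g, of 1 2] by auto
  then have "(1, 1) \<in> \<Union>(comps ?E)" unfolding Union_comps using assms by auto
  then obtain C where "C \<in> comps ?E" by auto
  moreover have "C \<subseteq> row 1" using Union_upper[OF calculation] unfolding Union_comps U by auto
  ultimately have "{C \<in> comps ?E. C \<subseteq> row 1} \<noteq> {}" by auto
  moreover have "finite (comps ?E)" by (rule finite_comps) (simp only: U, simp)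
  moreover have "loops g h = card {C \<in> comps ?E. C \<subseteq> row 1}" by (rule loops_eq) simp_all
  ultimately show ?thesis by (simp add: card_gt_0_iff)
qed

section \<open>The non-unital algebra B, its corners, and the projection to the group
  algebras\<close>

section \<open>The Brauer category algebra\<close>

lemma lin_ext_add_fun: "lin_ext (\<lambda>b. f b + g b) x = lin_ext f x + lin_ext g x"
  by (simp add: lin_ext_def sum.distrib)

lemma lin_ext_scale_fun: "lin_ext (\<lambda>b. scale c (f b)) x = scale c (lin_ext f x)"
  by (simp add: lin_ext_def scale_sum mult.commute)

lemma lin_ext_zero_fun [simp]: "lin_ext (\<lambda>b. 0) x = 0"
  by (simp add: lin_ext_def)

abbreviation diagrams :: "diagram set"
  where "diagrams \<equiv> \<Union>m s. brauer m s"

lemma diagrams_iff: "d \<in> diagrams \<longleftrightarrow> d \<in> brauer (src d) (tgt d)"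
  by (auto simp: brauer_iff)

lemma brauer_diagrams: "d \<in> brauer a b \<Longrightarrow> d \<in> diagrams"
  by blast

context
  fixes \<delta> :: "'k::field"
begin

lemma B_mult_simps [simp]:
  "B_mult \<delta> 0 y = 0" "B_mult \<delta> x 0 = 0"
  "B_mult \<delta> (x + x') y = B_mult \<delta> x y + B_mult \<delta> x' y"
  "B_mult \<delta> x (y + y') = B_mult \<delta> x y + B_mult \<delta> x y'"
  "B_mult \<delta> (scale c x) y = scale c (B_mult \<delta> x y)"
  "B_mult \<delta> x (scale c y) = scale c (B_mult \<delta> x y)"
  by (simp_all add: B_mult_def lin_ext_add_fun lin_ext_scale_fun)

lemma B_mult_basis:
  "B_mult \<delta> (basis g) (basis h) =
    (if tgt h = src g then scale (\<delta> ^ loops g h) (basis (stack g h)) else 0)"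
  by (simp add: B_mult_def)

lemma B_mult_brauer:
  "h \<in> brauer a b \<Longrightarrow> g \<in> brauer b c \<Longrightarrow>
    B_mult \<delta> (basis g) (basis h) = scale (\<delta> ^ loops g h) (basis (stack g h))"
  by (simp add: B_mult_basis brauer_iff)

lemma B_mult_closed:
  assumes "x \<in> B_alg" "y \<in> B_alg"
  shows "B_mult \<delta> x y \<in> B_alg"
  using assms(1) unfolding B_alg_def
proof (induction rule: free_space_induct)
  case (add x c g)
  have "B_mult \<delta> (basis g) y \<in> free_space diagrams"
    using assms(2) unfolding B_alg_def
  proof (induction rule: free_space_induct)
    case (add y d h)
    have "B_mult \<delta> (basis g) (basis h) \<in> free_space diagrams"
    proof (cases "tgt h = src g")
      case True
      have "h \<in> brauer (src h) (tgt h)" "g \<in> brauer (src g) (tgt g)"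
        using \<open>g \<in> diagrams\<close> \<open>h \<in> diagrams\<close> by (simp_all only: diagrams_iff)
      then have "stack g h \<in> brauer (src h) (tgt g)" using stack_brauer True by metis
      then have "stack g h \<in> diagrams" by (rule brauer_diagrams)
      then show ?thesis unfolding B_mult_basis by (simp del: UN_iff)
    qed (simp add: B_mult_basis)
    then show ?case using add by simp
  qed simp
  then show ?case using add by simp
qed simp

lemma B_mult_assoc:
  assumes "x \<in> B_alg" "y \<in> B_alg" "z \<in> B_alg"
  shows "B_mult \<delta> (B_mult \<delta> x y) z = B_mult \<delta> x (B_mult \<delta> y z)"
  using assms(1) unfolding B_alg_def
proof (induction rule: free_space_induct)
  case (add x c h)
  have "B_mult \<delta> (B_mult \<delta> (basis h) y) z = B_mult \<delta> (basis h) (B_mult \<delta> y z)"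
    using assms(2) unfolding B_alg_def
  proof (induction rule: free_space_induct)
    case (add y c' g)
    have "B_mult \<delta> (B_mult \<delta> (basis h) (basis g)) z = B_mult \<delta> (basis h) (B_mult \<delta> (basis g) z)"
      using assms(3) unfolding B_alg_def
    proof (induction rule: free_space_induct)
      case (add z c'' f)
      have f: "f \<in> brauer (src f) (tgt f)" and g: "g \<in> brauer (src g) (tgt g)" and h: "h \<in> brauer (src h) (tgt h)"
        using \<open>f \<in> diagrams\<close> \<open>g \<in> diagrams\<close> \<open>h \<in> diagrams\<close> by (simp_all only: diagrams_iff)
      have "B_mult \<delta> (B_mult \<delta> (basis h) (basis g)) (basis f) = B_mult \<delta> (basis h) (B_mult \<delta> (basis g) (basis f))"
      proof (cases "tgt f = src g \<and> tgt g = src h")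
        case True
        then show ?thesis
          using stack_assoc[of f "src f" "tgt f" g "tgt g" h "tgt h"] f g h
          by (simp add: B_mult_basis power_add[symmetric] add.commute)
      qed (auto simp: B_mult_basis)
      then show ?case using add by simp
    qed simp
    then show ?case using add by simp
  qed simp
  then show ?case using add by simp
qed simp

lemma B_id_in: "B_id m \<in> (B_alg :: (diagram \<Rightarrow>\<^sub>0 'k) set)"
  unfolding B_id_def B_alg_def by (intro free_space_simps brauer_diagrams[OF perm_brauer[OF permutes_id]])

lemma B_id_left: "g \<in> diagrams \<Longrightarrow> B_mult \<delta> (B_id m) (basis g) = (if tgt g = m then basis g else 0)"
  using stack_id_left[of g "src g" "tgt g"] unfolding diagrams_iff by (auto simp: B_id_def B_mult_basis)

lemma B_id_right: "g \<in> diagrams \<Longrightarrow> B_mult \<delta> (basis g) (B_id m) = (if src g = m then basis g else 0)"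
  using stack_id_right[of g "src g" "tgt g"] unfolding diagrams_iff by (auto simp: B_id_def B_mult_basis)

lemma idem_B: "idem B_alg (B_mult \<delta>) (B_id m)"
proof
  show "B_mult \<delta> (B_id m) (B_id m) = B_id m"
    using B_id_left[OF brauer_diagrams[OF perm_brauer[OF permutes_id]], of m m] by (simp add: B_id_def)
qed (use B_id_in B_mult_closed in auto)

lemma brauer_algebra_corner: "brauer_algebra \<delta> m = corner B_alg (B_mult \<delta>) (B_id m)"
  by (simp add: brauer_algebra_def corner_def)

lemma B_id_conj: "g \<in> diagrams \<Longrightarrow>
    B_mult \<delta> (B_mult \<delta> (B_id m) (basis g)) (B_id m) = (if g \<in> brauer m m then basis g else 0)"
  using diagrams_iff[of g] by (simp add: B_id_left B_id_right del: UN_iff) (auto simp: brauer_iff)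

lemma brauer_algebra_eq: "brauer_algebra \<delta> m = free_space (brauer m m)"
proof
  show "brauer_algebra \<delta> m \<subseteq> free_space (brauer m m)"
  proof
    fix y assume "y \<in> brauer_algebra \<delta> m"
    then obtain x where x: "x \<in> free_space diagrams" "y = B_mult \<delta> (B_mult \<delta> (B_id m) x) (B_id m)"
      by (auto simp: brauer_algebra_def B_alg_def)
    from x(1) have "B_mult \<delta> (B_mult \<delta> (B_id m) x) (B_id m) \<in> free_space (brauer m m)"
      by (induction rule: free_space_induct) (simp_all add: B_id_conj del: UN_iff)
    then show "y \<in> free_space (brauer m m)" using x by simp
  qed
  show "free_space (brauer m m) \<subseteq> brauer_algebra \<delta> m"
  proof
    fix x :: "diagram \<Rightarrow>\<^sub>0 'k" assume x: "x \<in> free_space (brauer m m)"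
    then have "B_mult \<delta> (B_mult \<delta> (B_id m) x) (B_id m) = x"
    proof (induction rule: free_space_induct)
      case (add x c b)
      then show ?case using B_id_conj[OF brauer_diagrams[OF add(2)], of m] by simp
    qed simp
    moreover have "x \<in> B_alg" using x by (auto simp: B_alg_def free_space_def)
    ultimately show "x \<in> brauer_algebra \<delta> m" unfolding brauer_algebra_def by (metis imageI)
  qed
qed

lemma trunc_tr: "trunc m V = tr (B_id m) V"
  by (simp add: trunc_def tr_def)

lemma B_regular_simps [simp]:
  "carrier (B_regular \<delta>) = B_alg" "zero (B_regular \<delta>) = 0" "add (B_regular \<delta>) = (+)"
  "module.smult (B_regular \<delta>) = scale" "act (B_regular \<delta>) = B_mult \<delta>"
  by (simp_all add: B_regular_def B_alg_def)

lemma lrep_B_regular: "lrep B_alg (B_regular \<delta>)"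
  unfolding B_regular_def by (rule lrep_free_rep) (use B_mult_closed in \<open>auto simp: B_alg_def\<close>)

lemma B_sharp_sub: "B_sharp \<subseteq> (B_alg :: (diagram \<Rightarrow>\<^sub>0 'k) set)"
  by (auto simp: B_sharp_def B_alg_def free_space_def)

end

subsection \<open>The projection to the group algebra\<close>

lemma finite_perms: "finite {\<pi>. \<pi> permutes {1..n::nat}}"
  by (rule finite_permutations) simp

lemma sym_part_simps [simp]:
  "sym_part n 0 = 0" "sym_part n (x + y) = sym_part n x + sym_part n y"
  "sym_part n (scale c x) = scale c (sym_part n x)"
  by (simp_all add: sym_part_def lookup_add single_add sum.distrib scale_sum)
    (intro sum.cong poly_mapping_eqI; simp add: lookup_single when_def)

lemma sym_part_basis_perm:
  assumes "\<pi> permutes {1..n}"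
  shows "sym_part n (basis (perm_diagram n \<pi>)) = basis \<pi>"
proof -
  have "sym_part n (basis (perm_diagram n \<pi>) :: diagram \<Rightarrow>\<^sub>0 'a) =
      (\<Sum>\<sigma> | \<sigma> permutes {1..n}. if \<sigma> = \<pi> then basis \<pi> else 0)"
    unfolding sym_part_def
  proof (rule sum.cong[OF refl])
    fix \<sigma> assume "\<sigma> \<in> {\<sigma>. \<sigma> permutes {1..n}}"
    then have "perm_diagram n \<pi> = perm_diagram n \<sigma> \<longleftrightarrow> \<sigma> = \<pi>"
      using perm_diagram_inj[OF assms] by auto
    then show "Poly_Mapping.single \<sigma> (Poly_Mapping.lookup (basis (perm_diagram n \<pi>)) (perm_diagram n \<sigma>)) =
      (if \<sigma> = \<pi> then basis \<pi> else (0 :: (nat \<Rightarrow> nat) \<Rightarrow>\<^sub>0 'a))"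
      by (simp add: lookup_basis) (simp add: basis_def)
  qed
  then show ?thesis using assms finite_perms by (simp add: sum.delta)
qed

lemma sym_part_basis_other:
  assumes "\<And>\<pi>. \<pi> permutes {1..n} \<Longrightarrow> d \<noteq> perm_diagram n \<pi>"
  shows "sym_part n (basis d) = 0"
  unfolding sym_part_def by (rule sum.neutral) (use assms in \<open>auto simp: lookup_basis\<close>)

lemma sym_part_closed: "sym_part n b \<in> sym_algebra n"
  unfolding sym_part_def sym_algebra_def
  by (intro free_space_sum) (auto simp: free_space_def)

lemma has_cap_perm [simp]: "\<not> has_cap (perm_diagram n \<pi>)" and has_cup_perm [simp]: "\<not> has_cup (perm_diagram n \<pi>)"
  by (auto simp: has_cap_def has_cup_def)

lemma has_cap_src:
  assumes "d \<in> brauer a b" "has_cap d"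
  obtains a' where "a = a' + 2"
proof -
  obtain e where e: "e \<in> strands d" "e \<subseteq> range Bot" using assms by (auto simp: has_cap_def)
  have pm: "pm (points a b) (strands d)" using assms by (simp add: brauer_iff)
  then have "e \<subseteq> points a b" "card e = 2" using e pm_Union[OF pm] by (auto simp: pm_def)
  then have "e \<subseteq> Bot ` {1..a}" using e(2) by (auto simp: points_def)
  then have "card e \<le> card (Bot ` {1..a})" by (intro card_mono) auto
  also have "\<dots> = a" by (simp add: card_image inj_on_def)
  finally have "2 \<le> a" using \<open>card e = 2\<close> by simp
  then show thesis using that[of "a - 2"] by simp
qed

section \<open>The induced module Delta(U) and its truncation at n points\<close>

section \<open>Standard modules\<close>

text \<open>\<open>sym_algebra\<close> carries no multiplication of its own. Compatibility with
  products is therefore stated for permutations, where the product is composition, and linearity in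
  the algebra argument is demanded separately.\<close>

definition srep :: "nat \<Rightarrow> ('k::field, (nat \<Rightarrow> nat) \<Rightarrow>\<^sub>0 'k, 'v) rep \<Rightarrow> bool"
  where "srep n U \<longleftrightarrow> lrep (sym_algebra n) U \<and>
    (\<forall>a\<in>sym_algebra n. \<forall>b\<in>sym_algebra n. \<forall>v\<in>carrier U. act U (a + b) v = act U a v \<oplus>\<^bsub>U\<^esub> act U b v) \<and>
    (\<forall>c. \<forall>a\<in>sym_algebra n. \<forall>v\<in>carrier U. act U (scale c a) v = c \<odot>\<^bsub>U\<^esub> act U a v) \<and>
    (\<forall>\<pi> \<sigma>. \<forall>v\<in>carrier U. \<pi> permutes {1..n} \<longrightarrow> \<sigma> permutes {1..n} \<longrightarrow>
      act U (basis \<pi>) (act U (basis \<sigma>) v) = act U (basis (\<pi> \<circ> \<sigma>)) v) \<and>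
    (\<forall>v\<in>carrier U. act U (basis id) v = v)"

lemma inflate_simps [simp]:
  "carrier (inflate n V) = carrier V" "zero (inflate n V) = zero V" "add (inflate n V) = add V"
  "module.smult (inflate n V) = module.smult V" "act (inflate n V) = (\<lambda>b. act V (sym_part n b))"
  by (simp_all add: inflate_def)

locale standard =
  fixes \<delta> :: "'k::field" and n :: nat and U :: "('k, (nat \<Rightarrow> nat) \<Rightarrow>\<^sub>0 'k, 'v) rep"
  assumes srep: "srep n U"
begin

lemma sp_closed: "sym_part n (x :: diagram \<Rightarrow>\<^sub>0 'k) \<in> sym_algebra n"
  by (rule sym_part_closed)

lemma sp_perm: "\<pi> permutes {1..n} \<Longrightarrow> sym_part n (basis (perm_diagram n \<pi>) :: diagram \<Rightarrow>\<^sub>0 'k) = basis \<pi>"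
  by (rule sym_part_basis_perm)

lemma scale_sym: "a \<in> sym_algebra n \<Longrightarrow> scale (c :: 'k) a \<in> sym_algebra n"
  by (simp add: sym_algebra_def)

lemma Bm_closed: "x \<in> B_alg \<Longrightarrow> y \<in> B_alg \<Longrightarrow> B_mult \<delta> x y \<in> B_alg"
  by (rule B_mult_closed)

lemma Bm_assoc: "x \<in> B_alg \<Longrightarrow> y \<in> B_alg \<Longrightarrow> z \<in> B_alg \<Longrightarrow>
    B_mult \<delta> (B_mult \<delta> x y) z = B_mult \<delta> x (B_mult \<delta> y z)"
  by (rule B_mult_assoc)

lemma Bid_in: "(B_id m :: diagram \<Rightarrow>\<^sub>0 'k) \<in> B_alg"
  by (rule B_id_in)

lemma Bscale_in: "x \<in> B_alg \<Longrightarrow> scale (c :: 'k) x \<in> B_alg"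
  by (simp add: B_alg_def)

lemma lrep_U: "lrep (sym_algebra n) U" using srep by (simp add: srep_def)

lemmas U = lrepD[OF lrep_U] and UV = vspD(1-7)[OF lrepD(1)[OF lrep_U]]

lemma act_add_alg: "a \<in> sym_algebra n \<Longrightarrow> b \<in> sym_algebra n \<Longrightarrow> v \<in> carrier U \<Longrightarrow> act U (a + b) v = act U a v \<oplus>\<^bsub>U\<^esub> act U b v"
  and act_scale_alg: "a \<in> sym_algebra n \<Longrightarrow> v \<in> carrier U \<Longrightarrow> act U (scale c a) v = c \<odot>\<^bsub>U\<^esub> act U a v"
  and act_perm: "v \<in> carrier U \<Longrightarrow> \<pi> permutes {1..n} \<Longrightarrow> \<sigma> permutes {1..n} \<Longrightarrow>
      act U (basis \<pi>) (act U (basis \<sigma>) v) = act U (basis (\<pi> \<circ> \<sigma>)) v"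
  and act_id: "v \<in> carrier U \<Longrightarrow> act U (basis id) v = v"
  using srep by (auto simp: srep_def)

lemma zero_sym: "0 \<in> sym_algebra n"
  by (simp add: sym_algebra_def)

lemma act_zero_alg: "v \<in> carrier U \<Longrightarrow> act U 0 v = \<zero>\<^bsub>U\<^esub>"
  using act_scale_alg[of 0 v 0] UV(4)[of "act U 0 v"] U(2)[OF zero_sym] zero_sym by simp

lemma vsp_inflate: "vsp (inflate n U)"
  by (rule vspI) (use vspD[OF U(1)] in simp_all)

lemma lrep_inflate: "lrep {} (inflate n U)"
  using vsp_inflate by (simp add: lrep_def)

lemma bimod: "bimod B_alg B_sharp (B_regular \<delta>) (B_mult \<delta>) (inflate n U)"
proof (rule bimod.intro)
  show "act (B_regular \<delta>) b (B_mult \<delta> x a) = B_mult \<delta> (act (B_regular \<delta>) b x) a"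
    if "b \<in> B_alg" "x \<in> carrier (B_regular \<delta>)" "a \<in> B_sharp" for b x a
    using Bm_assoc[of b x a] that subsetD[OF B_sharp_sub that(3)] by simp
  show "act (inflate n U) a v \<in> carrier (inflate n U)" if "v \<in> carrier (inflate n U)" for a v
    using U(2)[OF sp_closed] that by simp
  show "B_mult \<delta> x a \<in> carrier (B_regular \<delta>)" if "x \<in> carrier (B_regular \<delta>)" "a \<in> B_sharp" for x a
    using Bm_closed subsetD[OF B_sharp_sub that(2)] that(1) by simp
qed (rule lrep_B_regular vsp_inflate)+

sublocale b: bimod B_alg B_sharp "B_regular \<delta>" "B_mult \<delta>" "inflate n U"
  by (rule bimod)

abbreviation "Z \<equiv> Delta \<delta> (inflate n U)"

lemma b_T: "b.T = Z" by (simp add: Delta_def)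

lemmas tn_closed = b.tn_closed[unfolded b_T, simplified]
  and act_tn = b.act_tn[unfolded b_T, simplified]
  and tn_add_left = b.tn_add_left[unfolded b_T, simplified]
  and tn_add_right = b.tn_add_right[unfolded b_T, simplified]
  and tn_smult_left = b.tn_smult_left[unfolded b_T, simplified]
  and tn_smult_right = b.tn_smult_right[unfolded b_T, simplified]
  and tn_balanced = b.tn_balanced[unfolded b_T, simplified]
  and tn_zero_left = b.tn_zero_left[unfolded b_T, simplified]
  and tn_zero_right = b.tn_zero_right[unfolded b_T, simplified]
  and Z_induct = b.tensor_induct[unfolded b_T, simplified, consumes 1, case_names zero add]
  and Z_universal = b.tensor_universal[unfolded b_T, simplified]
  and lrep_Z = b.lrep_T[unfolded b_T]

lemmas Zl = lrepD(2-4)[OF lrep_Z] and ZV = vspD(1-7)[OF lrepD(1)[OF lrep_Z]]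

lemma arep_Z: "arep B_alg (B_mult \<delta>) Z"
  unfolding arep_def
proof (intro conjI ballI)
  fix x y :: "diagram \<Rightarrow>\<^sub>0 'k" and z assume xy: "x \<in> B_alg" "y \<in> B_alg" and "z \<in> carrier Z"
  from this(3) show "act Z (B_mult \<delta> x y) z = act Z x (act Z y z)"
  proof (induction rule: Z_induct)
    case zero
    then show ?case using xy Bm_closed act_zero[OF lrep_Z] by metis
  next
    case (add t w v)
    then show ?case using xy Bm_closed Bm_assoc Zl tn_closed act_tn by simp
  qed
qed (rule lrep_Z)

lemma basis_in: "d \<in> brauer a b \<Longrightarrow> (basis d :: diagram \<Rightarrow>\<^sub>0 'k) \<in> B_alg"
  unfolding B_alg_def by (intro free_space_simps brauer_diagrams[of d a b])

lemma basis_sharp: "d \<in> brauer a b \<Longrightarrow> \<not> has_cup d \<Longrightarrow> (basis d :: diagram \<Rightarrow>\<^sub>0 'k) \<in> B_sharp"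
  unfolding B_sharp_def by (intro free_space_simps) blast

text \<open>Being free of cups, \<open>h\<close> can be moved across the tensor sign, where it acts
  through \<open>sym_part n\<close>; this is zero on any diagram that is not of type (n, n).\<close>

lemma tn_mult_zero:
  assumes "y \<in> brauer b c" "h \<in> brauer a b" "\<not> has_cup h" "loops y h = 0" "a \<noteq> n \<or> b \<noteq> n" "v \<in> carrier U"
  shows "b.tn (basis (stack y h)) v = \<zero>\<^bsub>Z\<^esub>"
proof -
  have "sym_part n (basis h :: diagram \<Rightarrow>\<^sub>0 'k) = 0"
    using assms(2,5) by (intro sym_part_basis_other) (auto simp: brauer_iff)
  then have "b.tn (B_mult \<delta> (basis y) (basis h)) v = b.tn (basis y) \<zero>\<^bsub>U\<^esub>"
    using tn_balanced[of "basis y" v "basis h"] basis_in[OF assms(1)] basis_sharp[OF assms(2,3)] assms(6) act_zero_alg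
    by simp
  then show ?thesis
    using tn_zero_right basis_in[OF assms(1)] B_mult_brauer[OF assms(2,1), of \<delta>] assms(4) by simp
qed

text \<open>For a wrong source the identity of that source is split off, for a cap the cup-free
  factor from \<open>cap_factor\<close>. Either one becomes zero on the other side of the tensor
  sign.\<close>

lemma tn_vanish:
  assumes d: "d \<in> diagrams" and "has_cap d \<or> src d \<noteq> n" and v: "v \<in> carrier U"
  shows "b.tn (basis d) v = \<zero>\<^bsub>Z\<^esub>"
proof (cases "src d = n")
  case False
  have d': "d \<in> brauer (src d) (tgt d)" using d diagrams_iff by simp
  show ?thesis
    using tn_mult_zero[OF d' perm_brauer[OF permutes_id] _ _ _ v] stack_id_right[OF d'] False by simp
next
  case True
  then have "has_cap d" "d \<in> brauer n (tgt d)" using assms d diagrams_iff[of d] by auto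
  moreover obtain a where "n = a + 2" using has_cap_src[OF calculation(2,1)] .
  ultimately obtain y h where "y \<in> brauer a (tgt d)" "h \<in> brauer n a" "\<not> has_cup h" "stack y h = d" "loops y h = 0"
    using cap_factor[of d a "tgt d"] by metis
  then show ?thesis using tn_mult_zero[of y a "tgt d" h n v] v \<open>n = a + 2\<close> by auto
qed

definition \<iota> :: "'v \<Rightarrow> _"
  where "\<iota> v = b.tn (B_id n) v"

lemma \<iota>_closed: "v \<in> carrier U \<Longrightarrow> \<iota> v \<in> carrier Z"
  unfolding \<iota>_def by (rule tn_closed[OF Bid_in])

lemma \<iota>_add: "v \<in> carrier U \<Longrightarrow> w \<in> carrier U \<Longrightarrow> \<iota> (v \<oplus>\<^bsub>U\<^esub> w) = \<iota> v \<oplus>\<^bsub>Z\<^esub> \<iota> w"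
  and \<iota>_smult: "v \<in> carrier U \<Longrightarrow> \<iota> (c \<odot>\<^bsub>U\<^esub> v) = c \<odot>\<^bsub>Z\<^esub> \<iota> v"
  and \<iota>_zero: "\<iota> \<zero>\<^bsub>U\<^esub> = \<zero>\<^bsub>Z\<^esub>"
  unfolding \<iota>_def using Bid_in by (simp_all add: tn_add_right tn_smult_right tn_zero_right)

text \<open>There is no unit 1 with x = x1, but \<open>x\<close> differs from its right multiple by
  \<open>B_id n\<close> only in diagrams whose source is not n, and these vanish by
  \<open>tn_vanish\<close>.\<close>

lemma tn_eq_act:
  assumes "x \<in> B_alg" "v \<in> carrier U"
  shows "b.tn x v = act Z x (\<iota> v)"
proof -
  have "b.tn x v = b.tn (B_mult \<delta> x (B_id n)) v"
    using assms(1) unfolding B_alg_def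
  proof (induction rule: free_space_induct)
    case (add x c d)
    have d: "basis d \<in> (B_alg :: (diagram \<Rightarrow>\<^sub>0 'k) set)" using add(2) by (simp add: B_alg_def)
    have x: "x \<in> B_alg" using add(1) by (simp add: B_alg_def)
    have "b.tn (basis d) v = b.tn (B_mult \<delta> (basis d) (B_id n)) v"
      using tn_vanish[OF add(2) _ assms(2)] add(2) tn_zero_left[OF assms(2)] by (simp add: B_id_right)
    moreover have "scale c (basis d) \<in> B_alg" "B_mult \<delta> x (B_id n) \<in> B_alg" "B_mult \<delta> (basis d) (B_id n) \<in> B_alg"
      "scale c (B_mult \<delta> (basis d) (B_id n)) \<in> B_alg"
      using d x Bm_closed[of _ "B_id n"] Bid_in Bscale_in by auto
    ultimately show ?case
      using add(3) x d tn_add_left tn_smult_left assms(2) by simp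
  qed simp
  then show ?thesis using act_tn[of x "B_id n" v] assms Bid_in by (simp add: \<iota>_def)
qed

text \<open>Truncation at n keeps the diagrams with n upper points. Among them those with a cap or
  another source vanish, and the rest are permutations, which pass to \<open>v\<close>.\<close>

lemma e_act_\<iota>:
  assumes "x \<in> B_alg" "v \<in> carrier U"
  shows "act Z (B_id n) (act Z x (\<iota> v)) = \<iota> (act U (sym_part n x) v)"
proof -
  have "act Z (B_id n) (act Z x (\<iota> v)) = b.tn (B_mult \<delta> (B_id n) x) v"
    unfolding tn_eq_act[OF assms, symmetric] using act_tn assms Bid_in by simp
  also have "\<dots> = \<iota> (act U (sym_part n x) v)"
    using assms(1) unfolding B_alg_def
  proof (induction rule: free_space_induct)
    case zero
    then show ?case using tn_zero_left assms(2) act_zero_alg \<iota>_zero by simp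
  next
    case (add x c d)
    have x: "x \<in> B_alg" "basis d \<in> (B_alg :: (diagram \<Rightarrow>\<^sub>0 'k) set)" using add(1,2) by (simp_all add: B_alg_def)
    have cl: "B_mult \<delta> (B_id n) y \<in> B_alg" if "y \<in> B_alg" for y using Bm_closed Bid_in that by blast
    have "b.tn (B_mult \<delta> (B_id n) (basis d)) v = \<iota> (act U (sym_part n (basis d)) v)"
    proof (cases "\<exists>\<pi>. \<pi> permutes {1..n} \<and> d = perm_diagram n \<pi>")
      case True
      then obtain \<pi> where \<pi>: "\<pi> permutes {1..n}" "d = perm_diagram n \<pi>" by blast
      have db: "d \<in> brauer n n" using \<pi> perm_brauer by simp
      have "B_mult \<delta> (B_id n) (basis d) = B_mult \<delta> (B_id n) (basis d :: diagram \<Rightarrow>\<^sub>0 'k)" ..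
      moreover have "basis d \<in> (B_sharp :: (diagram \<Rightarrow>\<^sub>0 'k) set)" using basis_sharp[OF db] \<pi> by simp
      ultimately show ?thesis
        using tn_balanced[of "B_id n" v "basis d"] Bid_in assms(2) by (simp add: \<iota>_def)
    next
      case False
      then have "sym_part n (basis d :: diagram \<Rightarrow>\<^sub>0 'k) = 0" by (intro sym_part_basis_other) blast
      moreover have "b.tn (B_mult \<delta> (B_id n) (basis d)) v = \<zero>\<^bsub>Z\<^esub>"
      proof (cases "tgt d = n")
        case True
        have "has_cap d \<or> src d \<noteq> n"
          using no_cap_perm[of d n] False True add(2) diagrams_iff[of d] by metis
        then show ?thesis using True tn_vanish[OF add(2) _ assms(2)] add(2) by (simp add: B_id_left)
      next
        case False
        then show ?thesis using add(2) tn_zero_left assms(2) by (simp add: B_id_left)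
      qed
      ultimately show ?thesis using act_zero_alg \<iota>_zero assms(2) by simp
    qed
    moreover have "scale c (B_mult \<delta> (B_id n) (basis d)) \<in> B_alg" using cl[OF x(2)] by (simp add: B_alg_def)
    moreover have "scale c (sym_part n (basis d :: diagram \<Rightarrow>\<^sub>0 'k)) \<in> sym_algebra n"
      by (rule scale_sym[OF sp_closed])
    ultimately show ?case
      using add(3) x cl tn_add_left tn_smult_left assms(2) act_add_alg act_scale_alg \<iota>_add \<iota>_smult
        sp_closed U UV by simp
  qed
  finally show ?thesis .
qed

lemma sym_part_id: "sym_part n (B_id n :: diagram \<Rightarrow>\<^sub>0 'k) = basis id"
  unfolding B_id_def by (rule sp_perm[OF permutes_id])

text \<open>\<open>sym_part n\<close> is multiplicative as long as the right factor is free of cups;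
  for a zigzag it is not, since two non-permutations compose to an identity. The rule is the balance
  condition for the retraction that shows \<open>\<iota>\<close> to be injective.\<close>

lemma act_sym_mult:
  assumes "x \<in> B_alg" "a \<in> B_sharp" "v \<in> carrier U"
  shows "act U (sym_part n (B_mult \<delta> x a)) v = act U (sym_part n x) (act U (sym_part n a) v)"
proof -
  note cl = sp_closed U(2)[OF sp_closed]
  note sc = scale_sym[OF sp_closed]
  have basis_case: "act U (sym_part n (B_mult \<delta> (basis g) (basis h))) v =
      act U (sym_part n (basis g)) (act U (sym_part n (basis h)) v)"
    if g: "g \<in> diagrams" and h: "h \<in> diagrams" "\<not> has_cup h" for g h
  proof -
    have g': "g \<in> brauer (src g) (tgt g)" and h': "h \<in> brauer (src h) (tgt h)"
      using g h(1) by (simp_all only: diagrams_iff)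
    show ?thesis
    proof (cases "\<exists>\<sigma>. \<sigma> permutes {1..n} \<and> h = perm_diagram n \<sigma>")
      case True
      then obtain \<sigma> where \<sigma>: "\<sigma> permutes {1..n}" "h = perm_diagram n \<sigma>" by blast
      show ?thesis
      proof (cases "\<exists>\<pi>. \<pi> permutes {1..n} \<and> g = perm_diagram n \<pi>")
        case True
        then obtain \<pi> where \<pi>: "\<pi> permutes {1..n}" "g = perm_diagram n \<pi>" by blast
        have "B_mult \<delta> (basis g) (basis h) = basis (perm_diagram n (\<pi> \<circ> \<sigma>))"
          using stack_perm_perm[OF \<pi>(1) \<sigma>(1)] \<pi> \<sigma> by (simp add: B_mult_basis)
        then show ?thesis
          using \<pi> \<sigma> sp_perm permutes_compose[OF \<sigma>(1) \<pi>(1)] act_perm assms(3) by simp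
      next
        case False
        have "sym_part n (B_mult \<delta> (basis g) (basis h)) = 0"
        proof (cases "src g = n")
          case gn: True
          \<comment> \<open>As \<open>h\<close> is a permutation, \<open>g\<close> is recovered from
            the composite by the inverse permutation and would be a permutation itself.\<close>
          have "stack g h \<noteq> perm_diagram n \<pi>" if \<pi>: "\<pi> permutes {1..n}" for \<pi>
          proof
            assume eq: "stack g h = perm_diagram n \<pi>"
            have gb: "g \<in> brauer n (tgt g)" using g' gn by simp
            have "g = stack (stack g h) (perm_diagram n (inv_into UNIV \<sigma>))"
              using stack_assoc(1)[OF perm_brauer[OF permutes_inv[OF \<sigma>(1)]] perm_brauer[OF \<sigma>(1)] gb] \<sigma>
                stack_perm_perm(1)[OF \<sigma>(1) permutes_inv[OF \<sigma>(1)]] permutes_inv_o(1)[OF \<sigma>(1)]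
                stack_id_right(1)[OF gb] by simp
            also have "\<dots> = perm_diagram n (\<pi> \<circ> inv_into UNIV \<sigma>)"
              unfolding eq by (rule stack_perm_perm(1)[OF \<pi> permutes_inv[OF \<sigma>(1)]])
            finally show False using False permutes_compose[OF permutes_inv[OF \<sigma>(1)] \<pi>] by blast
          qed
          then have "sym_part n (basis (stack g h) :: diagram \<Rightarrow>\<^sub>0 'k) = 0" by (intro sym_part_basis_other) blast
          then show ?thesis by (simp add: B_mult_basis)
        qed (use \<sigma> in \<open>simp add: B_mult_basis\<close>)
        moreover have "sym_part n (basis g :: diagram \<Rightarrow>\<^sub>0 'k) = 0" using False by (intro sym_part_basis_other) blast
        ultimately show ?thesis using act_zero_alg cl assms(3) by simp
      qed
    next
      case False
      have "sym_part n (B_mult \<delta> (basis g) (basis h)) = 0"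
      proof (cases "tgt h = src g")
        case True
        \<comment> \<open>A cap of \<open>h\<close> would survive in the composite, so
          \<open>h\<close> has none. Having no cup either, it would be a permutation.\<close>
        have "stack g h \<noteq> perm_diagram n \<pi>" if \<pi>: "\<pi> permutes {1..n}" for \<pi>
        proof
          assume eq: "stack g h = perm_diagram n \<pi>"
          have "src (stack g h) = n" unfolding eq by simp
          then have hb: "h \<in> brauer n (tgt h)" using h' by simp
          have "\<not> has_cap h"
            using has_cap_stack[OF h', of g "tgt g"] g' True eq by auto
          then have "n \<le> tgt h" "tgt h \<le> n" using no_cap_le[OF hb] no_cup_le[OF hb] h by auto
          then have "h \<in> brauer n n" using hb by simp
          then show False using no_cap_perm \<open>\<not> has_cap h\<close> False by metis
        qed
        then have "sym_part n (basis (stack g h) :: diagram \<Rightarrow>\<^sub>0 'k) = 0" by (intro sym_part_basis_other) blast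
        then show ?thesis by (simp add: B_mult_basis)
      qed (simp add: B_mult_basis)
      moreover have "sym_part n (basis h :: diagram \<Rightarrow>\<^sub>0 'k) = 0" using False by (intro sym_part_basis_other) blast
      ultimately show ?thesis using act_zero_alg cl assms(3) act_zero[OF lrep_U] by simp
    qed
  qed
  show ?thesis
    using assms(1) unfolding B_alg_def
  proof (induction rule: free_space_induct)
    case zero
    then show ?case using act_zero_alg cl assms(3) by simp
  next
    case (add x c g)
    have "act U (sym_part n (B_mult \<delta> (basis g) a)) v = act U (sym_part n (basis g)) (act U (sym_part n a) v)"
      using assms(2) unfolding B_sharp_def
    proof (induction rule: free_space_induct)
      case zero
      then show ?case using act_zero_alg assms(3) act_zero[OF lrep_U sp_closed] by simp
    next
      case (add a d h)
      then show ?case using basis_case[OF \<open>g \<in> diagrams\<close>, of h] cl sc act_add_alg act_scale_alg assms(3) U UV by simp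
    qed
    then show ?case using add cl sc act_add_alg act_scale_alg assms(3) by simp
  qed
qed

text \<open>A tensor product given by relations might collapse. The linear map taking the tensor of
  \<open>x\<close> and \<open>v\<close> to the action of \<open>sym_part n x\<close> on
  \<open>v\<close> is a retraction and shows that \<open>U\<close> survives.\<close>

lemma \<iota>_inj: "inj_on \<iota> (carrier U)"
proof -
  have "\<exists>\<Phi>. rhom {} Z (inflate n U) \<Phi> \<and> (\<forall>x\<in>B_alg. \<forall>v\<in>carrier U. \<Phi> (b.tn x v) = act U (sym_part n x) v)"
  proof (rule Z_universal[of "{}" "inflate n U" "\<lambda>x. act U (sym_part n x)"])
    show "lrep {} (inflate n U)" by (rule lrep_inflate)
    show "act U (sym_part n (B_mult \<delta> x a)) v = act U (sym_part n x) (act U (sym_part n a) v)"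
      if "a \<in> B_sharp" "x \<in> B_alg" "v \<in> carrier U" for a x v
      by (rule act_sym_mult[OF that(2,1,3)])
  qed (use U sp_closed act_add_alg act_scale_alg in simp_all)
  then obtain \<Phi> where \<Phi>: "\<And>x v. x \<in> B_alg \<Longrightarrow> v \<in> carrier U \<Longrightarrow> \<Phi> (b.tn x v) = act U (sym_part n x) v" by blast
  have "\<Phi> (\<iota> v) = v" if "v \<in> carrier U" for v
    using \<Phi>[OF Bid_in that] act_id[OF that] sym_part_id by (simp add: \<iota>_def)
  then show ?thesis by (metis inj_on_inverseI)
qed

abbreviation "e \<equiv> B_id n :: diagram \<Rightarrow>\<^sub>0 'k"

lemma gen_\<iota>: "gen B_alg Z (\<iota> ` carrier U) = carrier Z"
proof
  have sub: "\<iota> ` carrier U \<subseteq> carrier Z" using \<iota>_closed by auto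
  then have S: "is_submodule B_alg Z (gen B_alg Z (\<iota> ` carrier U))" by (rule is_submodule_gen[OF lrep_Z])
  note S' = S[unfolded is_submodule_iff[OF lrepD(1)[OF lrep_Z]]]
  show "gen B_alg Z (\<iota> ` carrier U) \<subseteq> carrier Z" using S' by simp
  show "carrier Z \<subseteq> gen B_alg Z (\<iota> ` carrier U)"
  proof
    fix t assume "t \<in> carrier Z"
    then show "t \<in> gen B_alg Z (\<iota> ` carrier U)"
    proof (induction rule: Z_induct)
      case zero
      then show ?case using S' by simp
    next
      case (add t x v)
      have "\<iota> v \<in> gen B_alg Z (\<iota> ` carrier U)" using add(3) by (intro subsetD[OF gen_superset]) simp
      then have "b.tn x v \<in> gen B_alg Z (\<iota> ` carrier U)" using S' add tn_eq_act by simp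
      then show ?case using S' add by simp
    qed
  qed
qed

lemma carrier_tr_Z: "carrier (tr e Z) = \<iota> ` carrier U"
proof
  show "\<iota> ` carrier U \<subseteq> carrier (tr e Z)"
  proof (rule image_subsetI)
    fix v assume v: "v \<in> carrier U"
    have "act Z e (\<iota> v) = act Z e (act Z e (\<iota> v))"
      using idem.e_e[OF idem_B arep_Z \<iota>_closed[OF v]] by simp
    also have "\<dots> = \<iota> v" using e_act_\<iota>[OF Bid_in v] sym_part_id act_id[OF v] by simp
    finally show "\<iota> v \<in> carrier (tr e Z)" unfolding carrier_tr using \<iota>_closed[OF v] by (metis imageI)
  qed
  show "carrier (tr e Z) \<subseteq> \<iota> ` carrier U"
    unfolding carrier_tr
  proof (rule image_subsetI)
    fix t assume "t \<in> carrier Z"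
    then show "act Z e t \<in> \<iota> ` carrier U"
    proof (induction rule: Z_induct)
      case zero
      then show ?case using act_zero[OF lrep_Z Bid_in] \<iota>_zero UV(1) by (metis imageI)
    next
      case (add t x v)
      obtain u where u: "u \<in> carrier U" "act Z e t = \<iota> u" using add by auto
      have "act Z e (t \<oplus>\<^bsub>Z\<^esub> b.tn x v) = \<iota> u \<oplus>\<^bsub>Z\<^esub> \<iota> (act U (sym_part n x) v)"
        using Zl(2)[OF Bid_in add(1), of "b.tn x v"] tn_closed add u tn_eq_act e_act_\<iota> by simp
      also have "\<dots> = \<iota> (u \<oplus>\<^bsub>U\<^esub> act U (sym_part n x) v)"
        using \<iota>_add u U(2)[OF sp_closed add(3)] by simp
      finally show ?case using u U(2)[OF sp_closed add(3)] UV by simp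
    qed
  qed
qed

abbreviation "Cn \<equiv> corner B_alg (B_mult \<delta>) (e :: diagram \<Rightarrow>\<^sub>0 'k)"

lemma corner_act:
  assumes "x \<in> B_alg" "v \<in> carrier U"
  shows "act Z (B_mult \<delta> (B_mult \<delta> e x) e) (\<iota> v) = \<iota> (act U (sym_part n x) v)"
  using idem.act_eae_tr[OF idem_B arep_Z assms(1), of "\<iota> v" n] carrier_tr_Z assms e_act_\<iota> by auto

lemma sym_part_surj:
  fixes a :: "(nat \<Rightarrow> nat) \<Rightarrow>\<^sub>0 'k"
  assumes "a \<in> sym_algebra n"
  obtains x where "x \<in> B_alg" "sym_part n x = a"
proof -
  have "\<exists>x\<in>B_alg. sym_part n (x :: diagram \<Rightarrow>\<^sub>0 'k) = a"
    using assms unfolding sym_algebra_def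
  proof (induction rule: free_space_induct)
    case zero
    then show ?case by (intro bexI[of _ 0]) (auto simp: B_alg_def)
  next
    case (add a c \<pi>)
    then obtain x where x: "x \<in> B_alg" "sym_part n x = a" by auto
    have "x + scale c (basis (perm_diagram n \<pi>)) \<in> B_alg"
      using x basis_in[OF perm_brauer[of \<pi> n]] add by (auto simp: B_alg_def)
    then show ?case using x add by (intro bexI[of _ "x + scale c (basis (perm_diagram n \<pi>))"]) (auto simp: sp_perm)
  qed
  then show thesis using that by blast
qed

text \<open>The corner acts on the copy of \<open>U\<close> through \<open>sym_part n\<close>, which
  maps onto the group algebra, so both algebras have the same stable subspaces.\<close>

lemma submodule_\<iota>:
  assumes "S \<subseteq> carrier U"
  shows "is_submodule Cn (tr e Z) (\<iota> ` S) \<longleftrightarrow> is_submodule (sym_algebra n) U S"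
proof -
  have vt: "vsp (tr e Z)" by (rule lrepD(1)[OF idem.lrep_tr[OF idem_B arep_Z]])
  have mem: "\<iota> v \<in> \<iota> ` S \<longleftrightarrow> v \<in> S" if "v \<in> carrier U" for v
    using \<iota>_inj assms that by (meson inj_on_image_mem_iff)
  have sub: "v \<in> S \<Longrightarrow> v \<in> carrier U" for v using assms by auto
  have act: "(\<forall>a\<in>Cn. \<forall>w\<in>\<iota> ` S. act Z a w \<in> \<iota> ` S) \<longleftrightarrow> (\<forall>a\<in>sym_algebra n. \<forall>v\<in>S. act U a v \<in> S)"
  proof (intro iffI ballI)
    fix a :: "(nat \<Rightarrow> nat) \<Rightarrow>\<^sub>0 'k" and v assume l: "\<forall>a\<in>Cn. \<forall>w\<in>\<iota> ` S. act Z a w \<in> \<iota> ` S" and a: "a \<in> sym_algebra n" and v: "v \<in> S"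
    obtain x where x: "x \<in> B_alg" "sym_part n x = a" using sym_part_surj[OF a] .
    have "\<iota> (act U a v) \<in> \<iota> ` S"
      using l corner_act[OF x(1) sub[OF v]] x v idem.eae[OF idem_B x(1)] by (metis imageI)
    then show "act U a v \<in> S" using mem U(2)[OF a sub[OF v]] by simp
  next
    fix a w assume r: "\<forall>a\<in>sym_algebra n. \<forall>v\<in>S. act U a v \<in> S" and a: "a \<in> Cn" and "w \<in> \<iota> ` S"
    then obtain v x where "v \<in> S" "w = \<iota> v" "x \<in> B_alg" "a = B_mult \<delta> (B_mult \<delta> e x) e" by (auto simp: corner_def)
    then show "act Z a w \<in> \<iota> ` S" using corner_act[of x v] sub r sp_closed by auto
  qed
  have add: "(\<forall>w\<in>\<iota> ` S. \<forall>w'\<in>\<iota> ` S. w \<oplus>\<^bsub>Z\<^esub> w' \<in> \<iota> ` S) \<longleftrightarrow> (\<forall>v\<in>S. \<forall>v'\<in>S. v \<oplus>\<^bsub>U\<^esub> v' \<in> S)"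
    using \<iota>_add[symmetric] mem sub UV(2) by simp
  have smult: "(\<forall>c. \<forall>w\<in>\<iota> ` S. c \<odot>\<^bsub>Z\<^esub> w \<in> \<iota> ` S) \<longleftrightarrow> (\<forall>c. \<forall>v\<in>S. c \<odot>\<^bsub>U\<^esub> v \<in> S)"
    using \<iota>_smult[symmetric] mem sub UV(3) by simp
  have zero: "\<zero>\<^bsub>Z\<^esub> \<in> \<iota> ` S \<longleftrightarrow> \<zero>\<^bsub>U\<^esub> \<in> S" using mem[OF UV(1)] \<iota>_zero by simp
  have carrier: "\<iota> ` S \<subseteq> \<iota> ` carrier U" using assms by auto
  show ?thesis
    unfolding is_submodule_iff[OF vt] is_submodule_iff[OF U(1)] tr_simps carrier_tr_Z act add smult zero
    using carrier assms by simp
qed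

lemma local_\<iota>:
  assumes "is_local (sym_algebra n) U R"
  shows "is_local Cn (tr e Z) (\<iota> ` R)"
  unfolding is_local_def
proof (intro conjI allI impI)
  note R = assms[unfolded is_local_def]
  have RU: "R \<subseteq> carrier U" using gen_carrier_local[OF conjunct1[OF R] lrep_U] .
  show "is_submodule Cn (tr e Z) (\<iota> ` R)" using R submodule_\<iota>[OF RU] by simp
  show "\<iota> ` R \<noteq> carrier (tr e Z)"
    unfolding carrier_tr_Z using R RU inj_on_image_eq_iff[OF \<iota>_inj RU] by simp
  fix W assume W: "is_submodule Cn (tr e Z) W"
  have "W \<subseteq> \<iota> ` carrier U"
    using gen_carrier_local[OF W idem.lrep_tr[OF idem_B arep_Z]] carrier_tr_Z by simp
  then obtain S where S: "S \<subseteq> carrier U" "W = \<iota> ` S" by (meson subset_imageE)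
  then have "is_submodule (sym_algebra n) U S" using W submodule_\<iota> by simp
  then have "S \<subseteq> R \<or> S = carrier U" using R by simp
  then show "W \<subseteq> \<iota> ` R \<or> W = carrier (tr e Z)" unfolding carrier_tr_Z S(2) by auto
qed

end

section \<open>Tableaux, tabloids and their stabilizers\<close>

section \<open>Tableaux and tabloids\<close>

abbreviation iv :: "(nat \<Rightarrow> nat) \<Rightarrow> nat \<Rightarrow> nat"
  where "iv \<pi> \<equiv> inv_into UNIV \<pi>"

locale partition =
  fixes \<mu> :: "nat list"
  assumes partition: "\<mu> \<in> partitions"
begin

abbreviation "n \<equiv> sum_list \<mu>"
abbreviation "D \<equiv> young_diagram \<mu>"
abbreviation "N \<equiv> {1..n}"
abbreviation "tabx \<equiv> tableaux \<mu>"

text \<open>Tableaux are inverted to maps from entries to cells. Row and column stabilizers become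
  the permutations that preserve a function on the entries, and a permutation acts on such functions
  through its inverse.\<close>

definition pos :: "(nat \<times> nat \<Rightarrow> nat) \<Rightarrow> nat \<Rightarrow> nat \<times> nat"
  where "pos t = inv_into D t"

definition rw :: "(nat \<times> nat \<Rightarrow> nat) \<Rightarrow> nat \<Rightarrow> nat"
  where "rw t x = fst (pos t x)"

definition cl :: "(nat \<times> nat \<Rightarrow> nat) \<Rightarrow> nat \<Rightarrow> nat"
  where "cl t x = snd (pos t x)"

lemma D_iff: "(i, j) \<in> D \<longleftrightarrow> i < length \<mu> \<and> j < \<mu> ! i"
  by (simp add: young_diagram_def)

lemma D_down:
  assumes "(i, j) \<in> D" "i' \<le> i"
  shows "(i', j) \<in> D"
proof -
  have "sorted_wrt (\<ge>) \<mu>" using partition by (simp add: partitions_def)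
  then have "\<mu> ! i \<le> \<mu> ! i'"
    using assms D_iff by (cases "i' = i") (auto simp: sorted_wrt_iff_nth_less)
  then show ?thesis using assms by (auto simp: D_iff)
qed

lemma D_eq: "D = (SIGMA i:{..<length \<mu>}. {..<\<mu> ! i})"
  by (auto simp: young_diagram_def)

lemma finite_D: "finite D" and card_D: "card D = n"
  by (simp_all add: D_eq sum_list_sum_nth atLeast0LessThan)

context
  fixes t assumes t: "t \<in> tabx"
begin

lemma tab_bij: "bij_betw t D N"
  using t by (simp add: tableaux_def)

lemma tab_in: "p \<in> D \<Longrightarrow> t p \<in> N"
  using tab_bij by (auto simp: bij_betw_def)

lemma pos_tab: "p \<in> D \<Longrightarrow> pos t (t p) = p"
  using tab_bij by (auto simp: bij_betw_def pos_def)

lemma pos_in: "x \<in> N \<Longrightarrow> pos t x \<in> D" and tab_pos: "x \<in> N \<Longrightarrow> t (pos t x) = x"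
  using tab_bij unfolding pos_def bij_betw_def by (metis inv_into_into, metis f_inv_into_f)

lemma rw_cl: "x \<in> N \<Longrightarrow> (rw t x, cl t x) \<in> D" "x \<in> N \<Longrightarrow> t (rw t x, cl t x) = x"
  "(i, j) \<in> D \<Longrightarrow> rw t (t (i, j)) = i" "(i, j) \<in> D \<Longrightarrow> cl t (t (i, j)) = j"
  using pos_in tab_pos pos_tab by (simp_all add: rw_def cl_def)

lemma rw_cl_inj: "x \<in> N \<Longrightarrow> y \<in> N \<Longrightarrow> rw t x = rw t y \<Longrightarrow> cl t x = cl t y \<Longrightarrow> x = y"
  using rw_cl(2) by metis

lemma tab_perm:
  assumes "\<pi> permutes N"
  shows "\<pi> \<circ> t \<in> tabx"
proof -
  have "\<pi> 0 = 0" using assms by (intro permutes_not_in) auto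
  moreover have "bij_betw (\<pi> \<circ> t) D N" using bij_betw_trans[OF tab_bij permutes_imp_bij[OF assms]] .
  ultimately show ?thesis using t by (simp add: tableaux_def)
qed

lemma pos_perm:
  assumes "\<pi> permutes N" "x \<in> N"
  shows "pos (\<pi> \<circ> t) x = pos t (iv \<pi> x)"
proof -
  have y: "iv \<pi> x \<in> N" using permutes_in_image[OF permutes_inv[OF assms(1)]] assms(2) by simp
  have inj: "inj_on (\<pi> \<circ> t) D"
    using bij_betw_trans[OF tab_bij permutes_imp_bij[OF assms(1)]] by (simp add: bij_betw_def)
  have "(\<pi> \<circ> t) (pos t (iv \<pi> x)) = x"
    using tab_pos[OF y] permutes_inverses(1)[OF assms(1)] by simp
  then show ?thesis
    using inv_into_f_f[OF inj pos_in[OF y]] by (simp add: pos_def[of "\<pi> \<circ> t"])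
qed

lemma rw_perm: "\<pi> permutes N \<Longrightarrow> x \<in> N \<Longrightarrow> rw (\<pi> \<circ> t) x = rw t (iv \<pi> x)"
  and cl_perm: "\<pi> permutes N \<Longrightarrow> x \<in> N \<Longrightarrow> cl (\<pi> \<circ> t) x = cl t (iv \<pi> x)"
  by (simp_all add: rw_def cl_def pos_perm)

lemma row_stabilizer_iff: "\<pi> \<in> row_stabilizer \<mu> t \<longleftrightarrow> \<pi> permutes N \<and> (\<forall>x\<in>N. rw t (\<pi> x) = rw t x)"
proof (cases "\<pi> permutes N")
  case True
  have "(\<forall>(i, j)\<in>D. \<exists>j'. (i, j') \<in> D \<and> \<pi> (t (i, j)) = t (i, j')) \<longleftrightarrow> (\<forall>x\<in>N. rw t (\<pi> x) = rw t x)"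
  proof (intro iffI ballI)
    fix x assume *: "\<forall>(i, j)\<in>D. \<exists>j'. (i, j') \<in> D \<and> \<pi> (t (i, j)) = t (i, j')" and x: "x \<in> N"
    then obtain j' where "(rw t x, j') \<in> D" "\<pi> (t (rw t x, cl t x)) = t (rw t x, j')" using rw_cl(1)[OF x] by blast
    then show "rw t (\<pi> x) = rw t x" using rw_cl x by simp
  next
    fix p assume *: "\<forall>x\<in>N. rw t (\<pi> x) = rw t x" and p: "p \<in> D"
    have "\<pi> (t p) \<in> N" using permutes_in_image[OF True] tab_in[OF p] by simp
    then have "(rw t (\<pi> (t p)), cl t (\<pi> (t p))) \<in> D" "\<pi> (t p) = t (rw t (\<pi> (t p)), cl t (\<pi> (t p)))"
      using rw_cl by simp_all
    moreover have "rw t (\<pi> (t p)) = fst p" using * tab_in[OF p] rw_cl(3)[of "fst p" "snd p"] p by simp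
    ultimately show "case p of (i, j) \<Rightarrow> \<exists>j'. (i, j') \<in> D \<and> \<pi> (t (i, j)) = t (i, j')" by (cases p) auto
  qed
  then show ?thesis using True by (simp add: row_stabilizer_def)
qed (simp add: row_stabilizer_def)

lemma column_stabilizer_iff: "\<pi> \<in> column_stabilizer \<mu> t \<longleftrightarrow> \<pi> permutes N \<and> (\<forall>x\<in>N. cl t (\<pi> x) = cl t x)"
proof (cases "\<pi> permutes N")
  case True
  have "(\<forall>(i, j)\<in>D. \<exists>i'. (i', j) \<in> D \<and> \<pi> (t (i, j)) = t (i', j)) \<longleftrightarrow> (\<forall>x\<in>N. cl t (\<pi> x) = cl t x)"
  proof (intro iffI ballI)
    fix x assume *: "\<forall>(i, j)\<in>D. \<exists>i'. (i', j) \<in> D \<and> \<pi> (t (i, j)) = t (i', j)" and x: "x \<in> N"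
    then obtain i' where "(i', cl t x) \<in> D" "\<pi> (t (rw t x, cl t x)) = t (i', cl t x)" using rw_cl(1)[OF x] by blast
    then show "cl t (\<pi> x) = cl t x" using rw_cl x by simp
  next
    fix p assume *: "\<forall>x\<in>N. cl t (\<pi> x) = cl t x" and p: "p \<in> D"
    have "\<pi> (t p) \<in> N" using permutes_in_image[OF True] tab_in[OF p] by simp
    then have "(rw t (\<pi> (t p)), cl t (\<pi> (t p))) \<in> D" "\<pi> (t p) = t (rw t (\<pi> (t p)), cl t (\<pi> (t p)))"
      using rw_cl by simp_all
    moreover have "cl t (\<pi> (t p)) = snd p" using * tab_in[OF p] rw_cl(4)[of "fst p" "snd p"] p by simp
    ultimately show "case p of (i, j) \<Rightarrow> \<exists>i'. (i', j) \<in> D \<and> \<pi> (t (i, j)) = t (i', j)" by (cases p) auto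
  qed
  then show ?thesis using True by (simp add: column_stabilizer_def)
qed (simp add: column_stabilizer_def)

end

lemma tab_eqI:
  assumes "s \<in> tabx" "t \<in> tabx" "\<And>p. p \<in> D \<Longrightarrow> s p = t p"
  shows "s = t"
  using assms by (auto simp: tableaux_def fun_eq_iff) metis

lemma tab_trans:
  assumes s: "s \<in> tabx" and t: "t \<in> tabx"
  obtains \<pi> where "\<pi> permutes N" "s = \<pi> \<circ> t"
proof
  define \<pi> where "\<pi> x = (if x \<in> N then s (pos t x) else x)" for x
  have "bij_betw (pos t) N D" unfolding pos_def by (rule bij_betw_inv_into[OF tab_bij[OF t]])
  then have "bij_betw (s \<circ> pos t) N N" using tab_bij[OF s] by (rule bij_betw_trans)
  then have "bij_betw \<pi> N N" by (rule bij_betw_cong[THEN iffD1, rotated]) (simp add: \<pi>_def)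
  then show p: "\<pi> permutes N" by (intro bij_imp_permutes) (auto simp: \<pi>_def)
  show "s = \<pi> \<circ> t"
    by (rule tab_eqI[OF s tab_perm[OF t p]]) (use tab_in[OF t] pos_tab[OF t] in \<open>simp add: \<pi>_def\<close>)
qed

text \<open>Tabloids are compared from here on through the function that assigns to each entry its
  row.\<close>

lemma tabloid_eq:
  assumes t: "t \<in> tabx"
  shows "tabloid \<mu> t = {s \<in> tabx. \<forall>x\<in>N. rw s x = rw t x}"
proof (intro equalityI subsetI)
  fix s assume "s \<in> tabloid \<mu> t"
  then obtain \<pi> where \<pi>: "s = \<pi> \<circ> t" "\<pi> permutes N" "\<forall>x\<in>N. rw t (\<pi> x) = rw t x"
    by (auto simp: tabloid_def row_stabilizer_iff[OF t])
  have "rw s x = rw t x" if x: "x \<in> N" for x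
  proof -
    have "iv \<pi> x \<in> N" using permutes_in_image[OF permutes_inv[OF \<pi>(2)]] x by simp
    then have "rw t (\<pi> (iv \<pi> x)) = rw t (iv \<pi> x)" using \<pi>(3) by simp
    then show ?thesis using rw_perm[OF t \<pi>(2) x] \<pi>(1) permutes_inverses(1)[OF \<pi>(2)] by simp
  qed
  then show "s \<in> {s \<in> tabx. \<forall>x\<in>N. rw s x = rw t x}" using tab_perm[OF t \<pi>(2)] \<pi>(1) by simp
next
  fix s assume "s \<in> {s \<in> tabx. \<forall>x\<in>N. rw s x = rw t x}"
  then have s: "s \<in> tabx" "\<And>x. x \<in> N \<Longrightarrow> rw s x = rw t x" by auto
  obtain \<pi> where \<pi>: "\<pi> permutes N" "s = \<pi> \<circ> t" by (rule tab_trans[OF s(1) t])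
  have "rw t (\<pi> x) = rw t x" if x: "x \<in> N" for x
  proof -
    have px: "\<pi> x \<in> N" using permutes_in_image[OF \<pi>(1)] x by simp
    have "rw t (\<pi> x) = rw (\<pi> \<circ> t) (\<pi> x)" using s(2)[OF px] \<pi>(2) by simp
    also have "\<dots> = rw t x" using rw_perm[OF t \<pi>(1) px] permutes_inverses(2)[OF \<pi>(1)] by simp
    finally show ?thesis .
  qed
  then have "\<pi> \<in> row_stabilizer \<mu> t" using row_stabilizer_iff[OF t] \<pi>(1) by simp
  then show "s \<in> tabloid \<mu> t" using \<pi>(2) by (auto simp: tabloid_def)
qed

lemma tabloid_eq_iff:
  assumes "s \<in> tabx" "t \<in> tabx"
  shows "tabloid \<mu> s = tabloid \<mu> t \<longleftrightarrow> (\<forall>x\<in>N. rw s x = rw t x)"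
  unfolding tabloid_eq[OF assms(1)] tabloid_eq[OF assms(2)] using assms by auto

lemma tabloid_perm:
  assumes t: "t \<in> tabx" and \<pi>: "\<pi> permutes N"
  shows "(\<circ>) \<pi> ` tabloid \<mu> t = tabloid \<mu> (\<pi> \<circ> t)"
proof -
  have sub: "(\<circ>) \<pi> ` tabloid \<mu> t \<subseteq> tabloid \<mu> (\<pi> \<circ> t)" if t: "t \<in> tabx" and \<pi>: "\<pi> permutes N" for t \<pi>
  proof
    fix s assume "s \<in> (\<circ>) \<pi> ` tabloid \<mu> t"
    then obtain s' where s': "s = \<pi> \<circ> s'" "s' \<in> tabx" "\<forall>x\<in>N. rw s' x = rw t x" unfolding tabloid_eq[OF t] by auto
    have "rw s x = rw (\<pi> \<circ> t) x" if "x \<in> N" for x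
      using rw_perm[OF s'(2) \<pi> that] rw_perm[OF t \<pi> that] s' permutes_in_image[OF permutes_inv[OF \<pi>]] that by simp
    then show "s \<in> tabloid \<mu> (\<pi> \<circ> t)" unfolding tabloid_eq[OF tab_perm[OF t \<pi>]] using tab_perm[OF s'(2) \<pi>] s' by simp
  qed
  have "tabloid \<mu> (\<pi> \<circ> t) \<subseteq> (\<circ>) \<pi> ` tabloid \<mu> t"
  proof
    fix s assume s: "s \<in> tabloid \<mu> (\<pi> \<circ> t)"
    have "iv \<pi> \<circ> s \<in> tabloid \<mu> (iv \<pi> \<circ> (\<pi> \<circ> t))" using sub[OF tab_perm[OF t \<pi>] permutes_inv[OF \<pi>]] s by blast
    moreover have "iv \<pi> \<circ> (\<pi> \<circ> t) = t" "\<pi> \<circ> (iv \<pi> \<circ> s) = s"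
      using permutes_inv_o[OF \<pi>] by (simp_all add: o_assoc)
    ultimately show "s \<in> (\<circ>) \<pi> ` tabloid \<mu> t" by (metis imageI)
  qed
  with sub[OF t \<pi>] show ?thesis by blast
qed

lemma ex_tableau: "\<exists>t. t \<in> tabx"
proof -
  have "card D = card N" using card_D by simp
  then obtain f where f: "bij_betw f D N" using finite_same_card_bij[OF finite_D, of N] by auto
  define t where "t p = (if p \<in> D then f p else 0)" for p
  have "bij_betw t D N" by (rule bij_betw_cong[THEN iffD1, OF _ f]) (simp add: t_def)
  then show ?thesis by (intro exI[of _ t]) (simp add: tableaux_def t_def)
qed

section \<open>Specht modules and the action of column antisymmetrizers\<close>

section \<open>Specht modules\<close>

subsection \<open>The permutation module\<close>

definition pact :: "(nat \<Rightarrow> nat) \<Rightarrow> ((nat \<times> nat \<Rightarrow> nat) set \<Rightarrow>\<^sub>0 'k::field) \<Rightarrow> ((nat \<times> nat \<Rightarrow> nat) set \<Rightarrow>\<^sub>0 'k)"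
  where "pact \<pi> = lin_ext (\<lambda>T. basis ((\<circ>) \<pi> ` T))"

abbreviation PM :: "((nat \<times> nat \<Rightarrow> nat) set \<Rightarrow>\<^sub>0 'k::field) set"
  where "PM \<equiv> free_space (tabloid \<mu> ` tabx)"

lemma pact_simps [simp]: "pact \<pi> 0 = 0" "pact \<pi> (x + y) = pact \<pi> x + pact \<pi> y"
  "pact \<pi> (scale c x) = scale c (pact \<pi> x)" "pact \<pi> (basis T) = basis ((\<circ>) \<pi> ` T)"
  "pact \<pi> (pact \<sigma> x) = pact (\<pi> \<circ> \<sigma>) x" "pact id x = x"
proof -
  show "pact \<pi> (pact \<sigma> x) = pact (\<pi> \<circ> \<sigma>) x"
    unfolding pact_def lin_ext_comp by (simp add: image_image o_assoc)
  show "pact id x = x"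
    unfolding pact_def by simp
qed (simp_all add: pact_def)

lemma pact_sum: "pact \<pi> (\<Sum>i\<in>I. f i) = (\<Sum>i\<in>I. pact \<pi> (f i))"
  by (simp add: pact_def lin_ext_sum)

lemma pact_tabloid: "t \<in> tabx \<Longrightarrow> \<pi> permutes N \<Longrightarrow> pact \<pi> (basis (tabloid \<mu> t)) = basis (tabloid \<mu> (\<pi> \<circ> t))"
  by (simp add: tabloid_perm)

lemma pact_closed: "x \<in> PM \<Longrightarrow> \<pi> permutes N \<Longrightarrow> pact \<pi> x \<in> PM"
  unfolding pact_def by (rule lin_ext_closed) (auto simp: tabloid_perm intro!: free_space_simps tab_perm)

lemma perm_module_simps [simp]: "carrier (perm_module \<mu>) = PM" "zero (perm_module \<mu>) = 0"
  "add (perm_module \<mu>) = (+)" "module.smult (perm_module \<mu>) = scale"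
  "act (perm_module \<mu>) = (\<lambda>a x. lin_ext (\<lambda>\<pi>. pact \<pi> x) a)"
  by (simp_all add: perm_module_def pact_def)

lemma srep_perm_module: "srep n (perm_module \<mu> :: ('k::field, _, _) rep)"
proof -
  have "lrep (sym_algebra n) (perm_module \<mu> :: ('k, _, _) rep)"
    unfolding perm_module_def
  proof (rule lrep_free_rep)
    fix a :: "(nat \<Rightarrow> nat) \<Rightarrow>\<^sub>0 'k" and x :: "(nat \<times> nat \<Rightarrow> nat) set \<Rightarrow>\<^sub>0 'k"
    assume "a \<in> sym_algebra n" "x \<in> PM"
    then show "lin_ext (\<lambda>\<pi>. lin_ext (\<lambda>T. basis ((\<circ>) \<pi> ` T)) x) a \<in> PM"
      using pact_closed[of x] unfolding pact_def[symmetric] sym_algebra_def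
      by (intro lin_ext_closed[of a]) auto
  qed (simp_all add: lin_ext_add_fun lin_ext_scale_fun)
  then show ?thesis unfolding srep_def by simp
qed

lemma finite_column_stabilizer: "finite (column_stabilizer \<mu> t)"
  by (rule finite_subset[OF _ finite_perms[of n]]) (auto simp: column_stabilizer_def)

text \<open>James's signed column sum of \<open>t\<close>, as an operator on the permutation module
  and not as an element of the group algebra.\<close>

definition kap :: "(nat \<times> nat \<Rightarrow> nat) \<Rightarrow> ((nat \<times> nat \<Rightarrow> nat) set \<Rightarrow>\<^sub>0 'k::field) \<Rightarrow> ((nat \<times> nat \<Rightarrow> nat) set \<Rightarrow>\<^sub>0 'k)"
  where "kap t x = (\<Sum>\<rho>\<in>column_stabilizer \<mu> t. scale (of_int (sign \<rho>)) (pact \<rho> x))"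

lemma kap_simps [simp]: "kap t 0 = 0" "kap t (x + y) = kap t x + kap t y" "kap t (scale c x) = scale c (kap t x)"
  by (simp_all add: kap_def sum.distrib scale_sum mult.commute)

lemma polytabloid_kap: "t \<in> tabx \<Longrightarrow> polytabloid \<mu> t = kap t (basis (tabloid \<mu> t))"
  unfolding polytabloid_def kap_def
  by (intro sum.cong refl arg_cong2[of _ _ _ _ scale]) (auto simp: column_stabilizer_def pact_tabloid simp del: pact_simps)

lemma permN: "\<pi> permutes N \<Longrightarrow> permutation \<pi>"
  using permutation_permutes by (metis finite_atLeastAtMost)

lemma of_int_sign_square: "of_int (sign \<pi>) * of_int (sign \<pi>) = (1 :: 'k::field)"
  by (metis mult_1 of_int_1 of_int_mult sign_idempotent)

text \<open>Conjugation by \<open>\<pi>\<close> matches the column stabilizers of \<open>t\<close>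
  and \<open>\<pi> \<circ> t\<close> and preserves signs.\<close>

lemma pact_kap:
  assumes t: "t \<in> tabx" and \<pi>: "\<pi> permutes N"
  shows "pact \<pi> (kap t x) = kap (\<pi> \<circ> t) (pact \<pi> x)"
proof -
  note t' = tab_perm[OF t \<pi>]
  have io: "\<pi> \<circ> iv \<pi> = id" "iv \<pi> \<circ> \<pi> = id" using permutes_inv_o[OF \<pi>] by simp_all
  have ivo: "iv (iv \<pi>) = \<pi>" using permutes_inv_inv[OF \<pi>] .
  let ?c = "\<lambda>\<rho>. \<pi> \<circ> \<rho> \<circ> iv \<pi>" and ?d = "\<lambda>\<rho>. iv \<pi> \<circ> \<rho> \<circ> \<pi>"
  have inN: "\<pi> x \<in> N \<longleftrightarrow> x \<in> N" "iv \<pi> x \<in> N \<longleftrightarrow> x \<in> N" for x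
    using permutes_in_image[OF \<pi>] permutes_in_image[OF permutes_inv[OF \<pi>]] by auto
  have cl': "cl (\<pi> \<circ> t) x = cl t (iv \<pi> x)" if "x \<in> N" for x by (rule cl_perm[OF t \<pi> that])
  have c: "?c \<rho> \<in> column_stabilizer \<mu> (\<pi> \<circ> t)" if "\<rho> \<in> column_stabilizer \<mu> t" for \<rho>
  proof -
    have \<rho>: "\<rho> permutes N" "\<forall>x\<in>N. cl t (\<rho> x) = cl t x" using that column_stabilizer_iff[OF t] by auto
    have p: "?c \<rho> permutes N" using \<rho>(1) \<pi> permutes_inv by (intro permutes_compose) auto
    have "cl (\<pi> \<circ> t) (?c \<rho> x) = cl (\<pi> \<circ> t) x" if x: "x \<in> N" for x
    proof -
      have "?c \<rho> x \<in> N" using permutes_in_image[OF p] x by simp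
      then have "cl (\<pi> \<circ> t) (?c \<rho> x) = cl t (\<rho> (iv \<pi> x))"
        using cl' permutes_inverses(2)[OF \<pi>] by simp
      then show ?thesis using \<rho>(2) inN x cl' by simp
    qed
    then show ?thesis using column_stabilizer_iff[OF t'] p by simp
  qed
  have d: "?d \<rho> \<in> column_stabilizer \<mu> t" if "\<rho> \<in> column_stabilizer \<mu> (\<pi> \<circ> t)" for \<rho>
  proof -
    have \<rho>: "\<rho> permutes N" "\<forall>x\<in>N. cl (\<pi> \<circ> t) (\<rho> x) = cl (\<pi> \<circ> t) x" using that column_stabilizer_iff[OF t'] by auto
    have p: "?d \<rho> permutes N" using \<rho>(1) \<pi> permutes_inv by (intro permutes_compose) auto
    have "cl t (?d \<rho> x) = cl t x" if x: "x \<in> N" for x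
    proof -
      have "\<rho> (\<pi> x) \<in> N" using permutes_in_image[OF \<rho>(1)] inN x by simp
      then have "cl t (?d \<rho> x) = cl (\<pi> \<circ> t) (\<rho> (\<pi> x))" using cl' by simp
      also have "\<dots> = cl t x" using \<rho>(2) inN x cl'[of "\<pi> x"] permutes_inverses(2)[OF \<pi>] by simp
      finally show ?thesis .
    qed
    then show ?thesis using column_stabilizer_iff[OF t] p by simp
  qed
  have dc: "?d (?c \<rho>) = \<rho>" and cd: "?c (?d \<rho>) = \<rho>" for \<rho>
    using permutes_inverses[OF \<pi>] by (simp_all add: fun_eq_iff)
  have bij: "bij_betw ?c (column_stabilizer \<mu> t) (column_stabilizer \<mu> (\<pi> \<circ> t))"
    by (rule bij_betw_byWitness[where f' = ?d]) (use c d dc cd in auto)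
  have sgn: "sign (?c \<rho>) = sign \<rho>" if "\<rho> \<in> column_stabilizer \<mu> t" for \<rho>
  proof -
    have "\<rho> permutes N" using that column_stabilizer_iff[OF t] by auto
    then have "permutation \<rho>" "permutation \<pi>" "permutation (iv \<pi>)" using permN \<pi> permutes_inv[OF \<pi>] by auto
    then show ?thesis
      by (simp add: sign_compose permutation_compose sign_inverse)
  qed
  have "kap (\<pi> \<circ> t) (pact \<pi> x) = (\<Sum>\<rho>\<in>column_stabilizer \<mu> t. scale (of_int (sign (?c \<rho>))) (pact (?c \<rho>) (pact \<pi> x)))"
    unfolding kap_def by (rule sum.reindex_bij_betw[OF bij, symmetric])
  also have "\<dots> = (\<Sum>\<rho>\<in>column_stabilizer \<mu> t. pact \<pi> (scale (of_int (sign \<rho>)) (pact \<rho> x)))"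
  proof (intro sum.cong refl)
    fix \<rho> assume \<rho>: "\<rho> \<in> column_stabilizer \<mu> t"
    have "?c \<rho> \<circ> \<pi> = \<pi> \<circ> \<rho>" using permutes_inverses[OF \<pi>] by (simp add: fun_eq_iff)
    then show "scale (of_int (sign (?c \<rho>))) (pact (?c \<rho>) (pact \<pi> x)) = pact \<pi> (scale (of_int (sign \<rho>)) (pact \<rho> x))"
      using sgn[OF \<rho>] by simp
  qed
  finally show ?thesis by (simp add: kap_def pact_sum)
qed

lemma pact_polytabloid:
  assumes "t \<in> tabx" "\<pi> permutes N"
  shows "pact \<pi> (polytabloid \<mu> t) = polytabloid \<mu> (\<pi> \<circ> t)"
  unfolding polytabloid_kap[OF assms(1)] polytabloid_kap[OF tab_perm[OF assms]] pact_kap[OF assms]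
    pact_tabloid[OF assms] ..

lemma kap_mult_right:
  assumes t: "t \<in> tabx" and \<sigma>: "\<sigma> \<in> column_stabilizer \<mu> t"
  shows "kap t (pact \<sigma> x) = scale (of_int (sign \<sigma>)) (kap t x)"
proof -
  have \<sigma>': "\<sigma> permutes N" "\<forall>x\<in>N. cl t (\<sigma> x) = cl t x" using \<sigma> column_stabilizer_iff[OF t] by auto
  have cl\<sigma>: "cl t (iv \<sigma> x) = cl t x" if "x \<in> N" for x
    using \<sigma>'(2) permutes_in_image[OF permutes_inv[OF \<sigma>'(1)]] that permutes_inverses(1)[OF \<sigma>'(1)] by metis
  have "bij_betw (\<lambda>\<rho>. \<rho> \<circ> \<sigma>) (column_stabilizer \<mu> t) (column_stabilizer \<mu> t)"
  proof (rule bij_betw_byWitness[where f' = "\<lambda>\<rho>. \<rho> \<circ> iv \<sigma>"])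
    show "\<forall>\<rho>\<in>column_stabilizer \<mu> t. \<rho> \<circ> \<sigma> \<circ> iv \<sigma> = \<rho>" "\<forall>\<rho>\<in>column_stabilizer \<mu> t. \<rho> \<circ> iv \<sigma> \<circ> \<sigma> = \<rho>"
      using permutes_inverses[OF \<sigma>'(1)] by (simp_all add: fun_eq_iff)
    show "(\<lambda>\<rho>. \<rho> \<circ> \<sigma>) ` column_stabilizer \<mu> t \<subseteq> column_stabilizer \<mu> t"
      using \<sigma>' permutes_in_image[OF \<sigma>'(1)] by (auto simp: column_stabilizer_iff[OF t] intro!: permutes_compose)
    show "(\<lambda>\<rho>. \<rho> \<circ> iv \<sigma>) ` column_stabilizer \<mu> t \<subseteq> column_stabilizer \<mu> t"
      using cl\<sigma> permutes_inv[OF \<sigma>'(1)] permutes_in_image[OF permutes_inv[OF \<sigma>'(1)]]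
      by (auto simp: column_stabilizer_iff[OF t] intro!: permutes_compose)
  qed
  then have "kap t x = (\<Sum>\<rho>\<in>column_stabilizer \<mu> t. scale (of_int (sign (\<rho> \<circ> \<sigma>))) (pact (\<rho> \<circ> \<sigma>) x))"
    unfolding kap_def by (rule sum.reindex_bij_betw[symmetric])
  also have "\<dots> = (\<Sum>\<rho>\<in>column_stabilizer \<mu> t. scale (of_int (sign \<sigma>)) (scale (of_int (sign \<rho>)) (pact \<rho> (pact \<sigma> x))))"
  proof (intro sum.cong refl)
    fix \<rho> assume "\<rho> \<in> column_stabilizer \<mu> t"
    then have "sign (\<rho> \<circ> \<sigma>) = sign \<rho> * sign \<sigma>"
      using permN \<sigma>'(1) column_stabilizer_iff[OF t] by (simp add: sign_compose)
    then show "scale (of_int (sign (\<rho> \<circ> \<sigma>))) (pact (\<rho> \<circ> \<sigma>) x) =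
      scale (of_int (sign \<sigma>)) (scale (of_int (sign \<rho>)) (pact \<rho> (pact \<sigma> x)))" by (simp add: mult.commute)
  qed
  also have "\<dots> = scale (of_int (sign \<sigma>)) (kap t (pact \<sigma> x))"
    unfolding kap_def scale_sum ..
  finally have "scale (of_int (sign \<sigma>)) (kap t x) = scale (of_int (sign \<sigma>) * of_int (sign \<sigma>)) (kap t (pact \<sigma> x))" by simp
  then show ?thesis by (simp add: of_int_sign_square)
qed

subsection \<open>Column antisymmetrizers\<close>

text \<open>In the induction the largest element is at least the number of the others. The equality
  case is what turns an equation between sums of row indices into an equation between sets of
  rows.\<close>

lemma sum_inj_nat:
  fixes A :: "nat set"
  assumes "finite A"
  shows "\<Sum>{..<card A} \<le> \<Sum>A" and "\<Sum>A = \<Sum>{..<card A} \<Longrightarrow> A = {..<card A}"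
proof -
  have "\<Sum>{..<card A} \<le> \<Sum>A \<and> (\<Sum>A = \<Sum>{..<card A} \<longrightarrow> A = {..<card A})"
    using assms
  proof (induction A rule: finite_linorder_max_induct)
    case (insert b A)
    have "A \<subseteq> {..<b}" using insert by auto
    then have cb: "card A \<le> b" using card_mono[of "{..<b}" A] by simp
    have c: "card (insert b A) = Suc (card A)" "\<Sum>(insert b A) = b + \<Sum>A" using insert by auto
    then show ?case using insert cb by (auto simp: lessThan_Suc)
  qed simp
  then show "\<Sum>{..<card A} \<le> \<Sum>A" "\<Sum>A = \<Sum>{..<card A} \<Longrightarrow> A = {..<card A}" by auto
qed

lemma sum_rw: "t \<in> tabx \<Longrightarrow> (\<Sum>x\<in>N. rw t x) = (\<Sum>p\<in>D. fst p)"
  using sum.reindex_bij_betw[OF bij_betw_inv_into[OF tab_bij], of t fst] by (simp add: rw_def pos_def)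

lemma rw_column:
  assumes t: "t \<in> tabx"
  shows "rw t ` {x\<in>N. cl t x = c} = {..<card {x\<in>N. cl t x = c}}" and "inj_on (rw t) {x\<in>N. cl t x = c}"
proof -
  show inj: "inj_on (rw t) {x\<in>N. cl t x = c}" using rw_cl_inj[OF t] by (auto simp: inj_on_def)
  have "rw t ` {x\<in>N. cl t x = c} = {i. (i, c) \<in> D}"
  proof (intro equalityI subsetI)
    fix i assume "i \<in> {i. (i, c) \<in> D}"
    then show "i \<in> rw t ` {x\<in>N. cl t x = c}"
      using tab_in[OF t] rw_cl[OF t] by (intro image_eqI[of _ _ "t (i, c)"]) auto
  qed (use rw_cl[OF t] in auto)
  moreover have "\<exists>k. {i. (i, c) \<in> D} = {..<k}"
  proof (cases "{i. (i, c) \<in> D} = {}")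
    case False
    have fin: "finite {i. (i, c) \<in> D}" by (rule finite_subset[OF _ finite_imageI[OF finite_D, of fst]]) force
    let ?m = "Max {i. (i, c) \<in> D}"
    have "{i. (i, c) \<in> D} = {..<Suc ?m}"
    proof (intro equalityI subsetI)
      fix i assume "i \<in> {..<Suc ?m}"
      then have "i \<le> ?m" by simp
      moreover have "(?m, c) \<in> D" using Max_in[OF fin False] by simp
      ultimately show "i \<in> {i. (i, c) \<in> D}" using D_down by blast
    next
      fix i assume "i \<in> {i. (i, c) \<in> D}"
      then show "i \<in> {..<Suc ?m}" using Max_ge[OF fin, of i] by simp
    qed
    then show ?thesis by blast
  qed auto
  ultimately obtain k where k: "rw t ` {x\<in>N. cl t x = c} = {..<k}" by auto
  then have "card {x\<in>N. cl t x = c} = k" using card_image[OF inj] by simp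
  with k show "rw t ` {x\<in>N. cl t x = c} = {..<card {x\<in>N. cl t x = c}}" by simp
qed

text \<open>
  If the entries of each column of \<open>t\<close> lie in distinct rows of \<open>s\<close>, then comparing the sums of
  all row indices shows that they fill the same rows as in \<open>t\<close>.
\<close>

lemma column_straighten:
  assumes s: "s \<in> tabx" and t: "t \<in> tabx"
    and inj: "\<And>x y. x \<in> N \<Longrightarrow> y \<in> N \<Longrightarrow> rw s x = rw s y \<Longrightarrow> cl t x = cl t y \<Longrightarrow> x = y"
  obtains \<pi> where "\<pi> \<in> column_stabilizer \<mu> t" "tabloid \<mu> s = tabloid \<mu> (\<pi> \<circ> t)"
proof -
  let ?A = "\<lambda>c. {x\<in>N. cl t x = c}"
  have injs: "inj_on (rw s) (?A c)" for c using inj by (auto simp: inj_on_def)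
  have cd: "card (rw s ` ?A c) = card (?A c)" for c by (rule card_image[OF injs])
  have st: "\<Sum>(rw t ` ?A c) = (\<Sum>x\<in>?A c. rw t x)" for c
    using sum.reindex[OF rw_column(2)[OF t, of c], of "\<lambda>i. i"] by simp
  have ss: "\<Sum>(rw s ` ?A c) = (\<Sum>x\<in>?A c. rw s x)" for c
    using sum.reindex[OF injs[of c], of "\<lambda>i. i"] by simp
  have le: "(\<Sum>x\<in>?A c. rw t x) \<le> (\<Sum>x\<in>?A c. rw s x)" for c
    using sum_inj_nat(1)[of "rw s ` ?A c"] unfolding cd ss st[symmetric] rw_column(1)[OF t, of c] by simp
  have split: "(\<Sum>x\<in>N. f x) = (\<Sum>c\<in>cl t ` N. \<Sum>x\<in>?A c. f x)" for f :: "nat \<Rightarrow> nat"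
    by (rule sum.image_gen) simp
  have "(\<Sum>c\<in>cl t ` N. \<Sum>x\<in>?A c. rw t x) = (\<Sum>c\<in>cl t ` N. \<Sum>x\<in>?A c. rw s x)"
    using sum_rw[OF s] sum_rw[OF t] split by metis
  then have eq: "(\<Sum>x\<in>?A c. rw t x) = (\<Sum>x\<in>?A c. rw s x)" if "c \<in> cl t ` N" for c
    using sum_mono_inv[of "\<lambda>c. \<Sum>x\<in>?A c. rw t x" "cl t ` N" "\<lambda>c. \<Sum>x\<in>?A c. rw s x" c] le that by simp
  have im: "rw s ` ?A c = rw t ` ?A c" if c: "c \<in> cl t ` N" for c
  proof -
    have "\<Sum>(rw s ` ?A c) = \<Sum>{..<card (rw s ` ?A c)}"
      unfolding cd rw_column(1)[OF t, of c, symmetric] st ss using eq[OF c] by simp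
    then have "rw s ` ?A c = {..<card (rw s ` ?A c)}" by (intro sum_inj_nat(2)) simp_all
    then show ?thesis using rw_column(1)[OF t, of c] card_image[OF injs[of c]] by simp
  qed
  \<comment> \<open>\<open>f\<close> sends \<open>x\<close> to the entry of \<open>t\<close> in the
    column of \<open>x\<close> and in the row that \<open>s\<close> assigns to \<open>x\<close>; the
    cell exists because both tableaux fill the same rows in each column. The permutation sought is
    the inverse of \<open>f\<close>.\<close>
  define f where "f x = (if x \<in> N then t (rw s x, cl t x) else x)" for x
  have inD: "(rw s x, cl t x) \<in> D" if x: "x \<in> N" for x
  proof -
    have "rw s x \<in> rw t ` ?A (cl t x)" using im[of "cl t x"] x by auto
    then obtain y where "y \<in> N" "cl t y = cl t x" "rw s x = rw t y" by auto
    then show ?thesis using rw_cl(1)[OF t, of y] by simp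
  qed
  have "inj_on f N"
  proof (rule inj_onI)
    fix x y assume x: "x \<in> N" and y: "y \<in> N" and "f x = f y"
    then have "t (rw s x, cl t x) = t (rw s y, cl t y)" by (simp add: f_def)
    then have "(rw s x, cl t x) = (rw s y, cl t y)" using pos_tab[OF t] inD[OF x] inD[OF y] by metis
    then show "x = y" using inj x y by simp
  qed
  moreover have "f ` N \<subseteq> N" using inD tab_in[OF t] by (auto simp: f_def)
  ultimately have "bij_betw f N N" by (simp add: bij_betw_def endo_inj_surj)
  then have f: "f permutes N" by (intro bij_imp_permutes) (auto simp: f_def)
  have cf: "cl t (f x) = cl t x" and rf: "rw t (f x) = rw s x" if "x \<in> N" for x
    using rw_cl(3,4)[OF t inD[OF that]] that by (simp_all add: f_def)
  have inv: "iv f x \<in> N" if "x \<in> N" for x using permutes_in_image[OF permutes_inv[OF f]] that by simp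
  have "iv f \<in> column_stabilizer \<mu> t"
    unfolding column_stabilizer_iff[OF t]
  proof (intro conjI ballI permutes_inv[OF f])
    fix x assume "x \<in> N"
    then show "cl t (iv f x) = cl t x" using cf[OF inv] permutes_inverses(1)[OF f] by metis
  qed
  moreover have "tabloid \<mu> s = tabloid \<mu> (iv f \<circ> t)"
    unfolding tabloid_eq_iff[OF s tab_perm[OF t permutes_inv[OF f]]]
    using rw_perm[OF t permutes_inv[OF f]] rf permutes_inv_inv[OF f] by simp
  ultimately show thesis using that by blast
qed

context
  fixes dummy :: "'k::field"
  assumes char2: "CHAR('k) \<noteq> 2"
begin

lemma two_ne_zero: "(2 :: 'k) \<noteq> 0"
proof
  assume "(2 :: 'k) = 0"
  then have "of_nat 2 = (0 :: 'k)" by simp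
  then have "CHAR('k) dvd 2" by (simp only: of_nat_eq_0_iff_char_dvd)
  then have "CHAR('k) \<le> 2" "CHAR('k) \<noteq> 0" by (auto dest: dvd_imp_le intro: ccontr)
  moreover have "CHAR('k) \<noteq> 1" by (simp add: One_nat_def)
  ultimately show False using char2 by linarith
qed

text \<open>If two entries share a row of \<open>s\<close> and a column of \<open>t\<close>, their
  transposition fixes the tabloid but reverses the sign of the antisymmetrizer. The result equals
  its own negative and is zero because 2 is invertible. Otherwise \<open>s\<close> has the tabloid
  of a column permutation of \<open>t\<close>.\<close>

lemma kap_tabloid:
  assumes s: "s \<in> tabx" and t: "t \<in> tabx"
  shows "\<exists>c. kap t (basis (tabloid \<mu> s)) = scale (c :: 'k) (polytabloid \<mu> t)"
proof (cases "\<exists>x\<in>N. \<exists>y\<in>N. x \<noteq> y \<and> rw s x = rw s y \<and> cl t x = cl t y")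
  case True
  then obtain x y where xy: "x \<in> N" "y \<in> N" "x \<noteq> y" "rw s x = rw s y" "cl t x = cl t y" by auto
  let ?\<tau> = "transpose x y" and ?u = "basis (tabloid \<mu> s) :: _ \<Rightarrow>\<^sub>0 'k"
  have \<tau>: "?\<tau> permutes N" using xy by (intro permutes_swap_id)
  have "?\<tau> \<in> column_stabilizer \<mu> t"
    using \<tau> xy by (auto simp: column_stabilizer_iff[OF t] transpose_def)
  then have k: "kap t (pact ?\<tau> ?u) = scale (of_int (sign ?\<tau>)) (kap t ?u)"
    by (rule kap_mult_right[OF t])
  have "tabloid \<mu> (?\<tau> \<circ> s) = tabloid \<mu> s"
    unfolding tabloid_eq_iff[OF tab_perm[OF s \<tau>] s]
    using rw_perm[OF s \<tau>] xy by (auto simp: transpose_def)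
  then have u: "pact ?\<tau> ?u = ?u" unfolding pact_tabloid[OF s \<tau>] by simp
  have "kap t ?u = - kap t ?u" (is "?k = _")
    using k xy unfolding u by (simp add: sign_swap_id scale_minus)
  then have "?k + ?k = 0" by (simp add: eq_neg_iff_add_eq_0)
  then have "scale 2 ?k = 0" using scale_add_left[of 1 1 ?k] by simp
  then have "scale (inverse 2) (scale 2 ?k) = 0" by simp
  then have "?k = 0" using two_ne_zero by simp
  then show ?thesis by (intro exI[of _ 0]) simp
next
  case False
  then obtain \<pi> where \<pi>: "\<pi> \<in> column_stabilizer \<mu> t" "tabloid \<mu> s = tabloid \<mu> (\<pi> \<circ> t)"
    using column_straighten[OF s t] by metis
  then have "\<pi> permutes N" using column_stabilizer_iff[OF t] by simp
  then have "kap t (basis (tabloid \<mu> s)) = scale (of_int (sign \<pi>) :: 'k) (polytabloid \<mu> t)"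
    unfolding polytabloid_kap[OF t] kap_mult_right[OF t \<pi>(1), symmetric] \<pi>(2) by (subst pact_tabloid[OF t]) auto
  then show ?thesis by blast
qed

lemma kap_PM:
  assumes "u \<in> PM" and t: "t \<in> tabx"
  shows "\<exists>c. kap t u = scale (c :: 'k) (polytabloid \<mu> t)"
  using assms(1)
proof (induction rule: free_space_induct)
  case zero
  show ?case by (intro exI[of _ 0]) simp
next
  case (add u c T)
  then obtain s where s: "s \<in> tabx" "T = tabloid \<mu> s" by auto
  obtain a b where "kap t u = scale a (polytabloid \<mu> t)" "kap t (basis T) = scale (b :: 'k) (polytabloid \<mu> t)"
    using add kap_tabloid[OF s(1) t] s(2) by auto
  then have "kap t (u + scale c (basis T)) = scale (a + c * b) (polytabloid \<mu> t)"
    by (simp add: scale_add_left)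
  then show ?case by blast
qed

end

end

lemma srep_sub:
  assumes "srep n V" "is_submodule (sym_algebra n) V W"
  shows "srep n (sub_rep V W)"
  using assms lrep_sub_rep[of "sym_algebra n" V W] gen_carrier_local[OF assms(2)]
  unfolding srep_def by (simp add: subset_iff)

lemma srep_quot:
  fixes V :: "('k::field, _, 'v) rep"
  assumes "srep n V" "is_submodule (sym_algebra n) V M"
  shows "srep n (quot_rep V M)"
proof -
  have l: "lrep (sym_algebra n) V" using assms by (simp add: srep_def)
  note q = quot_act[OF l assms(2)]
  have b: "basis \<pi> \<in> (sym_algebra n :: (_ \<Rightarrow>\<^sub>0 'k) set)" if "\<pi> permutes {1..n}" for \<pi>
    using that by (simp add: sym_algebra_def)
  have id: "basis id \<in> (sym_algebra n :: (_ \<Rightarrow>\<^sub>0 'k) set)" by (rule b[OF permutes_id])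
  have cl: "a + c \<in> sym_algebra n" "scale d a \<in> sym_algebra n"
    if "a \<in> sym_algebra n" "c \<in> sym_algebra n" for a c :: "_ \<Rightarrow>\<^sub>0 'k" and d using that by (auto simp: sym_algebra_def)
  note c = lrepD(2)[OF l]
  show ?thesis
    unfolding srep_def carrier_quot_rep
  proof (intro conjI ballI allI impI, goal_cases)
    case 1
    show ?case by (rule lrep_quot_rep[OF l assms(2)])
  next
    case (2 a a' C)
    then obtain v where v: "C = M +>\<^bsub>V\<^esub> v" "v \<in> carrier V" by auto
    have "act V (a + a') v = act V a v \<oplus>\<^bsub>V\<^esub> act V a' v" using assms(1) 2 v by (simp add: srep_def)
    then show ?case
      unfolding v(1) q[OF cl(1)[OF 2(1,2)] v(2)] q[OF 2(1) v(2)] q[OF 2(2) v(2)] quot_add[OF l assms(2) c[OF 2(1) v(2)] c[OF 2(2) v(2)]]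
      by simp
  next
    case (3 d a C)
    then obtain v where v: "C = M +>\<^bsub>V\<^esub> v" "v \<in> carrier V" by auto
    have "act V (scale d a) v = d \<odot>\<^bsub>V\<^esub> act V a v" using assms(1) 3 v by (simp add: srep_def)
    then show ?case
      unfolding v(1) q[OF cl(2)[OF 3(1) 3(1)] v(2)] q[OF 3(1) v(2)] quot_smult[OF l assms(2) c[OF 3(1) v(2)]]
      by simp
  next
    case (4 \<pi> \<sigma> C)
    then obtain v where v: "C = M +>\<^bsub>V\<^esub> v" "v \<in> carrier V" by auto
    have "act V (basis \<pi>) (act V (basis \<sigma>) v) = act V (basis (\<pi> \<circ> \<sigma>)) v" using assms(1) 4 v by (simp add: srep_def)
    then show ?case
      unfolding v(1) q[OF b[OF permutes_compose[OF 4(3,2)]] v(2)] q[OF b[OF 4(3)] v(2)] q[OF b[OF 4(2)] c[OF b[OF 4(3)] v(2)]]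
      by simp
  next
    case (5 C)
    then obtain v where v: "C = M +>\<^bsub>V\<^esub> v" "v \<in> carrier V" by auto
    have "act V (basis id) v = v" using assms(1) v by (simp add: srep_def)
    then show ?case unfolding v(1) q[OF id v(2)] by simp
  qed
qed

subsection \<open>Counting permutations that preserve a function\<close>

text \<open>The permutations form a product of symmetric groups on the fibres of \<open>g\<close>,
  of order a product of factorials. The induction adds one point at a time, which multiplies the
  order by the current size of its fibre.\<close>

lemma card_preserving_perms:
  fixes g :: "nat \<Rightarrow> 'b"
  assumes "finite A" "\<And>x k. x \<in> A \<Longrightarrow> 0 < k \<Longrightarrow> k \<le> card {y\<in>A. g y = g x} \<Longrightarrow> of_nat k \<noteq> (0 :: 'k::field)"
  shows "of_nat (card {\<pi>. \<pi> permutes A \<and> (\<forall>x\<in>A. g (\<pi> x) = g x)}) \<noteq> (0 :: 'k)"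
  using assms
proof (induction A rule: finite_induct)
  case empty
  have "{\<pi>. \<pi> permutes ({} :: nat set) \<and> (\<forall>x\<in>{}. g (\<pi> x) = g x)} = {id}" by auto
  then show ?case by simp
next
  case (insert a A)
  let ?P = "\<lambda>A. {\<pi>. \<pi> permutes A \<and> (\<forall>x\<in>A. g (\<pi> x) = g x)}"
  let ?B = "{b\<in>insert a A. g b = g a}"
  let ?f = "\<lambda>(b, p). transpose a b \<circ> p"
  \<comment> \<open>\<open>b\<close> is the image of \<open>a\<close> under the permutation and lies
    in the same fibre; what remains after undoing this transposition fixes \<open>a\<close>.\<close>
  have eq: "?P (insert a A) = ?f ` (?B \<times> ?P A)"
  proof (intro equalityI subsetI)
    fix \<pi> assume \<pi>: "\<pi> \<in> ?P (insert a A)"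
    then have "\<pi> \<in> ?f ` {(b, p). b \<in> insert a A \<and> p \<in> {p. p permutes A}}"
      using permutes_insert[of a A] by blast
    then obtain b p where bp: "\<pi> = transpose a b \<circ> p" "b \<in> insert a A" "p permutes A" by auto
    have pa: "p a = a" using permutes_not_in[OF bp(3)] insert by auto
    have "g (\<pi> a) = g a" using \<pi> by auto
    then have gb: "g b = g a" using pa bp by simp
    have "g (transpose a b y) = g y" for y using gb by (auto simp: transpose_def)
    then have "g (p x) = g x" if "x \<in> A" for x using \<pi> that bp(1) by auto
    then show "\<pi> \<in> ?f ` (?B \<times> ?P A)" using bp gb by (intro image_eqI[of _ _ "(b, p)"]) auto
  next
    fix \<pi> assume "\<pi> \<in> ?f ` (?B \<times> ?P A)"
    then obtain b p where bp: "\<pi> = transpose a b \<circ> p" "b \<in> insert a A" "g b = g a" "p permutes A" "\<forall>x\<in>A. g (p x) = g x"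
      by auto
    have pa: "p a = a" using permutes_not_in[OF bp(4)] insert by auto
    have gt: "g (transpose a b y) = g y" for y using bp by (auto simp: transpose_def)
    have "\<pi> permutes insert a A"
      unfolding bp(1) using bp by (intro permutes_compose[OF permutes_subset[OF bp(4)]] permutes_swap_id) auto
    then show "\<pi> \<in> ?P (insert a A)" using bp gt pa by auto
  qed
  have inj: "inj_on ?f (?B \<times> ?P A)"
  proof (rule inj_onI, clarify)
    fix b p c q assume p: "p permutes A" and q: "q permutes A" and eq: "transpose a b \<circ> p = transpose a c \<circ> q"
    have "p a = a" "q a = a" using permutes_not_in p q insert by auto
    then have "b = c" using fun_cong[OF eq, of a] by simp
    then have "transpose a b \<circ> (transpose a b \<circ> p) = transpose a b \<circ> (transpose a b \<circ> q)" using eq by simp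
    then show "b = c \<and> p = q" using \<open>b = c\<close> by (simp add: o_assoc)
  qed
  have "card (?P (insert a A)) = card ?B * card (?P A)"
    unfolding eq card_image[OF inj] by (rule card_cartesian_product)
  moreover have "of_nat (card ?B) \<noteq> (0 :: 'k)"
  proof (rule insert.prems[of a])
    show "0 < card ?B" using insert.hyps by (auto simp: card_gt_0_iff)
  qed simp_all
  moreover have "of_nat (card (?P A)) \<noteq> (0 :: 'k)"
  proof (rule insert.IH)
    fix x k assume x: "x \<in> A" "0 < k" "k \<le> card {y\<in>A. g y = g x}"
    have "card {y\<in>A. g y = g x} \<le> card {y\<in>insert a A. g y = g x}"
      using insert.hyps by (intro card_mono) auto
    then show "of_nat k \<noteq> (0 :: 'k)" using insert.prems[of x k] x by auto
  qed
  ultimately show ?case by simp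
qed

lemma stab_inv:
  assumes "\<rho> permutes A"
  shows "(\<forall>x\<in>A. g (inv_into UNIV \<rho> x) = g x) \<longleftrightarrow> (\<forall>x\<in>A. g (\<rho> x) = g x)"
proof
  assume l: "\<forall>x\<in>A. g (inv_into UNIV \<rho> x) = g x"
  show "\<forall>x\<in>A. g (\<rho> x) = g x"
  proof
    fix x assume "x \<in> A"
    then have "\<rho> x \<in> A" using permutes_in_image[OF assms] by simp
    then show "g (\<rho> x) = g x" using l permutes_inverses(2)[OF assms] by metis
  qed
next
  assume r: "\<forall>x\<in>A. g (\<rho> x) = g x"
  show "\<forall>x\<in>A. g (inv_into UNIV \<rho> x) = g x"
  proof
    fix x assume "x \<in> A"
    then have "inv_into UNIV \<rho> x \<in> A" using permutes_in_image[OF permutes_inv[OF assms]] by simp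
    then show "g (inv_into UNIV \<rho> x) = g x" using r permutes_inverses(1)[OF assms] by metis
  qed
qed

context partition
begin

subsection \<open>Reversing the rows of a tableau\<close>

text \<open>The comparison tableau of James's argument: it has the same tabloid as \<open>t\<close>,
  but its columns are counted from the ends of the rows.\<close>

definition rev_tab :: "(nat \<times> nat \<Rightarrow> nat) \<Rightarrow> nat \<times> nat \<Rightarrow> nat"
  where "rev_tab t = (\<lambda>(i, j). if (i, j) \<in> D then t (i, \<mu> ! i - 1 - j) else 0)"

context
  fixes t assumes t: "t \<in> tabx"
begin

abbreviation len :: "nat \<Rightarrow> nat"
  where "len x \<equiv> \<mu> ! rw t x"

lemma rev_tab_in: "rev_tab t \<in> tabx"
proof -
  have "bij_betw (\<lambda>(i, j). (i, \<mu> ! i - 1 - j)) D D"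
    by (rule bij_betw_byWitness[where f' = "\<lambda>(i, j). (i, \<mu> ! i - 1 - j)"]) (auto simp: D_iff)
  from bij_betw_trans[OF this tab_bij[OF t]] have "bij_betw (rev_tab t) D N"
    by (rule bij_betw_cong[THEN iffD1, rotated]) (auto simp: rev_tab_def)
  then show ?thesis by (auto simp: tableaux_def rev_tab_def)
qed

lemma rw_cl_rev:
  assumes x: "x \<in> N"
  shows rw_rev: "rw (rev_tab t) x = rw t x" and cl_rev: "cl (rev_tab t) x = len x - 1 - cl t x"
    and cl_less: "cl t x < len x"
proof -
  have D: "(rw t x, cl t x) \<in> D" using rw_cl(1)[OF t x] .
  then show "cl t x < len x" by (simp add: D_iff)
  then have D': "(rw t x, len x - 1 - cl t x) \<in> D" using D by (auto simp: D_iff)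
  have "rev_tab t (rw t x, len x - 1 - cl t x) = x"
    using D' \<open>cl t x < len x\<close> rw_cl(2)[OF t x] by (simp add: rev_tab_def)
  then show "rw (rev_tab t) x = rw t x" "cl (rev_tab t) x = len x - 1 - cl t x"
    using rw_cl(3,4)[OF rev_tab_in D'] by simp_all
qed

abbreviation "Cs \<equiv> column_stabilizer \<mu> t"
abbreviation "Cr \<equiv> column_stabilizer \<mu> (rev_tab t)"

text \<open>These permutations keep the distance of an entry from both ends of its row, while the
  row may change to another one of equal length. They form a Young subgroup, whose order turns up as
  a coefficient.\<close>

definition G :: "(nat \<Rightarrow> nat) set"
  where "G = {\<pi>. \<pi> permutes N \<and> (\<forall>x\<in>N. (cl t (\<pi> x), len (\<pi> x)) = (cl t x, len x))}"

lemma G_sub: "G \<subseteq> Cs" "G \<subseteq> Cr"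
proof -
  show "G \<subseteq> Cs" by (auto simp: G_def column_stabilizer_iff[OF t])
  show "G \<subseteq> Cr"
  proof
    fix \<pi> assume \<pi>: "\<pi> \<in> G"
    then have p: "\<pi> permutes N" by (simp add: G_def)
    have "cl (rev_tab t) (\<pi> x) = cl (rev_tab t) x" if "x \<in> N" for x
      using cl_rev[OF that] cl_rev[of "\<pi> x"] permutes_in_image[OF p] that \<pi> by (simp add: G_def)
    then show "\<pi> \<in> Cr" using p column_stabilizer_iff[OF rev_tab_in] by simp
  qed
qed

text \<open>
  Entries are treated by increasing distance \<open>cl (rev_tab t) x\<close> from the end of their row. Once all
  smaller distances are settled, \<open>\<rho>\<close> can only lengthen rows at the current distance, while \<open>\<sigma>\<close>
  preserves the sum of the row lengths there.
\<close>

lemma common_tabloid_len: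
  assumes \<rho>: "\<rho> permutes N" "\<forall>x\<in>N. cl t (\<rho> x) = cl t x"
    and \<sigma>: "\<sigma> permutes N" "\<forall>x\<in>N. cl (rev_tab t) (\<sigma> x) = cl (rev_tab t) x"
    and eq: "\<forall>x\<in>N. rw t (\<rho> x) = rw t (\<sigma> x)"
  shows "x \<in> N \<Longrightarrow> len (\<rho> x) = len x"
proof -
  let ?d = "\<lambda>x. cl (rev_tab t) x"
  have inN: "\<rho> x \<in> N" "\<sigma> x \<in> N" if "x \<in> N" for x
    using permutes_in_image[OF \<rho>(1)] permutes_in_image[OF \<sigma>(1)] that by auto
  have dlt: "?d x = len x - 1 - cl t x" "cl t x < len x" if "x \<in> N" for x using cl_rev cl_less that by auto
  have "\<forall>x\<in>N. ?d x < j \<longrightarrow> len (\<rho> x) = len x" for j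
  proof (induction j)
    case (Suc j)
    let ?B = "{x\<in>N. ?d x < j}" and ?E = "{x\<in>N. ?d x = j}"
    \<comment> \<open>The settled entries are permuted among themselves, so no other entry can enter
      \<open>?B\<close>; at the current distance \<open>\<rho>\<close> cannot bring an entry closer
      to the end of its row.\<close>
    have "\<rho> ` ?B \<subseteq> ?B"
    proof (rule image_subsetI)
      fix x assume x: "x \<in> ?B"
      then have "len (\<rho> x) = len x" "cl t (\<rho> x) = cl t x" using Suc \<rho>(2) by auto
      then show "\<rho> x \<in> ?B" using dlt[of x] dlt[of "\<rho> x"] inN x by simp
    qed
    then have "\<rho> ` ?B = ?B" using permutes_inj_on[OF \<rho>(1)] by (intro endo_inj_surj) auto
    then have notB: "\<rho> x \<notin> ?B" if "x \<notin> ?B" for x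
      using that inj_image_mem_iff[OF permutes_inj[OF \<rho>(1)], of x ?B] by simp
    have ge: "len x \<le> len (\<rho> x)" if x: "x \<in> ?E" for x
    proof -
      have "?d (\<rho> x) \<ge> j" using notB[of x] x inN by auto
      then show ?thesis using dlt[of x] dlt[of "\<rho> x"] inN x \<rho>(2) by auto
    qed
    have "\<sigma> ` ?E \<subseteq> ?E" using inN \<sigma>(2) by auto
    then have "\<sigma> ` ?E = ?E" using permutes_inj_on[OF \<sigma>(1)] by (intro endo_inj_surj) auto
    then have bij: "bij_betw \<sigma> ?E ?E" using permutes_inj_on[OF \<sigma>(1)] by (simp add: bij_betw_def)
    have "(\<Sum>x\<in>?E. len (\<rho> x)) = (\<Sum>x\<in>?E. len (\<sigma> x))" using eq by (intro sum.cong) auto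
    also have "\<dots> = (\<Sum>x\<in>?E. len x)" by (rule sum.reindex_bij_betw[OF bij])
    finally have "len x = len (\<rho> x)" if "x \<in> ?E" for x
      using sum_mono_inv[of len ?E "\<lambda>x. len (\<rho> x)" x] ge that by simp
    then show ?case using Suc by (auto simp: less_Suc_eq)
  qed simp
  then show "x \<in> N \<Longrightarrow> len (\<rho> x) = len x" by blast
qed

text \<open>Equal tabloids mean that the inverses of \<open>\<rho>\<close> and
  \<open>\<sigma>\<close> send each entry to the same row. Once row lengths are known to be
  preserved, they also agree on the column in \<open>rev_tab t\<close>, and row and column determine
  an entry.\<close>

lemma common_tabloid:
  assumes \<rho>: "\<rho> \<in> Cs" and \<sigma>: "\<sigma> \<in> Cr"
  shows "tabloid \<mu> (\<sigma> \<circ> rev_tab t) = tabloid \<mu> (\<rho> \<circ> t) \<longleftrightarrow> \<sigma> = \<rho> \<and> \<rho> \<in> G"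
proof -
  have p: "\<rho> permutes N" "\<forall>x\<in>N. cl t (\<rho> x) = cl t x" using \<rho> column_stabilizer_iff[OF t] by auto
  have q: "\<sigma> permutes N" "\<forall>x\<in>N. cl (rev_tab t) (\<sigma> x) = cl (rev_tab t) x"
    using \<sigma> column_stabilizer_iff[OF rev_tab_in] by auto
  note p' = permutes_inv[OF p(1)] and q' = permutes_inv[OF q(1)]
  have cp: "\<forall>x\<in>N. cl t (iv \<rho> x) = cl t x" using stab_inv[OF p(1), of "cl t"] p(2) by simp
  have cq: "\<forall>x\<in>N. cl (rev_tab t) (iv \<sigma> x) = cl (rev_tab t) x" using stab_inv[OF q(1), of "cl (rev_tab t)"] q(2) by simp
  have inN: "iv \<rho> x \<in> N" "iv \<sigma> x \<in> N" if "x \<in> N" for x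
    using permutes_in_image[OF p'] permutes_in_image[OF q'] that by auto
  have "tabloid \<mu> (\<sigma> \<circ> rev_tab t) = tabloid \<mu> (\<rho> \<circ> t) \<longleftrightarrow> (\<forall>x\<in>N. rw t (iv \<rho> x) = rw t (iv \<sigma> x))"
    unfolding tabloid_eq_iff[OF tab_perm[OF rev_tab_in q(1)] tab_perm[OF t p(1)]]
    using rw_perm[OF rev_tab_in q(1)] rw_perm[OF t p(1)] rw_rev inN by auto
  also have "\<dots> \<longleftrightarrow> \<sigma> = \<rho> \<and> \<rho> \<in> G"
  proof
    assume eq: "\<forall>x\<in>N. rw t (iv \<rho> x) = rw t (iv \<sigma> x)"
    have len: "\<forall>x\<in>N. len (iv \<rho> x) = len x"
      using common_tabloid_len[OF p' cp q' cq eq] by blast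
    then have "\<forall>x\<in>N. (cl t (iv \<rho> x), len (iv \<rho> x)) = (cl t x, len x)" using cp by simp
    then have G: "\<rho> \<in> G"
      using stab_inv[OF p(1), of "\<lambda>x. (cl t x, len x)"] p(1) by (simp add: G_def)
    have "iv \<sigma> x = iv \<rho> x" for x
    proof (cases "x \<in> N")
      case True
      have "cl (rev_tab t) (iv \<rho> x) = cl (rev_tab t) x"
        using cl_rev[OF inN(1)[OF True]] cl_rev[OF True] len cp True by simp
      then show ?thesis
        using rw_cl_inj[OF rev_tab_in inN(2,1)[OF True]] rw_rev inN[OF True] eq cq True by simp
    next
      case False
      then show ?thesis using permutes_not_in[OF p'] permutes_not_in[OF q'] by simp
    qed
    then have "iv \<sigma> = iv \<rho>" by auto
    then have "\<sigma> = \<rho>" using permutes_inv_inv[OF p(1)] permutes_inv_inv[OF q(1)] by metis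
    then show "\<sigma> = \<rho> \<and> \<rho> \<in> G" using G by simp
  qed auto
  finally show ?thesis .
qed

text \<open>The contributing pairs consist of an element of \<open>G\<close> and its inverse. Their
  signs are equal and multiply to 1, so nothing cancels and the coefficient counts
  \<open>G\<close>.\<close>

lemma lookup_kap_rev:
  "Poly_Mapping.lookup (kap t (polytabloid \<mu> (rev_tab t))) (tabloid \<mu> t) = (of_nat (card G) :: 'k::field)"
proof -
  let ?s = "\<lambda>\<rho>. of_int (sign \<rho>) :: 'k"
  have tm: "?s \<rho> * (\<Sum>\<sigma>\<in>Cr. ?s \<sigma> * Poly_Mapping.lookup (basis (tabloid \<mu> (\<rho> \<circ> (\<sigma> \<circ> rev_tab t)))) (tabloid \<mu> t)) =
      (if \<rho> \<in> G then 1 else 0)" if \<rho>: "\<rho> \<in> Cs" for \<rho>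
  proof -
    have p: "\<rho> permutes N" "\<forall>x\<in>N. cl t (\<rho> x) = cl t x" using \<rho> column_stabilizer_iff[OF t] by auto
    have iC: "iv \<rho> \<in> Cs"
      using stab_inv[OF p(1), of "cl t"] p permutes_inv[OF p(1)] column_stabilizer_iff[OF t] by simp
    have iG: "iv \<rho> \<in> G \<longleftrightarrow> \<rho> \<in> G"
      using stab_inv[OF p(1), of "\<lambda>x. (cl t x, len x)"] p(1) permutes_inv[OF p(1)] by (simp add: G_def)
    have iff: "tabloid \<mu> (\<rho> \<circ> (\<sigma> \<circ> rev_tab t)) = tabloid \<mu> t \<longleftrightarrow> \<sigma> = iv \<rho> \<and> \<rho> \<in> G" if \<sigma>: "\<sigma> \<in> Cr" for \<sigma>
    proof -
      have q: "\<sigma> permutes N" using \<sigma> column_stabilizer_iff[OF rev_tab_in] by auto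
      note s = tab_perm[OF rev_tab_in q]
      have "tabloid \<mu> (\<rho> \<circ> (\<sigma> \<circ> rev_tab t)) = tabloid \<mu> t \<longleftrightarrow> tabloid \<mu> (\<sigma> \<circ> rev_tab t) = tabloid \<mu> (iv \<rho> \<circ> t)"
      proof
        assume "tabloid \<mu> (\<rho> \<circ> (\<sigma> \<circ> rev_tab t)) = tabloid \<mu> t"
        then have "tabloid \<mu> (iv \<rho> \<circ> (\<rho> \<circ> (\<sigma> \<circ> rev_tab t))) = tabloid \<mu> (iv \<rho> \<circ> t)"
          using tabloid_perm[OF tab_perm[OF s p(1)] permutes_inv[OF p(1)]] tabloid_perm[OF t permutes_inv[OF p(1)]] by metis
        moreover have "iv \<rho> \<circ> (\<rho> \<circ> (\<sigma> \<circ> rev_tab t)) = \<sigma> \<circ> rev_tab t"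
          using permutes_inv_o(2)[OF p(1)] by (simp add: o_assoc)
        ultimately show "tabloid \<mu> (\<sigma> \<circ> rev_tab t) = tabloid \<mu> (iv \<rho> \<circ> t)" by simp
      next
        assume "tabloid \<mu> (\<sigma> \<circ> rev_tab t) = tabloid \<mu> (iv \<rho> \<circ> t)"
        then have "tabloid \<mu> (\<rho> \<circ> (\<sigma> \<circ> rev_tab t)) = tabloid \<mu> (\<rho> \<circ> (iv \<rho> \<circ> t))"
          using tabloid_perm[OF s p(1)] tabloid_perm[OF tab_perm[OF t permutes_inv[OF p(1)]] p(1)] by metis
        moreover have "\<rho> \<circ> (iv \<rho> \<circ> t) = t"
          using permutes_inv_o(1)[OF p(1)] by (simp add: o_assoc)
        ultimately show "tabloid \<mu> (\<rho> \<circ> (\<sigma> \<circ> rev_tab t)) = tabloid \<mu> t" by simp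
      qed
      then show ?thesis using common_tabloid[OF iC \<sigma>] iG by simp
    qed
    have "(\<Sum>\<sigma>\<in>Cr. ?s \<sigma> * Poly_Mapping.lookup (basis (tabloid \<mu> (\<rho> \<circ> (\<sigma> \<circ> rev_tab t)))) (tabloid \<mu> t)) =
        (\<Sum>\<sigma>\<in>Cr. if \<sigma> = iv \<rho> then (if \<rho> \<in> G then ?s \<sigma> else 0) else 0)"
      using iff by (intro sum.cong) (auto simp: lookup_basis)
    also have "\<dots> = (if iv \<rho> \<in> Cr then (if \<rho> \<in> G then ?s (iv \<rho>) else 0) else 0)"
      using finite_column_stabilizer by (simp add: sum.delta)
    also have "\<dots> = (if \<rho> \<in> G then ?s \<rho> else 0)"
      using iG G_sub(2) sign_inverse[OF permN[OF p(1)]] by auto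
    finally show ?thesis by (simp add: of_int_sign_square)
  qed
  have "kap t (polytabloid \<mu> (rev_tab t)) = (\<Sum>\<rho>\<in>Cs. \<Sum>\<sigma>\<in>Cr. scale (?s \<rho> * ?s \<sigma>) (basis (tabloid \<mu> (\<rho> \<circ> (\<sigma> \<circ> rev_tab t)))))"
    unfolding kap_def polytabloid_def pact_sum scale_sum
  proof (intro sum.cong refl)
    fix \<rho> \<sigma> assume "\<rho> \<in> Cs" "\<sigma> \<in> Cr"
    then have "\<rho> permutes N" "\<sigma> permutes N"
      using column_stabilizer_iff[OF t] column_stabilizer_iff[OF rev_tab_in] by auto
    then have "pact \<rho> (basis (tabloid \<mu> (\<sigma> \<circ> rev_tab t))) = (basis (tabloid \<mu> (\<rho> \<circ> (\<sigma> \<circ> rev_tab t))) :: _ \<Rightarrow>\<^sub>0 'k)"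
      by (intro pact_tabloid tab_perm rev_tab_in)
    then show "scale (?s \<rho>) (pact \<rho> (scale (?s \<sigma>) (basis (tabloid \<mu> (\<sigma> \<circ> rev_tab t))))) =
        scale (?s \<rho> * ?s \<sigma>) (basis (tabloid \<mu> (\<rho> \<circ> (\<sigma> \<circ> rev_tab t))))"
      unfolding pact_simps(3) by (simp del: pact_simps)
  qed
  then have "Poly_Mapping.lookup (kap t (polytabloid \<mu> (rev_tab t))) (tabloid \<mu> t) =
      (\<Sum>\<rho>\<in>Cs. ?s \<rho> * (\<Sum>\<sigma>\<in>Cr. ?s \<sigma> * Poly_Mapping.lookup (basis (tabloid \<mu> (\<rho> \<circ> (\<sigma> \<circ> rev_tab t)))) (tabloid \<mu> t)))"
    by (simp add: lookup_sum sum_distrib_left mult.assoc)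
  also have "\<dots> = (\<Sum>\<rho>\<in>Cs. if \<rho> \<in> G then 1 else 0)" by (intro sum.cong refl tm)
  also have "\<dots> = of_nat (card (Cs \<inter> G))"
    using finite_column_stabilizer by (simp add: sum.If_cases Int_def)
  also have "Cs \<inter> G = G" using G_sub by auto
  finally show ?thesis .
qed

text \<open>Entries with the same column and the same row length lie in different rows of that
  length. A fibre therefore has at most as many elements as the part has repetitions, which by
  regularity is less than p unless p = 0.\<close>

lemma card_G:
  assumes "\<mu> \<in> regular_partitions CHAR('k::field)"
  shows "of_nat (card G) \<noteq> (0 :: 'k)"
  unfolding G_def
proof (rule card_preserving_perms)
  fix x k assume x: "x \<in> N" and k: "0 < k" "k \<le> card {y\<in>N. (cl t y, len y) = (cl t x, len x)}"
  have "card {y\<in>N. (cl t y, len y) = (cl t x, len x)} \<le> card {i. i < length \<mu> \<and> \<mu> ! i = len x}"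
  proof (rule card_inj_on_le[of "rw t"])
    show "inj_on (rw t) {y\<in>N. (cl t y, len y) = (cl t x, len x)}" using rw_cl_inj[OF t] by (auto simp: inj_on_def)
    show "rw t ` {y\<in>N. (cl t y, len y) = (cl t x, len x)} \<subseteq> {i. i < length \<mu> \<and> \<mu> ! i = len x}"
      using rw_cl(1)[OF t] by (auto simp: D_iff)
  qed simp
  also have "\<dots> = count_list \<mu> (len x)"
    by (simp add: count_list_eq_length_filter length_filter_conv_card eq_commute)
  finally have "k \<le> count_list \<mu> (len x)" using k by simp
  then have "CHAR('k) = 0 \<or> k < CHAR('k)"
    using assms le_less_trans by (auto simp: regular_partitions_def)
  then have "\<not> CHAR('k) dvd k" using k(1) by (auto dest: dvd_imp_le)
  then show "of_nat k \<noteq> (0 :: 'k)" by (simp add: of_nat_eq_0_iff_char_dvd)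
qed simp

end

subsection \<open>The maximal submodule\<close>

lemma polytabloid_PM: "t \<in> tabx \<Longrightarrow> polytabloid \<mu> t \<in> PM"
  unfolding polytabloid_def
  by (intro free_space_sum free_space_simps imageI tab_perm) (auto simp: column_stabilizer_def)

abbreviation SP :: "((nat \<times> nat \<Rightarrow> nat) set \<Rightarrow>\<^sub>0 'k::field) set"
  where "SP \<equiv> carrier (specht \<mu>)"

lemma SP_eq: "SP = kspan (perm_module \<mu>) (polytabloid \<mu> ` tabx)"
  by (simp add: specht_def)

lemma specht_simps [simp]: "zero (specht \<mu>) = 0" "add (specht \<mu>) = (+)" "module.smult (specht \<mu>) = scale"
  "act (specht \<mu>) = (\<lambda>a x. lin_ext (\<lambda>\<pi>. pact \<pi> x) a)"
  by (simp_all add: specht_def)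

lemma lrep_perm_module: "lrep (sym_algebra n) (perm_module \<mu>)"
  using srep_perm_module by (simp add: srep_def)

lemma sub_SP: "is_submodule (sym_algebra n) (perm_module \<mu>) (SP :: (_ \<Rightarrow>\<^sub>0 'k::field) set)"
  unfolding SP_eq
proof (rule is_submodule_kspan[OF lrep_perm_module])
  let ?K = "kspan (perm_module \<mu>) (polytabloid \<mu> ` tabx) :: (_ \<Rightarrow>\<^sub>0 'k) set"
  show sub: "polytabloid \<mu> ` tabx \<subseteq> (carrier (perm_module \<mu>) :: (_ \<Rightarrow>\<^sub>0 'k) set)" using polytabloid_PM by auto
  fix a :: "(nat \<Rightarrow> nat) \<Rightarrow>\<^sub>0 'k" and s :: "(nat \<times> nat \<Rightarrow> nat) set \<Rightarrow>\<^sub>0 'k"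
  assume a: "a \<in> sym_algebra n" and "s \<in> polytabloid \<mu> ` tabx"
  then obtain t where t: "t \<in> tabx" "s = polytabloid \<mu> t" by auto
  have K: "submodule ?K base_field (perm_module \<mu>)"
    by (rule submodule_kspan[OF lrepD(1)[OF lrep_perm_module] sub])
  note K' = K[unfolded submodule_iff[OF lrepD(1)[OF lrep_perm_module]]]
  show "act (perm_module \<mu>) a s \<in> ?K"
    using a unfolding sym_algebra_def
  proof (induction rule: free_space_induct)
    case zero
    then show ?case using K' by simp
  next
    case (add a c \<pi>)
    have "pact \<pi> s \<in> ?K"
      using add pact_polytabloid[OF t(1), of \<pi>] tab_perm[OF t(1), of \<pi>] kspan_superset t(2) by fastforce
    then show ?case using add K' by simp
  qed
qed

lemma srep_specht: "srep n (specht \<mu>)"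
proof -
  have "sub_rep (perm_module \<mu>) SP = (specht \<mu> :: ('a, _, _) rep)" unfolding SP_eq by (rule specht_def[symmetric])
  with srep_sub[OF srep_perm_module sub_SP] show ?thesis by metis
qed

lemma SP_PM: "u \<in> SP \<Longrightarrow> u \<in> PM"
  using gen_carrier_local[OF sub_SP lrep_perm_module] by auto

lemma kap_lin_ext: "kap t (lin_ext f x) = lin_ext (\<lambda>b. kap t (f b)) x"
proof -
  have "x \<in> free_space UNIV" by (simp add: free_space_def)
  then show ?thesis by (induction rule: free_space_induct) simp_all
qed

text \<open>The intersection of the Specht module with its orthogonal complement for James's
  bilinear form: \<open>kap t u\<close> is the polytabloid of \<open>t\<close> multiplied by the
  value of the form on \<open>u\<close> and that polytabloid.\<close>

definition Rad :: "((nat \<times> nat \<Rightarrow> nat) set \<Rightarrow>\<^sub>0 'k::field) set"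
  where "Rad = {u\<in>SP. \<forall>t\<in>tabx. kap t u = 0}"

text \<open>James's submodule theorem inside the Specht module: if \<open>kap t u\<close> is nonzero
  for some \<open>u \<in> W\<close>, it is a nonzero multiple of a polytabloid, whose translates
  span everything. Regularity provides the element outside \<open>Rad\<close>, the polytabloid of a
  reversed tableau.\<close>

lemma local_specht:
  assumes "CHAR('k::field) \<noteq> 2" and reg: "\<mu> \<in> regular_partitions CHAR('k)"
  shows "is_local (sym_algebra n) (specht \<mu>) (Rad :: (_ \<Rightarrow>\<^sub>0 'k) set)"
proof -
  have l: "lrep (sym_algebra n) (specht \<mu> :: ('k, _, _) rep)" using srep_specht by (simp add: srep_def)
  note S = is_submodule_iff[OF lrepD(1)[OF l]]
  note c = is_submodule_carrier[OF l, unfolded S]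
  have "is_submodule (sym_algebra n) (specht \<mu>) (Rad :: (_ \<Rightarrow>\<^sub>0 'k) set)"
    unfolding S
  proof (intro conjI ballI allI)
    fix a :: "(nat \<Rightarrow> nat) \<Rightarrow>\<^sub>0 'k" and u :: "(nat \<times> nat \<Rightarrow> nat) set \<Rightarrow>\<^sub>0 'k"
    assume a: "a \<in> sym_algebra n" and u: "u \<in> Rad"
    have "kap t (pact \<pi> u) = 0" if t: "t \<in> tabx" and \<pi>: "\<pi> permutes N" for t \<pi>
    proof -
      have "kap (\<pi> \<circ> (iv \<pi> \<circ> t)) (pact \<pi> u) = pact \<pi> (kap (iv \<pi> \<circ> t) u)"
        by (rule pact_kap[symmetric, OF tab_perm[OF t permutes_inv[OF \<pi>]] \<pi>])
      also have "\<dots> = 0" using u tab_perm[OF t permutes_inv[OF \<pi>]] by (simp add: Rad_def)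
      finally show ?thesis using permutes_inv_o(1)[OF \<pi>] by (simp add: o_assoc)
    qed
    then have "kap t (act (specht \<mu>) a u) = 0" if "t \<in> tabx" for t
      using a that lin_ext_cong[of a "{\<pi>. \<pi> permutes N}" "\<lambda>\<pi>. kap t (pact \<pi> u)" "\<lambda>_. 0"]
      by (simp add: kap_lin_ext sym_algebra_def)
    then show "act (specht \<mu>) a u \<in> Rad" using lrepD(2)[OF l a, of u] u by (simp add: Rad_def)
  qed (use c in \<open>auto simp: Rad_def\<close>)
  moreover have "(Rad :: (_ \<Rightarrow>\<^sub>0 'k) set) \<noteq> SP"
  proof -
    obtain t where t: "t \<in> tabx" using ex_tableau by auto
    have "polytabloid \<mu> (rev_tab t) \<in> (SP :: (_ \<Rightarrow>\<^sub>0 'k) set)"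
      unfolding SP_eq using rev_tab_in[OF t] by (intro subsetD[OF kspan_superset]) simp
    moreover have "kap t (polytabloid \<mu> (rev_tab t)) \<noteq> (0 :: _ \<Rightarrow>\<^sub>0 'k)"
      using lookup_kap_rev[OF t, where 'k = 'k] card_G[OF t reg] by auto
    ultimately show ?thesis using t by (auto simp: Rad_def)
  qed
  moreover have "W \<subseteq> Rad \<or> W = SP" if W: "is_submodule (sym_algebra n) (specht \<mu>) W" for W :: "(_ \<Rightarrow>\<^sub>0 'k) set"
  proof (cases "\<exists>u\<in>W. \<exists>t\<in>tabx. kap t u \<noteq> 0")
    case True
    then obtain u t where ut: "u \<in> W" "t \<in> tabx" "kap t u \<noteq> 0" by auto
    note W' = W[unfolded S]
    have WS: "W \<subseteq> SP" using W' by simp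
    \<comment> \<open>The antisymmetrizer as an element of the group algebra, so that the stability
      of \<open>W\<close> applies to \<open>kap t u\<close>.\<close>
    let ?a = "\<Sum>\<rho>\<in>column_stabilizer \<mu> t. scale (of_int (sign \<rho>)) (basis \<rho>) :: _ \<Rightarrow>\<^sub>0 'k"
    have "?a \<in> sym_algebra n"
      unfolding sym_algebra_def by (intro free_space_sum free_space_simps) (auto simp: column_stabilizer_def)
    moreover have "act (specht \<mu>) ?a u = kap t u" by (simp add: lin_ext_sum kap_def)
    ultimately have k: "kap t u \<in> W" using W' ut(1) by (metis (no_types, lifting))
    obtain c where c: "kap t u = scale c (polytabloid \<mu> t)"
      using kap_PM[OF assms(1) SP_PM ut(2)] ut(1) WS by blast
    then have "c \<noteq> 0" using ut by auto
    have "scale (inverse c) (kap t u) \<in> W" using W' k by simp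
    then have e: "polytabloid \<mu> t \<in> W" using c \<open>c \<noteq> 0\<close> by simp
    have "polytabloid \<mu> ` tabx \<subseteq> W"
    proof (rule image_subsetI)
      fix s assume "s \<in> tabx"
      then obtain \<pi> where \<pi>: "\<pi> permutes N" "s = \<pi> \<circ> t" using tab_trans[OF _ ut(2)] by metis
      have "basis \<pi> \<in> (sym_algebra n :: (_ \<Rightarrow>\<^sub>0 'k) set)" using \<pi> by (simp add: sym_algebra_def)
      then have "act (specht \<mu>) (basis \<pi>) (polytabloid \<mu> t) \<in> W" using W' e by blast
      then show "polytabloid \<mu> s \<in> W" using pact_polytabloid[OF ut(2) \<pi>(1), where 'a = 'k] \<pi>(2) by simp
    qed
    moreover have "submodule W base_field (perm_module \<mu>)"
      unfolding submodule_iff[OF lrepD(1)[OF lrep_perm_module]] using W' SP_PM WS by auto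
    ultimately have "SP \<subseteq> W" unfolding SP_eq by (intro kspan_least)
    then show ?thesis using WS by blast
  next
    case False
    then show ?thesis using W[unfolded S] by (auto simp: Rad_def)
  qed
  ultimately show ?thesis unfolding is_local_def by blast
qed

end

section \<open>The head of Delta(U) for a module U with largest proper submodule R\<close>

section \<open>Simple heads of standard modules\<close>

lemma local_of_simple:
  assumes "simple_rep A L" "lrep A L"
  shows "is_local A L {\<zero>\<^bsub>L\<^esub>}"
  using assms is_submodule_zero[OF assms(2)] by (auto simp: is_local_def simple_rep_def nonzero_rep_def)

lemma simple_quot_local:
  assumes "is_local A V R" "lrep A V"
  shows "simple_rep A (quot_rep V R)"
proof -
  have R: "is_submodule A V R" using assms by (simp add: is_local_def)
  have "hker V (quot_rep V R) (\<lambda>x. R +>\<^bsub>V\<^esub> x) = R"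
    using quot_kernel[OF assms(2) R] gen_carrier_local[OF R assms(2)] by (auto simp: hker_def)
  then show ?thesis
    using simple_of_local[OF assms lrep_quot_rep[OF assms(2) R] rhom_cls[OF assms(2) R]]
    by (simp add: carrier_quot_rep)
qed

lemma local_quot:
  assumes "is_local A V R" "lrep A V"
  shows "is_local A (quot_rep V R) {\<zero>\<^bsub>quot_rep V R\<^esub>}"
proof (rule local_of_simple[OF simple_quot_local[OF assms]])
  show "lrep A (quot_rep V R)" using lrep_quot_rep[OF assms(2)] assms(1) by (simp add: is_local_def)
qed

text \<open>For a Specht module U/R is D(lambda). The locale works with \<open>Delta\<close> of both
  \<open>U\<close> and U/R, because L(lambda) is defined by the latter and the claims concern the
  former.\<close>

locale standard_head = standard \<delta> n U
  for \<delta> :: "'k::field" and n :: nat and U :: "('k, (nat \<Rightarrow> nat) \<Rightarrow>\<^sub>0 'k, 'v) rep" +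
  fixes R :: "'v set"
  assumes local: "is_local (sym_algebra n) U R"
begin

lemma sub_R: "is_submodule (sym_algebra n) U R"
  using local by (simp add: is_local_def)

abbreviation "Q \<equiv> quot_rep U R"

sublocale q: standard \<delta> n Q
  by standard (rule srep_quot[OF srep sub_R])

abbreviation "ZQ \<equiv> Delta \<delta> (inflate n Q)"

abbreviation "L \<equiv> head B_alg ZQ"

definition "MQ = up B_alg (e :: diagram \<Rightarrow>\<^sub>0 'k) ZQ (q.\<iota> ` {\<zero>\<^bsub>Q\<^esub>})"

definition "M = up B_alg (e :: diagram \<Rightarrow>\<^sub>0 'k) Z (\<iota> ` R)"

lemma local_Z: "is_local B_alg Z M"
  unfolding M_def using idem.local_up[OF idem_B arep_Z _ local_\<iota>[OF local]] gen_\<iota> carrier_tr_Z by simp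

lemma local_ZQ: "is_local B_alg ZQ MQ"
  unfolding MQ_def
  using idem.local_up[OF idem_B q.arep_Z _ q.local_\<iota>[OF local_quot[OF local lrep_U]]] q.gen_\<iota> q.carrier_tr_Z by simp

lemma sub_MQ: "is_submodule B_alg ZQ MQ"
  using local_ZQ by (simp add: is_local_def)

lemma L_eq: "L = quot_rep ZQ MQ"
  by (simp add: head_def rad_local[OF local_ZQ q.lrep_Z])

lemma arep_L: "arep B_alg (B_mult \<delta>) L"
  unfolding L_eq by (rule idem.arep_quot[OF idem_B q.arep_Z sub_MQ])

lemma simple_L: "simple_rep B_alg L"
  unfolding L_eq by (rule simple_quot_local[OF local_ZQ q.lrep_Z])

abbreviation cZ :: "_ \<Rightarrow> _" where "cZ z \<equiv> MQ +>\<^bsub>ZQ\<^esub> z"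
abbreviation cU :: "_ \<Rightarrow> _" where "cU u \<equiv> R +>\<^bsub>U\<^esub> u"

lemma cU_in: "u \<in> carrier U \<Longrightarrow> cU u \<in> carrier Q"
  by (simp add: carrier_quot_rep)

text \<open>Determines the kernel of the map from \<open>U\<close> to \<open>L\<close>; it has to be
  \<open>R\<close> for the kernel on all of \<open>Delta\<close> to become \<open>M\<close>.\<close>

lemma q\<iota>_in_MQ:
  assumes "u \<in> carrier U"
  shows "q.\<iota> (cU u) \<in> MQ \<longleftrightarrow> u \<in> R"
proof -
  have z: "\<zero>\<^bsub>Q\<^esub> \<in> carrier Q" by (rule q.UV(1))
  have s: "is_submodule q.Cn (tr e ZQ) (q.\<iota> ` {\<zero>\<^bsub>Q\<^esub>})"
    using q.local_\<iota>[OF local_quot[OF local lrep_U]] by (simp add: is_local_def)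
  have t: "q.\<iota> (cU u) \<in> carrier (tr e ZQ)" using q.carrier_tr_Z cU_in[OF assms] by simp
  have "q.\<iota> (cU u) \<in> MQ \<longleftrightarrow> q.\<iota> (cU u) \<in> act ZQ e ` MQ"
    unfolding idem.e_sub[OF idem_B q.arep_Z sub_MQ] using t by simp
  also have "\<dots> \<longleftrightarrow> q.\<iota> (cU u) = q.\<iota> \<zero>\<^bsub>Q\<^esub>"
    using idem.e_up[OF idem_B q.arep_Z s] by (simp add: MQ_def)
  also have "\<dots> \<longleftrightarrow> cU u = \<zero>\<^bsub>Q\<^esub>"
    using inj_on_eq_iff[OF q.\<iota>_inj cU_in[OF assms] z] .
  also have "\<dots> \<longleftrightarrow> u \<in> R" using quot_kernel[OF lrep_U sub_R assms] by simp
  finally show ?thesis .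
qed

text \<open>\<open>L\<close> is by definition a quotient of \<open>ZQ\<close>, not of
  \<open>Z\<close>. The surjection of \<open>U\<close> onto the truncation of \<open>L\<close> is
  extended by \<open>rhom_extend\<close>, which also identifies the kernel. The trivial
  \<open>sub_rep\<close> appears because the extension lives on the submodule generated by the copy
  of \<open>U\<close>, which is all of \<open>Z\<close>.\<close>

lemma head_hom:
  "\<exists>\<psi>. rhom B_alg (sub_rep Z (carrier Z)) L \<psi> \<and> \<psi> ` carrier Z = carrier L \<and>
    hker (sub_rep Z (carrier Z)) L \<psi> = M"
proof -
  let ?e = "e :: diagram \<Rightarrow>\<^sub>0 'k"
  let ?W = "carrier (tr ?e Z)"
  define \<phi> where "\<phi> w = cZ (q.\<iota> (cU (the_inv_into (carrier U) \<iota> w)))" for w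
  have \<phi>: "\<phi> (\<iota> u) = cZ (q.\<iota> (cU u))" if "u \<in> carrier U" for u
    unfolding \<phi>_def using the_inv_into_f_f[OF \<iota>_inj that] by simp
  note qZ = quot_props[OF q.lrep_Z sub_MQ, folded L_eq]
  note qU = quot_props[OF lrep_U sub_R]
  have qi: "q.\<iota> (cU u) \<in> carrier ZQ" if "u \<in> carrier U" for u by (rule q.\<iota>_closed[OF cU_in[OF that]])
  have eq: "act ZQ ?e (q.\<iota> (cU u)) = q.\<iota> (cU u)" if "u \<in> carrier U" for u
    using idem.mem_tr[OF idem_B q.arep_Z] q.carrier_tr_Z cU_in[OF that] by blast
  have W: "is_submodule Cn (tr ?e Z) ?W"
    by (rule is_submodule_carrier[OF idem.lrep_tr[OF idem_B arep_Z]])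
  have hom: "rhom Cn (sub_rep Z ?W) (tr ?e L) \<phi>"
    unfolding rhom_def sub_rep_simps carrier_tr_Z
  proof (intro conjI ballI allI)
    fix w assume "w \<in> \<iota> ` carrier U"
    then obtain u where u: "u \<in> carrier U" "w = \<iota> u" by auto
    have "act L ?e (cZ (q.\<iota> (cU u))) = cZ (q.\<iota> (cU u))"
      using qZ(3)[OF Bid_in qi[OF u(1)]] eq[OF u(1)] by simp
    moreover have "cZ (q.\<iota> (cU u)) \<in> carrier L" using qi[OF u(1)] by (simp add: L_eq carrier_quot_rep)
    ultimately show "\<phi> w \<in> carrier (tr ?e L)" using \<phi>[OF u(1)] u(2) idem.mem_tr[OF idem_B arep_L] by simp
    show "\<phi> (c \<odot>\<^bsub>Z\<^esub> w) = c \<odot>\<^bsub>tr ?e L\<^esub> \<phi> w" for c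
    proof -
      have "\<phi> (c \<odot>\<^bsub>Z\<^esub> w) = cZ (q.\<iota> (cU (c \<odot>\<^bsub>U\<^esub> u)))" unfolding u(2) \<iota>_smult[OF u(1), symmetric] by (rule \<phi>[OF UV(3)[OF u(1)]])
      also have "\<dots> = c \<odot>\<^bsub>L\<^esub> cZ (q.\<iota> (cU u))"
        unfolding qU(2)[OF u(1), symmetric] q.\<iota>_smult[OF cU_in[OF u(1)]] qZ(2)[OF qi[OF u(1)]] ..
      finally show ?thesis using \<phi>[OF u(1)] u(2) by simp
    qed
    show "\<phi> (act Z a w) = act (tr ?e L) a (\<phi> w)" if "a \<in> Cn" for a
    proof -
      from that obtain x where x: "x \<in> B_alg" "a = B_mult \<delta> (B_mult \<delta> ?e x) ?e" by (auto simp: corner_def)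
      then have a: "a \<in> B_alg" using Bm_closed Bid_in by simp
      have "\<phi> (act Z a w) = cZ (q.\<iota> (cU (act U (sym_part n x) u)))"
        unfolding u(2) x(2) corner_act[OF x(1) u(1)] by (rule \<phi>[OF U(2)[OF sp_closed u(1)]])
      also have "\<dots> = cZ (act ZQ a (q.\<iota> (cU u)))"
        unfolding qU(3)[OF sp_closed u(1), symmetric] q.corner_act[OF x(1) cU_in[OF u(1)], symmetric] x(2) ..
      also have "\<dots> = act L a (cZ (q.\<iota> (cU u)))" by (rule qZ(3)[OF a qi[OF u(1)], symmetric])
      finally show ?thesis using \<phi>[OF u(1)] u(2) by simp
    qed
    fix w' assume "w' \<in> \<iota> ` carrier U"
    then obtain u' where u': "u' \<in> carrier U" "w' = \<iota> u'" by auto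
    show "\<phi> (w \<oplus>\<^bsub>Z\<^esub> w') = \<phi> w \<oplus>\<^bsub>tr ?e L\<^esub> \<phi> w'"
    proof -
      have "\<phi> (w \<oplus>\<^bsub>Z\<^esub> w') = cZ (q.\<iota> (cU (u \<oplus>\<^bsub>U\<^esub> u')))"
        unfolding u(2) u'(2) \<iota>_add[OF u(1) u'(1), symmetric] by (rule \<phi>[OF UV(2)[OF u(1) u'(1)]])
      also have "\<dots> = cZ (q.\<iota> (cU u)) \<oplus>\<^bsub>L\<^esub> cZ (q.\<iota> (cU u'))"
        unfolding qU(1)[OF u(1) u'(1), symmetric] q.\<iota>_add[OF cU_in[OF u(1)] cU_in[OF u'(1)]]
          qZ(1)[OF qi[OF u(1)] qi[OF u'(1)]] ..
      finally show ?thesis using \<phi>[OF u(1)] \<phi>[OF u'(1)] u(2) u'(2) by simp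
    qed
  qed
  have surj: "\<phi> ` ?W = carrier (tr ?e L)"
  proof
    show "\<phi> ` ?W \<subseteq> carrier (tr ?e L)" using rhomD(1)[OF hom] by auto
    show "carrier (tr ?e L) \<subseteq> \<phi> ` ?W"
    proof
      fix l assume "l \<in> carrier (tr ?e L)"
      then obtain z where z: "z \<in> carrier ZQ" "l = act L ?e (cZ z)"
        by (auto simp: carrier_tr L_eq carrier_quot_rep)
      have "act ZQ ?e z \<in> q.\<iota> ` carrier Q" using z(1) q.carrier_tr_Z by (auto simp: carrier_tr)
      then obtain u where u: "u \<in> carrier U" "act ZQ ?e z = q.\<iota> (cU u)" by (auto simp: carrier_quot_rep)
      have "l = \<phi> (\<iota> u)" using z qZ(3)[OF Bid_in z(1)] u \<phi>[OF u(1)] by simp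
      then show "l \<in> \<phi> ` ?W" using u(1) carrier_tr_Z by simp
    qed
  qed
  have zL: "\<zero>\<^bsub>L\<^esub> = MQ" by (simp add: L_eq)
  have ker_iff: "\<phi> (\<iota> u) = \<zero>\<^bsub>L\<^esub> \<longleftrightarrow> u \<in> R" if u: "u \<in> carrier U" for u
    unfolding \<phi>[OF u] zL using qZ(5)[OF qi[OF u]] q\<iota>_in_MQ[OF u] by simp
  have RU: "R \<subseteq> carrier U" by (rule gen_carrier_local[OF sub_R lrep_U])
  have ker: "hker (sub_rep Z ?W) (tr ?e L) \<phi> = \<iota> ` R"
    unfolding hker_def sub_rep_simps carrier_tr_Z tr_simps using ker_iff RU by auto
  have nz: "nonzero_rep (tr ?e L)"
  proof -
    obtain u where "u \<in> carrier U" "u \<notin> R" using local RU by (auto simp: is_local_def)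
    then have "\<phi> (\<iota> u) \<noteq> \<zero>\<^bsub>L\<^esub>" "\<phi> (\<iota> u) \<in> carrier (tr ?e L)" using ker_iff surj carrier_tr_Z by auto
    then show ?thesis by (auto simp: nonzero_rep_def)
  qed
  have g: "gen B_alg Z ?W = carrier Z" using gen_\<iota> carrier_tr_Z by simp
  have "M \<subseteq> carrier Z" by (auto simp: M_def up_def)
  then show ?thesis
    using idem.rhom_extend[OF idem_B arep_Z arep_L W simple_L nz hom surj ker] unfolding g M_def by (simp add: Int_absorb1)
qed

lemma tr_head_hom:
  obtains \<psi> where "rhom (brauer_algebra \<delta> m) (trunc m Z) (trunc m L) \<psi>"
    "\<psi> ` carrier (trunc m Z) = carrier (trunc m L)"
    "hker (trunc m Z) (trunc m L) \<psi> = act Z (B_id m) ` M"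
proof -
  obtain \<psi> where \<psi>: "rhom B_alg (sub_rep Z (carrier Z)) L \<psi>" "\<psi> ` carrier Z = carrier L"
    "hker (sub_rep Z (carrier Z)) L \<psi> = M" using head_hom by blast
  have Q: "is_submodule B_alg Z M" using local_Z by (simp add: is_local_def)
  have MZ: "M \<subseteq> carrier Z" by (rule gen_carrier_local[OF Q lrep_Z])
  note t = idem.rhom_tr[OF idem_B arep_Z arep_L is_submodule_carrier[OF lrep_Z] Q MZ \<psi>, of m]
  show thesis
    by (rule that[of \<psi>]) (use t in \<open>simp_all only: trunc_def tr_def brauer_algebra_corner sub_rep_simps\<close>)
qed

text \<open>Truncation is exact, so 1_m L is the quotient of 1_m Z by 1_m M.\<close>

lemma nonzero_trunc_L_iff: "nonzero_rep (trunc m L) \<longleftrightarrow> act Z (B_id m) ` M \<noteq> carrier (trunc m Z)"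
proof -
  obtain \<psi> where \<psi>: "rhom (brauer_algebra \<delta> m) (trunc m Z) (trunc m L) \<psi>"
    "\<psi> ` carrier (trunc m Z) = carrier (trunc m L)"
    "hker (trunc m Z) (trunc m L) \<psi> = act Z (B_id m) ` M" by (rule tr_head_hom)
  have "\<zero>\<^bsub>trunc m L\<^esub> \<in> carrier (trunc m L)"
    unfolding trunc_tr by (rule vspD(1)[OF lrepD(1)[OF idem.lrep_tr[OF idem_B arep_L]]])
  then have "carrier (trunc m L) = {\<zero>\<^bsub>trunc m L\<^esub>} \<longleftrightarrow> (\<forall>v\<in>carrier (trunc m Z). \<psi> v = \<zero>\<^bsub>trunc m L\<^esub>)"
    unfolding \<psi>(2)[symmetric] by blast
  also have "\<dots> \<longleftrightarrow> hker (trunc m Z) (trunc m L) \<psi> = carrier (trunc m Z)" by (auto simp: hker_def)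
  finally show ?thesis unfolding nonzero_rep_def \<psi>(3) by blast
qed

lemma simple_head_trunc:
  assumes "nonzero_rep (trunc m L)"
  shows "is_simple_head (brauer_algebra \<delta> m) (trunc m L) (trunc m Z)"
proof -
  obtain \<psi> where \<psi>: "rhom (brauer_algebra \<delta> m) (trunc m Z) (trunc m L) \<psi>"
    "\<psi> ` carrier (trunc m Z) = carrier (trunc m L)"
    "hker (trunc m Z) (trunc m L) \<psi> = act Z (B_id m) ` M" by (rule tr_head_hom)
  have loc: "is_local (brauer_algebra \<delta> m) (trunc m Z) (act Z (B_id m) ` M)"
    unfolding brauer_algebra_corner trunc_tr
    by (rule idem.local_tr[OF idem_B arep_Z local_Z]) (use assms nonzero_trunc_L_iff trunc_tr in metis)
  have l: "lrep (brauer_algebra \<delta> m) (trunc m Z)" "lrep (brauer_algebra \<delta> m) (trunc m L)"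
    unfolding brauer_algebra_corner trunc_tr
    by (rule idem.lrep_tr[OF idem_B arep_Z], rule idem.lrep_tr[OF idem_B arep_L])
  show ?thesis by (rule simple_headI[OF loc l \<psi>])
qed

end

section \<open>Which truncations of standard and simple modules are nonzero\<close>

section \<open>Vanishing of truncations\<close>

text \<open>A diagram that survives leads from n to m points without caps, which forces n \<le> m
  and equal parity.\<close>

lemma (in standard) trunc_nonzero_imp:
  assumes "nonzero_rep (trunc m Z)"
  shows "\<exists>d. m = n + 2 * d"
proof (rule ccontr)
  assume no: "\<nexists>d. m = n + 2 * d"
  have van: "b.tn (B_mult \<delta> (B_id m) x) v = \<zero>\<^bsub>Z\<^esub>" if "x \<in> B_alg" and v: "v \<in> carrier U" for x v
    using that(1) unfolding B_alg_def
  proof (induction rule: free_space_induct)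
    case zero
    then show ?case using tn_zero_left v by simp
  next
    case (add x c d)
    have x: "x \<in> B_alg" "basis d \<in> (B_alg :: (diagram \<Rightarrow>\<^sub>0 'k) set)" using add(1,2) by (simp_all add: B_alg_def)
    have "b.tn (B_mult \<delta> (B_id m) (basis d)) v = \<zero>\<^bsub>Z\<^esub>"
    proof (cases "tgt d = m")
      case True
      then have d: "d \<in> brauer (src d) m" using add(2) diagrams_iff[of d] by simp
      have "has_cap d \<or> src d \<noteq> n"
      proof (rule ccontr)
        assume "\<not> (has_cap d \<or> src d \<noteq> n)"
        then have "n \<le> m" "even (n + m)" using d no_cap_le[of d n m] brauer_parity[of d n m] by auto
        then have "m = n + 2 * ((m - n) div 2)" by auto
        then show False using no by blast
      qed
      then show ?thesis using True tn_vanish[OF add(2) _ v] add(2) by (simp add: B_id_left del: UN_iff)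
    next
      case False
      then show ?thesis using add(2) tn_zero_left v by (simp add: B_id_left del: UN_iff)
    qed
    then show ?case
      using add(3) x v tn_add_left tn_smult_left Bm_closed[OF Bid_in] Bscale_in ZV by simp
  qed
  have "act Z (B_id m) t = \<zero>\<^bsub>Z\<^esub>" if "t \<in> carrier Z" for t
    using that
  proof (induction rule: Z_induct)
    case zero
    then show ?case by (rule act_zero[OF lrep_Z Bid_in])
  next
    case (add t x v)
    then show ?case using Zl(2)[OF Bid_in] tn_closed act_tn[OF Bid_in] van ZV by simp
  qed
  then have "carrier (trunc m Z) = {\<zero>\<^bsub>Z\<^esub>}" using ZV(1) by (auto simp: trunc_def)
  then show False using assms by (simp add: nonzero_rep_def trunc_def)
qed

text \<open>The identity is factored through two more points at a time. Each step is a zigzag,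
  except the one from 0 to 2 points, where the circle is divided by its value
  \<open>\<delta>\<close>.\<close>

lemma zigzag_alg:
  fixes \<delta> :: "'k::field"
  assumes "n > 0 \<or> \<delta> \<noteq> 0 \<or> d = 0"
  shows "\<exists>b\<in>B_alg. \<exists>v\<in>B_alg. B_mult \<delta> (B_id (n + 2 * d)) v = v \<and> B_mult \<delta> b v = B_id n"
  using assms
proof (induction d)
  case 0
  have "B_mult \<delta> (B_id n) (B_id n) = B_id n" by (rule idem.e_idem[OF idem_B])
  then show ?case using B_id_in by force
next
  case (Suc d)
  let ?N = "n + 2 * d"
  obtain b v where bv: "b \<in> B_alg" "v \<in> B_alg" "B_mult \<delta> (B_id ?N) v = v" "B_mult \<delta> b v = B_id n" using Suc by auto
  obtain b1 v1 where 1: "b1 \<in> B_alg" "v1 \<in> B_alg" "B_mult \<delta> (B_id (?N + 2)) v1 = v1" "B_mult \<delta> b1 v1 = B_id ?N"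
  proof (cases "?N > 0")
    case True
    then obtain g h where gh: "g \<in> brauer (?N + 2) ?N" "h \<in> brauer ?N (?N + 2)" "stack g h = perm_diagram ?N id" "loops g h = 0"
      by (rule zigzag)
    have "tgt h = ?N + 2" using gh(2) by (simp add: brauer_iff)
    then show thesis
      using that[of "basis g" "basis h"] gh B_mult_brauer[OF gh(2,1), of \<delta>] B_id_left[OF brauer_diagrams[OF gh(2)], of \<delta> "?N + 2"]
        brauer_diagrams[OF gh(1)] brauer_diagrams[OF gh(2)]
      by (simp add: B_id_def B_alg_def del: UN_iff)
  next
    case False
    then have N: "?N = 0" "\<delta> \<noteq> 0" using Suc.prems by auto
    let ?id = "perm_diagram 0 id"
    have id: "?id \<in> brauer 0 0" by (rule perm_brauer[OF permutes_id])
    have g: "th ?id \<in> brauer 2 0" and h: "cup ?id \<in> brauer 0 2" using th_brauer[OF id] cup_brauer[OF id] by simp_all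
    have "B_mult \<delta> (scale (inverse \<delta>) (basis (th ?id))) (basis (cup ?id)) = B_id 0"
      using B_mult_brauer[OF h g, of \<delta>] circle N(2) by (simp add: B_id_def)
    then show thesis
      using that[of "scale (inverse \<delta>) (basis (th ?id))" "basis (cup ?id)"] N(1)
        B_id_left[OF brauer_diagrams[OF h], of \<delta> 2] brauer_diagrams[OF g] brauer_diagrams[OF h]
      by (simp add: B_alg_def del: UN_iff)
  qed
  have "B_mult \<delta> (B_id (?N + 2)) (B_mult \<delta> v1 v) = B_mult \<delta> v1 v"
    using B_mult_assoc[OF B_id_in 1(2) bv(2), of \<delta> "?N + 2"] 1(3) by simp
  moreover have "B_mult \<delta> (B_mult \<delta> b b1) (B_mult \<delta> v1 v) = B_id n"
    using B_mult_assoc[OF bv(1) 1(1) B_mult_closed[OF 1(2) bv(2)], of \<delta>] B_mult_assoc[OF 1(1,2) bv(2), of \<delta>] 1(4) bv(3,4) by simp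
  ultimately show ?case
    using B_mult_closed[OF bv(1) 1(1)] B_mult_closed[OF 1(2) bv(2)] by (auto simp: algebra_simps)
qed

context standard_head
begin

text \<open>For \<open>u\<close> outside \<open>R\<close> the element \<open>v\<close> takes
  \<open>\<iota> u\<close> into 1_m Z and \<open>b\<close> brings it back, so the image under
  \<open>v\<close> cannot lie in \<open>M\<close>.\<close>

lemma trunc_L_nonzero:
  assumes "n > 0 \<or> \<delta> \<noteq> 0 \<or> d = 0"
  shows "nonzero_rep (trunc (n + 2 * d) L)"
proof -
  let ?m = "n + 2 * d"
  obtain b v where bv: "b \<in> B_alg" "v \<in> B_alg" "B_mult \<delta> (B_id ?m) v = v" "B_mult \<delta> b v = B_id n"
    using zigzag_alg[OF assms] by blast
  have RU: "R \<subseteq> carrier U" by (rule gen_carrier_local[OF sub_R lrep_U])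
  then obtain u where u: "u \<in> carrier U" "u \<notin> R" using local by (auto simp: is_local_def)
  note iu = \<iota>_closed[OF u(1)]
  define x where "x = act Z v (\<iota> u)"
  have x: "x \<in> carrier Z" unfolding x_def by (rule Zl(1)[OF bv(2) iu])
  have "act Z (B_id ?m) x = x"
    using idem.arep_mul[OF idem_B arep_Z Bid_in[of ?m] bv(2) iu] bv(3) by (simp add: x_def)
  then have xt: "x \<in> carrier (trunc ?m Z)" using x unfolding trunc_def sub_rep_simps by (metis imageI)
  have "act Z b x = act Z e (\<iota> u)"
    using idem.arep_mul[OF idem_B arep_Z bv(1,2) iu] bv(4) by (simp add: x_def)
  then have "act Z e (act Z b x) = act Z e (act Z e (\<iota> u))" by simp
  also have "\<dots> = \<iota> u" using e_act_\<iota>[OF Bid_in u(1), of n] sym_part_id act_id[OF u(1)] by simp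
  finally have "act Z e (act Z b x) \<notin> \<iota> ` R" using inj_on_image_mem_iff[OF \<iota>_inj u(1) RU] u(2) by simp
  then have "x \<notin> M" using bv(1) by (auto simp: M_def up_def)
  moreover have "is_submodule B_alg Z M" using local_Z by (simp add: is_local_def)
  then have "act Z (B_id ?m) ` M \<subseteq> M" using idem.e_sub[OF idem_B arep_Z, of M ?m] by blast
  ultimately show ?thesis unfolding nonzero_trunc_L_iff using xt by blast
qed

text \<open>A composite from 0 through m to 0 points has a loop, which is worth
  \<open>\<delta> = 0\<close>. Thus no element of 1_m Z can be brought back to a nonzero vector on 0
  points, and 1_m Z lies in \<open>M\<close>.\<close>

lemma trunc_L_zero:
  assumes n: "n = 0" and \<delta>: "\<delta> = 0" and m: "m > 0"
  shows "\<not> nonzero_rep (trunc m L)"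
proof -
  have zero: "B_mult \<delta> (B_mult \<delta> (B_id 0) a) (B_mult \<delta> (B_id m) (B_mult \<delta> y (B_id 0))) = 0"
    if "a \<in> B_alg" and y: "y \<in> B_alg" for a y
    using that(1) unfolding B_alg_def
  proof (induction rule: free_space_induct)
    case (add a c g)
    have "B_mult \<delta> (B_mult \<delta> (B_id 0) (basis g)) (B_mult \<delta> (B_id m) (B_mult \<delta> y (B_id 0))) = 0"
      using y unfolding B_alg_def
    proof (induction rule: free_space_induct)
      case (add y c h)
      have "B_mult \<delta> (B_mult \<delta> (B_id 0) (basis g)) (B_mult \<delta> (B_id m) (B_mult \<delta> (basis h) (B_id 0))) = 0"
      proof (cases "tgt g = 0 \<and> src g = m \<and> tgt h = m \<and> src h = 0")
        case True
        have gh: "g \<in> brauer m 0" "h \<in> brauer 0 m"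
          using True \<open>g \<in> diagrams\<close> \<open>h \<in> diagrams\<close> diagrams_iff[of g] diagrams_iff[of h] by simp_all
        have l: "\<delta> ^ loops g h = 0" using loops_pos[OF gh(2,1) m] \<delta> by (simp add: power_0_left)
        have "B_mult \<delta> (basis g) (basis h) = 0"
          unfolding B_mult_brauer[OF gh(2,1)] l by simp
        then show ?thesis
          using True \<open>g \<in> diagrams\<close> \<open>h \<in> diagrams\<close>
          by (simp add: B_id_left B_id_right del: UN_iff)
      next
        case False
        then show ?thesis using \<open>g \<in> diagrams\<close> \<open>h \<in> diagrams\<close>
          by (auto simp: B_id_left B_id_right B_mult_basis simp del: UN_iff)
      qed
      then show ?case using add by simp
    qed simp
    then show ?case using add by simp
  qed simp
  have sub: "is_submodule B_alg Z M" using local_Z by (simp add: is_local_def)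
  have "\<zero>\<^bsub>Z\<^esub> \<in> \<iota> ` R" using sub_R \<iota>_zero is_submodule_iff[OF U(1)] by (metis imageI)
  have main: "act Z e (act Z a (act Z (B_id m) t)) = \<zero>\<^bsub>Z\<^esub>" if a: "a \<in> B_alg" and "t \<in> carrier Z" for a t
    using that(2)
  proof (induction rule: Z_induct)
    case zero
    then show ?case using act_zero[OF lrep_Z] a Bid_in by simp
  next
    case (add t x v)
    note iv = \<iota>_closed[OF add(3)]
    note am = idem.arep_mul[OF idem_B arep_Z]
    have e: "\<iota> v = act Z e (\<iota> v)" using e_act_\<iota>[OF Bid_in add(3), of n] idem.e_e[OF idem_B arep_Z iv]
        sym_part_id act_id[OF add(3)] by simp
    have "b.tn x v = act Z (B_mult \<delta> x e) (\<iota> v)"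
      using tn_eq_act[OF add(2,3)] am[OF add(2) Bid_in iv] e by simp
    then have "act Z e (act Z a (act Z (B_id m) (b.tn x v))) =
        act Z (B_mult \<delta> (B_mult \<delta> e a) (B_mult \<delta> (B_id m) (B_mult \<delta> x e))) (\<iota> v)"
      using am a add(2) Bid_in Bm_closed iv Zl(1) by simp
    also have "\<dots> = act Z 0 (\<iota> v)" using zero[OF a add(2)] n by simp
    also have "\<dots> = b.tn 0 v" using tn_eq_act[of 0 v] add(3) by (simp add: B_alg_def)
    also have "\<dots> = \<zero>\<^bsub>Z\<^esub>" by (rule tn_zero_left[OF add(3)])
    finally show ?case using add a Zl Bid_in tn_closed ZV by simp
  qed
  have "carrier (trunc m Z) \<subseteq> M"
    using main \<open>\<zero>\<^bsub>Z\<^esub> \<in> \<iota> ` R\<close> Zl(1)[OF Bid_in] by (auto simp: trunc_def M_def up_def)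
  then have "act Z (B_id m) ` M = carrier (trunc m Z)"
    unfolding trunc_tr using idem.e_sub[OF idem_B arep_Z sub, of m] by blast
  then show ?thesis unfolding nonzero_trunc_L_iff by simp
qed

end

section \<open>Comparison of the truncated standard module with the cell module\<close>

section \<open>Cell modules\<close>

lemma stack_perm_cup:
  assumes \<pi>: "\<pi> permutes {1..b}" and d: "d \<in> brauer a b"
  shows "stack (perm_diagram (b + 2) \<pi>) (cup d) = cup (stack (perm_diagram b \<pi>) d)"
proof -
  have \<pi>2: "\<pi> permutes {1..b + 2}" by (rule permutes_subset[OF \<pi>]) auto
  have "\<pi> (b + 1) = b + 1" "\<pi> (b + 2) = b + 2" using permutes_not_in[OF \<pi>] by simp_all
  moreover have "src d = a" "tgt d = b" using d by (simp_all add: brauer_iff)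
  ultimately show ?thesis
    unfolding stack_perm_left(1)[OF \<pi> d] stack_perm_left(1)[OF \<pi>2 cup_brauer[OF d]]
    by (intro diagram.expand) simp
qed

lemma stack_th_perm:
  assumes \<pi>: "\<pi> permutes {1..a}" and d: "d \<in> brauer a b"
  shows "stack (th d) (perm_diagram (a + 2) \<pi>) = th (stack d (perm_diagram a \<pi>))"
proof -
  have \<pi>2: "\<pi> permutes {1..a + 2}" by (rule permutes_subset[OF \<pi>]) auto
  have "flip (stack (th d) (perm_diagram (a + 2) \<pi>)) =
      stack (perm_diagram (a + 2) (inv_into UNIV \<pi>)) (cup (flip d))"
    unfolding flip_stack flip_perm[OF \<pi>2] by (simp add: cup_def)
  also have "\<dots> = cup (stack (perm_diagram a (inv_into UNIV \<pi>)) (flip d))"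
    using stack_perm_cup[OF permutes_inv[OF \<pi>], of "flip d" b] d by simp
  also have "\<dots> = flip (th (stack d (perm_diagram a \<pi>)))"
    unfolding cup_def flip_stack by (simp add: flip_perm[OF \<pi>, symmetric])
  finally show ?thesis by (metis flip_simps(3))
qed

lemma stack_thn_perm:
  assumes \<pi>: "\<pi> permutes {1..a}" and d: "d \<in> brauer a b"
  shows "stack ((th ^^ k) d) (perm_diagram (a + 2 * k) \<pi>) = (th ^^ k) (stack d (perm_diagram a \<pi>))"
    and "loops ((th ^^ k) d) (perm_diagram (a + 2 * k) \<pi>) = 0"
proof -
  have p: "\<pi> permutes {1..a + 2 * k}" for k by (rule permutes_subset[OF \<pi>]) auto
  show "stack ((th ^^ k) d) (perm_diagram (a + 2 * k) \<pi>) = (th ^^ k) (stack d (perm_diagram a \<pi>))"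
  proof (induction k)
    case (Suc k)
    show ?case using stack_th_perm[OF p thn_brauer[OF d], of k] Suc by (simp add: algebra_simps)
  qed simp
  show "loops ((th ^^ k) d) (perm_diagram (a + 2 * k) \<pi>) = 0"
    by (rule loops_perm_right[OF p thn_brauer[OF d]])
qed

lemma caps_cups_E:
  "E_diagram (n + 2 * k) k \<in> brauer (n + 2 * k) (n + 2 * k)"
  unfolding E_diagram_eq by (rule thn_brauer[OF cups_brauer])

text \<open>A permutation of the first n points is, as a function, also a permutation of the first m
  points fixing the rest; its diagram on m points extends it by straight strands.\<close>

definition hat :: "nat \<Rightarrow> ((nat \<Rightarrow> nat) \<Rightarrow>\<^sub>0 'k::field) \<Rightarrow> (diagram \<Rightarrow>\<^sub>0 'k)"
  where "hat m = lin_ext (\<lambda>\<pi>. basis (perm_diagram m \<pi>))"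

lemma hat_simps [simp]:
  "hat m 0 = 0" "hat m (x + y) = hat m x + hat m y" "hat m (scale c x) = scale c (hat m x)"
  "hat m (basis \<pi>) = basis (perm_diagram m \<pi>)"
  by (simp_all add: hat_def)

definition addcaps :: "nat \<Rightarrow> (diagram \<Rightarrow>\<^sub>0 'k::field) \<Rightarrow> (diagram \<Rightarrow>\<^sub>0 'k)"
  where "addcaps k = lin_ext (\<lambda>d. basis ((th ^^ k) d))"

lemma addcaps_simps [simp]:
  "addcaps k 0 = 0" "addcaps k (x + y) = addcaps k x + addcaps k y" "addcaps k (scale c x) = scale c (addcaps k x)"
  "addcaps k (basis d) = basis ((th ^^ k) d)"
  by (simp_all add: addcaps_def)

text \<open>The default value 0 lets the map be applied to every element of the bimodule, including
  elements of the ideal whose diagrams do not end in k caps.\<close>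

definition remcaps :: "nat \<Rightarrow> nat \<Rightarrow> nat \<Rightarrow> (diagram \<Rightarrow>\<^sub>0 'k::field) \<Rightarrow> (diagram \<Rightarrow>\<^sub>0 'k)"
  where "remcaps k n m = lin_ext (\<lambda>d. if d \<in> (th ^^ k) ` brauer n m
    then basis (inv_into (brauer n m) (th ^^ k) d) else 0)"

lemma remcaps_simps [simp]:
  "remcaps k n m 0 = 0" "remcaps k n m (x + y) = remcaps k n m x + remcaps k n m y"
  "remcaps k n m (scale c x) = scale c (remcaps k n m x)"
  by (simp_all add: remcaps_def)

lemma remcaps_basis:
  assumes "d \<in> brauer n m"
  shows "remcaps k n m (basis ((th ^^ k) d)) = basis d"
proof -
  have "inj_on (th ^^ k) (brauer n m)" by (rule inj_onI) (rule thn_inj)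
  then show ?thesis using assms by (simp add: remcaps_def)
qed

lemma remcaps_closed: "remcaps k n m x \<in> free_space (brauer n m)"
  unfolding remcaps_def by (rule lin_ext_closed[of _ UNIV]) (auto simp: free_space_def inv_into_into)

lemma remcaps_addcaps:
  assumes "x \<in> free_space (brauer n m)"
  shows "remcaps k n m (addcaps k x) = x"
  using assms by (induction rule: free_space_induct) (simp_all add: remcaps_basis)

lemma addcaps_closed: "x \<in> free_space (brauer a b) \<Longrightarrow> addcaps k x \<in> free_space (brauer (a + 2 * k) b)"
  unfolding addcaps_def by (erule lin_ext_closed) (simp add: thn_brauer)

lemma hat_closed:
  assumes "s \<in> sym_algebra n" "n \<le> m"
  shows "hat m s \<in> free_space (brauer m m)"
  using assms(1) unfolding hat_def sym_algebra_def
proof (rule lin_ext_closed)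
  fix \<pi> assume "\<pi> \<in> {\<pi>. \<pi> permutes {1..n}}"
  then have "\<pi> permutes {1..m}" using assms(2) by (auto intro: permutes_subset)
  then show "basis (perm_diagram m \<pi>) \<in> free_space (brauer m m)" by (simp add: perm_brauer)
qed

lemma hat_sharp: "s \<in> sym_algebra n \<Longrightarrow> hat n s \<in> B_sharp"
  unfolding hat_def sym_algebra_def B_sharp_def
proof (erule lin_ext_closed)
  fix \<pi> assume "\<pi> \<in> {\<pi>. \<pi> permutes {1..n}}"
  then have "perm_diagram n \<pi> \<in> diagrams" using brauer_diagrams[OF perm_brauer, of \<pi> n] by simp
  then show "basis (perm_diagram n \<pi>) \<in> free_space {d \<in> diagrams. \<not> has_cup d}" by simp
qed

lemma sym_part_hat:
  assumes "s \<in> sym_algebra n"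
  shows "sym_part n (hat n s) = s"
  using assms unfolding sym_algebra_def
  by (induction rule: free_space_induct) (simp_all add: sym_part_basis_perm)

lemma free_brauer_B_alg: "x \<in> free_space (brauer a b) \<Longrightarrow> x \<in> B_alg"
  by (auto simp: B_alg_def free_space_def)

text \<open>The span is an upper bound for \<open>brauer_ideal\<close>. A factorization through few
  points can be refuted by counting vertical strands, whereas membership in an ideal given by a
  generator offers no such test.\<close>

definition narrow :: "nat \<Rightarrow> nat \<Rightarrow> diagram set"
  where "narrow m j = {stack y h | y h i. i < j \<and> y \<in> brauer i m \<and> h \<in> brauer m i}"

text \<open>If \<open>d\<close> has no cap, all its n bottom points carry vertical strands, also
  after k caps are added. A diagram factoring through fewer than n points has fewer vertical
  strands.\<close>

lemma narrow_capped:
  assumes "d \<in> brauer n m" "(th ^^ k) d \<in> narrow (n + 2 * k) n"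
  shows "has_cap d"
proof (rule ccontr)
  assume "\<not> has_cap d"
  then have "free_bots ((th ^^ k) d) = {1..n}"
    using free_bots_no_cap free_bots_thn[OF assms(1), of k] assms(1) by (simp add: brauer_iff)
  moreover obtain y h i where y: "(th ^^ k) d = stack y h" "i < n" "y \<in> brauer i (n + 2 * k)" "h \<in> brauer (n + 2 * k) i"
    using assms(2) by (auto simp: narrow_def)
  moreover have "finite (free_bots h)" using y(4) by (auto simp: free_bots_def brauer_iff)
  then have "card (free_bots (stack y h)) \<le> card (free_bots h)" by (intro card_mono free_bots_stack[OF y(4,3)])
  ultimately show False using card_free_bots[OF y(4)] by simp
qed

context
  fixes \<delta> :: "'k::field"
begin

lemma B_mult_free:
  fixes x y :: "diagram \<Rightarrow>\<^sub>0 'k"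
  assumes "x \<in> free_space (brauer b c)" "y \<in> free_space (brauer a b)"
  shows "B_mult \<delta> x y \<in> free_space (brauer a c)"
  using assms(1)
proof (induction rule: free_space_induct)
  case (add x r g)
  have "B_mult \<delta> (basis g) y \<in> free_space (brauer a c)"
    using assms(2)
  proof (induction rule: free_space_induct)
    case (add y s h)
    then show ?case using stack_brauer[OF add(2) \<open>g \<in> brauer b c\<close>] by (simp add: B_mult_brauer[OF add(2) \<open>g \<in> brauer b c\<close>])
  qed simp
  then show ?case using add by simp
qed simp

lemma B_mult_addcaps:
  fixes x y :: "diagram \<Rightarrow>\<^sub>0 'k"
  assumes "x \<in> free_space (brauer b c)" "y \<in> free_space (brauer a b)"
  shows "B_mult \<delta> x (addcaps k y) = addcaps k (B_mult \<delta> x y)"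
  using assms(1)
proof (induction rule: free_space_induct)
  case (add x r g)
  note g = \<open>g \<in> brauer b c\<close>
  have "B_mult \<delta> (basis g) (addcaps k y) = addcaps k (B_mult \<delta> (basis g) y)"
    using assms(2)
  proof (induction rule: free_space_induct)
    case (add y s h)
    then show ?case using stack_thn[OF add(2) g, of k]
      by (simp add: B_mult_brauer[OF add(2) g] B_mult_brauer[OF thn_brauer[OF add(2)] g])
  qed simp
  then show ?case using add by simp
qed simp

lemma addcaps_hat:
  fixes x :: "diagram \<Rightarrow>\<^sub>0 'k"
  assumes "x \<in> free_space (brauer n b)" "s \<in> sym_algebra n"
  shows "B_mult \<delta> (addcaps k x) (hat (n + 2 * k) s) = addcaps k (B_mult \<delta> x (hat n s))"
  using assms(1)
proof (induction rule: free_space_induct)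
  case (add x r g)
  note g = \<open>g \<in> brauer n b\<close>
  have "B_mult \<delta> (basis ((th ^^ k) g)) (hat (n + 2 * k) s) = addcaps k (B_mult \<delta> (basis g) (hat n s))"
    using assms(2) unfolding sym_algebra_def
  proof (induction rule: free_space_induct)
    case (add s t \<pi>)
    then have \<pi>: "\<pi> permutes {1..n}" by simp
    then have "\<pi> permutes {1..n + 2 * k}" by (rule permutes_subset) auto
    note p = perm_brauer[OF this] perm_brauer[OF \<pi>]
    show ?case using add stack_thn_perm[OF \<pi> g, of k] loops_perm_right[OF \<pi> g]
      by (simp add: B_mult_brauer[OF p(1) thn_brauer[OF g]] B_mult_brauer[OF p(2) g])
  qed simp
  then show ?case using add by simp
qed simp

lemma two_sided_ideal_iff:
  fixes I :: "(diagram \<Rightarrow>\<^sub>0 'k) set"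
  shows "two_sided_ideal \<delta> m I \<longleftrightarrow> I \<subseteq> free_space (brauer m m) \<and> 0 \<in> I \<and>
    (\<forall>x\<in>I. \<forall>y\<in>I. x + y \<in> I) \<and> (\<forall>c. \<forall>x\<in>I. scale c x \<in> I) \<and>
    (\<forall>a\<in>free_space (brauer m m). \<forall>x\<in>I. B_mult \<delta> a x \<in> I \<and> B_mult \<delta> x a \<in> I)"
proof -
  have "is_submodule {} (B_regular \<delta>) (free_space (brauer m m))"
    unfolding is_submodule_iff[OF lrepD(1)[OF lrep_B_regular]] using free_brauer_B_alg by auto
  moreover have "lrep {} (B_regular \<delta>)" using lrepD(1)[OF lrep_B_regular[of \<delta>]] by (simp add: lrep_def)
  ultimately have "vsp (sub_rep (B_regular \<delta>) (free_space (brauer m m)))"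
    by (intro lrepD(1)[OF lrep_sub_rep])
  then show ?thesis unfolding two_sided_ideal_def brauer_algebra_eq by (simp add: submodule_iff)
qed

lemma two_sided_ideal_brauer_ideal: "two_sided_ideal \<delta> m (brauer_ideal \<delta> m j)"
proof (cases "2 * j \<le> m")
  case True
  have "two_sided_ideal \<delta> m (free_space (brauer m m))"
    unfolding two_sided_ideal_iff using B_mult_free by auto
  moreover have "basis (E_diagram m j) \<in> free_space (brauer m m)"
    using caps_cups_E[of "m - 2 * j" j] True by simp
  ultimately show ?thesis using True unfolding brauer_ideal_def two_sided_ideal_iff by auto
qed (auto simp: brauer_ideal_def two_sided_ideal_iff)

lemma two_sided_ideal_narrow: "two_sided_ideal \<delta> m (free_space (narrow m j))"
  unfolding two_sided_ideal_iff
proof (intro conjI ballI allI)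
  show "free_space (narrow m j) \<subseteq> free_space (brauer m m)"
    using stack_brauer unfolding free_space_def narrow_def by blast
  fix a x :: "diagram \<Rightarrow>\<^sub>0 'k" assume a: "a \<in> free_space (brauer m m)" and x: "x \<in> free_space (narrow m j)"
  have basis: "B_mult \<delta> (basis g) (basis d) \<in> free_space (narrow m j) \<and>
      B_mult \<delta> (basis d) (basis g) \<in> free_space (narrow m j)"
    if g: "g \<in> brauer m m" and d: "d \<in> narrow m j" for g d
  proof -
    obtain y h i where d: "d = stack y h" "i < j" "y \<in> brauer i m" "h \<in> brauer m i"
      using d by (auto simp: narrow_def)
    have dm: "d \<in> brauer m m" using d stack_brauer by simp
    have "stack g d = stack (stack g y) h" using stack_assoc(1)[OF d(4,3) g] d by simp
    then have 1: "stack g d \<in> narrow m j" using d stack_brauer[OF d(3) g] unfolding narrow_def by blast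
    have "stack d g = stack y (stack h g)" using stack_assoc(1)[OF g d(4,3)] d by simp
    then have 2: "stack d g \<in> narrow m j" using d stack_brauer[OF g d(4)] unfolding narrow_def by blast
    show ?thesis
      unfolding B_mult_brauer[OF dm g] B_mult_brauer[OF g dm] using 1 2 by simp
  qed
  have "B_mult \<delta> (basis g) x \<in> free_space (narrow m j) \<and> B_mult \<delta> x (basis g) \<in> free_space (narrow m j)"
    if "g \<in> brauer m m" for g
    using x
  proof (induction rule: free_space_induct)
    case (add x c d)
    then show ?case using basis[OF that add(2)] by simp
  qed simp
  note mult = this
  have "B_mult \<delta> a x \<in> free_space (narrow m j) \<and> B_mult \<delta> x a \<in> free_space (narrow m j)"
    using a
  proof (induction rule: free_space_induct)
    case (add a c g)
    then show ?case using mult[OF add(2)] by simp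
  qed simp
  then show "B_mult \<delta> a x \<in> free_space (narrow m j)" "B_mult \<delta> x a \<in> free_space (narrow m j)" by simp_all
qed auto

lemma E_factor:
  "basis (E_diagram (n + 2 * k) k) =
    B_mult \<delta> (basis (cups n k)) (basis ((th ^^ k) (perm_diagram n id)))"
  using B_mult_brauer[OF thn_brauer[OF perm_brauer[OF permutes_id]] cups_brauer[of n k], of \<delta> k]
    E_diagram_factor[of n k] by simp

text \<open>One more pair of cap and cup leaves a row of n - 2 points to pass through; for n < 2 the
  ideal is zero by convention.\<close>

lemma brauer_ideal_narrow: "brauer_ideal \<delta> (n + 2 * k) (k + 1) \<subseteq> free_space (narrow (n + 2 * k) n)"
proof (cases "n \<ge> 2")
  case True
  define n' where "n' = n - 2"
  have m: "n + 2 * k = n' + 2 * (k + 1)" "n' < n" using True by (simp_all add: n'_def)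
  have "E_diagram (n + 2 * k) (k + 1) \<in> narrow (n + 2 * k) n"
    unfolding narrow_def
    using m(2) cups_brauer[of n' "k + 1"] thn_brauer[OF perm_brauer[OF permutes_id], of "k + 1" n']
      E_diagram_factor(1)[of n' "k + 1"] unfolding m(1)[symmetric] by blast
  then show ?thesis
    using two_sided_ideal_narrow[of "n + 2 * k" n] True by (auto simp: brauer_ideal_def)
qed (auto simp: brauer_ideal_def)

text \<open>The reverse comparison. The diagram factors through n - 2 points; its upper factor is a
  left multiple of the standard cups and its lower factor a right multiple of the standard caps, so
  the generator of the ideal appears between them. No loop arises, hence no power of
  \<open>\<delta>\<close> spoils the equation.\<close>

lemma addcaps_capped:
  assumes x: "x \<in> brauer n (n + 2 * k)" and "has_cap x"
  shows "addcaps k (basis x) \<in> brauer_ideal \<delta> (n + 2 * k) (k + 1)"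
proof -
  let ?m = "n + 2 * k"
  obtain a where n: "n = a + 2" using has_cap_src[OF assms] .
  then have m: "?m = a + 2 * (k + 1)" by simp
  let ?c = "(th ^^ (k + 1)) (perm_diagram a id)"
  have c: "?c \<in> brauer ?m a" unfolding m by (rule thn_brauer[OF perm_brauer[OF permutes_id]])
  have cu: "cups a (k + 1) \<in> brauer a ?m" unfolding m by (rule cups_brauer)
  obtain y h where y: "y \<in> brauer a ?m" "h \<in> brauer n a" "stack y h = x" "loops y h = 0"
    using cap_factor[of x a ?m] assms n by metis
  obtain d where d: "d \<in> brauer ?m ?m" "stack d (cups a (k + 1)) = y" "loops d (cups a (k + 1)) = 0"
    using cups_factor[of y a "k + 1"] y(1) unfolding m by blast
  have "(th ^^ k) h \<in> brauer ?m a" by (rule thn_brauer[OF y(2)])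
  then obtain d' where d': "d' \<in> brauer ?m ?m" "stack ?c d' = (th ^^ k) h" "loops ?c d' = 0"
    using caps_factor[of "(th ^^ k) h" a "k + 1"] unfolding m by blast
  let ?M = "B_mult \<delta>"
  have in_B: "(basis g :: diagram \<Rightarrow>\<^sub>0 'k) \<in> B_alg" if "g \<in> brauer a b" for g a b
    using that by (intro free_brauer_B_alg[OF free_space_simps(4)])
  have "addcaps k (basis x) = ?M (basis y) (basis ((th ^^ k) h))"
    using B_mult_brauer[OF thn_brauer[OF y(2)] y(1), of \<delta> k] stack_thn[OF y(2,1), of k] y by simp
  also have "\<dots> = ?M (?M (basis d) (basis (cups a (k + 1)))) (?M (basis ?c) (basis d'))"
    using B_mult_brauer[OF cu d(1), of \<delta>] B_mult_brauer[OF d'(1) c, of \<delta>] d d' by simp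
  also have "\<dots> = ?M (basis d) (?M (?M (basis (cups a (k + 1))) (basis ?c)) (basis d'))"
    using in_B[OF d(1)] in_B[OF cu] in_B[OF c] in_B[OF d'(1)]
    by (simp add: B_mult_assoc B_mult_closed del: B_mult_simps)
  also have "\<dots> = ?M (basis d) (?M (basis (E_diagram ?m (k + 1))) (basis d'))"
    using E_factor[of a "k + 1"] by (simp only: m)
  finally have eq: "addcaps k (basis x) = ?M (basis d) (?M (basis (E_diagram ?m (k + 1))) (basis d'))" .
  have "?M (basis d) (?M (basis (E_diagram ?m (k + 1))) (basis d')) \<in> I"
    if "two_sided_ideal \<delta> ?m I" "basis (E_diagram ?m (k + 1)) \<in> I" for I
    using that d(1) d'(1) unfolding two_sided_ideal_iff by simp
  moreover have "2 * (k + 1) \<le> ?m" using m by simp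
  ultimately show ?thesis unfolding eq brauer_ideal_def by auto
qed

end

text \<open>
  The inverse isomorphisms between \<open>1\<^sub>m\<Delta>(U)\<close> and the cell module add and remove the last \<open>k\<close> caps.
  They are compatible with passing to the quotient because a diagram \<open>n \<rightarrow> m\<close> with a cap is zero in
  \<open>\<Delta>(U)\<close>, while adding \<open>k\<close> caps to it gives an element of the ideal \<open>J\<close>.
\<close>

locale cell = standard \<delta> n U
  for \<delta> :: "'k::field" and n :: nat and U :: "('k, (nat \<Rightarrow> nat) \<Rightarrow>\<^sub>0 'k, 'v) rep" +
  fixes k :: nat
begin

abbreviation "m \<equiv> n + 2 * k"

abbreviation BA :: "(diagram \<Rightarrow>\<^sub>0 'k) set"
  where "BA \<equiv> free_space (brauer m m)"

abbreviation H :: "(diagram \<Rightarrow>\<^sub>0 'k) set"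
  where "H \<equiv> free_space (brauer n m)"

abbreviation "J \<equiv> brauer_ideal \<delta> m (k + 1)"

abbreviation "W \<equiv> {B_mult \<delta> x (basis (E_diagram m k)) + y | x y. x \<in> BA \<and> y \<in> J}"

abbreviation "WR \<equiv> sub_rep (B_regular \<delta>) W"

abbreviation "WQ \<equiv> quot_rep WR J"

abbreviation "r \<equiv> \<lambda>C a. coset_map WR J (\<lambda>x. B_mult \<delta> x (hat m a)) C"

lemmas J = two_sided_ideal_brauer_ideal[of \<delta> m "k + 1", unfolded two_sided_ideal_iff]

lemma J_props:
  "x \<in> J \<Longrightarrow> x \<in> BA" "0 \<in> J" "x \<in> J \<Longrightarrow> y \<in> J \<Longrightarrow> x + y \<in> J" "x \<in> J \<Longrightarrow> scale c x \<in> J"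
  "a \<in> BA \<Longrightarrow> x \<in> J \<Longrightarrow> B_mult \<delta> a x \<in> J" "a \<in> BA \<Longrightarrow> x \<in> J \<Longrightarrow> B_mult \<delta> x a \<in> J"
  using J by blast+

lemma BA_mult: "x \<in> BA \<Longrightarrow> y \<in> free_space (brauer a m) \<Longrightarrow> B_mult \<delta> x y \<in> free_space (brauer a m)"
  by (rule B_mult_free)

lemma H_hat: "x \<in> H \<Longrightarrow> s \<in> sym_algebra n \<Longrightarrow> B_mult \<delta> x (hat n s) \<in> H"
  by (rule B_mult_free[OF _ hat_closed]) auto

lemma cups_surj:
  assumes "x \<in> H"
  shows "\<exists>y\<in>BA. B_mult \<delta> y (basis (cups n k)) = x"
  using assms
proof (induction rule: free_space_induct)
  case zero
  show ?case by (rule bexI[of _ 0]) simp_all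
next
  case (add x c d)
  then obtain y where y: "y \<in> BA" "B_mult \<delta> y (basis (cups n k)) = x" by blast
  obtain d' where "d' \<in> brauer m m" "stack d' (cups n k) = d" "loops d' (cups n k) = 0"
    using cups_factor[OF add(2)] by blast
  then show ?case
    using y B_mult_brauer[OF cups_brauer[of n k], of d' m \<delta>]
    by (intro bexI[of _ "y + scale c (basis d')"]) simp_all
qed

text \<open>Left multiples of the generator are the elements of \<open>H\<close> with k caps added:
  every element of \<open>H\<close> is a left multiple of the standard cups by
  \<open>cups_surj\<close>.\<close>

lemma W_eq: "W = {addcaps k x + y | x y. x \<in> H \<and> y \<in> J}"
proof -
  have c: "basis (cups n k) \<in> H" using cups_brauer[of n k] by simp
  have E: "B_mult \<delta> x (basis (E_diagram m k)) = addcaps k (B_mult \<delta> x (basis (cups n k)))" if "x \<in> BA" for x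
    using B_mult_addcaps[OF that c, of \<delta> k] by (simp add: E_diagram_eq)
  show ?thesis
  proof (intro equalityI subsetI)
    fix w assume "w \<in> W"
    then obtain x y where w: "w = B_mult \<delta> x (basis (E_diagram m k)) + y" "x \<in> BA" "y \<in> J" by blast
    have "w = addcaps k (B_mult \<delta> x (basis (cups n k))) + y" using w(1) E[OF w(2)] by simp
    then show "w \<in> {addcaps k x + y | x y. x \<in> H \<and> y \<in> J}"
      using w(3) BA_mult[OF w(2) c] by blast
  next
    fix w assume "w \<in> {addcaps k x + y | x y. x \<in> H \<and> y \<in> J}"
    then obtain x y where w: "w = addcaps k x + y" "x \<in> H" "y \<in> J" by blast
    obtain x' where x': "x' \<in> BA" "B_mult \<delta> x' (basis (cups n k)) = x" using cups_surj[OF w(2)] by blast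
    have "w = B_mult \<delta> x' (basis (E_diagram m k)) + y" using E[OF x'(1)] x'(2) w(1) by simp
    then show "w \<in> W" using x'(1) w(3) by blast
  qed
qed

lemma W_cases:
  assumes "w \<in> W"
  obtains x y where "x \<in> H" "y \<in> J" "w = addcaps k x + y"
  using assms unfolding W_eq by blast

lemma W_intro: "x \<in> H \<Longrightarrow> y \<in> J \<Longrightarrow> addcaps k x + y \<in> W"
  unfolding W_eq by blast

lemma addcaps_W: "x \<in> H \<Longrightarrow> addcaps k x \<in> W"
  using W_intro[OF _ J_props(2)] by simp

lemma J_W: "y \<in> J \<Longrightarrow> y \<in> W"
  using W_intro[of 0 y] by simp

lemma W_BA: "w \<in> W \<Longrightarrow> w \<in> BA"
proof (elim W_cases)
  fix x y assume "x \<in> H" "y \<in> J" "w = addcaps k x + y"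
  then show ?thesis using addcaps_closed[of x n m k] J_props(1) by simp
qed

lemma W_add: "w \<in> W \<Longrightarrow> w' \<in> W \<Longrightarrow> w + w' \<in> W"
proof (elim W_cases)
  fix x y x' y' assume "x \<in> H" "y \<in> J" "w = addcaps k x + y" "x' \<in> H" "y' \<in> J" "w' = addcaps k x' + y'"
  then show ?thesis using W_intro[of "x + x'" "y + y'"] J_props(3) by (simp add: algebra_simps)
qed

lemma W_scale: "w \<in> W \<Longrightarrow> scale c w \<in> W"
proof (elim W_cases)
  fix x y assume "x \<in> H" "y \<in> J" "w = addcaps k x + y"
  then show ?thesis using W_intro[of "scale c x" "scale c y"] J_props(4) by simp
qed

lemma W_mult: "a \<in> BA \<Longrightarrow> w \<in> W \<Longrightarrow> B_mult \<delta> a w \<in> W"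
proof (elim W_cases)
  fix x y assume "a \<in> BA" "x \<in> H" "y \<in> J" "w = addcaps k x + y"
  then show ?thesis
    using W_intro[of "B_mult \<delta> a x" "B_mult \<delta> a y"] J_props(5) BA_mult B_mult_addcaps[of a m m x n \<delta> k] by simp
qed

lemma W_hat: "w \<in> W \<Longrightarrow> s \<in> sym_algebra n \<Longrightarrow> B_mult \<delta> w (hat m s) \<in> W"
proof (elim W_cases)
  fix x y assume "s \<in> sym_algebra n" "x \<in> H" "y \<in> J" "w = addcaps k x + y"
  then show ?thesis
    using W_intro[of "B_mult \<delta> x (hat n s)" "B_mult \<delta> y (hat m s)"] J_props(6) hat_closed[of s n m] H_hat
      addcaps_hat[of x n m s \<delta> k] by simp
qed

lemma lrep_BA: "lrep BA (B_regular \<delta>)"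
  using lrepD[OF lrep_B_regular[of \<delta>]] free_brauer_B_alg[of _ m m] unfolding lrep_def by blast

lemma W_zero: "0 \<in> W"
  by (rule J_W[OF J_props(2)])

lemma sub_W: "is_submodule BA (B_regular \<delta>) W"
proof -
  have "W \<subseteq> B_alg" using free_brauer_B_alg[OF W_BA] by (rule subsetI)
  then show ?thesis
    unfolding is_submodule_iff[OF lrepD(1)[OF lrep_BA]] B_regular_simps
    by (intro conjI ballI allI W_zero W_add W_scale W_mult)
qed

lemma lrep_WR: "lrep BA WR"
  by (rule lrep_sub_rep[OF lrep_BA sub_W])

lemma sub_J: "is_submodule BA WR J"
  unfolding is_submodule_iff[OF lrepD(1)[OF lrep_WR]] sub_rep_simps B_regular_simps
  by (intro conjI ballI allI subsetI J_W J_props(2-5))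

lemma lrep_WQ: "lrep BA WQ"
  by (rule lrep_quot_rep[OF lrep_WR sub_J])

lemmas WQ = quot_props[OF lrep_WR sub_J, unfolded sub_rep_simps B_regular_simps]

lemma carrier_WQ: "carrier WQ = (\<lambda>x. J +>\<^bsub>WR\<^esub> x) ` W"
  unfolding carrier_quot_rep sub_rep_simps ..

definition cl :: "(diagram \<Rightarrow>\<^sub>0 'k) \<Rightarrow> (diagram \<Rightarrow>\<^sub>0 'k) set"
  where "cl x = J +>\<^bsub>WR\<^esub> addcaps k x"

lemma cl_simps:
  "x \<in> H \<Longrightarrow> cl x \<in> carrier WQ"
  "x \<in> H \<Longrightarrow> y \<in> H \<Longrightarrow> cl (x + y) = cl x \<oplus>\<^bsub>WQ\<^esub> cl y"
  "x \<in> H \<Longrightarrow> cl (scale c x) = c \<odot>\<^bsub>WQ\<^esub> cl x"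
  "a \<in> BA \<Longrightarrow> x \<in> H \<Longrightarrow> act WQ a (cl x) = cl (B_mult \<delta> a x)"
  unfolding cl_def carrier_WQ
  using WQ addcaps_W B_mult_addcaps[of a m m x n \<delta> k] by simp_all

lemma cl_J: "x \<in> H \<Longrightarrow> addcaps k x \<in> J \<Longrightarrow> cl x = \<zero>\<^bsub>WQ\<^esub>"
  unfolding cl_def using WQ(5) addcaps_W by simp

lemma cl_zero: "cl 0 = \<zero>\<^bsub>WQ\<^esub>"
  by (rule cl_J) (simp_all add: J_props)

lemma carrier_WQ_cl: "carrier WQ = cl ` H"
proof
  show "carrier WQ \<subseteq> cl ` H"
    unfolding carrier_WQ
  proof (rule image_subsetI)
    fix w assume "w \<in> W"
    then obtain x y where w: "x \<in> H" "y \<in> J" "w = addcaps k x + y" by (rule W_cases)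
    have "J +>\<^bsub>WR\<^esub> w = cl x \<oplus>\<^bsub>WQ\<^esub> (J +>\<^bsub>WR\<^esub> y)"
      unfolding cl_def w(3) using WQ(1) addcaps_W[OF w(1)] J_W[OF w(2)] by simp
    also have "J +>\<^bsub>WR\<^esub> y = \<zero>\<^bsub>WQ\<^esub>" using WQ(5)[OF J_W[OF w(2)]] w(2) by simp
    also have "cl x \<oplus>\<^bsub>WQ\<^esub> \<zero>\<^bsub>WQ\<^esub> = cl x"
      by (rule vspD(7)[OF lrepD(1)[OF lrep_WQ] cl_simps(1)[OF w(1)]])
    finally show "J +>\<^bsub>WR\<^esub> w \<in> cl ` H" using w(1) by simp
  qed
qed (use cl_simps(1) in blast)

lemma r_cl:
  assumes "x \<in> H" "s \<in> sym_algebra n"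
  shows "r (cl x) s = cl (B_mult \<delta> x (hat n s))"
proof -
  have "r (cl x) s = J +>\<^bsub>WR\<^esub> B_mult \<delta> (addcaps k x) (hat m s)"
    unfolding cl_def
  proof (rule coset_map_cls[OF lrepD(1)[OF lrep_WR]])
    show "submodule J base_field WR" using sub_J by (simp add: is_submodule_def)
  qed (use addcaps_W assms W_hat J_props(6) hat_closed[of s n m] in simp_all)
  then show ?thesis using addcaps_hat[OF assms] by (simp add: cl_def)
qed

sublocale c: bimod BA "sym_algebra n" WQ r U
proof (rule bimod.intro)
  show "r x a \<in> carrier WQ" if "x \<in> carrier WQ" "a \<in> sym_algebra n" for x a
  proof -
    obtain y where "y \<in> H" "x = cl y" using \<open>x \<in> carrier WQ\<close> unfolding carrier_WQ_cl by blast
    then show ?thesis using r_cl[OF _ that(2)] cl_simps(1) H_hat that(2) by simp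
  qed
  show "act WQ b (r x a) = r (act WQ b x) a" if b: "b \<in> BA" and "x \<in> carrier WQ" and a: "a \<in> sym_algebra n" for b x a
  proof -
    obtain y where y: "y \<in> H" "x = cl y" using \<open>x \<in> carrier WQ\<close> unfolding carrier_WQ_cl by blast
    have "B_mult \<delta> b (B_mult \<delta> y (hat n a)) = B_mult \<delta> (B_mult \<delta> b y) (hat n a)"
      using Bm_assoc[of b y "hat n a"] b y(1) hat_closed[OF a order_refl] free_brauer_B_alg by metis
    then show ?thesis using r_cl[OF _ a] cl_simps(4) H_hat BA_mult a b y by simp
  qed
qed (use lrep_WQ U in auto)

text \<open>The projection of \<open>B_alg\<close> onto \<open>H\<close>. The universal property of
  \<open>Delta\<close> concerns all of \<open>B_alg\<close>, so the map to the cell module must be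
  given there and not just on \<open>H\<close>.\<close>

definition pr :: "(diagram \<Rightarrow>\<^sub>0 'k) \<Rightarrow> (diagram \<Rightarrow>\<^sub>0 'k)"
  where "pr x = B_mult \<delta> (B_mult \<delta> (B_id m) x) (B_id n)"

lemma pr_simps [simp]:
  "pr 0 = 0" "pr (x + y) = pr x + pr y" "pr (scale c x) = scale c (pr x)"
  by (simp_all add: pr_def)

lemma pr_basis:
  assumes "d \<in> diagrams"
  shows "pr (basis d) = (if d \<in> brauer n m then basis d else 0)"
  unfolding pr_def using assms diagrams_iff[of d]
  by (simp add: B_id_left B_id_right del: UN_iff) (auto simp: brauer_iff)

lemma pr_closed: "x \<in> B_alg \<Longrightarrow> pr x \<in> H"
  unfolding B_alg_def
proof (induction rule: free_space_induct)
  case (add x c d)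
  then show ?case using pr_basis[OF add(2)] by simp
qed simp

lemma pr_id: "x \<in> H \<Longrightarrow> pr x = x"
proof (induction rule: free_space_induct)
  case (add x c d)
  then show ?case using pr_basis[OF brauer_diagrams[OF add(2)]] by simp
qed simp

lemma BA_id:
  assumes "a \<in> BA"
  shows "B_mult \<delta> (B_id m) a = a" "B_mult \<delta> a (B_id m) = a"
proof -
  have "B_mult \<delta> (B_id m) a = a \<and> B_mult \<delta> a (B_id m) = a"
    using assms
  proof (induction rule: free_space_induct)
    case (add a c d)
    have "src d = m" "tgt d = m" using add(2) by (simp_all add: brauer_iff)
    then show ?case
      using add by (simp add: B_id_left[OF brauer_diagrams[OF add(2)]] B_id_right[OF brauer_diagrams[OF add(2)]])
  qed simp
  then show "B_mult \<delta> (B_id m) a = a" "B_mult \<delta> a (B_id m) = a" by simp_all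
qed

lemma BA_B: "a \<in> BA \<Longrightarrow> a \<in> B_alg" and H_B: "x \<in> H \<Longrightarrow> x \<in> B_alg"
  by (rule free_brauer_B_alg, assumption)+

lemma pr_mult:
  assumes a: "a \<in> BA" and x: "x \<in> B_alg"
  shows "pr (B_mult \<delta> a x) = B_mult \<delta> a (pr x)"
proof -
  note aB = BA_B[OF a]
  have "pr (B_mult \<delta> a x) = B_mult \<delta> (B_mult \<delta> a x) (B_id n)"
    unfolding pr_def using Bm_assoc[OF Bid_in[of m] aB x] BA_id[OF a] by simp
  moreover have "B_mult \<delta> a (pr x) = B_mult \<delta> (B_mult \<delta> a (B_mult \<delta> (B_id m) x)) (B_id n)"
    unfolding pr_def by (rule Bm_assoc[OF aB Bm_closed[OF Bid_in x] Bid_in, symmetric])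
  moreover have "B_mult \<delta> a (B_mult \<delta> (B_id m) x) = B_mult \<delta> a x"
    using Bm_assoc[OF aB Bid_in[of m] x] BA_id[OF a] by simp
  ultimately show ?thesis by simp
qed

lemma hat_sp: "hat n (sym_part n (x :: diagram \<Rightarrow>\<^sub>0 'k)) \<in> free_space (brauer n n)"
  by (rule hat_closed[OF sp_closed order_refl])

text \<open>The balance condition for the map to the cell module. A cup-free diagram from n points
  that is not a permutation of them has a cap; the product inherits it and, with k further caps,
  falls into the ideal.\<close>

lemma cl_pr_mult:
  assumes "x \<in> B_alg" "a \<in> B_sharp"
  shows "cl (pr (B_mult \<delta> x a)) = cl (B_mult \<delta> (pr x) (hat n (sym_part n a)))"
proof -
  have basis_case: "cl (pr (B_mult \<delta> (basis g) (basis h))) = cl (B_mult \<delta> (pr (basis g)) (hat n (sym_part n (basis h))))"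
    if g: "g \<in> diagrams" and h: "h \<in> diagrams" "\<not> has_cup h" for g h
  proof -
    have g': "g \<in> brauer (src g) (tgt g)" and h': "h \<in> brauer (src h) (tgt h)"
      using g h(1) by (simp_all only: diagrams_iff)
    show ?thesis
    proof (cases "\<exists>\<sigma>. \<sigma> permutes {1..n} \<and> h = perm_diagram n \<sigma>")
      case True
      then obtain \<sigma> where \<sigma>: "\<sigma> permutes {1..n}" "h = perm_diagram n \<sigma>" by blast
      have hn: "h \<in> brauer n n" using \<sigma> perm_brauer by simp
      have *: "hat n (sym_part n (basis h :: diagram \<Rightarrow>\<^sub>0 'k)) = basis h" using \<sigma> sp_perm by simp
      have "pr (B_mult \<delta> (basis g) (basis h)) = B_mult \<delta> (pr (basis g)) (basis h)"
      proof (cases "g \<in> brauer n m")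
        case True
        then show ?thesis
          using pr_id[of "basis g"] pr_id[OF B_mult_free[of "basis g" n m "basis h" n \<delta>]] hn by simp
      next
        case False
        have "pr (B_mult \<delta> (basis g) (basis h)) = 0"
        proof (cases "src g = n")
          case True
          then have gn: "g \<in> brauer n (tgt g)" "tgt g \<noteq> m" using g' False by auto
          have "stack g h \<in> diagrams" "stack g h \<notin> brauer n m"
            using brauer_diagrams[OF stack_brauer[OF hn gn(1)]] gn(2) by (simp, simp add: brauer_iff)
          then show ?thesis unfolding B_mult_brauer[OF hn gn(1)] using pr_basis by simp
        qed (use \<sigma> in \<open>simp add: B_mult_basis\<close>)
        then show ?thesis using pr_basis[OF g] False by simp
      qed
      then show ?thesis unfolding * by simp
    next
      case False
      then have *: "sym_part n (basis h :: diagram \<Rightarrow>\<^sub>0 'k) = 0" by (intro sym_part_basis_other) blast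
      have "cl (pr (B_mult \<delta> (basis g) (basis h))) = \<zero>\<^bsub>WQ\<^esub>"
      proof (cases "tgt h = src g \<and> src h = n \<and> tgt g = m")
        case True
        then have gb: "g \<in> brauer (tgt h) m" and hb: "h \<in> brauer n (tgt h)" using g' h' by auto
        have "has_cap h"
        proof (rule ccontr)
          assume "\<not> has_cap h"
          then have "n \<le> tgt h" "tgt h \<le> n" using no_cap_le[OF hb] no_cup_le[OF hb] h by auto
          then have "h \<in> brauer n n" using hb by simp
          then show False using no_cap_perm \<open>\<not> has_cap h\<close> False by metis
        qed
        then have "has_cap (stack g h)" using has_cap_stack[OF hb gb] by simp
        moreover have sb: "stack g h \<in> brauer n m" by (rule stack_brauer[OF hb gb])
        ultimately have "cl (basis (stack g h)) = \<zero>\<^bsub>WQ\<^esub>"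
          using cl_J[of "basis (stack g h)"] addcaps_capped[of "stack g h" n k \<delta>] by simp
        then show ?thesis
          unfolding B_mult_brauer[OF hb gb]
          using sb cl_simps(3)[of "basis (stack g h)"] pr_id[of "basis (stack g h)"]
            vspD(5)[OF lrepD(1)[OF lrep_WQ]] by simp
      next
        case ne: False
        have "pr (B_mult \<delta> (basis g) (basis h)) = 0"
        proof (cases "tgt h = src g")
          case True
          then have "stack g h \<in> brauer (src h) (tgt g)" using stack_brauer[OF h'] g' by simp
          moreover from this have "stack g h \<notin> brauer n m" using ne True by (auto simp: brauer_iff)
          ultimately show ?thesis using pr_basis[OF brauer_diagrams] True by (simp add: B_mult_basis)
        qed (simp add: B_mult_basis)
        then show ?thesis using cl_zero by simp
      qed
      then show ?thesis unfolding * using cl_zero by simp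
    qed
  qed
  have sharp: "B_sharp = free_space {d \<in> diagrams. \<not> has_cup d}" by (simp add: B_sharp_def)
  have basis: "cl (pr (B_mult \<delta> (basis g) a)) = cl (B_mult \<delta> (pr (basis g)) (hat n (sym_part n a)))"
    if g: "g \<in> diagrams" for g
    using assms(2) unfolding sharp
  proof (induction rule: free_space_induct)
    case (add a c h)
    have gB: "basis g \<in> (B_alg :: (diagram \<Rightarrow>\<^sub>0 'k) set)" "basis h \<in> (B_alg :: (diagram \<Rightarrow>\<^sub>0 'k) set)"
      using g add(2) by (auto simp: B_alg_def simp del: UN_iff)
    have aB: "a \<in> B_alg" using add(1) by (auto simp: B_alg_def free_space_def)
    have "cl (pr (B_mult \<delta> (basis g) (basis h))) = cl (B_mult \<delta> (pr (basis g)) (hat n (sym_part n (basis h))))"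
      using basis_case[OF g] add(2) by blast
    moreover note Hs = pr_closed[OF Bm_closed[OF gB(1) aB]] pr_closed[OF Bm_closed[OF gB]]
      B_mult_free[OF pr_closed[OF gB(1)] hat_sp, of \<delta> a] B_mult_free[OF pr_closed[OF gB(1)] hat_sp, of \<delta> "basis h"]
    ultimately show ?case using add(3) by (simp add: cl_simps)
  qed (simp add: cl_zero)
  show ?thesis
    using assms(1) unfolding B_alg_def
  proof (induction rule: free_space_induct)
    case (add x c g)
    have gB: "basis g \<in> (B_alg :: (diagram \<Rightarrow>\<^sub>0 'k) set)" using add(2) by (simp add: B_alg_def del: UN_iff)
    have xB: "x \<in> B_alg" using add(1) by (simp add: B_alg_def)
    have aB: "a \<in> B_alg" using assms(2) B_sharp_sub by blast
    note Hs = pr_closed[OF Bm_closed[OF gB aB]] pr_closed[OF Bm_closed[OF xB aB]]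
      B_mult_free[OF pr_closed[OF gB] hat_sp, of \<delta> a] B_mult_free[OF pr_closed[OF xB] hat_sp, of \<delta> a]
    then show ?case using add(3) basis[OF add(2)] by (simp add: cl_simps)
  qed (simp add: cl_zero)
qed

lemma Phi_ex: "\<exists>\<Phi>. rhom BA Z c.T \<Phi> \<and> (\<forall>x\<in>B_alg. \<forall>v\<in>carrier U. \<Phi> (b.tn x v) = c.tn (cl (pr x)) v)"
proof (rule Z_universal[of BA c.T "\<lambda>x. c.tn (cl (pr x))"])
  show "BA \<subseteq> B_alg" using BA_B by blast
  show "lrep BA c.T" by (rule c.lrep_T)
  fix x a :: "diagram \<Rightarrow>\<^sub>0 'k" and v assume x: "x \<in> B_alg" and v: "v \<in> carrier U"
  show "c.tn (cl (pr (B_mult \<delta> x a))) v = c.tn (cl (pr x)) (act U (sym_part n a) v)" if "a \<in> B_sharp"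
    unfolding cl_pr_mult[OF x that] r_cl[OF pr_closed[OF x] sp_closed, symmetric]
    by (rule c.tn_balanced[OF cl_simps(1)[OF pr_closed[OF x]] v sp_closed])
  show "c.tn (cl (pr (B_mult \<delta> a x))) v = act c.T a (c.tn (cl (pr x)) v)" if "a \<in> BA"
    unfolding pr_mult[OF that x] c.act_tn[OF that cl_simps(1)[OF pr_closed[OF x]] v]
      cl_simps(4)[OF that pr_closed[OF x]] ..
qed (simp_all add: pr_closed cl_simps c.tn_closed c.tn_add_left c.tn_add_right c.tn_smult_left c.tn_smult_right
    del: quot_rep_simps)

text \<open>An element of the ideal is a combination of narrow diagrams. If such a diagram ends in k
  caps, it has yet another cap, and what remains vanishes in \<open>Delta\<close>.\<close>

lemma tn_remcaps_J:
  assumes "y \<in> J" "v \<in> carrier U"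
  shows "b.tn (remcaps k n m y) v = \<zero>\<^bsub>Z\<^esub>"
proof -
  have "y \<in> free_space (narrow m n)" using brauer_ideal_narrow assms(1) by blast
  then show ?thesis
  proof (induction rule: free_space_induct)
    case zero
    then show ?case using tn_zero_left assms(2) by simp
  next
    case (add y c d)
    have "b.tn (remcaps k n m (basis d)) v = \<zero>\<^bsub>Z\<^esub>"
    proof (cases "d \<in> (th ^^ k) ` brauer n m")
      case True
      then obtain x where x: "x \<in> brauer n m" "d = (th ^^ k) x" by blast
      then show ?thesis
        using tn_vanish[OF brauer_diagrams[OF x(1)] _ assms(2)] narrow_capped[OF x(1)] add(2)
        by (simp add: remcaps_basis[OF x(1)])
    next
      case False
      then show ?thesis using tn_zero_left assms(2) by (simp add: remcaps_def)
    qed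
    moreover have B: "remcaps k n m z \<in> B_alg" for z :: "diagram \<Rightarrow>\<^sub>0 'k" by (rule H_B[OF remcaps_closed])
    ultimately show ?case
      using add(3) tn_add_left[OF B Bscale_in[OF B] assms(2)] tn_smult_left[OF B assms(2)] ZV(1,5,6) by simp
  qed
qed

text \<open>Linearity is enough, as \<open>\<Psi>\<close> only serves as inverse of the equivariant
  \<open>\<Phi>\<close>. For fixed \<open>v\<close> the removal of caps is factored through the
  quotient by the ideal; the resulting family of maps is then bilinear and balanced.\<close>

lemma Psi_ex: "\<exists>\<Psi>. rhom {} c.T Z \<Psi> \<and> (\<forall>x\<in>H. \<forall>v\<in>carrier U. \<Psi> (c.tn (cl x) v) = b.tn x v)"
proof -
  have B: "remcaps k n m z \<in> B_alg" for z :: "diagram \<Rightarrow>\<^sub>0 'k" by (rule H_B[OF remcaps_closed])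
  have "\<exists>g. rhom {} WQ Z g \<and> (\<forall>x\<in>H. g (cl x) = b.tn x v)" if v: "v \<in> carrier U" for v
  proof -
    have l: "lrep {} WR" "lrep {} Z" "is_submodule {} WR J"
      using lrep_WR lrep_Z sub_J by (auto simp: lrep_def is_submodule_def)
    have h: "rhom {} WR Z (\<lambda>w. b.tn (remcaps k n m w) v)"
      unfolding rhom_def using B Bscale_in tn_closed tn_add_left tn_smult_left v by simp
    obtain g where g: "rhom {} WQ Z g" "\<And>w. w \<in> W \<Longrightarrow> g (J +>\<^bsub>WR\<^esub> w) = b.tn (remcaps k n m w) v"
      using rhom_quot_factor[OF l h] tn_remcaps_J v by auto
    have "g (cl x) = b.tn x v" if "x \<in> H" for x
      using g(2)[OF addcaps_W[OF that]] remcaps_addcaps[OF that, of k] by (simp add: cl_def)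
    then show ?thesis using g(1) by blast
  qed
  then have "\<forall>v\<in>carrier U. \<exists>g. rhom {} WQ Z g \<and> (\<forall>x\<in>H. g (cl x) = b.tn x v)" ..
  from bchoice[OF this] obtain \<psi> where \<psi>: "\<And>v. v \<in> carrier U \<Longrightarrow> rhom {} WQ Z (\<psi> v)"
    "\<And>x v. v \<in> carrier U \<Longrightarrow> x \<in> H \<Longrightarrow> \<psi> v (cl x) = b.tn x v" by blast
  have "\<exists>\<Psi>. rhom {} c.T Z \<Psi> \<and> (\<forall>x\<in>carrier WQ. \<forall>v\<in>carrier U. \<Psi> (c.tn x v) = \<psi> v x)"
  proof (rule c.tensor_universal[of "{}" Z "\<lambda>C v. \<psi> v C"])
    show "lrep {} Z" using lrep_Z by (simp add: lrep_def)
    fix C v assume C: "C \<in> carrier WQ" and v: "v \<in> carrier U"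
    obtain x where x: "x \<in> H" "C = cl x" using C unfolding carrier_WQ_cl by blast
    show "\<psi> (v \<oplus>\<^bsub>U\<^esub> w) C = \<psi> v C \<oplus>\<^bsub>Z\<^esub> \<psi> w C" if "w \<in> carrier U" for w
      using x v that \<psi>(2) UV(2) tn_add_right H_B by simp
    show "\<psi> (s \<odot>\<^bsub>U\<^esub> v) C = s \<odot>\<^bsub>Z\<^esub> \<psi> v C" for s
      using x v \<psi>(2) UV(3) tn_smult_right H_B by simp
    show "\<psi> v (r C s) = \<psi> (act U s v) C" if s: "s \<in> sym_algebra n" for s
    proof -
      have "\<psi> v (r C s) = b.tn (B_mult \<delta> x (hat n s)) v"
        unfolding x(2) r_cl[OF x(1) s] by (rule \<psi>(2)[OF v H_hat[OF x(1) s]])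
      also have "\<dots> = b.tn x (act U s v)"
        using tn_balanced[OF H_B[OF x(1)] v hat_sharp[OF s]] sym_part_hat[OF s] by simp
      also have "\<dots> = \<psi> (act U s v) C" unfolding x(2) by (rule \<psi>(2)[OF U(2)[OF s v] x(1), symmetric])
      finally show ?thesis .
    qed
  qed (use rhomD(1-3)[OF \<psi>(1)] in auto)
  then show ?thesis using \<psi>(2) cl_simps(1) by auto
qed

text \<open>On all of \<open>Z\<close> the composite of \<open>\<Phi>\<close> and then
  \<open>\<Psi>\<close> is the projection by \<open>B_id m\<close>, so the two maps are inverse to
  each other on 1_m Z.\<close>

lemma rep_iso_cell: "rep_iso BA (trunc m Z) c.T"
proof -
  obtain \<Phi> where \<Phi>: "rhom BA Z c.T \<Phi>" "\<And>x v. x \<in> B_alg \<Longrightarrow> v \<in> carrier U \<Longrightarrow> \<Phi> (b.tn x v) = c.tn (cl (pr x)) v"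
    using Phi_ex by blast
  obtain \<Psi> where \<Psi>: "rhom {} c.T Z \<Psi>" "\<And>x v. x \<in> H \<Longrightarrow> v \<in> carrier U \<Longrightarrow> \<Psi> (c.tn (cl x) v) = b.tn x v"
    using Psi_ex by blast
  note f = rhomD[OF \<Phi>(1)] and g = rhomD[OF \<Psi>(1)]
  note z = rhom_zero[OF lrepD(1)[OF lrep_Z] c.vsp_T \<Phi>(1)] rhom_zero[OF c.vsp_T lrepD(1)[OF lrep_Z] \<Psi>(1)]
  have \<Psi>\<Phi>: "\<Psi> (\<Phi> t) = act Z (B_id m) t" if "t \<in> carrier Z" for t
    using that
  proof (induction rule: Z_induct)
    case zero
    then show ?case using z act_zero[OF lrep_Z Bid_in] by simp
  next
    case (add t x v)
    have mx: "B_mult \<delta> (B_id m) x \<in> B_alg" by (rule Bm_closed[OF Bid_in add(2)])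
    have "\<Psi> (\<Phi> (b.tn x v)) = b.tn (pr x) v"
      using \<Phi>(2)[OF add(2,3)] \<Psi>(2)[OF pr_closed[OF add(2)] add(3)] by simp
    also have "\<dots> = act Z (pr x) (\<iota> v)" by (rule tn_eq_act[OF H_B[OF pr_closed[OF add(2)]] add(3)])
    also have "\<dots> = act Z (B_mult \<delta> (B_id m) x) (act Z (B_id n) (\<iota> v))"
      unfolding pr_def by (rule idem.arep_mul[OF idem_B arep_Z mx Bid_in \<iota>_closed[OF add(3)]])
    also have "act Z (B_id n) (\<iota> v) = \<iota> v"
      using e_act_\<iota>[OF Bid_in[of n] add(3)] idem.e_e[OF idem_B arep_Z \<iota>_closed[OF add(3)], of n]
        sym_part_id act_id[OF add(3)] by simp
    also have "act Z (B_mult \<delta> (B_id m) x) (\<iota> v) = act Z (B_id m) (b.tn x v)"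
      using tn_eq_act[OF mx add(3)] act_tn[OF Bid_in add(2,3)] by simp
    finally show ?case
      using add f(1,2) g(1,2) Zl(1,2) Bid_in tn_closed by simp
  qed
  have \<Phi>\<Psi>: "\<Phi> (\<Psi> t) = t" if "t \<in> carrier c.T" for t
    using that
  proof (induction rule: c.tensor_induct)
    case zero
    then show ?case using z by simp
  next
    case (add t C v)
    obtain x where x: "x \<in> H" "C = cl x" using add(2) unfolding carrier_WQ_cl by blast
    have "\<Phi> (\<Psi> (c.tn C v)) = c.tn C v"
      using \<Psi>(2)[OF x(1) add(3)] \<Phi>(2)[OF H_B[OF x(1)] add(3)] pr_id[OF x(1)] x(2) by simp
    then show ?case using add f(2) g(1,2) c.tn_closed by simp
  qed
  have tr: "carrier (trunc m Z) = act Z (B_id m) ` carrier Z" by (simp add: trunc_def)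
  have sub: "t \<in> carrier Z" if "t \<in> carrier (trunc m Z)" for t using that Zl(1)[OF Bid_in] unfolding tr by blast
  have inv: "\<Psi> (\<Phi> t) = t" if t: "t \<in> carrier (trunc m Z)" for t
  proof -
    obtain s where "s \<in> carrier Z" "t = act Z (B_id m) s" using t unfolding tr by blast
    then show ?thesis using \<Psi>\<Phi>[OF sub[OF t]] idem.e_e[OF idem_B arep_Z, of s m] by simp
  qed
  have "bij_betw \<Phi> (carrier (trunc m Z)) (carrier c.T)"
  proof (rule bij_betw_byWitness[of _ \<Psi>])
    show "\<Psi> ` carrier c.T \<subseteq> carrier (trunc m Z)"
    proof (rule image_subsetI)
      fix t assume t: "t \<in> carrier c.T"
      have "\<Psi> t = act Z (B_id m) (\<Psi> t)" using \<Psi>\<Phi>[OF g(1)[OF t]] \<Phi>\<Psi>[OF t] by simp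
      then show "\<Psi> t \<in> carrier (trunc m Z)" unfolding tr using g(1)[OF t] by (rule image_eqI)
    qed
  qed (use inv \<Phi>\<Psi> f(1) sub in auto)
  moreover have "rhom BA (trunc m Z) c.T \<Phi>" using f sub unfolding rhom_def by (auto simp: trunc_def)
  ultimately show ?thesis unfolding rep_iso_iff by blast
qed

end

lemma cell_module_iso:
  fixes \<delta> :: "'k::field"
  assumes "srep (sum_list \<mu>) (specht \<mu> :: ('k, _, _) rep)"
  shows "rep_iso (brauer_algebra \<delta> (sum_list \<mu> + 2 * k)) (trunc (sum_list \<mu> + 2 * k) (Delta_tilde \<delta> \<mu>))
    (cell_module \<delta> (sum_list \<mu> + 2 * k) \<mu>)"
proof -
  interpret cell \<delta> "sum_list \<mu>" "specht \<mu>" k by standard (rule assms)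
  show ?thesis
    using rep_iso_cell unfolding Delta_tilde_def cell_module_def brauer_algebra_eq hat_def by (simp add: Let_def)
qed

section \<open>The index sets of partitions, and the conclusion\<close>

lemma ex_minus_double_iff: "(\<exists>d. 2 * d \<le> m \<and> s = m - 2 * d) \<longleftrightarrow> (\<exists>d. m = s + 2 * d)" for m s :: nat
  by presburger

lemma Lambda_plus_iff:
  "\<mu> \<in> Lambda_plus m \<longleftrightarrow> \<mu> \<in> partitions \<and> (\<exists>d. m = sum_list \<mu> + 2 * d)"
  using ex_minus_double_iff[of m "sum_list \<mu>"] by (auto simp: Lambda_plus_def partitions_of_def)

lemma Lambda_p_plus_iff:
  "lam \<in> Lambda_p_plus p m \<longleftrightarrow> lam \<in> regular_partitions p \<and> (\<exists>d. m = sum_list lam + 2 * d)"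
  using ex_minus_double_iff[of m "sum_list lam"] by (auto simp: Lambda_p_plus_def regular_partitions_of_def)

lemma partition_sum_list_zero: "lam \<in> partitions \<Longrightarrow> sum_list lam = 0 \<longleftrightarrow> lam = []"
  by (cases lam) (auto simp: partitions_def)

lemma (in standard_head) nonzero_trunc_Z:
  assumes "nonzero_rep (trunc m L)"
  shows "nonzero_rep (trunc m Z)"
  unfolding nonzero_rep_def
proof
  assume z: "carrier (trunc m Z) = {\<zero>\<^bsub>trunc m Z\<^esub>}"
  have "is_submodule B_alg Z M" using local_Z by (simp add: is_local_def)
  then have "\<zero>\<^bsub>Z\<^esub> \<in> M" "M \<subseteq> carrier Z" unfolding is_submodule_iff[OF lrepD(1)[OF lrep_Z]] by simp_all
  then have "act Z (B_id m) ` M = carrier (trunc m Z)" using z by (auto simp: trunc_def)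
  then show False using assms nonzero_trunc_L_iff by simp
qed

theorem proposition3p18:
  fixes \<delta> :: "'k::alg_closed_field" and m :: nat and \<mu> lam :: "nat list"
  assumes "CHAR('k) \<noteq> 2"
    and "\<mu> \<in> partitions"
    and "lam \<in> regular_partitions CHAR('k)"
  shows
    "((nonzero_rep (trunc m (Delta_tilde \<delta> \<mu>)) \<longrightarrow> \<mu> \<in> Lambda_plus m) \<and>
      (\<mu> \<in> Lambda_plus m \<longrightarrow>
        rep_iso (brauer_algebra \<delta> m) (trunc m (Delta_tilde \<delta> \<mu>)) (cell_module \<delta> m \<mu>))) \<and>
     (nonzero_rep (trunc m (L_mod \<delta> lam)) \<longleftrightarrow> lam \<in> Lambda_p_plus_tilde CHAR('k) \<delta> m) \<and>
     (lam \<in> Lambda_p_plus_tilde CHAR('k) \<delta> m \<and> \<mu> \<in> Lambda_plus m \<longrightarrow>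
        comp_mult B_alg (Delta_tilde \<delta> \<mu>) (L_mod \<delta> lam) =
          comp_mult (brauer_algebra \<delta> m) (trunc m (Delta_tilde \<delta> \<mu>)) (trunc m (L_mod \<delta> lam)) \<and>
        is_simple_head (brauer_algebra \<delta> m) (trunc m (L_mod \<delta> lam)) (trunc m (Delta_tilde \<delta> lam)))"
proof -
  have lam: "lam \<in> partitions" using assms(3) by (simp add: regular_partitions_def)
  interpret pm: partition \<mu> by standard (rule assms(2))
  interpret pl: partition lam by standard (rule lam)
  interpret sm: standard \<delta> "sum_list \<mu>" "specht \<mu> :: ('k, _, _) rep" by standard (rule pm.srep_specht)
  \<comment> \<open>With \<open>R\<close> the radical of the Specht module, the quotient in this
    locale is \<open>D_mod lam\<close>, and its \<open>L\<close> is
    \<open>L_mod \<delta> lam\<close>.\<close>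
  interpret sl: standard_head \<delta> "sum_list lam" "specht lam :: ('k, _, _) rep" "pl.Rad"
    by (intro standard_head.intro standard.intro standard_head_axioms.intro pl.srep_specht
      pl.local_specht[OF assms(1,3)])
  have L: "L_mod \<delta> lam = sl.L"
    using rad_local[OF pl.local_specht[OF assms(1,3)] sl.lrep_U] by (simp add: L_mod_def D_mod_def head_def)
  have Dm: "Delta_tilde \<delta> \<mu> = sm.Z" and Dl: "Delta_tilde \<delta> lam = sl.Z" by (simp_all add: Delta_tilde_def)
  have one: "\<mu> \<in> Lambda_plus m" if "nonzero_rep (trunc m (Delta_tilde \<delta> \<mu>))"
    using sm.trunc_nonzero_imp that assms(2) by (simp add: Dm Lambda_plus_iff)
  have iso: "rep_iso (brauer_algebra \<delta> m) (trunc m (Delta_tilde \<delta> \<mu>)) (cell_module \<delta> m \<mu>)"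
    if "\<mu> \<in> Lambda_plus m"
    using that cell_module_iso[OF pm.srep_specht, of \<delta>] by (auto simp: Lambda_plus_iff)
  have two: "nonzero_rep (trunc m (L_mod \<delta> lam)) \<longleftrightarrow> lam \<in> Lambda_p_plus_tilde CHAR('k) \<delta> m"
  proof
    assume nz: "nonzero_rep (trunc m (L_mod \<delta> lam))"
    then have "nonzero_rep (trunc m sl.Z)" unfolding L by (rule sl.nonzero_trunc_Z)
    then have "\<exists>d. m = sum_list lam + 2 * d" by (rule sl.trunc_nonzero_imp)
    moreover have "lam \<noteq> []" if "0 < m" "\<delta> = 0"
      using sl.trunc_L_zero[OF _ that(2,1)] nz partition_sum_list_zero[OF lam] unfolding L by auto
    ultimately show "lam \<in> Lambda_p_plus_tilde CHAR('k) \<delta> m"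
      using assms(3) by (auto simp: Lambda_p_plus_tilde_def Lambda_p_plus_iff)
  next
    assume t: "lam \<in> Lambda_p_plus_tilde CHAR('k) \<delta> m"
    then obtain d where d: "m = sum_list lam + 2 * d"
      by (auto simp: Lambda_p_plus_tilde_def Lambda_p_plus_iff split: if_splits)
    \<comment> \<open>If \<open>lam = []\<close> and d > 0, then m = 2d is positive and even, which
      for \<open>\<delta> = 0\<close> is the excluded case.\<close>
    have "lam \<noteq> [] \<or> \<delta> \<noteq> 0 \<or> d = 0"
      using t d by (auto simp: Lambda_p_plus_tilde_def split: if_splits)
    then have "sum_list lam > 0 \<or> \<delta> \<noteq> 0 \<or> d = 0" using partition_sum_list_zero[OF lam] by linarith
    then show "nonzero_rep (trunc m (L_mod \<delta> lam))" unfolding L d by (rule sl.trunc_L_nonzero)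
  qed
  have three: "comp_mult B_alg (Delta_tilde \<delta> \<mu>) (L_mod \<delta> lam) =
      comp_mult (brauer_algebra \<delta> m) (trunc m (Delta_tilde \<delta> \<mu>)) (trunc m (L_mod \<delta> lam))"
    if "nonzero_rep (trunc m (L_mod \<delta> lam))"
    using idem.comp_mult_tr[OF idem_B sm.arep_Z sl.arep_L sl.simple_L, of m] that
    unfolding Dm L brauer_algebra_corner trunc_tr .
  have "is_simple_head (brauer_algebra \<delta> m) (trunc m (L_mod \<delta> lam)) (trunc m (Delta_tilde \<delta> lam))"
    if "nonzero_rep (trunc m (L_mod \<delta> lam))"
    using sl.simple_head_trunc that unfolding L Dl .
  with one iso two three show ?thesis by blast
qed

end
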